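(* Fix integers $r\ge 0$ and $m\ge 2r$, and let $\mathfrak A_{m,r}$, types, purity, the operations $\mathfrak C_i^{\mu}$, labelled link patterns and the classes $\mathcal E\ell\ell(\mathcal P)$ be as defined in the context. Then: (1) $\mathfrak A_{m,r}$ is a subalgebra of the algebra of meromorphic functions in the $m+r+2$ variables $u,x_1,\dots,x_m,h,\mu_1,\dots,\mu_r$ (and the parameter $\tau$). (2) $\mathfrak A_{m,r}$ is graded by integral quadratic forms in $m+r+2$ variables via the type; the homogeneous elements are the pure functions. (3) The operations $\mathfrak C_i^{\mu}$, $i=1,\dots,m-1$, satisfy the braid relations with parameters $$\mathfrak C_i^{\mu}\,\mathfrak C_{i+1}^{\mu\nu}\,\mathfrak C_i^{\nu}=\mathfrak C_{i+1}^{\nu}\,\mathfrak C_i^{\mu\nu}\,\mathfrak C_{i+1}^{\mu}$$ and the flip relation $$s_k^\mu\,\mathfrak C_k^{\mu_k/\mu_{k+1}}\big(\mathcal E\ell\ell(\mathcal P^{\min}_{m,r})\big)=\mathfrak C_{m-r+k}^{\mu_{k+1}/\mu_k}\big(\mathcal E\ell\ell(\mathcal P^{\min}_{m,r})\big)\qquad (1\le k<r),$$ where $s_k^\mu$ exchanges the variables $\mu_k$ and $\mu_{k+1}$. (4) For every nonzero pure element $f\in\mathfrak A_{m,r}$ and $i\in\{1,\dots,m-1\}$ there exists a unique parameter $\mu$ such that $\mathfrak C_i^{\mu}(f)$ is pure (provided this parameter is not trivial, so that the operation is defined). (5) The operations $\mathfrak C_i^\mu$ permute the Borisov–Libgober equivariant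 elliptic classes of upper-triangular 2-nilpotent Borel orbits in $\mathrm{Hom}(\mathbb C^m,\mathbb C^m)$: the classes $\mathcal E\ell\ell(\mathcal P)$ are well defined, and if $\mathcal P$ and $s_i\mathcal P$ are upper-triangular labelled link patterns of rank $r$ with $\ell_{\min}(s_i\mathcal P)=\ell_{\min}(\mathcal P)+1$, then $\mathfrak C_i^{\nu}(\mathcal E\ell\ell(\mathcal P))=\mathcal E\ell\ell(s_i\mathcal P)$, where $\nu$ is the parameter for which $\mathfrak C_i^\nu(\mathcal E\ell\ell(\mathcal P))$ is pure. (6) The same holds for the elliptic classes, equivariant with respect to the extended torus $(\mathbb C^* )^m\times\mathbb C^*$ (the last factor, with character $u$, acting by scalar multiplication on matrices), of all 2-nilpotent Borel orbits, i.e. for all labelled link patterns, not necessarily upper-triangular.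
   Context: **Functions.** For $\operatorname{Im}\tau>0$, $q=e^{2\pi i\tau}$, put $\theta_\tau(x)=2q^{1/8}\sin(\pi x)\prod_{n\ge1}(1-q^n)(1-q^ne^{2\pi i x})(1-q^ne^{-2\pi i x})$, $F_\tau(x,y)=\frac{\theta_\tau'(0)\theta_\tau(x+y)}{\theta_\tau(x)\theta_\tau(y)}$, and let $\delta=\delta_\tau$ be the function on $\mathbb C^*\times\mathbb C^*$ with $\delta(e^{2\pi i x},e^{2\pi i y})=F_\tau(x,y)$. Variables: $u=x_0,x_1,\dots,x_m$ and $h=\mu_0,\mu_1,\dots,\mu_r$ in $\mathbb C^*$. $\mathfrak A_{m,r}$ is the algebra generated by the meromorphic functions $\delta(\ell_1,\ell_2)$, where $\ell_1$ is a nontrivial Laurent monomial in $u,x_1,\dots,x_m$ and $\ell_2$ a nontrivial Laurent monomial in $h,\mu_1,\dots,\mu_r$. **Types.** In arguments of $\delta$ the variables are written multiplicatively, in quadratic forms additively. A theta function $\theta(\ell)$ of an integral linear combination $\ell$ of variables has type $\tfrac12\ell^2$; types add under products and subtract under quotients, so $\delta(\ell_1,\ell_2)$ has type $\ell_1\ell_2$. A Laurent polynomial in such theta functions is pure if all its summands have the same type; this common quadratic form is its type. **Operations.** For a nontrivial character $\mu$ (a Laurent monomial in $h,\mu_1,\dots,\mu_r$), $\mathfrak C_i^\mu(f)=\delta(\tfrac{x_{i+1}}{x_i},\mu)f+\delta(\tfrac{x_i}{x_{i+1}},h)\,s_if$, where $s_i$ exchanges $x_i$ and $x_{i+1}$ and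 fixes the other variables; all parameters occurring are assumed nontrivial. **Link patterns.** A labelled link pattern of rank $r$ is a sequence $\mathcal P=((a_1,b_1),\dots,(a_r,b_r))$ of pairs (source, target) with all $a_i,b_i\in\{1,\dots,m\}$ distinct. It represents the orbit, under conjugation by the group $\mathrm B_m$ of invertible upper-triangular matrices, of the matrix with entries $1$ at positions $(b_i,a_i)$ and $0$ elsewhere; every $\mathrm B_m$-orbit of matrices $N$ with $N^2=0$ of rank $r$ arises in this way. $\mathcal P$ is upper-triangular if $b_i<a_i$ for all $i$. $w\in\mathfrak S_m$ acts on sources and targets by $j\mapsto w(j)$; $\sigma\in\mathfrak S_r$ acts by relabelling, $\sigma^\mu$ giving the label $\sigma(i)$ to the arrow labelled $i$; on functions $\sigma^\mu$ replaces $\mu_i$ by $\mu_{\sigma(i)}$. The minimal pattern is $\mathcal P^{\min}_{m,r}=((m-r+1,1),\dots,(m,r))$; its orbit closure $X^{\min}_{m,r}$ is the vector space of matrices with $a_{i,j}=0$ for $j<m-r+i$. Let $\ell_{\min}(\mathcal P)$ be the minimal length of $w\in\mathfrak S_m$ such that $\mathcal P=\sigma^\mu w\mathcal P^{\min}_{m,r}$ for some $\sigma\in\mathfrak S_r$. **Elliptic classes.** Attaching to the boundary component $\{a_{i,m-r+i}=0\}$ of $X^{\min}_{m,r}$ a multiplicity $\lambda_i$ and putting $\mu_i=h^{1-\lambda_i}$ (treated as free variables), the Borisov–Libgober class is $$\mathcal E\ell\ell(\mathcal P^{\min}_{m,r})=\prod_{i=1}^r\Big(\delta(u\tfrac{x_i}{x_{m-r+i}},\mu_i)\prod_{j=m-r+i+1}^m\delta(u\tfrac{x_i}{x_j},h)\Big).$$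 For general $\mathcal P=\sigma^\mu w\mathcal P^{\min}_{m,r}$ with $w$ of minimal length $\ell$ and reduced word $w=s_{i_1}\cdots s_{i_\ell}$, consider the resolution $Z=P_{i_1}\times_{\mathrm B}\cdots\times_{\mathrm B}P_{i_\ell}\times_{\mathrm B}X^{\min}_{m,r}$ of the orbit closure ($P_i$ is the minimal parabolic subgroup generated by $\mathrm B_m$ and $s_i$), with a boundary divisor $D$ having multiplicities $\lambda_i$ along the components coming from $X^{\min}_{m,r}$ and $a_k$ along the component where the $k$-th factor lies in $\mathrm B$, $h^{1-a_k}=\nu_k$. The class $\mathcal E\ell\ell(\mathcal P)$ is $\sigma^\mu$ applied to the push-forward to $\mathrm{Hom}(\mathbb C^m,\mathbb C^m)$ of the Borisov–Libgober elliptic class of $(Z,D)$ (localized, i.e. divided by the Euler class), where, inductively from $k=\ell$ down to $1$, the $\nu_k$ are chosen in the unique way making the corresponding push-forward pure. By localization at the torus-fixed points of $Z$, this push-forward is $$\sum_{\varepsilon\in\{0,1\}^\ell}\ \prod_{k=1}^{\ell}\delta\Big(v_k\big(\tfrac{x_{i_k+1}}{x_{i_k}}\big),\,c_k\Big)\cdot v_\ell\big(\mathcal E\ell\ell(\mathcal P^{\min}_{m,r})\big),\qquad v_k=s_{i_1}^{\varepsilon_1}\cdots s_{i_k}^{\varepsilon_k},$$ with $c_k=\nu_k$ if $\varepsilon_k=0$ and $c_k=h$ if $\varepsilon_k=1$; here permutations act on the $x$-variables only, $x_j\mapsto x_{v(j)}$. "Well defined" means independent of the choice of $\sigma$, $w$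 (of minimal length) and the reduced word. *)

theory Defs
  imports
    "HOL-Analysis.Analysis"
    "HOL-Library.Poly_Mapping"
    "HOL-Combinatorics.Permutations"
begin

section \<open>Theta functions and the function \<open>\<delta>\<close>\<close>

text \<open>Here \<open>q\<^sup>a\<close> always means \<open>exp (2\<pi>\<i>\<tau>a)\<close>; the product index is shifted by one.\<close>

definition qpow :: "complex \<Rightarrow> complex \<Rightarrow> complex" where
  "qpow \<tau> a = exp (2 * of_real pi * \<i> * \<tau> * a)"

definition theta :: "complex \<Rightarrow> complex \<Rightarrow> complex" where
  "theta \<tau> x = 2 * qpow \<tau> (1/8) * sin (of_real pi * x) *
     prodinf (\<lambda>n. (1 - qpow \<tau> (of_nat (Suc n)))
         * (1 - qpow \<tau> (of_nat (Suc n)) * exp (2 * of_real pi * \<i> * x))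
         * (1 - qpow \<tau> (of_nat (Suc n)) * exp (- (2 * of_real pi * \<i> * x))))"

definition F :: "complex \<Rightarrow> complex \<Rightarrow> complex \<Rightarrow> complex" where
  "F \<tau> x y = deriv (theta \<tau>) 0 * theta \<tau> (x + y) / (theta \<tau> x * theta \<tau> y)"

text \<open>\<open>F\<close> is 1-periodic in both arguments, so the branch of the logarithm is irrelevant; see
  \<open>delta_exp\<close> below.\<close>

definition delta :: "complex \<Rightarrow> complex \<Rightarrow> complex \<Rightarrow> complex" where
  "delta \<tau> a b = F \<tau> (Ln a / (2 * of_real pi * \<i>)) (Ln b / (2 * of_real pi * \<i>))"

lemma theta_plus_1: "theta \<tau> (x + 1) = - theta \<tau> x"
proof -
  have e: "exp (2 * of_real pi * \<i> * (x + 1)) = exp (2 * of_real pi * \<i> * x)"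
    using exp_plus_2pin[of "2 * of_real pi * \<i> * x" 1] by (simp add: algebra_simps)
  have e': "exp (- (2 * of_real pi * \<i> * (x + 1))) = exp (- (2 * of_real pi * \<i> * x))"
    using e by (simp only: exp_minus)
  have s: "sin (of_real pi * (x + 1)) = - sin (of_real pi * x)"
    by (simp add: algebra_simps sin_add flip: sin_of_real cos_of_real)
  show ?thesis
    unfolding theta_def e e' s by simp
qed

lemma theta_plus_int: "theta \<tau> (x + of_int n) = (-1) powi n * theta \<tau> x"
proof (induction n arbitrary: x rule: int_induct[where k = 0])
  case (step1 i)
  show ?case
    using step1.IH[of "x"] theta_plus_1[of \<tau> "x + of_int i"]
    by (simp add: power_int_add add.assoc)
next
  case (step2 i)
  show ?case
    using step2.IH[of "x"] theta_plus_1[of \<tau> "x + of_int (i - 1)"]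
    by (simp add: power_int_diff add.assoc)
qed simp

lemma F_periodic: "F \<tau> (x + of_int a) (y + of_int b) = F \<tau> x y"
proof -
  have *: "x + of_int a + (y + of_int b) = x + y + of_int (a + b)" by simp
  have nz: "(-1::complex) powi a \<noteq> 0" "(-1::complex) powi b \<noteq> 0" by simp_all
  show ?thesis
    unfolding F_def * theta_plus_int using nz by (simp add: power_int_add)
qed

lemma delta_exp:
  "delta \<tau> (exp (2 * of_real pi * \<i> * x)) (exp (2 * of_real pi * \<i> * y)) = F \<tau> x y"
proof -
  have ex: "\<exists>n::int. Ln (exp (2 * of_real pi * \<i> * z)) / (2 * of_real pi * \<i>) = z + of_int n" for z
  proof -
    have "exp (Ln (exp (2 * of_real pi * \<i> * z))) = exp (2 * of_real pi * \<i> * z)"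
      by simp
    then obtain n :: int where
      "Ln (exp (2 * of_real pi * \<i> * z)) = 2 * of_real pi * \<i> * z + (of_int (2 * n) * pi) * \<i>"
      unfolding exp_eq by blast
    then show ?thesis
      by (intro exI[of _ n]) (simp add: field_simps)
  qed
  obtain a b :: int where
    "Ln (exp (2 * of_real pi * \<i> * x)) / (2 * of_real pi * \<i>) = x + of_int a"
    "Ln (exp (2 * of_real pi * \<i> * y)) / (2 * of_real pi * \<i>) = y + of_int b"
    using ex by meson
  then show ?thesis
    unfolding delta_def by (simp only: F_periodic)
qed

section \<open>Variables, monomials, quadratic forms\<close>

text \<open>\<open>Xv 0\<close> is \<open>u\<close> and \<open>Mv 0\<close> is \<open>h\<close>.  The same type of points serves for the multiplicative
  variables in \<open>\<complex>\<^sup>*\<close> and for their additive (logarithmic) counterparts; the coordinate \<open>Tau\<close> is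
  the parameter \<open>\<tau>\<close> in both cases.\<close>

datatype var = Tau | Xv nat | Mv nat

type_synonym point = "var \<Rightarrow> complex"
type_synonym func = "point \<Rightarrow> complex"

text \<open>Laurent monomials with coefficient 1, written additively.\<close>

type_synonym monomial = "var \<Rightarrow>\<^sub>0 int"

abbreviation xm :: "nat \<Rightarrow> monomial" where "xm i \<equiv> Poly_Mapping.single (Xv i) 1"
abbreviation mum :: "nat \<Rightarrow> monomial" where "mum j \<equiv> Poly_Mapping.single (Mv j) 1"
abbreviation um :: monomial where "um \<equiv> xm 0"
abbreviation hm :: monomial where "hm \<equiv> mum 0"

definition xvars :: "nat \<Rightarrow> var set" where "xvars m = Xv ` {0..m}"
definition muvars :: "nat \<Rightarrow> var set" where "muvars r = Mv ` {0..r}"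
definition vars :: "nat \<Rightarrow> nat \<Rightarrow> var set" where "vars m r = xvars m \<union> muvars r"

definition mon_value :: "monomial \<Rightarrow> point \<Rightarrow> complex" where
  "mon_value l p = (\<Prod>v\<in>Poly_Mapping.keys l. p v powi Poly_Mapping.lookup l v)"

definition lin :: "monomial \<Rightarrow> point \<Rightarrow> complex" where
  "lin l z = (\<Sum>v\<in>Poly_Mapping.keys l. of_int (Poly_Mapping.lookup l v) * z v)"

definition deltaf :: "monomial \<Rightarrow> monomial \<Rightarrow> func" where
  "deltaf l1 l2 = (\<lambda>p. delta (p Tau) (mon_value l1 p) (mon_value l2 p))"

text \<open>Characters in the variables \<open>h, \<mu>\<^sub>1, \<dots>, \<mu>\<^sub>r\<close>.\<close>

definition is_char :: "nat \<Rightarrow> monomial \<Rightarrow> bool" where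
  "is_char r \<mu> \<longleftrightarrow> Poly_Mapping.keys \<mu> \<subseteq> muvars r"

definition nontrivial_char :: "nat \<Rightarrow> monomial \<Rightarrow> bool" where
  "nontrivial_char r \<mu> \<longleftrightarrow> is_char r \<mu> \<and> \<mu> \<noteq> 0"

text \<open>Quadratic forms are represented by the polynomial functions they define on additive
  coordinates.\<close>

definition integral_qform :: "nat \<Rightarrow> nat \<Rightarrow> func \<Rightarrow> bool" where
  "integral_qform m r Q \<longleftrightarrow> (\<exists>c :: var \<Rightarrow> var \<Rightarrow> int.
     Q = (\<lambda>z. \<Sum>v\<in>vars m r. \<Sum>w\<in>vars m r. of_int (c v w) * z v * z w))"

section \<open>Meromorphic functions\<close>

text \<open>Meromorphic functions are represented by total functions whose values on the polar divisor
  are irrelevant; equality of meromorphic functions is equality on a dense open subset.\<close>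

definition gen_eq :: "point set \<Rightarrow> func \<Rightarrow> func \<Rightarrow> bool" where
  "gen_eq D f g \<longleftrightarrow> (\<exists>U. open U \<and> U \<subseteq> D \<and> D \<subseteq> closure U \<and> (\<forall>p\<in>U. f p = g p))"

text \<open>Multiplicative and additive domains.\<close>

definition dom_mult :: "nat \<Rightarrow> nat \<Rightarrow> point set" where
  "dom_mult m r = {p. Im (p Tau) > 0 \<and> (\<forall>v\<in>vars m r. p v \<noteq> 0)}"

definition dom_add :: "point set" where
  "dom_add = {z. Im (z Tau) > 0}"

definition expo :: "point \<Rightarrow> point" where
  "expo z = (\<lambda>v. if v = Tau then z Tau else exp (2 * of_real pi * \<i> * z v))"

abbreviation mer_eq :: "nat \<Rightarrow> nat \<Rightarrow> func \<Rightarrow> func \<Rightarrow> bool" where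
  "mer_eq m r \<equiv> gen_eq (dom_mult m r)"

text \<open>Holomorphic functions of several variables: continuous and holomorphic in each variable
  separately.\<close>

definition several_holomorphic_on :: "func \<Rightarrow> point set \<Rightarrow> bool" where
  "several_holomorphic_on g W \<longleftrightarrow> continuous_on W g \<and>
     (\<forall>p\<in>W. \<forall>v. (\<lambda>t. g (p(v := t))) field_differentiable at (p v))"

definition mer_fun :: "nat \<Rightarrow> nat \<Rightarrow> func set" where
  "mer_fun m r = {f.
     (\<forall>p q. (\<forall>v\<in>insert Tau (vars m r). p v = q v) \<longrightarrow> f p = f q) \<and>
     (\<forall>p\<in>dom_mult m r. \<exists>W g h. open W \<and> p \<in> W \<and> W \<subseteq> dom_mult m r \<and>
        several_holomorphic_on g W \<and> several_holomorphic_on h W \<and>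
        W \<subseteq> closure {q \<in> W. h q \<noteq> 0} \<and>
        (\<forall>q\<in>W. h q \<noteq> 0 \<longrightarrow> f q = g q / h q))}"

definition subalgebra_of :: "func set \<Rightarrow> func set \<Rightarrow> bool" where
  "subalgebra_of S B \<longleftrightarrow> S \<subseteq> B \<and> (\<forall>c. (\<lambda>p. c) \<in> S) \<and>
     (\<forall>f\<in>S. \<forall>g\<in>S. (\<lambda>p. f p + g p) \<in> S \<and> (\<lambda>p. f p * g p) \<in> S)"

text \<open>The algebra generated by the functions \<open>\<delta>(\<ell>\<^sub>1, \<ell>\<^sub>2)\<close>.  The last rule makes it independent of
  the choice of representatives of meromorphic functions.\<close>

inductive_set frakA :: "nat \<Rightarrow> nat \<Rightarrow> func set" for m r where
  gen: "\<lbrakk>l1 \<noteq> 0; Poly_Mapping.keys l1 \<subseteq> xvars m; l2 \<noteq> 0; Poly_Mapping.keys l2 \<subseteq> muvars r\<rbrakk>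
        \<Longrightarrow> deltaf l1 l2 \<in> frakA m r"
| const: "(\<lambda>p. c) \<in> frakA m r"
| add: "f \<in> frakA m r \<Longrightarrow> g \<in> frakA m r \<Longrightarrow> (\<lambda>p. f p + g p) \<in> frakA m r"
| mult: "f \<in> frakA m r \<Longrightarrow> g \<in> frakA m r \<Longrightarrow> (\<lambda>p. f p * g p) \<in> frakA m r"
| repr: "f \<in> frakA m r \<Longrightarrow> g \<in> mer_fun m r \<Longrightarrow> mer_eq m r f g \<Longrightarrow> g \<in> frakA m r"

section \<open>Types and purity\<close>

text \<open>A Laurent monomial in theta functions is given by the exponents of the \<open>\<theta>(\<ell>)\<close>.\<close>

type_synonym theta_monomial = "monomial \<Rightarrow>\<^sub>0 int"

definition theta_mono_value :: "theta_monomial \<Rightarrow> point \<Rightarrow> complex" where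
  "theta_mono_value e z =
     (\<Prod>l\<in>Poly_Mapping.keys e. theta (z Tau) (lin l z) powi Poly_Mapping.lookup e l)"

definition theta_mono_type :: "theta_monomial \<Rightarrow> func" where
  "theta_mono_type e =
     (\<lambda>z. \<Sum>l\<in>Poly_Mapping.keys e. of_int (Poly_Mapping.lookup e l) * ((lin l z)\<^sup>2 / 2))"

definition theta_monomials :: "nat \<Rightarrow> nat \<Rightarrow> theta_monomial set" where
  "theta_monomials m r = {e. \<forall>l\<in>Poly_Mapping.keys e. l \<noteq> 0 \<and> Poly_Mapping.keys l \<subseteq> vars m r}"

text \<open>The coefficients of the Laurent polynomials are holomorphic functions of \<open>\<tau>\<close>; this is
  needed because of the factor \<open>\<theta>\<^sub>\<tau>'(0)\<close> in \<open>\<delta>\<close>, which has type 0.  Theta functions are not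
  single-valued in the multiplicative variables, so \<open>f\<close> is pulled back to additive ones.\<close>

definition has_type :: "nat \<Rightarrow> nat \<Rightarrow> func \<Rightarrow> func \<Rightarrow> bool" where
  "has_type m r f Q \<longleftrightarrow> (\<exists>(S :: theta_monomial set) (c :: theta_monomial \<Rightarrow> complex \<Rightarrow> complex).
     finite S \<and> S \<subseteq> theta_monomials m r \<and>
     (\<forall>e\<in>S. theta_mono_type e = Q \<and> c e holomorphic_on {\<tau>. Im \<tau> > 0}) \<and>
     gen_eq dom_add (\<lambda>z. f (expo z)) (\<lambda>z. \<Sum>e\<in>S. c e (z Tau) * theta_mono_value e z))"

definition pure :: "nat \<Rightarrow> nat \<Rightarrow> func \<Rightarrow> bool" where
  "pure m r f \<longleftrightarrow> (\<exists>Q. has_type m r f Q)"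

definition type_piece :: "nat \<Rightarrow> nat \<Rightarrow> func \<Rightarrow> func set" where
  "type_piece m r Q = {f \<in> frakA m r. has_type m r f Q}"

text \<open>\<open>A\<close> (functions up to \<open>gen_eq D\<close>) is the direct sum of the subspaces \<open>G Q\<close>, \<open>Q \<in> I\<close>, and
  \<open>1 \<in> G 0\<close>, \<open>G Q \<cdot> G Q' \<subseteq> G (Q + Q')\<close>.\<close>

definition graded_algebra :: "point set \<Rightarrow> func set \<Rightarrow> func set \<Rightarrow> (func \<Rightarrow> func set) \<Rightarrow> bool" where
  "graded_algebra D A I G \<longleftrightarrow>
     (\<forall>Q\<in>I. G Q \<subseteq> A \<and> (\<lambda>p. 0) \<in> G Q \<and>
        (\<forall>f\<in>G Q. \<forall>g\<in>G Q. (\<lambda>p. f p + g p) \<in> G Q) \<and>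
        (\<forall>c. \<forall>f\<in>G Q. (\<lambda>p. c * f p) \<in> G Q)) \<and>
     (\<lambda>z. 0) \<in> I \<and> (\<lambda>p. 1) \<in> G (\<lambda>z. 0) \<and>
     (\<forall>Q\<in>I. \<forall>Q'\<in>I. (\<lambda>z. Q z + Q' z) \<in> I \<and>
        (\<forall>f\<in>G Q. \<forall>g\<in>G Q'. (\<lambda>p. f p * g p) \<in> G (\<lambda>z. Q z + Q' z))) \<and>
     (\<forall>f\<in>A. \<exists>S g. finite S \<and> S \<subseteq> I \<and> (\<forall>Q\<in>S. g Q \<in> G Q) \<and>
        gen_eq D f (\<lambda>p. \<Sum>Q\<in>S. g Q p)) \<and>
     (\<forall>S g. finite S \<and> S \<subseteq> I \<and> (\<forall>Q\<in>S. g Q \<in> G Q) \<and>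
        gen_eq D (\<lambda>p. \<Sum>Q\<in>S. g Q p) (\<lambda>p. 0) \<longrightarrow> (\<forall>Q\<in>S. gen_eq D (g Q) (\<lambda>p. 0)))"

section \<open>Operations\<close>

fun ren_x :: "(nat \<Rightarrow> nat) \<Rightarrow> var \<Rightarrow> var" where
  "ren_x v Tau = Tau" | "ren_x v (Xv j) = Xv (v j)" | "ren_x v (Mv j) = Mv j"

fun ren_mu :: "(nat \<Rightarrow> nat) \<Rightarrow> var \<Rightarrow> var" where
  "ren_mu s Tau = Tau" | "ren_mu s (Xv j) = Xv j" | "ren_mu s (Mv j) = Mv (s j)"

text \<open>Substitutions \<open>x\<^sub>j \<mapsto> x\<^bsub>v(j)\<^esub>\<close> and \<open>\<mu>\<^sub>j \<mapsto> \<mu>\<^bsub>s(j)\<^esub>\<close>; as operations on functions they are left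
  actions of the symmetric groups.\<close>

definition act_x :: "(nat \<Rightarrow> nat) \<Rightarrow> func \<Rightarrow> func" where
  "act_x v f = (\<lambda>p. f (\<lambda>a. p (ren_x v a)))"

definition act_mu :: "(nat \<Rightarrow> nat) \<Rightarrow> func \<Rightarrow> func" where
  "act_mu s f = (\<lambda>p. f (\<lambda>a. p (ren_mu s a)))"

abbreviation simple_refl :: "nat \<Rightarrow> nat \<Rightarrow> nat" where
  "simple_refl i \<equiv> Transposition.transpose i (Suc i)"

definition opC :: "nat \<Rightarrow> monomial \<Rightarrow> func \<Rightarrow> func" where
  "opC i \<mu> f = (\<lambda>p. deltaf (xm (Suc i) - xm i) \<mu> p * f p
                  + deltaf (xm i - xm (Suc i)) hm p * act_x (simple_refl i) f p)"

text \<open>The types of the two summands of \<open>opC i \<mu> f\<close> agree, where \<open>Q\<close> is the type of \<open>f\<close>.  This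
  makes sense for trivial \<open>\<mu>\<close> as well.\<close>

definition balanced :: "nat \<Rightarrow> monomial \<Rightarrow> func \<Rightarrow> bool" where
  "balanced i \<mu> Q \<longleftrightarrow>
     (\<lambda>z. lin (xm (Suc i) - xm i) z * lin \<mu> z + Q z) =
     (\<lambda>z. lin (xm i - xm (Suc i)) z * lin hm z + act_x (simple_refl i) Q z)"

section \<open>Labelled link patterns\<close>

text \<open>\<open>P k = (a\<^sub>k, b\<^sub>k)\<close> is the pair (source, target) of the arrow labelled \<open>k\<close>; only the values for
  \<open>k \<in> {1..r}\<close> matter.\<close>

type_synonym pattern = "nat \<Rightarrow> nat \<times> nat"

definition link_pattern :: "nat \<Rightarrow> nat \<Rightarrow> pattern \<Rightarrow> bool" where
  "link_pattern m r P \<longleftrightarrow>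
     (\<forall>k\<in>{1..r}. fst (P k) \<in> {1..m} \<and> snd (P k) \<in> {1..m}) \<and>
     inj_on (fst \<circ> P) {1..r} \<and> inj_on (snd \<circ> P) {1..r} \<and>
     (fst \<circ> P) ` {1..r} \<inter> (snd \<circ> P) ` {1..r} = {}"

definition upper_triangular :: "nat \<Rightarrow> pattern \<Rightarrow> bool" where
  "upper_triangular r P \<longleftrightarrow> (\<forall>k\<in>{1..r}. snd (P k) < fst (P k))"

definition pattern_eq :: "nat \<Rightarrow> pattern \<Rightarrow> pattern \<Rightarrow> bool" where
  "pattern_eq r P P' \<longleftrightarrow> (\<forall>k\<in>{1..r}. P k = P' k)"

definition move_pattern :: "(nat \<Rightarrow> nat) \<Rightarrow> pattern \<Rightarrow> pattern" where
  "move_pattern w P = (\<lambda>k. map_prod w w (P k))"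

definition relabel_pattern :: "(nat \<Rightarrow> nat) \<Rightarrow> pattern \<Rightarrow> pattern" where
  "relabel_pattern \<sigma> P = (\<lambda>k. P (inv \<sigma> k))"

definition min_pattern :: "nat \<Rightarrow> nat \<Rightarrow> pattern" where
  "min_pattern m r = (\<lambda>k. (m - r + k, k))"

text \<open>\<open>word_perm [i\<^sub>1, \<dots>, i\<^sub>l] = s\<^bsub>i\<^sub>1\<^esub> \<circ> \<dots> \<circ> s\<^bsub>i\<^sub>l\<^esub>\<close>.\<close>

definition word_perm :: "nat list \<Rightarrow> nat \<Rightarrow> nat" where
  "word_perm ws = foldr (\<lambda>i v. simple_refl i \<circ> v) ws id"

definition perm_length :: "nat \<Rightarrow> (nat \<Rightarrow> nat) \<Rightarrow> nat" where
  "perm_length m w = (LEAST n. \<exists>ws. set ws \<subseteq> {1..<m} \<and> word_perm ws = w \<and> length ws = n)"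

definition reduced_word :: "nat \<Rightarrow> (nat \<Rightarrow> nat) \<Rightarrow> nat list \<Rightarrow> bool" where
  "reduced_word m w ws \<longleftrightarrow>
     set ws \<subseteq> {1..<m} \<and> word_perm ws = w \<and> length ws = perm_length m w"

definition presents :: "nat \<Rightarrow> nat \<Rightarrow> pattern \<Rightarrow> (nat \<Rightarrow> nat) \<Rightarrow> (nat \<Rightarrow> nat) \<Rightarrow> bool" where
  "presents m r P \<sigma> w \<longleftrightarrow> \<sigma> permutes {1..r} \<and> w permutes {1..m} \<and>
     pattern_eq r P (relabel_pattern \<sigma> (move_pattern w (min_pattern m r)))"

definition min_length :: "nat \<Rightarrow> nat \<Rightarrow> pattern \<Rightarrow> nat" where
  "min_length m r P = (LEAST n. \<exists>\<sigma> w. presents m r P \<sigma> w \<and> perm_length m w = n)"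

section \<open>Elliptic classes\<close>

definition ell_min :: "nat \<Rightarrow> nat \<Rightarrow> func" where
  "ell_min m r = (\<lambda>p. \<Prod>i\<in>{1..r}. deltaf (um + xm i - xm (m - r + i)) (mum i) p
                       * (\<Prod>j\<in>{m - r + i + 1..m}. deltaf (um + xm i - xm j) hm p))"

text \<open>\<open>subword_perm ws \<epsilon> k = s\<^bsub>i\<^sub>1\<^esub>\<^bsup>\<epsilon>\<^sub>1\<^esup> \<circ> \<dots> \<circ> s\<^bsub>i\<^sub>k\<^esub>\<^bsup>\<epsilon>\<^sub>k\<^esup>\<close>: the element \<open>v\<^sub>k\<close> of a torus-fixed point.\<close>

definition subword_perm :: "nat list \<Rightarrow> bool list \<Rightarrow> nat \<Rightarrow> nat \<Rightarrow> nat" where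
  "subword_perm ws \<epsilon> k = word_perm (map fst (filter snd (take k (zip ws \<epsilon>))))"

text \<open>Push-forward of the Borisov--Libgober class of the resolution given by the word \<open>ws\<close>, with
  multiplicity parameters \<open>\<nu>\<close> along the boundary components, written as the sum of the
  contributions of the torus-fixed points.  List positions start at 0.\<close>

definition push_forward :: "nat \<Rightarrow> nat \<Rightarrow> nat list \<Rightarrow> monomial list \<Rightarrow> func" where
  "push_forward m r ws \<nu> = (\<lambda>p. \<Sum>\<epsilon>\<in>{\<epsilon> :: bool list. length \<epsilon> = length ws}.
     (\<Prod>k<length ws. act_x (subword_perm ws \<epsilon> (Suc k))
        (deltaf (xm (Suc (ws ! k)) - xm (ws ! k)) (if \<epsilon> ! k then hm else \<nu> ! k)) p)
     * act_x (subword_perm ws \<epsilon> (length ws)) (ell_min m r) p)"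

definition purifying :: "nat \<Rightarrow> nat \<Rightarrow> nat list \<Rightarrow> monomial list \<Rightarrow> bool" where
  "purifying m r ws \<nu> \<longleftrightarrow> length \<nu> = length ws \<and>
     (\<forall>k<length ws. nontrivial_char r (\<nu> ! k) \<and>
        pure m r (push_forward m r (drop k ws) (drop k \<nu>)))"

text \<open>A choice of \<open>\<sigma>\<close>, of \<open>w\<close> of minimal length and of a reduced word for \<open>w\<close>.\<close>

definition ell_choice ::
    "nat \<Rightarrow> nat \<Rightarrow> pattern \<Rightarrow> (nat \<Rightarrow> nat) \<Rightarrow> (nat \<Rightarrow> nat) \<Rightarrow> nat list \<Rightarrow> bool" where
  "ell_choice m r P \<sigma> w ws \<longleftrightarrow> presents m r P \<sigma> w \<and>
     perm_length m w = min_length m r P \<and> reduced_word m w ws"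

definition is_ell :: "nat \<Rightarrow> nat \<Rightarrow> pattern \<Rightarrow> func \<Rightarrow> bool" where
  "is_ell m r P E \<longleftrightarrow> (\<exists>\<sigma> w ws \<nu>. ell_choice m r P \<sigma> w ws \<and> purifying m r ws \<nu> \<and>
     E = act_mu \<sigma> (push_forward m r ws \<nu>))"

definition ell_well_defined :: "nat \<Rightarrow> nat \<Rightarrow> pattern \<Rightarrow> bool" where
  "ell_well_defined m r P \<longleftrightarrow>
     (\<exists>\<sigma> w ws. ell_choice m r P \<sigma> w ws) \<and>
     (\<forall>\<sigma> w ws. ell_choice m r P \<sigma> w ws \<longrightarrow> (\<exists>!\<nu>. purifying m r ws \<nu>)) \<and>
     (\<forall>E E'. is_ell m r P E \<and> is_ell m r P E' \<longrightarrow> mer_eq m r E E')"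

end

theory Submission
  imports Defs "HOL-Complex_Analysis.Complex_Analysis" "HOL-Real_Asymp.Real_Asymp"
begin

text \<open>In additive coordinates \<open>\<delta>\<close> becomes the quotient \<open>F\<close> of theta functions, and it is enough
  to verify identities generically.  Comparing quasi-periods and zeros gives the three-term identity
  for \<open>\<theta>\<close>, hence Fay's identity for \<open>F\<close>, from which the braid and flip relations follow.  A function
  of type \<open>Q\<close> picks up an exponential factor determined by \<open>Q\<close> under translations by \<open>\<tau>\<close> times a
  lattice vector; the \<open>k\<close>-fold translation gives a factor whose growth in \<open>k\<close> tells the types apart,
  so functions of different types are linearly independent.

  The type of a nonzero homogeneous element is \<open>\<Sum>\<^sub>j x\<^sub>j A\<^sub>j\<close> with characters \<open>A\<^sub>j\<close>, and the two summands
  of the operation with parameter \<open>\<nu>\<close> have the same type exactly if \<open>\<nu> = A\<^sub>i - A\<^sub>i\<^sub>+\<^sub>1 - h\<close>.  After a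
  shift of the \<open>A\<^sub>j\<close> by multiples of \<open>h\<close> the operation then merely exchanges two characters.  So all
  parameters along a word are explicit, the push-forward is an iterated operation, and by Matsumoto's
  theorem and the braid relation it depends only on the permutation.  Any two presentations of minimal
  length of a pattern are connected by flips, which the flip relation accounts for.\<close>

section \<open>Theta functions\<close>

text \<open>Everything said about types holds for nonzero functions only: the zero function has
  every type, and a class that vanished would leave its purifying parameter undetermined.
  Nonvanishing is therefore carried along each word. Applying the operation with parameter
  \<open>- \<nu>\<close> after the one with parameter \<open>\<nu>\<close> gives a scalar multiple
  of the original function, and the scalar is generically nonzero unless \<open>\<nu>\<close> is
  \<open>h\<close> or \<open>- h\<close>. These two parameters can occur only when two vertices off
  the arrows are exchanged; a word of minimal length never does this, since leaving out the letter
  would present the same pattern. Purity of a sum says nothing in advance about the type of the sum,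
  so independence is proved for arbitrary finite families of types. It rests on one integer vector
  at which finitely many distinct quadratic forms take distinct values. Well-definedness uses a
  normal form: flips lead from any presentation of minimal length to one that is increasing on the
  targets \<open>1, ..., r\<close>, and such a presentation is unique.\<close>

definition theta_factor :: "nat \<Rightarrow> complex \<Rightarrow> complex \<Rightarrow> complex" where
  "theta_factor n \<tau> x = (1 - qpow \<tau> (of_nat (Suc n)))
         * (1 - qpow \<tau> (of_nat (Suc n)) * exp (2 * of_real pi * \<i> * x))
         * (1 - qpow \<tau> (of_nat (Suc n)) * exp (- (2 * of_real pi * \<i> * x)))"

definition theta_prod :: "complex \<Rightarrow> complex \<Rightarrow> complex" where
  "theta_prod \<tau> x = prodinf (\<lambda>n. theta_factor n \<tau> x)"

lemma theta_alt: "theta \<tau> x = 2 * qpow \<tau> (1/8) * sin (of_real pi * x) * theta_prod \<tau> x"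
  by (simp add: theta_def theta_prod_def theta_factor_def)

lemma norm_qpow_nat: "norm (qpow \<tau> (of_nat n)) = exp (- 2 * pi * Im \<tau>) ^ n"
proof -
  have "norm (qpow \<tau> (of_nat n)) = exp (real n * (- 2 * pi * Im \<tau>))"
    by (simp add: qpow_def algebra_simps)
  thus ?thesis by (simp only: exp_of_nat_mult)
qed

text \<open>The factor is a product of \<open>1 - a\<close>, \<open>1 - b\<close> and
  \<open>1 - c\<close>, where all three numbers have modulus at most \<open>M * t\<close>. The
  product minus 1 expands into seven monomials, and as \<open>M * t \<le> M\<close>, each of them is
  at most \<open>M ^ 3 * t\<close>.\<close>

lemma theta_factor_bound:
  assumes "norm (qpow \<tau> (of_nat (Suc n))) \<le> t" "t \<le> 1" "M \<ge> 1"
    "norm (exp (2 * of_real pi * \<i> * x)) \<le> M" "norm (exp (- (2 * of_real pi * \<i> * x))) \<le> M"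
  shows "norm (theta_factor n \<tau> x - 1) \<le> 7 * M ^ 3 * t"
proof -
  define a where "a = qpow \<tau> (of_nat (Suc n))"
  define b where "b = a * exp (2 * of_real pi * \<i> * x)"
  define c where "c = a * exp (- (2 * of_real pi * \<i> * x))"
  have t0: "0 \<le> t" using assms(1) norm_ge_zero order_trans by blast
  have a: "norm a \<le> M * t"
    using assms(1,3) t0 unfolding a_def by (meson mult_right_mono order_trans mult_left_le_one_le mult_le_cancel_right1 not_less)
  have at: "norm a \<le> t" using assms(1) by (simp add: a_def)
  have b: "norm b \<le> M * t" unfolding b_def norm_mult
    using mult_mono[OF at assms(4) t0] by (simp add: mult.commute)
  have c: "norm c \<le> M * t" unfolding c_def norm_mult
    using mult_mono[OF at assms(5) t0] by (simp add: mult.commute)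
  define s where "s = M * t"
  have s0: "0 \<le> s" "s \<le> M" using assms t0 by (auto simp: s_def mult_left_le)
  have "theta_factor n \<tau> x - 1 = - a - b - c + a * b + a * c + b * c - a * b * c"
    unfolding theta_factor_def a_def[symmetric] b_def[symmetric] c_def[symmetric]
    by (simp add: algebra_simps)
  also have "norm \<dots> \<le> norm a + norm b + norm c + norm (a * b) + norm (a * c) + norm (b * c) + norm (a * b * c)"
    by norm
  also have "\<dots> \<le> s + s + s + s * s + s * s + s * s + s * s * s"
    unfolding norm_mult using a b c s0 unfolding s_def[symmetric]
    by (intro add_mono mult_mono) auto
  also have "\<dots> \<le> 7 * (M * M * s)"
  proof -
    have "1 * s \<le> M * M * s"
      using assms(3) s0 by (intro mult_right_mono) (auto intro: order_trans[OF _ mult_mono[of 1 M 1 M]])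
    moreover have "s * s \<le> M * M * s"
      using assms(3) s0 by (intro mult_right_mono) (auto intro: order_trans[OF _ mult_mono[of 1 M s M]])
    moreover have "s * s * s \<le> M * M * s"
      using assms(3) s0 by (intro mult_right_mono mult_mono) auto
    ultimately show ?thesis by linarith
  qed
  also have "\<dots> = 7 * M ^ 3 * t"
    by (simp add: s_def power3_eq_cube)
  finally show ?thesis .
qed

section \<open>Convergence of the theta product, continuity and holomorphy\<close>

lemma continuous_theta_factor:
  "continuous_on A f \<Longrightarrow> continuous_on A g \<Longrightarrow> continuous_on A (\<lambda>p. theta_factor n (f p) (g p))"
  unfolding theta_factor_def qpow_def by (intro continuous_intros)

text \<open>Uniformity is wanted in \<open>\<tau>\<close> and \<open>x\<close> together, because
  theta has to be jointly continuous and holomorphic in the modulus as well. On a compact set the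
  exponentials are bounded by some \<open>M\<close> and the nome by some \<open>\<rho> < 1\<close>,
  so a geometric series dominates.\<close>

lemma uniformly_convergent_theta_prod:
  assumes K: "compact K" "\<And>\<tau> x. (\<tau>, x) \<in> K \<Longrightarrow> Im \<tau> > 0"
  shows "uniformly_convergent_on K (\<lambda>N p. \<Prod>n<N. theta_factor n (fst p) (snd p))"
    and "p \<in> K \<Longrightarrow> summable (\<lambda>n. norm (theta_factor n (fst p) (snd p) - 1))"
proof -
  have "compact ((\<lambda>p. exp (- 2 * pi * Im (fst p))) ` K)"
    by (intro compact_continuous_image continuous_intros K)
  moreover have "compact ((\<lambda>p. norm (exp (2 * of_real pi * \<i> * snd p)) + norm (exp (- (2 * of_real pi * \<i> * snd p)))) ` K)"
    by (intro compact_continuous_image continuous_intros K)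
  ultimately obtain M0 where M0: "\<And>p. p \<in> K \<Longrightarrow>
      norm (exp (2 * of_real pi * \<i> * snd p)) + norm (exp (- (2 * of_real pi * \<i> * snd p))) \<le> M0"
    by (force dest!: compact_imp_bounded simp: bounded_iff)
  define M where "M = max M0 1"
  have M: "M \<ge> 1" "norm (exp (2 * of_real pi * \<i> * snd p)) \<le> M" 
      "norm (exp (- (2 * of_real pi * \<i> * snd p))) \<le> M" if "p \<in> K" for p
    using M0[OF that] norm_ge_zero[of "exp (2 * of_real pi * \<i> * snd p)"]
      norm_ge_zero[of "exp (- (2 * of_real pi * \<i> * snd p))"]
    unfolding M_def by linarith+
  obtain \<rho> where \<rho>: "\<rho> < 1" "0 \<le> \<rho>" "\<And>p. p \<in> K \<Longrightarrow> exp (- 2 * pi * Im (fst p)) \<le> \<rho>"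
  proof (cases "K = {}")
    case False
    obtain p0 where "p0 \<in> K" "\<forall>p\<in>K. exp (- 2 * pi * Im (fst p)) \<le> exp (- 2 * pi * Im (fst p0))"
      using continuous_attains_sup[OF K(1) False, of "\<lambda>p. exp (- 2 * pi * Im (fst p))"]
      by (force intro!: continuous_intros)
    moreover have "exp (- 2 * pi * Im (fst p0)) < 1"
      using K(2)[of "fst p0" "snd p0"] \<open>p0 \<in> K\<close> by simp
    ultimately show ?thesis using that[of "exp (- 2 * pi * Im (fst p0))"] by simp
  qed (use that[of 0] in auto)
  have bound: "norm (theta_factor n (fst p) (snd p) - 1) \<le> 7 * M ^ 3 * \<rho> ^ Suc n" if p: "p \<in> K" for n p
  proof (rule theta_factor_bound)
    show "norm (qpow (fst p) (of_nat (Suc n))) \<le> \<rho> ^ Suc n"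
      unfolding norm_qpow_nat by (intro power_mono \<rho>(3) p) simp
    show "\<rho> ^ Suc n \<le> 1" using \<rho> by (intro power_le_one) auto
  qed (use M p in auto)
  have sm: "summable (\<lambda>n. 7 * M ^ 3 * \<rho> ^ Suc n)"
    using \<rho> by (intro summable_mult) (auto simp: summable_Suc_iff intro: summable_geometric)
  show "p \<in> K \<Longrightarrow> summable (\<lambda>n. norm (theta_factor n (fst p) (snd p) - 1))"
    by (rule summable_comparison_test'[OF sm, of 0]) (use bound in auto)
  show "uniformly_convergent_on K (\<lambda>N p. \<Prod>n<N. theta_factor n (fst p) (snd p))"
  proof (rule Infinite_Products.uniformly_convergent_on_prod')
    show "uniformly_convergent_on K (\<lambda>N x. \<Sum>n<N. norm (theta_factor n (fst x) (snd x) - 1))"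
      by (rule Weierstrass_m_test'[OF _ sm]) (use bound in auto)
  qed (intro continuous_theta_factor continuous_intros K)+
qed

lemma convergent_theta_prod:
  assumes "Im \<tau> > 0"
  shows "convergent_prod (\<lambda>n. theta_factor n \<tau> x)"
proof -
  have "summable (\<lambda>n. norm (theta_factor n \<tau> x - 1))"
    using uniformly_convergent_theta_prod(2)[of "{(\<tau>, x)}" "(\<tau>, x)"] assms by auto
  thus ?thesis
    by (intro abs_convergent_prod_imp_convergent_prod) (simp add: abs_convergent_prod_conv_summable)
qed

text \<open>Uniform convergence provides some limit function; pointwise it must be the value of
  \<open>prodinf\<close>, by uniqueness of limits.\<close>

lemma uniform_limit_theta_prod:
  assumes K: "compact K" "\<And>\<tau> x. (\<tau>, x) \<in> K \<Longrightarrow> Im \<tau> > 0"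
  shows "uniform_limit K (\<lambda>N p. \<Prod>n<N. theta_factor n (fst p) (snd p))
           (\<lambda>p. theta_prod (fst p) (snd p)) sequentially"
proof -
  have "uniformly_convergent_on K (\<lambda>N p. \<Prod>n<N. theta_factor n (fst p) (snd p))"
    by (rule uniformly_convergent_theta_prod(1)) (use K in auto)
  then obtain g where g: "uniform_limit K (\<lambda>N p. \<Prod>n<N. theta_factor n (fst p) (snd p)) g sequentially"
    by (auto simp: uniformly_convergent_on_def)
  also have "?this \<longleftrightarrow> ?thesis"
  proof (intro uniform_limit_cong)
    fix p assume p: "p \<in> K"
    have "(\<lambda>N. \<Prod>n<N. theta_factor n (fst p) (snd p)) \<longlonglongrightarrow> g p"
      by (rule tendsto_uniform_limitI[OF g p])
    hence 1: "(\<lambda>N. \<Prod>n\<le>N. theta_factor n (fst p) (snd p)) \<longlonglongrightarrow> g p"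
      by (simp add: LIMSEQ_lessThan_iff_atMost)
    have "(\<lambda>N. \<Prod>n\<le>N. theta_factor n (fst p) (snd p)) \<longlonglongrightarrow> theta_prod (fst p) (snd p)"
      unfolding theta_prod_def
      by (rule convergent_prod_LIMSEQ[OF convergent_theta_prod]) (use p K(2)[of "fst p" "snd p"] in auto)
    thus "g p = theta_prod (fst p) (snd p)" using 1 LIMSEQ_unique by blast
  qed auto
  finally show ?thesis .
qed

lemma isCont_theta_prod:
  assumes "Im \<tau> > 0"
  shows "isCont (\<lambda>p. theta_prod (fst p) (snd p)) (\<tau>, x)"
proof -
  \<comment> \<open>The radius \<open>Im \<tau> / 2\<close> keeps the closed ball inside the upper
    half-plane.\<close>
  define K where "K = cball \<tau> (Im \<tau> / 2) \<times> cball x 1"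
  have Im: "Im \<sigma> > 0" if "\<sigma> \<in> cball \<tau> (Im \<tau> / 2)" for \<sigma>
  proof -
    have "\<bar>Im (\<tau> - \<sigma>)\<bar> \<le> Im \<tau> / 2"
      using that abs_Im_le_cmod[of "\<tau> - \<sigma>"] by (simp add: dist_norm)
    thus ?thesis using assms by (simp add: abs_if split: if_splits)
  qed
  have "continuous_on K (\<lambda>p. theta_prod (fst p) (snd p))"
  proof (rule uniform_limit_theorem[OF _ uniform_limit_theta_prod])
    show "compact K" unfolding K_def by (intro compact_Times) auto
  qed (use Im in \<open>auto simp: K_def intro!: always_eventually continuous_intros continuous_theta_factor\<close>)
  moreover have "(\<tau>, x) \<in> interior K"
    unfolding K_def interior_Times using assms by (auto simp: interior_cball)
  ultimately show ?thesis
    using continuous_on_interior by blast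
qed

lemma continuous_on_theta [continuous_intros]:
  assumes "continuous_on A f" "continuous_on A g" "\<And>p. p \<in> A \<Longrightarrow> Im (f p) > 0"
  shows "continuous_on A (\<lambda>p. theta (f p) (g p))"
proof -
  have "continuous_on {p. Im (fst p) > 0} (\<lambda>p. theta_prod (fst p) (snd p))"
    by (intro continuous_at_imp_continuous_on) (auto intro: isCont_theta_prod)
  hence "continuous_on A ((\<lambda>p. theta_prod (fst p) (snd p)) \<circ> (\<lambda>p. (f p, g p)))"
    by (intro continuous_on_compose continuous_on_Pair assms) (rule continuous_on_subset, use assms in auto)
  hence *: "continuous_on A (\<lambda>p. theta_prod (f p) (g p))" by (simp add: o_def)
  have "continuous_on A (sin \<circ> (\<lambda>p. of_real pi * g p))"
    by (intro continuous_on_compose continuous_intros assms)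
  hence s: "continuous_on A (\<lambda>p. sin (of_real pi * g p))" by (simp add: o_def)
  show ?thesis unfolding theta_alt qpow_def
    by (intro continuous_intros assms(1,2) * s)
qed

text \<open>Stated along a curve \<open>(f z, g z)\<close>, so that holomorphy in \<open>x\<close>,
  in \<open>\<tau>\<close> and in a coordinate entering both is covered at once. Locally uniform
  limits of holomorphic functions are holomorphic.\<close>

lemma holomorphic_theta_prod:
  assumes f: "f holomorphic_on S" and g: "g holomorphic_on S" and S: "open S"
    and Im: "\<And>z. z \<in> S \<Longrightarrow> Im (f z) > 0"
  shows "(\<lambda>z. theta_prod (f z) (g z)) holomorphic_on S"
proof (rule holomorphic_uniform_sequence[OF S])
  show "(\<lambda>z. \<Prod>n<N. theta_factor n (f z) (g z)) holomorphic_on S" for N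
    unfolding theta_factor_def qpow_def by (intro holomorphic_intros f g)
  fix x assume "x \<in> S"
  then obtain d where d: "d > 0" "cball x d \<subseteq> S" using S open_contains_cball by blast
  define K where "K = (\<lambda>z. (f z, g z)) ` cball x d"
  have "compact K" unfolding K_def
    using d f g by (intro compact_continuous_image continuous_on_Pair)
      (auto intro: continuous_on_subset holomorphic_on_imp_continuous_on)
  hence "uniform_limit K (\<lambda>N p. \<Prod>n<N. theta_factor n (fst p) (snd p))
           (\<lambda>p. theta_prod (fst p) (snd p)) sequentially"
    using Im d by (intro uniform_limit_theta_prod) (auto simp: K_def)
  hence "uniform_limit (cball x d) (\<lambda>N z. \<Prod>n<N. theta_factor n (f z) (g z))
           (\<lambda>z. theta_prod (f z) (g z)) sequentially"
    unfolding uniform_limit_iff K_def by simp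
  thus "\<exists>d>0. cball x d \<subseteq> S \<and> uniform_limit (cball x d) (\<lambda>N z. \<Prod>n<N. theta_factor n (f z) (g z))
           (\<lambda>z. theta_prod (f z) (g z)) sequentially"
    using d by blast
qed

lemma holomorphic_theta [holomorphic_intros]:
  assumes "f holomorphic_on S" "g holomorphic_on S" "open S" "\<And>z. z \<in> S \<Longrightarrow> Im (f z) > 0"
  shows "(\<lambda>z. theta (f z) (g z)) holomorphic_on S"
  unfolding theta_alt qpow_def
  by (intro holomorphic_intros assms holomorphic_theta_prod)

lemma theta_uminus: "theta \<tau> (- x) = - theta \<tau> x"
  by (simp add: theta_def mult.assoc mult.commute mult.left_commute)

lemma theta_0 [simp]: "theta \<tau> 0 = 0"
  by (simp add: theta_def)

section \<open>The zeros of theta\<close>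

lemma exp_eq_1_iff_int: "exp (2 * of_real pi * \<i> * z) = 1 \<longleftrightarrow> (\<exists>a :: int. z = of_int a)"
proof -
  have "exp (2 * of_real pi * \<i> * z) = 1 \<longleftrightarrow> (\<exists>n::int. 2 * of_real pi * \<i> * z = of_int (2 * n) * pi * \<i>)"
    by (rule exp_eq_1[THEN trans]) (auto simp: complex_eq_iff)
  also have "\<dots> \<longleftrightarrow> (\<exists>a :: int. z = of_int a)"
    by (intro ex_cong1) (auto simp: field_simps)
  finally show ?thesis .
qed

text \<open>A convergent infinite product vanishes only through one of its factors. Powers of the
  nome have modulus less than 1, so the first part of a factor never vanishes; the other two parts
  give the two alternatives.\<close>

lemma theta_prod_eq_0_iff:
  assumes \<tau>: "Im \<tau> > 0"
  shows "theta_prod \<tau> x = 0 \<longleftrightarrow>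
    (\<exists>n. \<exists>a::int. of_nat (Suc n) * \<tau> + x = of_int a \<or> of_nat (Suc n) * \<tau> - x = of_int a)"
proof -
  let ?e = "\<lambda>z. exp (2 * of_real pi * \<i> * z)"
  have q: "qpow \<tau> (of_nat n) = ?e (of_nat n * \<tau>)" for n
    by (simp add: qpow_def algebra_simps)
  have "theta_prod \<tau> x = 0 \<longleftrightarrow> (\<exists>n. theta_factor n \<tau> x = 0)"
  proof -
    have "(\<lambda>n. theta_factor n \<tau> x) has_prod theta_prod \<tau> x"
      unfolding theta_prod_def using convergent_theta_prod[OF \<tau>] by (rule convergent_prod_has_prod)
    thus ?thesis using has_prod_eq_0_iff[of "\<lambda>n. theta_factor n \<tau> x" "theta_prod \<tau> x"] by (auto simp: image_iff)
  qed
  also have "\<dots> \<longleftrightarrow> (\<exists>n. \<exists>a::int. of_nat (Suc n) * \<tau> + x = of_int a \<or> of_nat (Suc n) * \<tau> - x = of_int a)"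
  proof (intro ex_cong1)
    fix n
    have "1 - qpow \<tau> (of_nat (Suc n)) \<noteq> 0"
    proof
      assume "1 - qpow \<tau> (of_nat (Suc n)) = 0"
      hence "norm (qpow \<tau> (of_nat (Suc n))) = 1" by (metis eq_iff_diff_eq_0 norm_one)
      moreover have "exp (- 2 * pi * Im \<tau>) ^ Suc n < 1"
        by (rule power_Suc_less_one) (use \<tau> in auto)
      ultimately show False unfolding norm_qpow_nat by linarith
    qed
    hence "theta_factor n \<tau> x = 0 \<longleftrightarrow> ?e (of_nat (Suc n) * \<tau> + x) = 1 \<or> ?e (of_nat (Suc n) * \<tau> - x) = 1"
    proof -
      have "?e (of_nat (Suc n) * \<tau> + x) = ?e (of_nat (Suc n) * \<tau>) * exp (2 * of_real pi * \<i> * x)"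
        "?e (of_nat (Suc n) * \<tau> - x) = ?e (of_nat (Suc n) * \<tau>) * exp (- (2 * of_real pi * \<i> * x))"
        by (simp_all add: exp_add[symmetric] ring_distribs right_diff_distrib)
      thus ?thesis using \<open>1 - qpow \<tau> (of_nat (Suc n)) \<noteq> 0\<close> unfolding theta_factor_def q
        by (simp del: of_nat_Suc)
    qed
    thus "theta_factor n \<tau> x = 0 \<longleftrightarrow> (\<exists>a::int. of_nat (Suc n) * \<tau> + x = of_int a \<or> of_nat (Suc n) * \<tau> - x = of_int a)"
      unfolding exp_eq_1_iff_int by blast
  qed
  finally show ?thesis .
qed

lemma theta_eq_0_iff:
  assumes \<tau>: "Im \<tau> > 0"
  shows "theta \<tau> x = 0 \<longleftrightarrow> (\<exists>a b :: int. x = of_int a + of_int b * \<tau>)"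
proof -
  note p = theta_prod_eq_0_iff[OF \<tau>]
  have s: "sin (of_real pi * x) = 0 \<longleftrightarrow> (\<exists>a :: int. x = of_int a)"
    unfolding sin_eq_0 by (intro ex_cong1) (simp add: field_simps)
  have "theta \<tau> x = 0 \<longleftrightarrow> (\<exists>a :: int. x = of_int a) \<or> theta_prod \<tau> x = 0"
    unfolding theta_alt by (simp add: s qpow_def)
  also have "\<dots> \<longleftrightarrow> (\<exists>a b :: int. x = of_int a + of_int b * \<tau>)"
  proof
    assume "(\<exists>a :: int. x = of_int a) \<or> theta_prod \<tau> x = 0"
    thus "\<exists>a b :: int. x = of_int a + of_int b * \<tau>"
    proof
      assume "\<exists>a :: int. x = of_int a"
      thus ?thesis by (metis add.right_neutral mult_zero_left of_int_0)
    next
      assume "theta_prod \<tau> x = 0"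
      then obtain n and a :: int where "of_nat (Suc n) * \<tau> + x = of_int a \<or> of_nat (Suc n) * \<tau> - x = of_int a"
        unfolding p by blast
      hence "x = of_int a + of_int (- int (Suc n)) * \<tau> \<or> x = of_int (- a) + of_int (int (Suc n)) * \<tau>"
        by (auto simp: algebra_simps)
      thus ?thesis by blast
    qed
  next
    assume "\<exists>a b :: int. x = of_int a + of_int b * \<tau>"
    then obtain a b :: int where x: "x = of_int a + of_int b * \<tau>" by blast
    show "(\<exists>a :: int. x = of_int a) \<or> theta_prod \<tau> x = 0"
    proof (cases "b = 0")
      case False
      \<comment> \<open>The factors are indexed from 0, so the power of the nome with exponent
        \<open>|b|\<close> sits at index \<open>|b| - 1\<close>.\<close>
      define n where "n = nat (\<bar>b\<bar> - 1)"
      have n: "int (Suc n) = \<bar>b\<bar>" using False by (simp add: n_def)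
      have nc: "(of_nat (Suc n) :: complex) = of_int \<bar>b\<bar>" by (metis n of_int_of_nat_eq)
      have "of_nat (Suc n) * \<tau> + x = of_int a \<or> of_nat (Suc n) * \<tau> - x = of_int (- a)"
        unfolding nc x by (cases "b < 0") (auto simp: algebra_simps)
      thus ?thesis unfolding p by blast
    qed (use x in auto)
  qed
  finally show ?thesis .
qed

section \<open>Quasi-periodicity\<close>

text \<open>Passing from \<open>x\<close> to \<open>x + \<tau>\<close> moves the powers of
  \<open>q\<close> in the two \<open>x\<close>-dependent parts of each factor by one in opposite
  directions, so partial products telescope. Multiplying across by the boundary terms avoids a
  division by something that may vanish.\<close>

lemma theta_prod_plus_tau:
  assumes \<tau>: "Im \<tau> > 0"
  shows "theta_prod \<tau> (x + \<tau>) * (1 - exp (2 * of_real pi * \<i> * (x + \<tau>))) =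
    theta_prod \<tau> x * (1 - exp (- (2 * of_real pi * \<i> * x)))"
proof -
  define q where "q = exp (2 * of_real pi * \<i> * \<tau>)"
  define w where "w = exp (2 * of_real pi * \<i> * x)"
  have q0: "q \<noteq> 0" and w0: "w \<noteq> 0" by (auto simp: q_def w_def)
  have qp: "qpow \<tau> (of_nat n) = q ^ n" for n
    by (simp add: qpow_def q_def exp_of_nat2_mult[symmetric] algebra_simps)
  have e: "exp (2 * of_real pi * \<i> * (x + \<tau>)) = q * w"
    "exp (- (2 * of_real pi * \<i> * (x + \<tau>))) = inverse (q * w)"
    "exp (- (2 * of_real pi * \<i> * x)) = inverse w"
    by (simp_all add: q_def w_def exp_add[symmetric] exp_minus[symmetric] algebra_simps)
  have nq: "norm q < 1" using \<tau> by (simp add: q_def)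
  \<comment> \<open>An exact identity between partial products; in the limit the boundary terms
    containing \<open>q ^ N\<close> tend to 1.\<close>
  have fin: "(\<Prod>n<N. theta_factor n \<tau> (x + \<tau>)) * ((1 - q * w) * (1 - q ^ N * inverse w)) =
      (\<Prod>n<N. theta_factor n \<tau> x) * ((1 - q ^ Suc N * w) * (1 - inverse w))" for N
  proof (induction N)
    case (Suc N)
    have A: "theta_factor N \<tau> (x + \<tau>) = (1 - q ^ Suc N) * (1 - q ^ Suc (Suc N) * w) * (1 - q ^ N * inverse w)"
      unfolding theta_factor_def qp e using q0 w0 by (simp add: field_simps)
    have B: "theta_factor N \<tau> x = (1 - q ^ Suc N) * (1 - q ^ Suc N * w) * (1 - q ^ Suc N * inverse w)"
      unfolding theta_factor_def qp e w_def[symmetric] by simp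
    have "(\<Prod>n<Suc N. theta_factor n \<tau> (x + \<tau>)) * ((1 - q * w) * (1 - q ^ Suc N * inverse w)) =
       ((\<Prod>n<N. theta_factor n \<tau> (x + \<tau>)) * ((1 - q * w) * (1 - q ^ N * inverse w))) *
       ((1 - q ^ Suc N) * (1 - q ^ Suc (Suc N) * w) * (1 - q ^ Suc N * inverse w))"
      unfolding prod.lessThan_Suc A by (simp only: mult_ac)
    also have "\<dots> = (\<Prod>n<Suc N. theta_factor n \<tau> x) * ((1 - q ^ Suc (Suc N) * w) * (1 - inverse w))"
      unfolding Suc.IH prod.lessThan_Suc B by (simp only: mult_ac)
    finally show ?case .
  qed (simp add: mult_ac)
  have lim: "(\<lambda>N. \<Prod>n<N. theta_factor n \<tau> y) \<longlonglongrightarrow> theta_prod \<tau> y" for y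
    using convergent_prod_LIMSEQ[OF convergent_theta_prod[OF \<tau>, of y]]
    by (simp add: theta_prod_def LIMSEQ_lessThan_iff_atMost)
  have qN: "(\<lambda>N. q ^ N) \<longlonglongrightarrow> 0" using nq by (rule LIMSEQ_power_zero)
  have "(\<lambda>N. (\<Prod>n<N. theta_factor n \<tau> (x + \<tau>)) * ((1 - q * w) * (1 - q ^ N * inverse w))) \<longlonglongrightarrow>
        theta_prod \<tau> (x + \<tau>) * ((1 - q * w) * (1 - 0 * inverse w))"
    by (intro tendsto_intros lim qN)
  moreover have "(\<lambda>N. (\<Prod>n<N. theta_factor n \<tau> x) * ((1 - q ^ Suc N * w) * (1 - inverse w))) \<longlonglongrightarrow>
        theta_prod \<tau> x * ((1 - 0 * w) * (1 - inverse w))"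
    by (intro tendsto_intros lim LIMSEQ_Suc[OF qN])
  ultimately have "theta_prod \<tau> (x + \<tau>) * ((1 - q * w) * (1 - 0 * inverse w)) =
      theta_prod \<tau> x * ((1 - 0 * w) * (1 - inverse w))"
    unfolding fin using LIMSEQ_unique by blast
  thus ?thesis unfolding e by simp
qed

text \<open>Up to a constant, the sine is an exponential times
  \<open>exp (2 * pi * \<i> * y) - 1\<close>, or another exponential times
  \<open>1 - exp (- (2 * pi * \<i> * y))\<close>. These are precisely the boundary factors left over
  by the telescoping product, one for each side.\<close>

lemma theta_plus_tau:
  assumes \<tau>: "Im \<tau> > 0"
  shows "theta \<tau> (x + \<tau>) = - exp (- (of_real pi * \<i> * (\<tau> + 2 * x))) * theta \<tau> x"
proof -
  have s: "sin (of_real pi * y) = exp (- (of_real pi * \<i> * y)) * (exp (2 * of_real pi * \<i> * y) - 1) / (2 * \<i>)" for y :: complex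
    unfolding sin_exp_eq by (simp add: algebra_simps exp_add[symmetric])
  have s': "sin (of_real pi * y) = exp (of_real pi * \<i> * y) * (1 - exp (- (2 * of_real pi * \<i> * y))) / (2 * \<i>)" for y :: complex
    unfolding sin_exp_eq by (simp add: algebra_simps exp_add[symmetric])
  have ee: "exp (- (of_real pi * \<i> * (\<tau> + 2 * x))) * exp (of_real pi * \<i> * x) = exp (- (of_real pi * \<i> * (x + \<tau>)))"
    by (simp add: exp_add[symmetric] algebra_simps)
  have "theta \<tau> (x + \<tau>) = - 2 * qpow \<tau> (1/8) * exp (- (of_real pi * \<i> * (x + \<tau>))) / (2 * \<i>) *
     (theta_prod \<tau> (x + \<tau>) * (1 - exp (2 * of_real pi * \<i> * (x + \<tau>))))"
    unfolding theta_alt s by (simp add: field_simps)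
  also have "\<dots> = - exp (- (of_real pi * \<i> * (\<tau> + 2 * x))) * theta \<tau> x"
    unfolding theta_prod_plus_tau[OF \<tau>] theta_alt s' ee[symmetric] by (simp add: field_simps)
  finally show ?thesis .
qed

lemma theta_plus_int_tau:
  assumes \<tau>: "Im \<tau> > 0"
  shows "theta \<tau> (x + of_int k * \<tau>) =
    (-1) powi k * exp (- (of_real pi * \<i> * (of_int k ^ 2 * \<tau> + 2 * of_int k * x))) * theta \<tau> x"
proof (induction k arbitrary: x rule: int_induct[where k = 0])
  case (step1 i)
  have "theta \<tau> (x + of_int (i + 1) * \<tau>) = theta \<tau> ((x + \<tau>) + of_int i * \<tau>)"
    by (simp add: algebra_simps)
  also have "\<dots> = - ((-1) powi i) * (exp (- (of_real pi * \<i> * (of_int i ^ 2 * \<tau> + 2 * of_int i * (x + \<tau>)))) *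
      exp (- (of_real pi * \<i> * (\<tau> + 2 * x)))) * theta \<tau> x"
    unfolding step1.IH theta_plus_tau[OF \<tau>] by simp
  also have "exp (- (of_real pi * \<i> * (of_int i ^ 2 * \<tau> + 2 * of_int i * (x + \<tau>)))) *
      exp (- (of_real pi * \<i> * (\<tau> + 2 * x))) = exp (- (of_real pi * \<i> * (of_int (i + 1) ^ 2 * \<tau> + 2 * of_int (i + 1) * x)))"
    unfolding exp_add[symmetric] by (simp add: power2_eq_square algebra_simps)
  finally show ?case by (simp add: power_int_add)
next
  case (step2 i)
  define y where "y = x - \<tau>"
  have "theta \<tau> (x + of_int (i - 1) * \<tau>) = theta \<tau> (y + of_int i * \<tau>)"
    by (simp add: algebra_simps y_def)
  also have "\<dots> = (-1) powi i * exp (- (of_real pi * \<i> * (of_int i ^ 2 * \<tau> + 2 * of_int i * y))) * theta \<tau> y"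
    by (rule step2.IH)
  also have "theta \<tau> y = - exp (of_real pi * \<i> * (\<tau> + 2 * y)) * theta \<tau> x"
  proof -
    have "theta \<tau> x = - exp (- (of_real pi * \<i> * (\<tau> + 2 * y))) * theta \<tau> y"
      using theta_plus_tau[OF \<tau>, of y] by (simp add: y_def)
    moreover have "exp (of_real pi * \<i> * (\<tau> + 2 * y)) * exp (- (of_real pi * \<i> * (\<tau> + 2 * y))) = 1"
      unfolding exp_add[symmetric] by simp
    ultimately show ?thesis by (simp add: mult.assoc[symmetric])
  qed
  also have "(-1) powi i * exp (- (of_real pi * \<i> * (of_int i ^ 2 * \<tau> + 2 * of_int i * y))) * (- exp (of_real pi * \<i> * (\<tau> + 2 * y)) * theta \<tau> x)
    = - ((-1) powi i) * (exp (- (of_real pi * \<i> * (of_int i ^ 2 * \<tau> + 2 * of_int i * y))) * exp (of_real pi * \<i> * (\<tau> + 2 * y))) * theta \<tau> x"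
    by simp
  also have "exp (- (of_real pi * \<i> * (of_int i ^ 2 * \<tau> + 2 * of_int i * y))) * exp (of_real pi * \<i> * (\<tau> + 2 * y)) =
     exp (- (of_real pi * \<i> * (of_int (i - 1) ^ 2 * \<tau> + 2 * of_int (i - 1) * x)))"
    unfolding exp_add[symmetric] y_def by (simp add: power2_eq_square algebra_simps)
  finally show ?case by (simp add: power_int_diff)
qed simp

lemma theta_entire:
  assumes \<tau>: "Im \<tau> > 0" and "g holomorphic_on S"
  shows "(\<lambda>x. theta \<tau> (g x)) holomorphic_on S"
proof -
  have "theta \<tau> holomorphic_on UNIV"
    using holomorphic_theta[of "\<lambda>_. \<tau>" UNIV "\<lambda>x. x"] \<tau> by (auto intro: holomorphic_intros)
  from holomorphic_on_compose[OF assms(2) holomorphic_on_subset[OF this]]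
  show ?thesis by (simp add: o_def)
qed

section \<open>The derivative at zero and the simplicity of all zeros\<close>

text \<open>Only differentiating the sine contributes, since the sine itself vanishes at 0. From the
  explicit value one reads off that the derivative is nonzero and that it is holomorphic in
  \<open>\<tau>\<close>.\<close>

lemma deriv_theta_0:
  assumes \<tau>: "Im \<tau> > 0"
  shows "deriv (theta \<tau>) 0 = 2 * qpow \<tau> (1/8) * of_real pi * theta_prod \<tau> 0"
proof -
  have "(\<lambda>x. theta_prod \<tau> x) holomorphic_on UNIV"
    using \<tau> by (intro holomorphic_theta_prod holomorphic_intros) auto
  hence d: "(theta_prod \<tau> has_field_derivative deriv (theta_prod \<tau>) 0) (at 0)"
    using holomorphic_derivI by blast
  have "((\<lambda>x. 2 * qpow \<tau> (1/8) * sin (of_real pi * x) * theta_prod \<tau> x) has_field_derivative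
     2 * qpow \<tau> (1/8) * of_real pi * theta_prod \<tau> 0) (at 0)"
    by (rule derivative_eq_intros d refl | simp)+
  hence "(theta \<tau> has_field_derivative 2 * qpow \<tau> (1/8) * of_real pi * theta_prod \<tau> 0) (at 0)"
    by (simp add: theta_alt[abs_def])
  thus ?thesis by (rule DERIV_imp_deriv)
qed

lemma deriv_theta_0_nonzero:
  assumes \<tau>: "Im \<tau> > 0"
  shows "deriv (theta \<tau>) 0 \<noteq> 0"
proof -
  have "of_nat (Suc n) * \<tau> \<noteq> of_int a" for n and a :: int
  proof
    assume "of_nat (Suc n) * \<tau> = of_int a"
    hence "Im (of_nat (Suc n) * \<tau>) = 0" by simp
    thus False using \<tau> by (simp del: of_nat_Suc)
  qed
  hence "theta_prod \<tau> 0 \<noteq> 0" unfolding theta_prod_eq_0_iff[OF \<tau>] by auto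
  thus ?thesis unfolding deriv_theta_0[OF \<tau>] by (simp add: qpow_def)
qed

text \<open>The factor \<open>deriv (theta \<tau>) 0\<close> of \<open>F\<close> becomes a
  coefficient in \<open>has_type\<close>, where holomorphy in \<open>\<tau>\<close> is
  demanded.\<close>

lemma holomorphic_deriv_theta_0:
  "(\<lambda>\<tau>. deriv (theta \<tau>) 0) holomorphic_on {\<tau>. Im \<tau> > 0}"
proof -
  have "(\<lambda>\<tau>. 2 * qpow \<tau> (1/8) * of_real pi * theta_prod \<tau> 0) holomorphic_on {\<tau>. Im \<tau> > 0}"
    unfolding qpow_def by (intro holomorphic_intros holomorphic_theta_prod open_halfspace_Im_gt) auto
  thus ?thesis by (rule holomorphic_transform) (simp add: deriv_theta_0)
qed

lemma theta_lattice:
  assumes "Im \<tau> > 0"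
  shows "theta \<tau> (x + (of_int a + of_int b * \<tau>)) =
    (-1) powi a * ((-1) powi b * exp (- (of_real pi * \<i> * (of_int b ^ 2 * \<tau> + 2 * of_int b * x)))) * theta \<tau> x"
  using theta_plus_int[of \<tau> "x + of_int b * \<tau>" a] theta_plus_int_tau[OF assms, of x b]
  by (simp add: add_ac mult_ac)

text \<open>Quasi-periodicity carries the zero at 0 to every lattice point and multiplies the
  derivative there by a nonvanishing exponential.\<close>

lemma deriv_theta_zero_nonzero:
  assumes \<tau>: "Im \<tau> > 0" and "theta \<tau> z = 0"
  shows "deriv (theta \<tau>) z \<noteq> 0"
proof -
  obtain a b :: int where z: "z = of_int a + of_int b * \<tau>"
    using assms theta_eq_0_iff by blast
  define g where "g x = (-1) powi a * ((-1) powi b * exp (- (of_real pi * \<i> * (of_int b ^ 2 * \<tau> + 2 * of_int b * x))))" for x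
  have eq: "theta \<tau> (x + z) = g x * theta \<tau> x" for x
    unfolding z g_def by (rule theta_lattice[OF \<tau>])
  have hol: "theta \<tau> holomorphic_on UNIV" using theta_entire[OF \<tau>, of "\<lambda>x. x"] by (auto intro: holomorphic_intros)
  have "(theta \<tau> has_field_derivative deriv (theta \<tau>) (0 + z)) (at (0 + z))"
    using hol holomorphic_derivI by blast
  hence 1: "((\<lambda>x. theta \<tau> (x + z)) has_field_derivative deriv (theta \<tau>) z) (at 0)"
    unfolding DERIV_shift by simp
  have d: "(theta \<tau> has_field_derivative deriv (theta \<tau>) 0) (at 0)"
    using hol holomorphic_derivI by blast
  have "g holomorphic_on UNIV"
    unfolding g_def by (intro holomorphic_intros)
  then obtain g' where g': "(g has_field_derivative g') (at 0)"
    using holomorphic_derivI by blast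
  have 2: "((\<lambda>x. g x * theta \<tau> x) has_field_derivative g 0 * deriv (theta \<tau>) 0) (at 0)"
    using DERIV_mult[OF g' d] by (simp add: mult.commute)
  have "deriv (theta \<tau>) z = g 0 * deriv (theta \<tau>) 0"
    using 1 2 unfolding eq by (rule DERIV_unique)
  moreover have "g 0 \<noteq> 0" by (simp add: g_def)
  ultimately show ?thesis using deriv_theta_0_nonzero[OF \<tau>] by simp
qed

section \<open>The three-term identity\<close>

text \<open>Entire functions have no zero divisors. In this way identities proved off the zero set
  of an auxiliary function are extended to all arguments.\<close>

lemma entire_mult_eq_0:
  assumes f: "f holomorphic_on UNIV" and g: "g holomorphic_on UNIV" and "g z0 \<noteq> 0" 
    and fg: "\<And>z. f z * g z = 0"
  shows "f z = (0::complex)"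
proof -
  have "isCont g z0"
    using holomorphic_on_imp_continuous_on[OF g] by (simp add: continuous_on_eq_continuous_at)
  then obtain e where "e > 0" "\<And>y. dist z0 y < e \<Longrightarrow> g y \<noteq> 0"
    using assms(3) continuous_at_avoid by blast
  then obtain T where T: "open T" "z0 \<in> T" "\<And>z. z \<in> T \<Longrightarrow> g z \<noteq> 0"
    using that[of "ball z0 e"] by auto
  have "f w = 0" if "w \<in> T" for w using fg[of w] T(3)[OF that] by simp
  thus ?thesis
    using analytic_continuation_open[of T UNIV f "\<lambda>_. 0" z] f T by auto
qed

text \<open>Division works because all zeros of the theta function are simple.\<close>

lemma theta_divides:
  assumes \<tau>: "Im \<tau> > 0" and N: "N holomorphic_on UNIV"
    and zero: "\<And>x. theta \<tau> (x - u) = 0 \<Longrightarrow> N x = 0"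
  shows "\<exists>M. M holomorphic_on UNIV \<and> (\<forall>x. N x = theta \<tau> (x - u) * M x)"
proof -
  define M where "M x = (if theta \<tau> (x - u) = 0 then deriv N x / deriv (theta \<tau>) (x - u)
    else N x / theta \<tau> (x - u))" for x
  have th: "(\<lambda>x. theta \<tau> (x - u)) holomorphic_on UNIV"
    by (intro theta_entire \<tau> holomorphic_intros)
  have "M analytic_on UNIV"
  proof (subst analytic_on_analytic_at, safe)
    fix x0 :: complex
    \<comment> \<open>The difference quotient at \<open>x0\<close>, entire after removal of the
      singularity. If theta vanishes at \<open>x0 - u\<close>, then \<open>N\<close> vanishes at
      \<open>x0\<close> too, so near \<open>x0\<close> the function \<open>M\<close> is a quotient
      of two difference quotients; the denominator is nonzero at \<open>x0\<close> because the zero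
      of theta is simple.\<close>
    define q where "q f x = (if x = x0 then deriv f x0 else (f x - f x0) / (x - x0))" for f :: "complex \<Rightarrow> complex" and x
    have q: "q f holomorphic_on UNIV" if "f holomorphic_on UNIV" for f
      unfolding q_def[abs_def] using pole_lemma_open[OF that] by simp
    show "M analytic_on {x0}"
    proof (cases "theta \<tau> (x0 - u) = 0")
      case True
      let ?t = "\<lambda>x. theta \<tau> (x - u)"
      have "deriv ?t x0 = deriv (theta \<tau>) (x0 - u)"
      proof -
        have "theta \<tau> holomorphic_on UNIV" using theta_entire[OF \<tau>, of "\<lambda>x. x"] by (auto intro: holomorphic_intros)
        hence "(theta \<tau> has_field_derivative deriv (theta \<tau>) (x0 - u)) (at (x0 - u))"
          using holomorphic_derivI by blast
        hence "(?t has_field_derivative deriv (theta \<tau>) (x0 - u)) (at x0)"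
          using DERIV_shift[of "theta \<tau>" _ x0 "-u"] by simp
        thus ?thesis by (rule DERIV_imp_deriv)
      qed
      note dt = this
      have t0: "q ?t x0 \<noteq> 0"
        using deriv_theta_zero_nonzero[OF \<tau> True] by (simp add: q_def dt)
      define T where "T = {x. q ?t x \<noteq> 0}"
      have "open T" unfolding T_def
        using q[OF th] by (intro open_Collect_neq) (auto intro: holomorphic_on_imp_continuous_on)
      have "M x = q N x / q ?t x" if "x \<in> T" for x
      proof (cases "x = x0")
        case False
        have "?t x \<noteq> 0" using that False True by (auto simp: T_def q_def)
        thus ?thesis using False True zero[OF True] by (simp add: M_def q_def)
      qed (use True dt in \<open>simp add: M_def q_def\<close>)
      moreover have "(\<lambda>x. q N x / q ?t x) holomorphic_on T"
        by (intro holomorphic_on_divide holomorphic_on_subset[OF q[OF N]] holomorphic_on_subset[OF q[OF th]])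
           (auto simp: T_def)
      ultimately have "M holomorphic_on T"
        using holomorphic_transform[of "\<lambda>x. q N x / q ?t x" T M] by simp
      thus ?thesis unfolding analytic_at using \<open>open T\<close> t0 by (auto simp: T_def)
    next
      case False
      define T where "T = {x. theta \<tau> (x - u) \<noteq> 0}"
      have "open T" unfolding T_def
        using th by (intro open_Collect_neq) (auto intro: holomorphic_on_imp_continuous_on)
      have "(\<lambda>x. N x / theta \<tau> (x - u)) holomorphic_on T"
        by (intro holomorphic_on_divide holomorphic_on_subset[OF N] holomorphic_on_subset[OF th])
           (auto simp: T_def)
      hence "M holomorphic_on T"
        by (rule holomorphic_transform) (simp add: M_def T_def)
      thus ?thesis unfolding analytic_at using \<open>open T\<close> False by (auto simp: T_def)
    qed
  qed
  hence "M holomorphic_on UNIV" by (simp add: analytic_imp_holomorphic)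
  thus ?thesis using zero by (intro exI[of _ M]) (auto simp: M_def)
qed

text \<open>Liouville's theorem: reduction modulo the periods shows that all values are already
  taken on a compact parallelogram.\<close>

lemma doubly_periodic_constant:
  assumes \<tau>: "Im \<tau> > 0" and f: "f holomorphic_on UNIV"
    and p1: "\<And>x. f (x + 1) = f x" and p2: "\<And>x. f (x + \<tau>) = f x"
  shows "\<exists>c. \<forall>x. f x = (c :: complex)"
proof -
  have q1: "f (x + of_int n) = f x" for x n
  proof (induction n arbitrary: x rule: int_induct[where k = 0])
    case (step1 i) thus ?case using p1[of "x + of_int i"] by (simp add: add.assoc)
  next
    case (step2 i) thus ?case using p1[of "x + of_int (i - 1)"] by (simp add: add.assoc)
  qed simp
  have q2: "f (x + of_int n * \<tau>) = f x" for x n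
  proof (induction n arbitrary: x rule: int_induct[where k = 0])
    case (step1 i) thus ?case using p2[of "x + of_int i * \<tau>"] by (simp add: algebra_simps)
  next
    case (step2 i) thus ?case using p2[of "x + of_int (i - 1) * \<tau>"] by (simp add: algebra_simps)
  qed simp
  define K where "K = (\<lambda>(s, t). of_real s + of_real t * \<tau>) ` (cbox (0::real) 1 \<times> cbox (0::real) 1)"
  have "compact K" unfolding K_def case_prod_beta
    by (intro compact_continuous_image compact_Times compact_cbox continuous_intros)
  hence "bounded (f ` K)"
    using f by (intro compact_imp_bounded compact_continuous_image)
      (auto intro: holomorphic_on_imp_continuous_on holomorphic_on_subset)
  moreover have "range f \<subseteq> f ` K"
  proof safe
    fix x :: complex
    define t where "t = Im x / Im \<tau>"
    define s where "s = Re (x - of_real t * \<tau>)"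
    have "x = of_real s + of_real t * \<tau>"
      using \<tau> by (simp add: complex_eq_iff s_def t_def)
    also have "\<dots> = (of_real (frac s) + of_real (frac t) * \<tau>) + of_int \<lfloor>t\<rfloor> * \<tau> + of_int \<lfloor>s\<rfloor>"
      by (simp add: frac_def algebra_simps)
    finally have "f x = f (of_real (frac s) + of_real (frac t) * \<tau>)"
      by (simp only: q1 q2)
    moreover have "of_real (frac s) + of_real (frac t) * \<tau> \<in> K"
      unfolding K_def using frac_ge_0[of s] frac_ge_0[of t] frac_lt_1[of s] frac_lt_1[of t]
      by (intro image_eqI[of _ _ "(frac s, frac t)"]) (auto intro: less_imp_le)
    ultimately show "f x \<in> f ` K" by blast
  qed
  ultimately have "bounded (range f)" by (rule bounded_subset)
  hence "f constant_on UNIV" using Liouville_theorem f by blast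
  thus ?thesis by (auto simp: constant_on_def)
qed


text \<open>The point \<open>1 / 2\<close> does not lie in the lattice of zeros.\<close>

lemma theta_not_identically_0:
  assumes \<tau>: "Im \<tau> > 0"
  shows "\<exists>x. theta \<tau> x \<noteq> 0"
proof -
  have "\<not> (\<exists>a b :: int. of_real (1 / 2) = of_int a + of_int b * \<tau>)"
  proof
    assume "\<exists>a b :: int. of_real (1 / 2) = of_int a + of_int b * \<tau>"
    then obtain a b :: int where e: "of_real (1 / 2) = of_int a + of_int b * \<tau>" by blast
    have "Im (of_real (1 / 2)) = of_int b * Im \<tau>" unfolding e by simp
    hence "b = 0" using \<tau> by simp
    moreover have "Re (of_real (1 / 2)) = of_int a + of_int b * Re \<tau>" unfolding e by simp
    ultimately have "(1::real) = of_int (2 * a)" by simp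
    hence "1 = 2 * a" using of_int_eq_iff[of 1 "2 * a", where 'a = real] by simp
    thus False by presburger
  qed
  thus ?thesis using theta_eq_0_iff[OF \<tau>] by blast
qed

text \<open>Let \<open>N\<close> consist of the first two terms and let
  \<open>D y x = t (x + y) * t (x - y)\<close>, both as functions of \<open>x\<close>. They acquire
  the same factor under each period, and \<open>N\<close> vanishes at \<open>y\<close> and
  \<open>- y\<close>. So \<open>N / D\<close> is entire and doubly periodic, hence constant, and the
  constant is found at \<open>x = w\<close>.\<close>

lemma weierstrass_three_term:
  assumes \<tau>: "Im \<tau> > 0"
  defines "t \<equiv> theta \<tau>"
  shows "t (x + z) * t (x - z) * (t (y + w) * t (y - w)) - t (x + w) * t (x - w) * (t (y + z) * t (y - z))
       + t (x + y) * t (x - y) * (t (w + z) * t (w - z)) = 0"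
proof -
  define N where "N y z w x = t (x + z) * t (x - z) * (t (y + w) * t (y - w)) - t (x + w) * t (x - w) * (t (y + z) * t (y - z))" for x y z w
  define D where "D y x = t (x + y) * t (x - y)" for x y
  have odd: "t (- x) = - t x" for x by (simp add: t_def theta_uminus)
  have odd': "t (a - b) = - t (b - a)" for a b using odd[of "b - a"] by simp
  have hol: "(\<lambda>x. t (g x)) holomorphic_on S" if "g holomorphic_on S" for g S
    unfolding t_def by (rule theta_entire[OF \<tau> that])
  have hN: "N y z w holomorphic_on UNIV" "(\<lambda>w. N y z w x) holomorphic_on UNIV" "(\<lambda>y. N y z w x) holomorphic_on UNIV" for x y z w
    unfolding N_def[abs_def] by (intro holomorphic_intros hol)+
  have hD: "D y holomorphic_on UNIV" "(\<lambda>y. D y x) holomorphic_on UNIV" for x y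
    unfolding D_def[abs_def] by (intro holomorphic_intros hol)+
  have nz: "\<exists>x. t (c * x + d) \<noteq> 0" if "c \<noteq> 0" for c d
  proof -
    obtain e where "t e \<noteq> 0" using theta_not_identically_0[OF \<tau>] unfolding t_def by blast
    thus ?thesis using that by (intro exI[of _ "(e - d) / c"]) simp
  qed
  have t1: "t (x + 1) = - t x" for x by (simp add: t_def theta_plus_1)
  have tt: "t (x + \<tau>) = - exp (- (of_real pi * \<i> * (\<tau> + 2 * x))) * t x" for x
    unfolding t_def by (rule theta_plus_tau[OF \<tau>])
  have pair1: "t (x + 1 + z) * t (x + 1 - z) = t (x + z) * t (x - z)" for x z
    using t1[of "x + z"] t1[of "x - z"] by (simp add: algebra_simps)
  have pairt: "t (x + \<tau> + z) * t (x + \<tau> - z) = exp (- (of_real pi * \<i> * (2 * \<tau> + 4 * x))) * (t (x + z) * t (x - z))" for x z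
  proof -
    have "t (x + \<tau> + z) * t (x + \<tau> - z) = t ((x + z) + \<tau>) * t ((x - z) + \<tau>)" by (simp add: algebra_simps)
    also have "\<dots> = (exp (- (of_real pi * \<i> * (\<tau> + 2 * (x + z)))) * exp (- (of_real pi * \<i> * (\<tau> + 2 * (x - z))))) * (t (x + z) * t (x - z))"
      unfolding tt by simp
    also have "exp (- (of_real pi * \<i> * (\<tau> + 2 * (x + z)))) * exp (- (of_real pi * \<i> * (\<tau> + 2 * (x - z)))) = exp (- (of_real pi * \<i> * (2 * \<tau> + 4 * x)))"
      unfolding exp_add[symmetric] by (simp add: algebra_simps)
    finally show ?thesis .
  qed
  have N1: "N y z w (x + 1) = N y z w x" for x y z w unfolding N_def pair1 ..
  have D1: "D y (x + 1) = D y x" for x y unfolding D_def pair1 ..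
  define E where "E x = exp (- (of_real pi * \<i> * (2 * \<tau> + 4 * x)))" for x
  have E0: "E x \<noteq> 0" for x by (simp add: E_def)
  have Nt: "N y z w (x + \<tau>) = E x * N y z w x" for x y z w
    unfolding N_def pairt E_def by (simp add: algebra_simps)
  have Dt: "D y (x + \<tau>) = E x * D y x" for x y unfolding D_def pairt E_def ..
  have Neven: "N y z w (- x) = N y z w x" for x y z w
  proof -
    have "t (- x + v) * t (- x - v) = t (x + v) * t (x - v)" for v
    proof -
      have "- x + v = - (x - v)" "- x - v = - (x + v)" by simp_all
      thus ?thesis unfolding odd by (simp only: odd) (simp add: mult.commute)
    qed
    thus ?thesis unfolding N_def by metis
  qed
  have Nlat: "N y z w (x + (of_int a + of_int b * \<tau>)) = 0" if "N y z w x = 0" for x y z w a b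
  proof -
    have *: "N y z w (x + of_int a) = 0" if "N y z w x = 0" for x
      using that
    proof (induction a arbitrary: x rule: int_induct[where k = 0])
      case (step1 i) thus ?case using N1[of y z w "x + of_int i"] by (simp add: add.assoc)
    next
      case (step2 i) thus ?case using N1[of y z w "x + of_int (i - 1)"] by (simp add: add.assoc)
    qed simp
    have "N y z w (x + of_int b * \<tau>) = 0"
      using that
    proof (induction b arbitrary: x rule: int_induct[where k = 0])
      case (step1 i) thus ?case using Nt[of y z w "x + of_int i * \<tau>"] by (simp add: algebra_simps)
    next
      case (step2 i) thus ?case using Nt[of y z w "x + of_int (i - 1) * \<tau>"] E0 by (simp add: algebra_simps)
    qed simp
    from *[OF this] show ?thesis by (simp add: algebra_simps)
  qed
  \<comment> \<open>The condition \<open>t (2 * y) \<noteq> 0\<close> says that \<open>y\<close> and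
    \<open>- y\<close> are distinct modulo the lattice, so the two zeros can be divided out one
    after the other; \<open>D y w \<noteq> 0\<close> allows evaluation at \<open>w\<close>.\<close>
  have main: "N y z w x = - D y x * (t (w + z) * t (w - z))" if y2: "t (2 * y) \<noteq> 0" and Dw: "D y w \<noteq> 0" for x y z w
  proof -
    have Ny: "N y z w y = 0" by (simp add: N_def mult_ac)
    have "N y z w x = 0" if "theta \<tau> (x - y) = 0" for x
    proof -
      obtain a b :: int where "x - y = of_int a + of_int b * \<tau>" using theta_eq_0_iff[OF \<tau>] \<open>theta \<tau> (x - y) = 0\<close> by blast
      hence "x = y + (of_int a + of_int b * \<tau>)" by (simp add: algebra_simps)
      thus ?thesis using Nlat[OF Ny] by simp
    qed
    with theta_divides[OF \<tau> hN(1), of y] obtain M1 where M1: "M1 holomorphic_on UNIV"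
      "\<And>x. N y z w x = t (x - y) * M1 x" unfolding t_def by blast
    have "M1 x = 0" if "theta \<tau> (x - (- y)) = 0" for x
    proof -
      obtain a b :: int where "x - (- y) = of_int a + of_int b * \<tau>" using theta_eq_0_iff[OF \<tau>] \<open>theta \<tau> (x - (-y)) = 0\<close> by blast
      hence x: "x = - y + (of_int a + of_int b * \<tau>)" by (simp add: algebra_simps)
      have "N y z w (- y) = 0" using Neven Ny by simp
      from Nlat[OF this] have "N y z w x = 0" unfolding x .
      moreover have "t (x - y) \<noteq> 0"
      proof -
        have xy: "x - y = - (2 * y) + (of_int a + of_int b * \<tau>)" by (simp add: x)
        show ?thesis unfolding xy t_def theta_lattice[OF \<tau>] using y2 by (simp add: t_def theta_uminus)
      qed
      ultimately show ?thesis using M1(2)[of x] by simp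
    qed
    with theta_divides[OF \<tau> M1(1), of "- y"] have
      "\<exists>M. M holomorphic_on UNIV \<and> (\<forall>x. M1 x = theta \<tau> (x - (- y)) * M x)" by blast
    then obtain M where M: "M holomorphic_on UNIV"
      "\<And>x. M1 x = t (x + y) * M x" unfolding t_def by auto
    have ND: "N y z w x = D y x * M x" for x unfolding M1(2) M(2) D_def by (simp add: mult_ac)
    have p: "M (x + c) = M x" if "c = 1 \<or> c = \<tau>" for x c
    proof -
      have "(M (x + c) - M x) * D y x = 0" for x
        using that ND[of "x + 1"] ND[of x] ND[of "x + \<tau>"] N1[of y z w x] D1[of y x] Nt[of y z w x] Dt[of y x] E0[of x]
        by (auto simp: algebra_simps)
      moreover have "(M \<circ> (\<lambda>x. x + c)) holomorphic_on UNIV"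
        by (intro holomorphic_on_compose holomorphic_intros holomorphic_on_subset[OF M(1)]) simp
      hence "(\<lambda>x. M (x + c) - M x) holomorphic_on UNIV"
        unfolding o_def by (intro holomorphic_intros M(1))
      ultimately have "M (x + c) - M x = 0"
        using entire_mult_eq_0[of "\<lambda>x. M (x + c) - M x" "D y" w x] Dw hD by blast
      thus ?thesis by simp
    qed
    obtain C where C: "\<And>x. M x = C" using doubly_periodic_constant[OF \<tau> M(1)] p by blast
    \<comment> \<open>At \<open>x = w\<close> the second term of \<open>N\<close> drops out, as
      theta vanishes at 0.\<close>
    have "t (w + z) * t (w - z) * (t (y + w) * t (y - w)) = D y w * C"
      using ND[of w] C unfolding N_def t_def by simp
    also have "t (y + w) * t (y - w) = - D y w" using odd'[of y w] by (simp add: D_def add.commute)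
    finally have "D y w * C = D y w * (- (t (w + z) * t (w - z)))" by (simp add: mult_ac)
    hence "C = - (t (w + z) * t (w - z))" using Dw mult_left_cancel by blast
    thus ?thesis using ND[of x] C by simp
  qed
  \<comment> \<open>The left side is entire in \<open>w\<close>, so the restriction on
    \<open>D y w\<close> is removed by multiplying with it. The same is done afterwards in the
    variable \<open>y\<close> with \<open>t (2 * y)\<close>.\<close>
  have main2: "N y z w x + D y x * (t (w + z) * t (w - z)) = 0" if y2: "t (2 * y) \<noteq> 0" for x y z w
  proof -
    have "D y 0 \<noteq> 0 \<or> True" by simp
    have "\<exists>w. D y w \<noteq> 0"
    proof (rule ccontr)
      assume "\<nexists>w. D y w \<noteq> 0"
      hence z: "t (w + y) * t (w - y) = 0" for w by (simp add: D_def)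
      obtain v where v: "t (v - y) \<noteq> 0" using nz[of 1 "-y"] by auto
      have "t (w + y) = 0" for w
        by (rule entire_mult_eq_0[of "\<lambda>w. t (w + y)" "\<lambda>w. t (w - y)" v]) (auto intro!: hol holomorphic_intros simp: v z)
      thus False using nz[of 1 y] by auto
    qed
    then obtain v where v: "D y v \<noteq> 0" by blast
    show ?thesis
    proof (rule entire_mult_eq_0[of "\<lambda>w. N y z w x + D y x * (t (w + z) * t (w - z))" "D y" v])
      show "(\<lambda>w. N y z w x + D y x * (t (w + z) * t (w - z))) holomorphic_on UNIV"
        by (intro holomorphic_intros hN hol)
      show "(N y z w x + D y x * (t (w + z) * t (w - z))) * D y w = 0" for w
        using main[OF y2, of w] by (cases "D y w = 0") auto
    qed (use v hD in auto)
  qed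
  obtain v where v: "t (2 * v) \<noteq> 0" using nz[of 2 0] by auto
  have "N y z w x + D y x * (t (w + z) * t (w - z)) = 0"
  proof (rule entire_mult_eq_0[of "\<lambda>y. N y z w x + D y x * (t (w + z) * t (w - z))" "\<lambda>y. t (2 * y)" v])
    show "(\<lambda>y. N y z w x + D y x * (t (w + z) * t (w - z))) holomorphic_on UNIV"
      by (intro holomorphic_intros hN hD)
    show "(N y z w x + D y x * (t (w + z) * t (w - z))) * t (2 * y) = 0" for y
      using main2 by (cases "t (2 * y) = 0") auto
  qed (use v in \<open>auto intro!: hol holomorphic_intros\<close>)
  thus ?thesis by (simp add: N_def D_def mult_ac)
qed

section \<open>Identities for \<open>F\<close>\<close>

lemma F_uminus: "F \<tau> (- x) (- y) = - F \<tau> x y"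
  using theta_uminus[of \<tau> "x + y"] by (simp add: F_def theta_uminus)

text \<open>With denominators cleared this is the three-term identity: \<open>x\<close>,
  \<open>y\<close>, \<open>z\<close>, \<open>w\<close> are the half-sums for which its twelve
  arguments become those of the numerators and of the denominators left over.\<close>

lemma fay_identity:
  assumes \<tau>: "Im \<tau> > 0"
    and nz: "theta \<tau> x1 \<noteq> 0" "theta \<tau> x2 \<noteq> 0" "theta \<tau> y1 \<noteq> 0" "theta \<tau> y2 \<noteq> 0"
      "theta \<tau> (y1 + y2) \<noteq> 0" "theta \<tau> (x2 - x1) \<noteq> 0"
  shows "F \<tau> x1 y1 * F \<tau> x2 y2 =
    F \<tau> x1 (y1 + y2) * F \<tau> (x2 - x1) y2 + F \<tau> x2 (y1 + y2) * F \<tau> (x1 - x2) y1"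
proof -
  let ?t = "theta \<tau>"
  have A: "?t (x1 - x2) = - ?t (x2 - x1)" using theta_uminus[of \<tau> "x2 - x1"] by simp
  define x y z w where "x = (x1 + y1 + x2 + y2) / 2" and "y = (- x1 + y1 + x2 + y2) / 2"
    and "z = (x1 + y1 - x2 - y2) / 2" and "w = (x1 + y1 - x2 + y2) / 2"
  have e: "x + z = x1 + y1" "x - z = x2 + y2" "y + w = y1 + y2" "y - w = x2 - x1"
    "x + w = x1 + (y1 + y2)" "x - w = x2" "y + z = y1" "y - z = x2 - x1 + y2"
    "x + y = x2 + (y1 + y2)" "x - y = x1" "w + z = x1 - x2 + y1" "w - z = y2"
    by (simp_all add: x_def y_def z_def w_def field_simps)
  note B = weierstrass_three_term[OF \<tau>, of x z y w, unfolded e]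
  show ?thesis unfolding F_def A using nz B by (simp add: divide_simps) algebra
qed

text \<open>With the Weierstrass function p, the product
  \<open>F \<tau> (- a) h * F \<tau> a h\<close> is p(h) - p(a). This is why the difference does not
  involve \<open>h\<close>.\<close>

lemma F_mult_uminus_diff:
  assumes \<tau>: "Im \<tau> > 0"
    and nz: "theta \<tau> a \<noteq> 0" "theta \<tau> b \<noteq> 0" "theta \<tau> h \<noteq> 0"
  shows "F \<tau> (- b) h * F \<tau> b h - F \<tau> (- a) h * F \<tau> a h =
    (deriv (theta \<tau>) 0)\<^sup>2 * theta \<tau> (b + a) * theta \<tau> (b - a) / ((theta \<tau> a)\<^sup>2 * (theta \<tau> b)\<^sup>2)"
proof -
  note B = weierstrass_three_term[OF \<tau>, of h a b 0, simplified]
  have e: "- a + h = h - a" "- b + h = h - b" "a + h = h + a" "b + h = h + b" by simp_all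
  show ?thesis unfolding F_def theta_uminus e using nz B
    by (simp add: divide_simps theta_uminus power2_eq_square) algebra
qed

text \<open>The companion for fixed \<open>a\<close>, with value p(h) - p(n) for the Weierstrass
  function p. It is the scalar by which the composite of the operations with parameters
  \<open>n\<close> and \<open>- n\<close> multiplies a function.\<close>

lemma F_mult_uminus_diff':
  assumes \<tau>: "Im \<tau> > 0"
    and nz: "theta \<tau> a \<noteq> 0" "theta \<tau> n \<noteq> 0" "theta \<tau> h \<noteq> 0"
  shows "F \<tau> (- a) h * F \<tau> a h - F \<tau> (- a) n * F \<tau> a n =
    (deriv (theta \<tau>) 0)\<^sup>2 * theta \<tau> (n + h) * theta \<tau> (n - h) / ((theta \<tau> h)\<^sup>2 * (theta \<tau> n)\<^sup>2)"
proof -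
  note B = weierstrass_three_term[OF \<tau>, of n a h 0, simplified]
  have e: "- a + h = h - a" "- a + n = n - a" "a + h = h + a" "a + n = n + a" by simp_all
  show ?thesis unfolding F_def theta_uminus e using nz B
    by (simp add: divide_simps theta_uminus power2_eq_square) algebra
qed

text \<open>These are the coefficients of \<open>f\<close> itself on the two sides of the braid
  relation. The products free of \<open>h\<close> differ by the three-term identity, those with
  \<open>h\<close> by \<open>F_mult_uminus_diff\<close>; both differences are the same multiple of
  \<open>F \<tau> (a + b) (m + n)\<close>.\<close>

lemma braid_identity:
  assumes \<tau>: "Im \<tau> > 0"
    and nz: "theta \<tau> a \<noteq> 0" "theta \<tau> b \<noteq> 0" "theta \<tau> h \<noteq> 0" "theta \<tau> (a + b) \<noteq> 0"
      "theta \<tau> m \<noteq> 0" "theta \<tau> n \<noteq> 0" "theta \<tau> (m + n) \<noteq> 0"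
  shows "F \<tau> a m * F \<tau> a n * F \<tau> b (m + n) + F \<tau> (- a) h * F \<tau> a h * F \<tau> (a + b) (m + n) =
    F \<tau> b n * F \<tau> b m * F \<tau> a (m + n) + F \<tau> (- b) h * F \<tau> b h * F \<tau> (a + b) (m + n)"
proof -
  let ?t = "theta \<tau>" and ?D = "deriv (theta \<tau>) 0"
  define x y z w where "x = a + (m + n) / 2" and "y = b + (m + n) / 2"
    and "z = (m - n) / 2" and "w = (m + n) / 2"
  have e: "x + z = a + m" "x - z = a + n" "y + w = b + (m + n)" "y - w = b"
    "x + w = a + (m + n)" "x - w = a" "y + z = b + m" "y - z = b + n"
    "x + y = a + b + (m + n)" "x - y = a - b" "w + z = m" "w - z = n"
    by (simp_all add: x_def y_def z_def w_def field_simps)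
  note B = weierstrass_three_term[OF \<tau>, of x z y w, unfolded e]
  have A: "?t (a - b) = - ?t (b - a)" using theta_uminus[of \<tau> "b - a"] by simp
  have "F \<tau> a m * F \<tau> a n * F \<tau> b (m + n) - F \<tau> b n * F \<tau> b m * F \<tau> a (m + n) =
     ?D ^ 3 * ?t (a + b + (m + n)) * ?t (b - a) / ((?t a)\<^sup>2 * (?t b)\<^sup>2 * ?t (m + n))"
    unfolding F_def using nz B A by (simp add: divide_simps power2_eq_square power3_eq_cube) algebra
  also have "\<dots> = (?D\<^sup>2 * ?t (b + a) * ?t (b - a) / ((?t a)\<^sup>2 * (?t b)\<^sup>2)) * F \<tau> (a + b) (m + n)"
    unfolding F_def add.commute[of b a] using nz by (simp add: divide_simps power2_eq_square power3_eq_cube)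
  also have "\<dots> = (F \<tau> (- b) h * F \<tau> b h - F \<tau> (- a) h * F \<tau> a h) * F \<tau> (a + b) (m + n)"
    using F_mult_uminus_diff[OF \<tau> nz(1-3)] by simp
  finally show ?thesis by (simp add: algebra_simps)
qed

text \<open>This is what remains of the flip relation when common factors of the class are
  cancelled. Terms are grouped by the factors they share, \<open>F \<tau> a h\<close> in one pair
  and \<open>F \<tau> a m * F \<tau> (b + c) n\<close> in the other. Each difference is evaluated by
  one three-term identity, and both contain theta of \<open>a + c - b\<close>.\<close>

lemma flip_identity:
  assumes \<tau>: "Im \<tau> > 0"
    and nz: "theta \<tau> a \<noteq> 0" "theta \<tau> b \<noteq> 0" "theta \<tau> c \<noteq> 0" "theta \<tau> h \<noteq> 0" "theta \<tau> m \<noteq> 0" "theta \<tau> n \<noteq> 0"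
      "theta \<tau> (n - m) \<noteq> 0" "theta \<tau> (b - a) \<noteq> 0" "theta \<tau> (a + c) \<noteq> 0" "theta \<tau> (b + c) \<noteq> 0"
  shows "F \<tau> (b - a) (n - m) * F \<tau> (a + c) n * F \<tau> a h * F \<tau> b m + F \<tau> (a - b) h * F \<tau> (b + c) n * F \<tau> b h * F \<tau> a m =
    F \<tau> c (n - m) * F \<tau> (a + c) m * F \<tau> a h * F \<tau> b n + F \<tau> (- c) h * F \<tau> a m * F \<tau> (a + c) h * F \<tau> (b + c) n"
proof -
  let ?t = "theta \<tau>" and ?D = "deriv (theta \<tau>) 0"
  have A: "?t (a - b) = - ?t (b - a)" "?t (b - a - c) = - ?t (a + c - b)"
    using theta_uminus[of \<tau> "b - a"] theta_uminus[of \<tau> "a + c - b"] by (simp_all add: algebra_simps)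
  define x y z w where "x = b/2 + c/2 - m/2 + n" and "y = b/2 + c/2 + m/2"
    and "z = -a + b/2 - c/2 - m/2" and "w = b/2 - c/2 + m/2"
  have e: "x + z = b - a + (n - m)" "x - z = a + c + n" "y + w = b + m" "y - w = c"
    "x + w = b + n" "x - w = c + (n - m)" "y + z = b - a" "y - z = a + c + m"
    "x + y = b + c + n" "x - y = n - m" "w + z = b - a - c" "w - z = a + m"
    by (simp_all add: x_def y_def z_def w_def field_simps)
  note B = weierstrass_three_term[OF \<tau>, of x z y w, unfolded e A]
  have 1: "F \<tau> (b - a) (n - m) * F \<tau> (a + c) n * F \<tau> b m - F \<tau> c (n - m) * F \<tau> (a + c) m * F \<tau> b n =
     ?D ^ 3 * ?t (b + c + n) * ?t (a + m) * ?t (a + c - b) / (?t (b - a) * ?t c * ?t (a + c) * ?t b * ?t m * ?t n)"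
    unfolding F_def using nz B by (simp add: divide_simps power2_eq_square power3_eq_cube) algebra
  define x' y' z' w' where "x' = a/2 + h" and "y' = a/2" and "z' = - a/2 - c" and "w' = a/2 - b"
  have e': "x' + z' = h - c" "x' - z' = h + (a + c)" "y' + w' = a - b" "y' - w' = b"
    "x' + w' = h + (a - b)" "x' - w' = h + b" "y' + z' = - c" "y' - z' = a + c"
    "x' + y' = h + a" "x' - y' = h" "w' + z' = - (b + c)" "w' - z' = a + c - b"
    by (simp_all add: x'_def y'_def z'_def w'_def field_simps)
  note B' = weierstrass_three_term[OF \<tau>, of x' z' y' w', unfolded e' A theta_uminus]
  have e'': "- c + h = h - c" "a + c + h = h + (a + c)" "a - b + h = h + (a - b)" "b + h = h + b" "a + h = h + a" by simp_all
  have 2: "F \<tau> (- c) h * F \<tau> (a + c) h - F \<tau> (a - b) h * F \<tau> b h =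
     ?D ^ 2 * ?t (h + a) * ?t (b + c) * ?t (a + c - b) / (?t (b - a) * ?t b * ?t c * ?t (a + c) * ?t h)"
    unfolding F_def e'' theta_uminus A using nz B' by (simp add: divide_simps power2_eq_square power3_eq_cube) algebra
  have "F \<tau> a h * (F \<tau> (b - a) (n - m) * F \<tau> (a + c) n * F \<tau> b m - F \<tau> c (n - m) * F \<tau> (a + c) m * F \<tau> b n)
     = F \<tau> a m * F \<tau> (b + c) n * (F \<tau> (- c) h * F \<tau> (a + c) h - F \<tau> (a - b) h * F \<tau> b h)"
    unfolding 1 2 unfolding F_def e'' using nz by (simp add: divide_simps power2_eq_square power3_eq_cube)
  thus ?thesis by (simp add: algebra_simps)
qed

section \<open>Generic equality\<close>

text \<open>Extends \<open>gen_eq\<close> from equalities to arbitrary properties, so that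
  nonvanishing of denominators can be combined with equalities.\<close>

definition generic :: "point set \<Rightarrow> (point \<Rightarrow> bool) \<Rightarrow> bool" where
  "generic D P \<longleftrightarrow> (\<exists>U. open U \<and> U \<subseteq> D \<and> D \<subseteq> closure U \<and> (\<forall>p\<in>U. P p))"

lemma gen_eq_generic: "gen_eq D f g \<longleftrightarrow> generic D (\<lambda>p. f p = g p)"
  by (simp add: gen_eq_def generic_def)

lemma generic_all: "open D \<Longrightarrow> (\<And>p. p \<in> D \<Longrightarrow> P p) \<Longrightarrow> generic D P"
  unfolding generic_def using closure_subset by blast

lemma generic_mono: "generic D P \<Longrightarrow> (\<And>p. p \<in> D \<Longrightarrow> P p \<Longrightarrow> Q p) \<Longrightarrow> generic D Q"
  unfolding generic_def by blast

lemma dense_open_Int: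
  fixes U V D :: "point set"
  assumes "open U" "open V" "U \<subseteq> D" "D \<subseteq> closure U" "D \<subseteq> closure V"
  shows "D \<subseteq> closure (U \<inter> V)"
proof
  fix x assume x: "x \<in> D"
  have meets: "W \<inter> T \<noteq> {}" if "y \<in> closure W" "open T" "y \<in> T" for y :: point and W T
    using that unfolding closure_iff_nhds_not_empty by blast
  show "x \<in> closure (U \<inter> V)"
    unfolding closure_iff_nhds_not_empty
  proof (intro allI impI)
    fix A T assume T: "T \<subseteq> A" "open T" "x \<in> T"
    have "U \<inter> T \<noteq> {}" using meets assms(4) x T by blast
    then obtain y where y: "y \<in> T" "y \<in> U" by blast
    moreover have "open (U \<inter> T)" using T assms(1) by blast
    ultimately have "V \<inter> (U \<inter> T) \<noteq> {}" using meets[of y V "U \<inter> T"] assms(3,5) by blast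
    thus "U \<inter> V \<inter> A \<noteq> {}" using T by blast
  qed
qed

lemma generic_conj:
  assumes "generic D P" "generic D Q"
  shows "generic D (\<lambda>p. P p \<and> Q p)"
proof -
  obtain U V where "open U" "U \<subseteq> D" "D \<subseteq> closure U" "\<forall>p\<in>U. P p"
    "open V" "V \<subseteq> D" "D \<subseteq> closure V" "\<forall>p\<in>V. Q p"
    using assms unfolding generic_def by blast
  thus ?thesis unfolding generic_def
    by (intro exI[of _ "U \<inter> V"]) (auto intro: dense_open_Int[THEN subsetD])
qed

lemma generic_mono2:
  assumes "generic D P" "generic D Q" "\<And>p. p \<in> D \<Longrightarrow> P p \<Longrightarrow> Q p \<Longrightarrow> R p"
  shows "generic D R"
  using generic_mono[OF generic_conj[OF assms(1,2)], of R] assms(3) by blast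

lemma generic_ball_finite:
  assumes "finite A" "open D" "\<And>a. a \<in> A \<Longrightarrow> generic D (P a)"
  shows "generic D (\<lambda>p. \<forall>a\<in>A. P a p)"
  using assms(1,3)
proof (induction A)
  case (insert a A)
  have "generic D (\<lambda>p. P a p \<and> (\<forall>a\<in>A. P a p))" using insert by (intro generic_conj) auto
  thus ?case by (rule generic_mono) auto
qed (auto intro!: generic_all assms)

lemma gen_eq_refl: "open D \<Longrightarrow> gen_eq D f f"
  unfolding gen_eq_generic by (erule generic_all) simp

lemma gen_eq_sym: "gen_eq D f g \<Longrightarrow> gen_eq D g f"
  unfolding gen_eq_generic by (erule generic_mono) simp

lemma gen_eq_trans: "gen_eq D f g \<Longrightarrow> gen_eq D g h \<Longrightarrow> gen_eq D f h"
  unfolding gen_eq_generic by (erule (1) generic_mono2) simp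

lemma gen_eq_add: "gen_eq D f f' \<Longrightarrow> gen_eq D g g' \<Longrightarrow> gen_eq D (\<lambda>p. f p + g p) (\<lambda>p. f' p + g' p)"
  unfolding gen_eq_generic by (erule (1) generic_mono2) simp

lemma gen_eq_mult: "gen_eq D f f' \<Longrightarrow> gen_eq D g g' \<Longrightarrow> gen_eq D (\<lambda>p. f p * g p) (\<lambda>p. f' p * g' p)"
  unfolding gen_eq_generic by (erule (1) generic_mono2) simp

lemma gen_eq_sum:
  assumes "finite A" "open D" "\<And>a. a \<in> A \<Longrightarrow> gen_eq D (f a) (g a)"
  shows "gen_eq D (\<lambda>p. \<Sum>a\<in>A. f a p) (\<lambda>p. \<Sum>a\<in>A. g a p)"
proof -
  have "generic D (\<lambda>p. \<forall>a\<in>A. f a p = g a p)"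
    using assms by (intro generic_ball_finite) (auto simp: gen_eq_generic)
  thus ?thesis unfolding gen_eq_generic by (rule generic_mono) auto
qed

text \<open>A dense open set of validity need not be stable under lattice translations. Where both
  sides are continuous the identity holds at every point, so translates of a point may be
  inserted.\<close>

lemma generic_eq_continuous:
  fixes f g :: func
  assumes "generic D (\<lambda>p. f p = g p)" "open V" "V \<subseteq> D"
    "continuous_on V f" "continuous_on V g" "p \<in> V"
  shows "f p = g p"
proof (rule ccontr)
  assume ne: "f p \<noteq> g p"
  obtain U where U: "open U" "D \<subseteq> closure U" "\<forall>p\<in>U. f p = g p"
    using assms(1) unfolding generic_def by blast
  have "continuous_on V (\<lambda>p. f p - g p)" using assms by (intro continuous_intros)
  hence "open (V \<inter> (\<lambda>p. f p - g p) -` (- {0}))"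
    using assms(2) by (rule continuous_open_preimage) (auto simp: open_Compl)
  moreover have "p \<in> V \<inter> (\<lambda>p. f p - g p) -` (- {0})" using assms ne by auto
  moreover have "p \<in> closure U" using assms U by blast
  ultimately have "U \<inter> (V \<inter> (\<lambda>p. f p - g p) -` (- {0})) \<noteq> {}"
    unfolding closure_iff_nhds_not_empty by blast
  thus False using U by auto
qed

section \<open>Linear forms\<close>

lemma lin_superset:
  assumes "finite A" "Poly_Mapping.keys l \<subseteq> A"
  shows "lin l z = (\<Sum>v\<in>A. of_int (Poly_Mapping.lookup l v) * z v)"
  unfolding lin_def using assms by (intro sum.mono_neutral_left) (auto simp: in_keys_iff)

lemma lin_0 [simp]: "lin 0 z = 0"
  by (simp add: lin_def)

lemma lin_plus: "lin (l + l') z = lin l z + lin l' z"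
proof -
  let ?A = "Poly_Mapping.keys l \<union> Poly_Mapping.keys l'"
  have "Poly_Mapping.keys (l + l') \<subseteq> ?A" by (rule Poly_Mapping.keys_add)
  thus ?thesis
    by (subst (1 2 3) lin_superset[of ?A])
       (auto simp: lookup_add ring_distribs sum.distrib)
qed

lemma lin_uminus: "lin (- l) z = - lin l z"
  using lin_plus[of l "- l" z] by (simp add: add_eq_0_iff)

lemma lin_minus: "lin (l - l') z = lin l z - lin l' z"
  using lin_plus[of l "- l'" z] by (simp add: lin_uminus)

lemma lin_single [simp]: "lin (Poly_Mapping.single v c) z = of_int c * z v"
  by (simp add: lin_def)

lemma lin_sum: "lin (\<Sum>a\<in>A. f a) z = (\<Sum>a\<in>A. lin (f a) z)"
  by (induction A rule: infinite_finite_induct) (simp_all add: lin_plus)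

lemma lin_add_arg: "lin l (\<lambda>v. z v + c v) = lin l z + lin l c"
  by (simp add: lin_def ring_distribs sum.distrib)

lemma lin_scale_arg: "lin l (\<lambda>v. c * z v) = c * lin l z"
  by (simp add: lin_def sum_distrib_left mult_ac)

lemma lin_cong: "(\<And>v. v \<in> Poly_Mapping.keys l \<Longrightarrow> z v = z' v) \<Longrightarrow> lin l z = lin l z'"
  by (simp add: lin_def)

lemma lin_upd: "lin l (z(v := z v + t)) = lin l z + of_int (Poly_Mapping.lookup l v) * t"
proof -
  have "z(v := z v + t) = (\<lambda>w. z w + (if w = v then t else 0))" by auto
  hence "lin l (z(v := z v + t)) = lin l z + lin l (\<lambda>w. if w = v then t else 0)"
    by (simp only: lin_add_arg)
  also have "lin l (\<lambda>w. if w = v then t else 0) = of_int (Poly_Mapping.lookup l v) * t"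
    by (simp add: lin_def if_distrib[of "\<lambda>x. _ * x"] sum.delta in_keys_iff cong: if_cong)
  finally show ?thesis .
qed

lemma lin_eq_imp_eq: 
  assumes "\<And>z. lin l z = lin l' z"
  shows "l = l'"
proof (rule poly_mapping_eqI)
  fix v
  have "lin l ((\<lambda>_. 0)(v := 0 + 1)) = lin l' ((\<lambda>_. 0)(v := 0 + 1))" by (rule assms)
  thus "Poly_Mapping.lookup l v = Poly_Mapping.lookup l' v"
    using lin_upd[of l "\<lambda>_. 0" v 1] lin_upd[of l' "\<lambda>_. 0" v 1] assms[of "\<lambda>_. 0"] by simp
qed

lemma continuous_on_lin [continuous_intros]:
  "(\<And>v. continuous_on S (\<lambda>p. g p v)) \<Longrightarrow> continuous_on S (\<lambda>p. lin l (g p))"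
  unfolding lin_def by (intro continuous_intros)

lemma continuous_on_coord [continuous_intros]: "continuous_on S (\<lambda>p :: point. p v)"
  by (rule continuous_on_subset[OF continuous_on_product_coordinates]) simp

lemma open_dom_add [simp]: "open dom_add"
  unfolding dom_add_def by (intro open_Collect_less continuous_intros)

lemma finite_vars [simp]: "finite (vars m r)" "finite (xvars m)" "finite (muvars r)"
  by (auto simp: vars_def xvars_def muvars_def)

lemma Tau_notin_vars [simp]: "Tau \<notin> vars m r" "Tau \<notin> xvars m" "Tau \<notin> muvars r"
  by (auto simp: vars_def xvars_def muvars_def)

lemma open_dom_mult [simp]: "open (dom_mult m r)"
proof -
  have "dom_mult m r = {p. Im (p Tau) > 0} \<inter> (\<Inter>v\<in>vars m r. {p. p v \<noteq> 0})"
    by (auto simp: dom_mult_def)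
  also have "open \<dots>"
    by (intro open_Int open_INT finite_vars ballI open_Collect_less open_Collect_neq continuous_intros)
  finally show ?thesis .
qed

text \<open>Vary one coordinate \<open>v\<close> that occurs in \<open>l\<close>: theta becomes an
  entire function of it that is not identically zero, so it cannot vanish on a whole ball. As
  \<open>Tau\<close> does not occur in \<open>l\<close>, the modulus stays fixed.\<close>

lemma generic_theta_nonzero:
  assumes l: "l \<noteq> 0" "Tau \<notin> Poly_Mapping.keys l"
  shows "generic dom_add (\<lambda>z. theta (z Tau) (lin l z) \<noteq> 0)"
proof -
  have cont: "continuous_on dom_add (\<lambda>z. theta (z Tau) (lin l z))"
    by (intro continuous_intros) (auto simp: dom_add_def)
  define U where "U = {z \<in> dom_add. theta (z Tau) (lin l z) \<noteq> 0}"
  have "U = dom_add \<inter> (\<lambda>z. theta (z Tau) (lin l z)) -` (- {0})" by (auto simp: U_def)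
  moreover have "open \<dots>" using cont open_dom_add
    by (rule continuous_open_preimage) (auto simp: open_Compl)
  ultimately have "open U" by simp
  moreover have "dom_add \<subseteq> closure U"
  proof
    fix z assume z: "z \<in> dom_add"
    hence \<tau>: "Im (z Tau) > 0" by (simp add: dom_add_def)
    obtain v where v: "v \<in> Poly_Mapping.keys l" using l(1) by fastforce
    hence vT: "v \<noteq> Tau" and lv: "Poly_Mapping.lookup l v \<noteq> 0" using l(2) by (auto simp: in_keys_iff)
    show "z \<in> closure U" unfolding closure_iff_nhds_not_empty
    proof (intro allI impI)
      fix A T assume T: "T \<subseteq> A" "open T" "z \<in> T"
      define g where "g t = z(v := z v + t)" for t
      have "continuous_on UNIV (\<lambda>t. if i = v then z v + t else z i)" for i
        by (cases "i = v") (auto intro!: continuous_intros)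
      hence "continuous_on UNIV g" unfolding g_def fun_upd_def
        by (rule continuous_on_coordinatewise_then_product)
      hence "open (g -` T)" using T by (simp add: open_vimage)
      moreover have "0 \<in> g -` T" using T by (simp add: g_def)
      ultimately obtain e where e: "e > 0" "ball 0 e \<subseteq> g -` T" using open_contains_ball by blast
      have "\<exists>t\<in>ball 0 e. theta (z Tau) (lin l z + of_int (Poly_Mapping.lookup l v) * t) \<noteq> 0"
      proof (rule ccontr)
        assume "\<not> (\<exists>t\<in>ball 0 e. theta (z Tau) (lin l z + of_int (Poly_Mapping.lookup l v) * t) \<noteq> 0)"
        hence 0: "theta (z Tau) (lin l z + of_int (Poly_Mapping.lookup l v) * t) = 0" if "t \<in> ball 0 e" for t
          using that by blast
        have hol: "(\<lambda>t. theta (z Tau) (lin l z + of_int (Poly_Mapping.lookup l v) * t)) holomorphic_on UNIV"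
          by (intro theta_entire \<tau> holomorphic_intros)
        have "theta (z Tau) (lin l z + of_int (Poly_Mapping.lookup l v) * t) = 0" for t
          by (rule analytic_continuation_open[OF open_ball[of 0 e] open_UNIV _ connected_UNIV subset_UNIV hol holomorphic_on_const 0])
             (use e in auto)
        from this[of "(x - lin l z) / of_int (Poly_Mapping.lookup l v)" for x] lv
        have "theta (z Tau) x = 0" for x by simp
        thus False using theta_not_identically_0[OF \<tau>] by blast
      qed
      then obtain t where t: "t \<in> ball 0 e" "theta (z Tau) (lin l z + of_int (Poly_Mapping.lookup l v) * t) \<noteq> 0" by blast
      have "g t \<in> T" using t e by blast
      moreover have "g t \<in> U" using z t(2) vT by (simp add: U_def g_def lin_upd dom_add_def)
      ultimately show "U \<inter> A \<noteq> {}" using T by blast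
    qed
  qed
  ultimately show ?thesis unfolding generic_def by (intro exI[of _ U]) (auto simp: U_def)
qed

section \<open>Multiplicative and additive coordinates\<close>

definition depends :: "nat \<Rightarrow> nat \<Rightarrow> func \<Rightarrow> bool" where
  "depends m r f \<longleftrightarrow> (\<forall>p q. (\<forall>v\<in>insert Tau (vars m r). p v = q v) \<longrightarrow> f p = f q)"

text \<open>A branch of the inverse of \<open>expo\<close> near \<open>expo z0\<close>, holomorphic
  where the quotients in \<open>log_dom\<close> have positive real part. The other coordinates are
  frozen at their values in \<open>z0\<close>, so that \<open>expo z0\<close> is sent back to
  exactly \<open>z0\<close>.\<close>

definition local_log :: "nat \<Rightarrow> nat \<Rightarrow> point \<Rightarrow> point \<Rightarrow> point" where
  "local_log m r z0 p = (\<lambda>v. if v = Tau then p Tau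
     else if v \<in> vars m r then z0 v + Ln (p v / expo z0 v) / (2 * of_real pi * \<i>) else z0 v)"

definition log_dom :: "nat \<Rightarrow> nat \<Rightarrow> point \<Rightarrow> point set" where
  "log_dom m r z0 = {p. Im (p Tau) > 0 \<and> (\<forall>v\<in>vars m r. Re (p v / expo z0 v) > 0)}"

lemma expo_Tau [simp]: "expo z Tau = z Tau"
  by (simp add: expo_def)

lemma expo_eq: "v \<noteq> Tau \<Longrightarrow> expo z v = exp (2 * of_real pi * \<i> * z v)"
  by (simp add: expo_def)

lemma expo_nonzero: "v \<noteq> Tau \<Longrightarrow> expo z v \<noteq> 0"
  by (simp add: expo_def)

lemma continuous_on_expo [continuous_intros]:
  "(\<And>v. continuous_on S (\<lambda>p. g p v)) \<Longrightarrow> continuous_on S (\<lambda>p. expo (g p) v)"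
  by (cases "v = Tau") (auto simp: expo_def intro!: continuous_intros)

lemma open_log_dom: "open (log_dom m r z0)"
proof -
  have "log_dom m r z0 = {p. Im (p Tau) > 0} \<inter> (\<Inter>v\<in>vars m r. {p. Re (p v / expo z0 v) > 0})"
    by (auto simp: log_dom_def)
  also have "continuous_on UNIV (\<lambda>p. p v / expo z0 v)" if "v \<in> vars m r" for v
  proof -
    have "v \<noteq> Tau" using that by auto
    thus ?thesis using expo_nonzero[of v z0] by (intro continuous_intros) auto
  qed
  hence "open {p. Re (p v / expo z0 v) > 0}" if "v \<in> vars m r" for v
    using that by (intro open_Collect_less continuous_on_Re continuous_on_const)
  hence "open ({p. Im (p Tau) > 0} \<inter> (\<Inter>v\<in>vars m r. {p. Re (p v / expo z0 v) > 0}))"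
    by (intro open_Int open_INT finite_vars ballI) (auto intro!: open_Collect_less continuous_intros)
  finally show ?thesis .
qed

lemma log_dom_subset: "log_dom m r z0 \<subseteq> dom_mult m r"
  by (auto simp: log_dom_def dom_mult_def)

lemma continuous_on_local_log: "continuous_on (log_dom m r z0) (\<lambda>p. local_log m r z0 p v)"
proof -
  have "continuous_on (log_dom m r z0) (\<lambda>p. Ln (p v / expo z0 v))" if "v \<in> vars m r"
    using that expo_nonzero[of v z0]
    by (intro continuous_intros) (auto simp: log_dom_def complex_nonpos_Reals_iff)
  thus ?thesis unfolding local_log_def
    by (cases "v = Tau"; cases "v \<in> vars m r") (auto intro!: continuous_intros)
qed

lemma expo_local_log:
  assumes "p \<in> log_dom m r z0" "v \<in> insert Tau (vars m r)"
  shows "expo (local_log m r z0 p) v = p v"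
proof (cases "v = Tau")
  case False
  hence v: "v \<in> vars m r" using assms by simp
  hence nz: "p v / expo z0 v \<noteq> 0" using assms(1) by (auto simp: log_dom_def)
  have "expo (local_log m r z0 p) v = exp (2 * of_real pi * \<i> * z0 v + Ln (p v / expo z0 v))"
    using False v by (simp add: expo_eq local_log_def ring_distribs)
  also have "\<dots> = p v"
    using nz False by (simp add: exp_add expo_eq)
  finally show ?thesis .
qed (simp add: local_log_def)

lemma local_log_expo:
  assumes "v \<in> insert Tau (vars m r) \<Longrightarrow> p v = expo z0 v"
  shows "local_log m r z0 p v = z0 v"
  using assms by (auto simp: local_log_def expo_nonzero)

lemma in_log_dom:
  assumes "\<And>v. v \<in> insert Tau (vars m r) \<Longrightarrow> p v = expo z0 v" "Im (z0 Tau) > 0"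
  shows "p \<in> log_dom m r z0"
  unfolding log_dom_def
proof (safe)
  show "0 < Im (p Tau)" using assms by simp
  fix v assume v: "v \<in> vars m r"
  hence "v \<noteq> Tau" by auto
  thus "0 < Re (p v / expo z0 v)" using assms(1)[of v] v expo_nonzero[of v z0] by simp
qed

lemma exists_log:
  assumes "p \<in> dom_mult m r"
  obtains z where "z \<in> dom_add" "\<And>v. v \<in> insert Tau (vars m r) \<Longrightarrow> expo z v = p v"
proof
  define z where "z = (\<lambda>v. if v = Tau then p Tau else Ln (p v) / (2 * of_real pi * \<i>))"
  show "z \<in> dom_add" using assms by (simp add: z_def dom_add_def dom_mult_def)
  show "expo z v = p v" if "v \<in> insert Tau (vars m r)" for v
    using that assms by (cases "v = Tau") (auto simp: z_def expo_def dom_mult_def)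
qed

lemma open_preimage_contains:
  fixes f :: "point \<Rightarrow> point"
  assumes "open S" "\<And>v. continuous_on S (\<lambda>p. f p v)" "open T"
  shows "open (S \<inter> f -` T)"
  using assms by (intro continuous_open_preimage) (auto intro: continuous_on_coordinatewise_then_product)

text \<open>In the relevant coordinates \<open>expo\<close> is a surjective local homeomorphism, so
  dense open sets can be pushed forward and pulled back. The remaining coordinates of a point may be
  0, which is no exponential; the hypothesis on \<open>P\<close> lets them be altered
  freely.\<close>

lemma generic_transport:
  assumes dep: "\<And>p q. (\<forall>v\<in>insert Tau (vars m r). p v = q v) \<Longrightarrow> P p = P q"
  shows "generic (dom_mult m r) P \<longleftrightarrow> generic dom_add (\<lambda>z. P (expo z))"
proof
  let ?W = "insert Tau (vars m r)"
  assume "generic dom_add (\<lambda>z. P (expo z))"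
  then obtain U where U: "open U" "U \<subseteq> dom_add" "dom_add \<subseteq> closure U" "\<And>z. z \<in> U \<Longrightarrow> P (expo z)"
    unfolding generic_def by blast
  \<comment> \<open>The image of \<open>U\<close>, enlarged by arbitrary values in the irrelevant
    coordinates so that it becomes open.\<close>
  define U' where "U' = {p. \<exists>z\<in>U. \<forall>v\<in>?W. p v = expo z v}"
  have "open U'"
  proof (subst open_subopen, safe)
    fix p assume "p \<in> U'"
    then obtain z where z: "z \<in> U" "\<forall>v\<in>?W. p v = expo z v" by (auto simp: U'_def)
    define T where "T = log_dom m r z \<inter> local_log m r z -` U"
    have "open T" unfolding T_def
      by (intro open_preimage_contains open_log_dom continuous_on_local_log U)
    moreover have "local_log m r z p = z"
      using z by (intro ext local_log_expo) auto
    hence "p \<in> T" using z U by (auto simp: T_def dom_add_def intro!: in_log_dom)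
    moreover have "T \<subseteq> U'"
    proof
      fix q assume "q \<in> T"
      hence q: "q \<in> log_dom m r z" "local_log m r z q \<in> U" by (auto simp: T_def)
      have "\<forall>v\<in>?W. q v = expo (local_log m r z q) v" using expo_local_log[OF q(1)] by simp
      thus "q \<in> U'" using q(2) unfolding U'_def by blast
    qed
    ultimately show "\<exists>T. open T \<and> p \<in> T \<and> T \<subseteq> U'" by blast
  qed
  moreover have "U' \<subseteq> dom_mult m r"
  proof
    fix p assume "p \<in> U'"
    then obtain z where z: "z \<in> U" "\<forall>v\<in>?W. p v = expo z v" by (auto simp: U'_def)
    have "expo z v \<noteq> 0" if "v \<in> vars m r" for v using that by (intro expo_nonzero) auto
    thus "p \<in> dom_mult m r" using z U(2) by (auto simp: dom_mult_def dom_add_def)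
  qed
  moreover have "dom_mult m r \<subseteq> closure U'"
  proof
    fix p assume p: "p \<in> dom_mult m r"
    then obtain z where z: "z \<in> dom_add" "\<And>v. v \<in> ?W \<Longrightarrow> expo z v = p v" by (rule exists_log) blast
    \<comment> \<open>Only the relevant coordinates are exponentiated and the others are taken from
      \<open>p\<close>; this gives back \<open>p\<close> at \<open>z\<close>.\<close>
    define g where "g z = (\<lambda>v. if v \<in> ?W then expo z v else p v)" for z
    show "p \<in> closure U'" unfolding closure_iff_nhds_not_empty
    proof (intro allI impI)
      fix A T assume T: "T \<subseteq> A" "open T" "p \<in> T"
      have "continuous_on UNIV (\<lambda>z. g z v)" for v unfolding g_def
        by (cases "v \<in> ?W") (auto intro!: continuous_intros)
      hence "open (UNIV \<inter> g -` T)" using T by (intro open_preimage_contains) auto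
      moreover have "g z = p" using z by (auto simp: g_def)
      hence "z \<in> UNIV \<inter> g -` T" using T by auto
      moreover have "z \<in> closure U" using z U by blast
      ultimately obtain y where y: "y \<in> U" "g y \<in> T" unfolding closure_iff_nhds_not_empty by blast
      hence "g y \<in> U'" by (auto simp: U'_def g_def)
      thus "U' \<inter> A \<noteq> {}" using y T by blast
    qed
  qed
  moreover have "P p" if "p \<in> U'" for p
    using that U(4) dep unfolding U'_def by blast
  ultimately show "generic (dom_mult m r) P" unfolding generic_def by blast
next
  let ?W = "insert Tau (vars m r)"
  assume "generic (dom_mult m r) P"
  then obtain U where U: "open U" "U \<subseteq> dom_mult m r" "dom_mult m r \<subseteq> closure U" "\<And>z. z \<in> U \<Longrightarrow> P z"
    unfolding generic_def by blast
  define V where "V = {z. \<exists>p\<in>U. \<forall>v\<in>?W. p v = expo z v}"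
  have "open V"
  proof (subst open_subopen, safe)
    fix z assume "z \<in> V"
    then obtain p where p: "p \<in> U" "\<forall>v\<in>?W. p v = expo z v" by (auto simp: V_def)
    define g where "g z = (\<lambda>v. if v \<in> ?W then expo z v else p v)" for z
    have "continuous_on UNIV (\<lambda>z. g z v)" for v unfolding g_def
      by (cases "v \<in> ?W") (auto intro!: continuous_intros)
    hence "open (UNIV \<inter> g -` U)" using U by (intro open_preimage_contains) auto
    moreover have "g z = p" using p by (auto simp: g_def)
    hence "z \<in> UNIV \<inter> g -` U" using p by auto
    moreover have "UNIV \<inter> g -` U \<subseteq> V" unfolding V_def by (auto simp: g_def intro!: bexI[of _ "g _"])
    ultimately show "\<exists>T. open T \<and> z \<in> T \<and> T \<subseteq> V" by blast
  qed
  moreover have "V \<subseteq> dom_add"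
    using U(2) by (auto simp: V_def dom_add_def dom_mult_def)
  moreover have "dom_add \<subseteq> closure V"
  proof
    fix z assume z: "z \<in> dom_add"
    show "z \<in> closure V" unfolding closure_iff_nhds_not_empty
    proof (intro allI impI)
      fix A T assume T: "T \<subseteq> A" "open T" "z \<in> T"
      define S where "S = log_dom m r z \<inter> local_log m r z -` T"
      have "open S" unfolding S_def
        by (intro open_preimage_contains open_log_dom continuous_on_local_log T)
      moreover have "local_log m r z (expo z) = z" by (intro ext local_log_expo) auto
      hence "expo z \<in> S" using T z by (auto simp: S_def dom_add_def intro!: in_log_dom)
      moreover have "expo z \<in> closure U"
        using U(3) log_dom_subset[of m r z] \<open>expo z \<in> S\<close> unfolding S_def by blast
      ultimately obtain p where p: "p \<in> U" "p \<in> S" unfolding closure_iff_nhds_not_empty by blast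
      have pl: "p \<in> log_dom m r z" using p by (simp add: S_def)
      have "\<forall>v\<in>?W. p v = expo (local_log m r z p) v" using expo_local_log[OF pl] by simp
      hence "local_log m r z p \<in> V" unfolding V_def using p(1) by blast
      thus "V \<inter> A \<noteq> {}" using p T by (auto simp: S_def)
    qed
  qed
  moreover have "P (expo z)" if "z \<in> V" for z
    using that U(4) dep unfolding V_def by blast
  ultimately show "generic dom_add (\<lambda>z. P (expo z))" unfolding generic_def by blast
qed

lemma mer_eq_iff:
  assumes "depends m r f" "depends m r g"
  shows "mer_eq m r f g \<longleftrightarrow> gen_eq dom_add (\<lambda>z. f (expo z)) (\<lambda>z. g (expo z))"
proof -
  have "(f p = g p) = (f q = g q)" if "\<forall>v\<in>insert Tau (vars m r). p v = q v" for p q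
  proof -
    have "f p = f q" "g p = g q" using assms that unfolding depends_def by blast+
    thus ?thesis by simp
  qed
  thus ?thesis unfolding gen_eq_generic by (intro generic_transport) auto
qed

section \<open>Functions with a type\<close>

lemma theta_mono_value_superset:
  assumes "finite A" "Poly_Mapping.keys e \<subseteq> A"
  shows "theta_mono_value e z = (\<Prod>l\<in>A. theta (z Tau) (lin l z) powi Poly_Mapping.lookup e l)"
  unfolding theta_mono_value_def using assms
  by (intro prod.mono_neutral_left) (auto simp: in_keys_iff)

lemma theta_mono_type_superset:
  assumes "finite A" "Poly_Mapping.keys e \<subseteq> A"
  shows "theta_mono_type e z = (\<Sum>l\<in>A. of_int (Poly_Mapping.lookup e l) * ((lin l z)\<^sup>2 / 2))"
  unfolding theta_mono_type_def using assms
  by (intro sum.mono_neutral_left) (auto simp: in_keys_iff)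

lemma theta_mono_value_plus:
  assumes "\<And>l. l \<in> Poly_Mapping.keys e \<union> Poly_Mapping.keys f \<Longrightarrow> theta (z Tau) (lin l z) \<noteq> 0"
  shows "theta_mono_value (e + f) z = theta_mono_value e z * theta_mono_value f z"
proof -
  let ?A = "Poly_Mapping.keys e \<union> Poly_Mapping.keys f"
  have "Poly_Mapping.keys (e + f) \<subseteq> ?A" by (rule Poly_Mapping.keys_add)
  thus ?thesis
    by (subst (1 2 3) theta_mono_value_superset[of ?A])
       (auto simp: lookup_add prod.distrib[symmetric] power_int_add assms intro!: prod.cong)
qed

lemma theta_mono_type_plus:
  "theta_mono_type (e + f) = (\<lambda>z. theta_mono_type e z + theta_mono_type f z)"
proof
  fix z
  let ?A = "Poly_Mapping.keys e \<union> Poly_Mapping.keys f"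
  have "Poly_Mapping.keys (e + f) \<subseteq> ?A" by (rule Poly_Mapping.keys_add)
  thus "theta_mono_type (e + f) z = theta_mono_type e z + theta_mono_type f z"
    by (subst (1 2 3) theta_mono_type_superset[of ?A])
       (auto simp: lookup_add distrib_right sum.distrib simp del: times_divide_eq_right)
qed

lemma theta_monomials_plus:
  "e \<in> theta_monomials m r \<Longrightarrow> f \<in> theta_monomials m r \<Longrightarrow> e + f \<in> theta_monomials m r"
  using Poly_Mapping.keys_add[of e f] unfolding theta_monomials_def by blast

lemma theta_monomials_0 [simp]: "0 \<in> theta_monomials m r"
  by (simp add: theta_monomials_def)

lemma theta_monomials_single:
  "l \<noteq> 0 \<Longrightarrow> Poly_Mapping.keys l \<subseteq> vars m r \<Longrightarrow> Poly_Mapping.single l k \<in> theta_monomials m r"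
  by (auto simp: theta_monomials_def)

lemma theta_mono_value_single: "theta_mono_value (Poly_Mapping.single l k) z = theta (z Tau) (lin l z) powi k"
  by (subst theta_mono_value_superset[of "{l}"]) auto

lemma theta_mono_type_single: "theta_mono_type (Poly_Mapping.single l k) z = of_int k * ((lin l z)\<^sup>2 / 2)"
  by (subst theta_mono_type_superset[of "{l}"]) auto

lemma generic_theta_keys:
  assumes "e \<in> theta_monomials m r"
  shows "generic dom_add (\<lambda>z. \<forall>l\<in>Poly_Mapping.keys e. theta (z Tau) (lin l z) \<noteq> 0)"
proof (intro generic_ball_finite generic_theta_nonzero)
  fix l assume "l \<in> Poly_Mapping.keys e"
  hence "l \<noteq> 0 \<and> Poly_Mapping.keys l \<subseteq> vars m r" using assms by (auto simp: theta_monomials_def)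
  thus "l \<noteq> 0" "Tau \<notin> Poly_Mapping.keys l" using Tau_notin_vars(1)[of m r] by blast+
qed auto

text \<open>The condition of \<open>has_type\<close> without the pull-back along
  \<open>expo\<close>, so that it applies to functions given directly in additive
  coordinates.\<close>

definition has_type_add :: "nat \<Rightarrow> nat \<Rightarrow> func \<Rightarrow> func \<Rightarrow> bool" where
  "has_type_add m r f Q \<longleftrightarrow> (\<exists>(S :: theta_monomial set) (c :: theta_monomial \<Rightarrow> complex \<Rightarrow> complex).
     finite S \<and> S \<subseteq> theta_monomials m r \<and>
     (\<forall>e\<in>S. theta_mono_type e = Q \<and> c e holomorphic_on {\<tau>. Im \<tau> > 0}) \<and>
     gen_eq dom_add f (\<lambda>z. \<Sum>e\<in>S. c e (z Tau) * theta_mono_value e z))"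

lemma has_type_iff_add: "has_type m r f Q \<longleftrightarrow> has_type_add m r (\<lambda>z. f (expo z)) Q"
  by (simp add: has_type_def has_type_add_def)

lemma has_type_add_cong: "gen_eq dom_add f g \<Longrightarrow> has_type_add m r g Q \<Longrightarrow> has_type_add m r f Q"
  unfolding has_type_add_def by (meson gen_eq_trans)

text \<open>An arbitrary index set admits repeated theta monomials, as they arise in sums and
  products; their coefficients are added up.\<close>

lemma has_type_addI:
  fixes I :: "'i set" and e :: "'i \<Rightarrow> theta_monomial"
  assumes "finite I" "\<And>i. i \<in> I \<Longrightarrow> e i \<in> theta_monomials m r" "\<And>i. i \<in> I \<Longrightarrow> theta_mono_type (e i) = Q"
    "\<And>i. i \<in> I \<Longrightarrow> c i holomorphic_on {\<tau>. Im \<tau> > 0}"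
    "gen_eq dom_add f (\<lambda>z. \<Sum>i\<in>I. c i (z Tau) * theta_mono_value (e i) z)"
  shows "has_type_add m r f Q"
proof -
  have "(\<Sum>i\<in>I. c i (z Tau) * theta_mono_value (e i) z) =
      (\<Sum>x\<in>e ` I. (\<Sum>i | i \<in> I \<and> e i = x. c i (z Tau)) * theta_mono_value x z)" for z
    by (subst sum.image_gen[OF assms(1), of _ e])
       (auto simp: sum_distrib_right intro!: sum.cong)
  with assms show ?thesis unfolding has_type_add_def
    by (intro exI[of _ "e ` I"] exI[of _ "\<lambda>x \<tau>. \<Sum>i | i \<in> I \<and> e i = x. c i \<tau>"])
       (auto intro!: holomorphic_intros)
qed

lemma has_type_add_0: "has_type_add m r (\<lambda>_. 0) Q"
  unfolding has_type_add_def by (intro exI[of _ "{}"]) (auto intro: gen_eq_refl)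

lemma has_type_add_const: "has_type_add m r (\<lambda>_. c) (\<lambda>_. 0)"
  by (rule has_type_addI[of "{()}" "\<lambda>_. 0" _ _ _ "\<lambda>_ _. c"])
     (auto simp: theta_mono_type_def theta_mono_value_def intro: gen_eq_refl holomorphic_intros)

lemma has_type_add_plus:
  assumes "has_type_add m r f Q" "has_type_add m r g Q"
  shows "has_type_add m r (\<lambda>z. f z + g z) Q"
proof -
  obtain S c where S: "finite S" "S \<subseteq> theta_monomials m r"
    "\<forall>e\<in>S. theta_mono_type e = Q \<and> c e holomorphic_on {\<tau>. Im \<tau> > 0}"
    "gen_eq dom_add f (\<lambda>z. \<Sum>e\<in>S. c e (z Tau) * theta_mono_value e z)"
    using assms(1) unfolding has_type_add_def by blast
  obtain S' c' where S': "finite S'" "S' \<subseteq> theta_monomials m r"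
    "\<forall>e\<in>S'. theta_mono_type e = Q \<and> c' e holomorphic_on {\<tau>. Im \<tau> > 0}"
    "gen_eq dom_add g (\<lambda>z. \<Sum>e\<in>S'. c' e (z Tau) * theta_mono_value e z)"
    using assms(2) unfolding has_type_add_def by blast
  show ?thesis
  proof (rule has_type_addI[of "S <+> S'" "case_sum id id" _ _ _ "case_sum c c'"])
    have "gen_eq dom_add (\<lambda>z. f z + g z)
      (\<lambda>z. (\<Sum>e\<in>S. c e (z Tau) * theta_mono_value e z) + (\<Sum>e\<in>S'. c' e (z Tau) * theta_mono_value e z))"
      by (intro gen_eq_add S S')
    thus "gen_eq dom_add (\<lambda>z. f z + g z)
      (\<lambda>z. \<Sum>i\<in>S <+> S'. case_sum c c' i (z Tau) * theta_mono_value (case_sum id id i) z)"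
      using S(1) S'(1) by (simp add: sum.Plus)
  qed (use S S' in auto)
qed

lemma has_type_add_mult:
  assumes "has_type_add m r f Q" "has_type_add m r g Q'"
  shows "has_type_add m r (\<lambda>z. f z * g z) (\<lambda>z. Q z + Q' z)"
proof -
  obtain S c where S: "finite S" "S \<subseteq> theta_monomials m r"
    "\<forall>e\<in>S. theta_mono_type e = Q \<and> c e holomorphic_on {\<tau>. Im \<tau> > 0}"
    "gen_eq dom_add f (\<lambda>z. \<Sum>e\<in>S. c e (z Tau) * theta_mono_value e z)"
    using assms(1) unfolding has_type_add_def by blast
  obtain S' c' where S': "finite S'" "S' \<subseteq> theta_monomials m r"
    "\<forall>e\<in>S'. theta_mono_type e = Q' \<and> c' e holomorphic_on {\<tau>. Im \<tau> > 0}"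
    "gen_eq dom_add g (\<lambda>z. \<Sum>e\<in>S'. c' e (z Tau) * theta_mono_value e z)"
    using assms(2) unfolding has_type_add_def by blast
  show ?thesis
  proof (rule has_type_addI[of "S \<times> S'" "\<lambda>(e, e'). e + e'" _ _ _ "\<lambda>(e, e') \<tau>. c e \<tau> * c' e' \<tau>"])
    \<comment> \<open>Exponents may be added only where the theta functions involved do not vanish,
      since integer powers of 0 do not turn sums of exponents into products.\<close>
    have nz: "generic dom_add (\<lambda>z. \<forall>e\<in>S \<union> S'. \<forall>l\<in>Poly_Mapping.keys e. theta (z Tau) (lin l z) \<noteq> 0)"
      using S S' by (intro generic_ball_finite[of "S \<union> S'"] generic_theta_keys) auto
    have "gen_eq dom_add (\<lambda>z. f z * g z)
      (\<lambda>z. (\<Sum>e\<in>S. c e (z Tau) * theta_mono_value e z) * (\<Sum>e\<in>S'. c' e (z Tau) * theta_mono_value e z))"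
      by (intro gen_eq_mult S S')
    also have "gen_eq dom_add (\<lambda>z. (\<Sum>e\<in>S. c e (z Tau) * theta_mono_value e z) * (\<Sum>e\<in>S'. c' e (z Tau) * theta_mono_value e z))
       (\<lambda>z. \<Sum>i\<in>S \<times> S'. (case i of (e, e') \<Rightarrow> \<lambda>\<tau>. c e \<tau> * c' e' \<tau>) (z Tau) * theta_mono_value (case i of (e, e') \<Rightarrow> e + e') z)"
      unfolding gen_eq_generic
    proof (rule generic_mono[OF nz])
      fix z assume nz: "\<forall>e\<in>S \<union> S'. \<forall>l\<in>Poly_Mapping.keys e. theta (z Tau) (lin l z) \<noteq> 0"
      have "theta_mono_value (e + e') z = theta_mono_value e z * theta_mono_value e' z"
        if "e \<in> S" "e' \<in> S'" for e e'
        using nz that by (intro theta_mono_value_plus) auto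
      thus "(\<Sum>e\<in>S. c e (z Tau) * theta_mono_value e z) * (\<Sum>e\<in>S'. c' e (z Tau) * theta_mono_value e z) =
        (\<Sum>i\<in>S \<times> S'. (case i of (e, e') \<Rightarrow> \<lambda>\<tau>. c e \<tau> * c' e' \<tau>) (z Tau) * theta_mono_value (case i of (e, e') \<Rightarrow> e + e') z)"
        unfolding sum_product sum.cartesian_product
        by (intro sum.cong) (auto simp: mult_ac)
    qed
    finally (gen_eq_trans) show "gen_eq dom_add (\<lambda>z. f z * g z)
       (\<lambda>z. \<Sum>i\<in>S \<times> S'. (case i of (e, e') \<Rightarrow> \<lambda>\<tau>. c e \<tau> * c' e' \<tau>) (z Tau) * theta_mono_value (case i of (e, e') \<Rightarrow> e + e') z)" .
  next
    show "finite (S \<times> S')" using S S' by simp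
  next
    fix i assume "i \<in> S \<times> S'"
    then obtain e e' where i: "i = (e, e')" "e \<in> S" "e' \<in> S'" by blast
    show "(case i of (e, e') \<Rightarrow> e + e') \<in> theta_monomials m r"
      using i S(2) S'(2) by (auto intro!: theta_monomials_plus)
    show "theta_mono_type (case i of (e, e') \<Rightarrow> e + e') = (\<lambda>z. Q z + Q' z)"
      using i S S' by (simp add: theta_mono_type_plus)
    show "(case i of (e, e') \<Rightarrow> \<lambda>\<tau>. c e \<tau> * c' e' \<tau>) holomorphic_on {\<tau>. 0 < Im \<tau>}"
      using i S S' by (auto intro!: holomorphic_intros)
  qed
qed

text \<open>The type is \<open>((l1 + l2)^2 - l1^2 - l2^2) / 2 = l1 * l2\<close>. The two monomials
  involve disjoint sets of variables, so \<open>l1 + l2\<close> is nontrivial and is an admissible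
  argument of theta.\<close>

lemma has_type_add_F:
  assumes "l1 \<noteq> 0" "Poly_Mapping.keys l1 \<subseteq> xvars m" "l2 \<noteq> 0" "Poly_Mapping.keys l2 \<subseteq> muvars r"
  shows "has_type_add m r (\<lambda>z. F (z Tau) (lin l1 z) (lin l2 z)) (\<lambda>z. lin l1 z * lin l2 z)"
proof -
  have k: "Poly_Mapping.keys l1 \<subseteq> vars m r" "Poly_Mapping.keys l2 \<subseteq> vars m r"
    using assms by (auto simp: vars_def)
  hence k12: "Poly_Mapping.keys (l1 + l2) \<subseteq> vars m r" using Poly_Mapping.keys_add[of l1 l2] by blast
  have "l1 + l2 \<noteq> 0"
  proof
    assume 0: "l1 + l2 = 0"
    obtain v where v: "v \<in> Poly_Mapping.keys l1" using assms(1) by fastforce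
    hence "v \<notin> Poly_Mapping.keys l2" using assms by (auto simp: xvars_def muvars_def)
    hence "Poly_Mapping.lookup (l1 + l2) v \<noteq> 0" using v by (simp add: lookup_add in_keys_iff)
    thus False using 0 by simp
  qed
  note nz = this assms(1,3)
  define e where "e = Poly_Mapping.single (l1 + l2) 1 + (Poly_Mapping.single l1 (-1) + Poly_Mapping.single l2 (-1) :: theta_monomial)"
  have e: "e \<in> theta_monomials m r" unfolding e_def
    using nz k k12 by (intro theta_monomials_plus theta_monomials_single)
  have gn: "generic dom_add (\<lambda>z. \<forall>l\<in>{l1, l2, l1 + l2}. theta (z Tau) (lin l z) \<noteq> 0)"
    using nz k k12 Tau_notin_vars(1)[of m r]
    by (intro generic_ball_finite generic_theta_nonzero) auto
  show ?thesis
  proof (rule has_type_addI[of "{()}" "\<lambda>_. e" _ _ _ "\<lambda>_ \<tau>. deriv (theta \<tau>) 0"])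
    show "theta_mono_type e = (\<lambda>z. lin l1 z * lin l2 z)"
      unfolding e_def theta_mono_type_plus theta_mono_type_single
      by (auto simp: fun_eq_iff lin_plus field_simps power2_eq_square)
    have "gen_eq dom_add (\<lambda>z. F (z Tau) (lin l1 z) (lin l2 z)) (\<lambda>z. deriv (theta (z Tau)) 0 * theta_mono_value e z)"
      unfolding gen_eq_generic
    proof (rule generic_mono[OF gn])
      fix z assume nz: "\<forall>l\<in>{l1, l2, l1 + l2}. theta (z Tau) (lin l z) \<noteq> 0"
      have "theta_mono_value e z = theta (z Tau) (lin (l1 + l2) z) powi 1 *
        (theta (z Tau) (lin l1 z) powi (-1) * theta (z Tau) (lin l2 z) powi (-1))"
      proof -
        have "Poly_Mapping.keys (Poly_Mapping.single l1 (-1) + Poly_Mapping.single l2 (-1) :: theta_monomial) \<subseteq> {l1, l2}"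
          using Poly_Mapping.keys_add[of "Poly_Mapping.single l1 (-1) :: theta_monomial" "Poly_Mapping.single l2 (-1)"] by auto
        hence "theta_mono_value e z = theta_mono_value (Poly_Mapping.single (l1 + l2) 1) z *
            theta_mono_value (Poly_Mapping.single l1 (-1) + Poly_Mapping.single l2 (-1)) z"
          unfolding e_def by (intro theta_mono_value_plus) (use nz in auto)
        also have "theta_mono_value (Poly_Mapping.single l1 (-1) + Poly_Mapping.single l2 (-1)) z =
            theta_mono_value (Poly_Mapping.single l1 (-1)) z * theta_mono_value (Poly_Mapping.single l2 (-1)) z"
          by (intro theta_mono_value_plus) (use nz in auto)
        finally show ?thesis unfolding theta_mono_value_single .
      qed
      thus "F (z Tau) (lin l1 z) (lin l2 z) = deriv (theta (z Tau)) 0 * theta_mono_value e z"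
        by (simp add: F_def lin_plus power_int_minus divide_inverse)
    qed
    thus "gen_eq dom_add (\<lambda>z. F (z Tau) (lin l1 z) (lin l2 z))
       (\<lambda>z. \<Sum>i\<in>{()}. deriv (theta (z Tau)) 0 * theta_mono_value e z)" by simp
  qed (use e holomorphic_deriv_theta_0 in auto)
qed

section \<open>Renaming of variables\<close>

text \<open>The two groups of variables are preserved separately, since the generators of the
  algebra pair a monomial of one group with a monomial of the other.\<close>

definition renaming :: "nat \<Rightarrow> nat \<Rightarrow> (var \<Rightarrow> var) \<Rightarrow> bool" where
  "renaming m r \<rho> \<longleftrightarrow> bij \<rho> \<and> \<rho> Tau = Tau \<and> \<rho> ` xvars m = xvars m \<and> \<rho> ` muvars r = muvars r"

text \<open>\<open>map_key\<close> precomposes the coefficient function, so moving the variable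
  \<open>v\<close> to \<open>\<rho> v\<close> takes the inverse permutation.\<close>

definition rename :: "(var \<Rightarrow> var) \<Rightarrow> monomial \<Rightarrow> monomial" where
  "rename \<rho> l = Poly_Mapping.map_key (inv \<rho>) l"

lemma keys_rename: "bij \<rho> \<Longrightarrow> Poly_Mapping.keys (rename \<rho> l) = \<rho> ` Poly_Mapping.keys l"
  by (simp add: rename_def keys_map_key bij_imp_bij_inv bij_is_inj bij_vimage_eq_inv_image inv_inv_eq)

lemma lookup_rename: "bij \<rho> \<Longrightarrow> Poly_Mapping.lookup (rename \<rho> l) (\<rho> v) = Poly_Mapping.lookup l v"
  by (simp add: rename_def map_key.rep_eq bij_imp_bij_inv bij_is_inj)

lemma lin_rename:
  assumes "bij \<rho>"
  shows "lin (rename \<rho> l) z = lin l (z \<circ> \<rho>)"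
proof -
  have "inj_on \<rho> (Poly_Mapping.keys l)" using assms by (meson bij_is_inj inj_on_subset subset_UNIV)
  thus ?thesis unfolding lin_def keys_rename[OF assms]
    by (subst sum.reindex) (auto simp: lookup_rename assms)
qed

lemma mon_value_rename:
  assumes "bij \<rho>"
  shows "mon_value (rename \<rho> l) p = mon_value l (p \<circ> \<rho>)"
proof -
  have "inj_on \<rho> (Poly_Mapping.keys l)" using assms by (meson bij_is_inj inj_on_subset subset_UNIV)
  thus ?thesis unfolding mon_value_def keys_rename[OF assms]
    by (subst prod.reindex) (auto simp: lookup_rename assms)
qed

lemma rename_single: "bij \<rho> \<Longrightarrow> rename \<rho> (Poly_Mapping.single v c) = Poly_Mapping.single (\<rho> v) c"
  using map_key_single[of "inv \<rho>" "\<rho> v" c] by (simp add: rename_def bij_imp_bij_inv bij_is_inj)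

lemma rename_plus: "bij \<rho> \<Longrightarrow> rename \<rho> (a + b) = rename \<rho> a + rename \<rho> b"
  by (simp add: rename_def map_key_plus bij_imp_bij_inv bij_is_inj)

lemma rename_minus:
  assumes "bij \<rho>" shows "rename \<rho> (a - b) = rename \<rho> a - rename \<rho> b"
proof -
  have "rename \<rho> (a - b) + rename \<rho> b = rename \<rho> a" using assms rename_plus[of \<rho> "a - b" b] by simp
  thus ?thesis by (simp add: eq_diff_eq)
qed

lemma rename_inj: "bij \<rho> \<Longrightarrow> rename \<rho> a = rename \<rho> b \<longleftrightarrow> a = b"
  by (metis lookup_rename poly_mapping_eqI)

lemma rename_0 [simp]: "bij \<rho> \<Longrightarrow> rename \<rho> 0 = 0"
  using rename_minus[of \<rho> 0 0] by simp

lemma rename_eq_0_iff: "bij \<rho> \<Longrightarrow> rename \<rho> a = 0 \<longleftrightarrow> a = 0"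
  using rename_inj[of \<rho> a 0] by simp

lemma inj_rename: "bij \<rho> \<Longrightarrow> inj (rename \<rho>)"
  by (auto simp: inj_def rename_inj)

lemma renaming_vars: "renaming m r \<rho> \<Longrightarrow> \<rho> ` vars m r = vars m r"
  by (simp add: renaming_def vars_def image_Un)

lemma renaming_bij: "renaming m r \<rho> \<Longrightarrow> bij \<rho>"
  by (simp add: renaming_def)

lemma renaming_inv: "renaming m r \<rho> \<Longrightarrow> renaming m r (inv \<rho>)"
  unfolding renaming_def
  by (metis bij_betw_def bij_imp_bij_inv bij_is_inj inv_f_f image_inv_f_f)

lemma continuous_on_rename: "continuous_on S (\<lambda>p :: point. (p \<circ> \<rho>) v)"
  unfolding o_def by (rule continuous_on_coord)

lemma generic_rename:
  assumes "bij \<rho>" "generic D P" "\<And>p. p \<circ> \<rho> \<in> D \<longleftrightarrow> p \<in> D'"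
  shows "generic D' (\<lambda>p. P (p \<circ> \<rho>))"
proof -
  obtain U where U: "open U" "U \<subseteq> D" "D \<subseteq> closure U" "\<And>z. z \<in> U \<Longrightarrow> P z"
    using assms(2) unfolding generic_def by blast
  define V where "V = {p. p \<circ> \<rho> \<in> U}"
  have "open (UNIV \<inter> (\<lambda>p. p \<circ> \<rho>) -` U)"
    by (intro open_preimage_contains continuous_on_rename U) auto
  hence "open V" by (simp add: V_def vimage_def)
  moreover have "V \<subseteq> D'" using U(2) assms(3) by (auto simp: V_def)
  moreover have "D' \<subseteq> closure V"
  proof
    fix p assume p: "p \<in> D'"
    show "p \<in> closure V" unfolding closure_iff_nhds_not_empty
    proof (intro allI impI)
      fix A T assume T: "T \<subseteq> A" "open T" "p \<in> T"
      have inv: "(q \<circ> \<rho>) \<circ> inv \<rho> = q" "(q \<circ> inv \<rho>) \<circ> \<rho> = q" for q :: point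
        using assms(1) by (auto simp: fun_eq_iff bij_is_surj bij_is_inj surj_f_inv_f)
      have "open (UNIV \<inter> (\<lambda>p. p \<circ> inv \<rho>) -` T)"
        by (intro open_preimage_contains continuous_on_rename T) auto
      moreover have "p \<circ> \<rho> \<in> UNIV \<inter> (\<lambda>p. p \<circ> inv \<rho>) -` T" using T inv by simp
      moreover have "p \<circ> \<rho> \<in> closure U" using p assms(3) U(3) by blast
      ultimately obtain q where q: "q \<in> U" "q \<circ> inv \<rho> \<in> T" unfolding closure_iff_nhds_not_empty by blast
      hence "q \<circ> inv \<rho> \<in> V" using inv by (simp add: V_def)
      thus "V \<inter> A \<noteq> {}" using q T by blast
    qed
  qed
  ultimately show ?thesis using U(4) unfolding generic_def by (intro exI[of _ V]) (auto simp: V_def)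
qed

lemma dom_add_rename: "renaming m r \<rho> \<Longrightarrow> p \<circ> \<rho> \<in> dom_add \<longleftrightarrow> p \<in> dom_add"
  by (simp add: dom_add_def renaming_def)

lemma dom_mult_rename:
  assumes "renaming m r \<rho>" shows "p \<circ> \<rho> \<in> dom_mult m r \<longleftrightarrow> p \<in> dom_mult m r"
proof -
  have "(\<forall>v\<in>vars m r. p (\<rho> v) \<noteq> 0) \<longleftrightarrow> (\<forall>v\<in>\<rho> ` vars m r. p v \<noteq> 0)" by simp
  thus ?thesis using assms renaming_vars[OF assms] by (simp add: dom_mult_def renaming_def)
qed

lemma expo_rename:
  assumes "renaming m r \<rho>" shows "expo z \<circ> \<rho> = expo (z \<circ> \<rho>)"
proof
  fix v
  have "\<rho> v = Tau \<longleftrightarrow> v = Tau" using assms by (metis renaming_def bij_is_inj injD)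
  thus "(expo z \<circ> \<rho>) v = expo (z \<circ> \<rho>) v" using assms by (simp add: expo_def renaming_def)
qed

lemma gen_eq_rename_mult:
  "renaming m r \<rho> \<Longrightarrow> mer_eq m r f g \<Longrightarrow> mer_eq m r (\<lambda>p. f (p \<circ> \<rho>)) (\<lambda>p. g (p \<circ> \<rho>))"
  unfolding gen_eq_generic
  by (rule generic_rename[of \<rho> "dom_mult m r" "\<lambda>p. f p = g p"]) (auto simp: dom_mult_rename renaming_bij)

lemma gen_eq_rename_add:
  "renaming m r \<rho> \<Longrightarrow> gen_eq dom_add f g \<Longrightarrow> gen_eq dom_add (\<lambda>p. f (p \<circ> \<rho>)) (\<lambda>p. g (p \<circ> \<rho>))"
  unfolding gen_eq_generic
  by (rule generic_rename[of \<rho> "dom_add" "\<lambda>p. f p = g p"]) (auto simp: dom_add_rename renaming_bij)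

lemma has_type_add_rename:
  assumes \<rho>: "renaming m r \<rho>" and "has_type_add m r f Q"
  shows "has_type_add m r (\<lambda>z. f (z \<circ> \<rho>)) (\<lambda>z. Q (z \<circ> \<rho>))"
proof -
  obtain S c where S: "finite S" "S \<subseteq> theta_monomials m r"
    "\<forall>e\<in>S. theta_mono_type e = Q \<and> c e holomorphic_on {\<tau>. Im \<tau> > 0}"
    "gen_eq dom_add f (\<lambda>z. \<Sum>e\<in>S. c e (z Tau) * theta_mono_value e z)"
    using assms(2) unfolding has_type_add_def by blast
  note bij = renaming_bij[OF \<rho>]
  have bij': "bij (rename \<rho>)"
  proof (rule bijI)
    show "surj (rename \<rho>)"
    proof (rule surjI)
      fix l show "rename \<rho> (rename (inv \<rho>) l) = l"
      proof (rule poly_mapping_eqI)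
        fix v
        obtain w where v: "v = \<rho> w" using bij by (metis bij_pointE)
        have "Poly_Mapping.lookup (rename (inv \<rho>) l) w = Poly_Mapping.lookup l v"
          using lookup_rename[OF bij_imp_bij_inv[OF bij], of l v] v bij by (simp add: bij_is_inj)
        thus "Poly_Mapping.lookup (rename \<rho> (rename (inv \<rho>) l)) v = Poly_Mapping.lookup l v"
          using bij v by (simp add: lookup_rename)
      qed
    qed
  qed (rule inj_rename[OF bij])
  \<comment> \<open>The induced renaming of theta monomials. Their keys are linear forms, which is
    why \<open>rename \<rho>\<close> has to be a bijection of all monomials.\<close>
  define R where "R e = Poly_Mapping.map_key (inv (rename \<rho>)) e" for e :: theta_monomial
  have iR: "inj (inv (rename \<rho>))" using bij' by (simp add: bij_imp_bij_inv bij_is_inj)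
  have keysR: "Poly_Mapping.keys (R e) = rename \<rho> ` Poly_Mapping.keys e" for e
    using bij' by (simp add: R_def keys_map_key iR bij_vimage_eq_inv_image bij_imp_bij_inv inv_inv_eq)
  have lookR: "Poly_Mapping.lookup (R e) (rename \<rho> l) = Poly_Mapping.lookup e l" for e l
    using bij' by (simp add: R_def map_key.rep_eq iR bij_is_inj)
  have inj: "inj_on (rename \<rho>) A" for A using inj_rename[OF bij] by (rule inj_on_subset) simp
  have val: "theta_mono_value (R e) z = theta_mono_value e (z \<circ> \<rho>)" for e z
    using \<rho> unfolding theta_mono_value_def keysR
    by (subst prod.reindex[OF inj]) (auto simp: lookR lin_rename[OF bij] renaming_def)
  have ty: "theta_mono_type (R e) z = theta_mono_type e (z \<circ> \<rho>)" for e z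
    unfolding theta_mono_type_def keysR
    by (subst sum.reindex[OF inj]) (auto simp: lookR lin_rename[OF bij])
  show ?thesis
  proof (rule has_type_addI[of S R _ _ _ c])
    show "gen_eq dom_add (\<lambda>z. f (z \<circ> \<rho>)) (\<lambda>z. \<Sum>i\<in>S. c i (z Tau) * theta_mono_value (R i) z)"
      using gen_eq_rename_add[OF \<rho> S(4)] \<rho> by (simp add: val renaming_def)
  next
    fix e assume e: "e \<in> S"
    have "l \<noteq> 0 \<and> Poly_Mapping.keys l \<subseteq> vars m r" if "l \<in> Poly_Mapping.keys e" for l
      using e S(2) that by (auto simp: theta_monomials_def)
    hence "rename \<rho> l \<noteq> 0 \<and> Poly_Mapping.keys (rename \<rho> l) \<subseteq> vars m r" if "l \<in> Poly_Mapping.keys e" for l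
      using renaming_vars[OF \<rho>] that unfolding keys_rename[OF bij] rename_eq_0_iff[OF bij] by blast
    thus "R e \<in> theta_monomials m r" by (auto simp: theta_monomials_def keysR)
    show "theta_mono_type (R e) = (\<lambda>z. Q (z \<circ> \<rho>))" using e S(3) by (auto simp: ty)
  qed (use S in auto)
qed

section \<open>Independence of functions of different types\<close>

lemma tendsto_exp_quadratic:
  fixes a b :: complex
  assumes "Re a < 0"
  shows "(\<lambda>k::nat. exp (of_nat k ^ 2 * a + of_nat k * b)) \<longlonglongrightarrow> 0"
proof (rule tendsto_norm_zero_cancel)
  have "norm (exp (of_nat k ^ 2 * a + of_nat k * b)) = exp (real k ^ 2 * Re a + real k * Re b)" for k
  proof -
    have "Re (of_nat k ^ 2 * a) = real k ^ 2 * Re a" by (metis Re_complex_of_real of_real_of_nat_eq of_real_power scaleR_complex.simps(1) scaleR_conv_of_real real_scaleR_def)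
    thus ?thesis by simp
  qed
  moreover have "(\<lambda>k::nat. exp (real k ^ 2 * Re a + real k * Re b)) \<longlonglongrightarrow> 0"
    using assms by real_asymp
  ultimately show "(\<lambda>k::nat. norm (exp (of_nat k ^ 2 * a + of_nat k * b))) \<longlonglongrightarrow> 0" by simp
qed

text \<open>The term with the largest \<open>Re (a i)\<close> dominates as \<open>k\<close> grows.\<close>

lemma exp_quadratic_independent:
  fixes a b \<phi> :: "'i \<Rightarrow> complex"
  assumes fin: "finite I" and inj: "inj_on (\<lambda>i. Re (a i)) I"
    and sum0: "\<And>k::nat. (\<Sum>i\<in>I. \<phi> i * exp (of_nat k ^ 2 * a i + of_nat k * b i)) = 0"
    and i: "i \<in> I"
  shows "\<phi> i = 0"
proof (rule ccontr)
  assume "\<phi> i \<noteq> 0"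
  define J where "J = {i \<in> I. \<phi> i \<noteq> 0}"
  have J: "finite J" "J \<noteq> {}" using fin i \<open>\<phi> i \<noteq> 0\<close> by (auto simp: J_def)
  have "Max ((\<lambda>i. Re (a i)) ` J) \<in> (\<lambda>i. Re (a i)) ` J" using J by (intro Max_in) auto
  then obtain i0 where "i0 \<in> J" "Re (a i0) = Max ((\<lambda>i. Re (a i)) ` J)" by auto
  hence i0: "i0 \<in> J" "\<And>j. j \<in> J \<Longrightarrow> Re (a j) \<le> Re (a i0)" using J by simp_all
  \<comment> \<open>Division by the dominating exponential; every remaining term then tends to
    0.\<close>
  have eq: "\<phi> i0 = - (\<Sum>j\<in>J - {i0}. \<phi> j * exp (of_nat k ^ 2 * (a j - a i0) + of_nat k * (b j - b i0)))" for k :: nat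
  proof -
    let ?e = "exp (- (of_nat k ^ 2 * a i0 + of_nat k * b i0))"
    have "0 = (\<Sum>j\<in>I. \<phi> j * exp (of_nat k ^ 2 * a j + of_nat k * b j)) * ?e" by (simp add: sum0)
    also have "(\<Sum>j\<in>I. \<phi> j * exp (of_nat k ^ 2 * a j + of_nat k * b j)) = (\<Sum>j\<in>J. \<phi> j * exp (of_nat k ^ 2 * a j + of_nat k * b j))"
      using fin by (intro sum.mono_neutral_right) (auto simp: J_def)
    also have "\<dots> * ?e = (\<Sum>j\<in>J. \<phi> j * exp (of_nat k ^ 2 * (a j - a i0) + of_nat k * (b j - b i0)))"
      unfolding sum_distrib_right mult.assoc exp_add[symmetric] by (simp add: algebra_simps)
    also have "\<dots> = \<phi> i0 + (\<Sum>j\<in>J - {i0}. \<phi> j * exp (of_nat k ^ 2 * (a j - a i0) + of_nat k * (b j - b i0)))"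
      using J i0(1) by (subst sum.remove[of _ i0]) auto
    finally show ?thesis by (simp add: eq_neg_iff_add_eq_0)
  qed
  have "(\<lambda>k. - (\<Sum>j\<in>J - {i0}. \<phi> j * exp (of_nat k ^ 2 * (a j - a i0) + of_nat k * (b j - b i0)))) \<longlonglongrightarrow> - (\<Sum>j\<in>J - {i0}. \<phi> j * 0)"
  proof (intro tendsto_intros tendsto_exp_quadratic)
    fix j assume j: "j \<in> J - {i0}"
    hence "Re (a j) \<noteq> Re (a i0)" using inj i0 by (auto simp: J_def inj_on_def)
    thus "Re (a j - a i0) < 0" using i0(2)[of j] j by auto
  qed
  hence "(\<lambda>k::nat. \<phi> i0) \<longlonglongrightarrow> 0" unfolding eq[symmetric] by simp
  hence "\<phi> i0 = 0" using LIMSEQ_const_iff by blast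
  thus False using i0(1) by (simp add: J_def)
qed

section \<open>Integer vectors separating finitely many quadratic forms\<close>

text \<open>What counts is that the restriction to every line is a polynomial of degree at most two
  with leading coefficient \<open>Q w\<close>; \<open>B\<close> is the polar form.\<close>

definition quadratic :: "nat \<Rightarrow> nat \<Rightarrow> func \<Rightarrow> bool" where
  "quadratic m r Q \<longleftrightarrow> (\<exists>B. \<forall>z w t. Q (\<lambda>v. z v + t * w v) = Q z + t * B z w + t ^ 2 * Q w) \<and>
     (\<forall>z z'. (\<forall>v\<in>vars m r. z v = z' v) \<longrightarrow> Q z = Q z')"

lemma quadratic_theta_mono_type:
  assumes "e \<in> theta_monomials m r"
  shows "quadratic m r (theta_mono_type e)"
  unfolding quadratic_def
proof (intro conjI exI allI impI)
  let ?c = "\<lambda>l. of_int (Poly_Mapping.lookup e l) :: complex"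
  fix z w :: point and t
  show "theta_mono_type e (\<lambda>v. z v + t * w v) = theta_mono_type e z +
      t * (\<lambda>(z :: point) (w :: point). \<Sum>l\<in>Poly_Mapping.keys e. ?c l * (lin l z * lin l w)) z w + t ^ 2 * theta_mono_type e w"
    unfolding theta_mono_type_def lin_add_arg lin_scale_arg
    by (simp add: sum_distrib_left sum.distrib[symmetric] power2_eq_square field_simps)
next
  fix z z' :: point assume "\<forall>v\<in>vars m r. z v = z' v"
  hence "lin l z = lin l z'" if "l \<in> Poly_Mapping.keys e" for l
    using assms that by (intro lin_cong) (auto simp: theta_monomials_def)
  thus "theta_mono_type e z = theta_mono_type e z'" by (simp add: theta_mono_type_def)
qed

lemma quadratic_diff:
  assumes "quadratic m r P" "quadratic m r Q"
  shows "quadratic m r (\<lambda>z. P z - Q z)"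
proof -
  obtain B where B: "\<And>z w t. P (\<lambda>v. z v + t * w v) = P z + t * B z w + t ^ 2 * P w"
    using assms(1) unfolding quadratic_def by blast
  obtain C where C: "\<And>z w t. Q (\<lambda>v. z v + t * w v) = Q z + t * C z w + t ^ 2 * Q w"
    using assms(2) unfolding quadratic_def by blast
  have "P z - Q z = P z' - Q z'" if "\<forall>v\<in>vars m r. z v = z' v" for z z'
    using assms that unfolding quadratic_def by metis
  moreover have "P (\<lambda>v. z v + t * w v) - Q (\<lambda>v. z v + t * w v) = P z - Q z + t * (B z w - C z w) + t ^ 2 * (P w - Q w)" for z w t
    unfolding B C by (simp add: algebra_simps)
  ultimately show ?thesis unfolding quadratic_def by (intro conjI exI[of _ "\<lambda>z w. B z w - C z w"]) blast+
qed

text \<open>A quadratic form vanishing at all integer points is zero: coordinates are freed from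
  integrality one at a time, because a quadratic polynomial vanishing at 0, 1 and -1 is
  zero.\<close>

lemma quadratic_int_point:
  assumes "quadratic m r D" "D z0 \<noteq> 0"
  shows "\<exists>n :: var \<Rightarrow> int. D (\<lambda>v. of_int (n v)) \<noteq> 0"
proof (rule ccontr)
  assume "\<not> ?thesis"
  hence zero: "D (\<lambda>v. of_int (n v)) = 0" for n :: "var \<Rightarrow> int" by blast
  obtain B where B: "\<And>z w t. D (\<lambda>v. z v + t * w v) = D z + t * B z w + t ^ 2 * D w"
    using assms(1) unfolding quadratic_def by blast
  have "D z = 0" if "finite A" "\<And>v. v \<notin> A \<Longrightarrow> z v \<in> \<int>" for A z
    using that
  proof (induction A arbitrary: z)
    case empty
    hence "\<forall>v. \<exists>n. z v = of_int n" by (auto elim!: Ints_cases)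
    then obtain n where "\<And>v. z v = of_int (n v)" by metis
    hence "z = (\<lambda>v. of_int (n v))" by auto
    thus ?case using zero by simp
  next
    case (insert a A)
    define y where "y = z(a := 0)"
    define w :: point where "w = (\<lambda>v. if v = a then 1 else 0)"
    have yt: "(\<lambda>v. y v + t * w v) = z(a := t)" for t by (auto simp: y_def w_def)
    have at: "D (z(a := of_int n)) = 0" for n
      using insert.prems by (intro insert.IH) auto
    have eqs: "D y + of_int n * B y w + of_int n ^ 2 * D w = 0" for n
      using at[of n] B[of y "of_int n" w] unfolding yt by simp
    from eqs[of 0] eqs[of 1] eqs[of "-1"] have 0: "D y = 0" "B y w + D w = 0" "- B y w + D w = 0" by simp_all
    hence "2 * D w = 0" by (simp add: algebra_simps eq_neg_iff_add_eq_0)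
    hence "D w = 0" "B y w = 0" using 0 by auto
    moreover have "z = (\<lambda>v. y v + z a * w v)" unfolding yt by simp
    ultimately show ?case using B[of y "z a" w] 0(1) by simp
  qed
  from this[of "vars m r" "\<lambda>v. if v \<in> vars m r then z0 v else 0"]
  have "D (\<lambda>v. if v \<in> vars m r then z0 v else 0) = 0" by simp
  moreover have "D (\<lambda>v. if v \<in> vars m r then z0 v else 0) = D z0"
    using assms(1) unfolding quadratic_def by (simp del: fun_upd_apply)
  ultimately show False using assms(2) by simp
qed

text \<open>Start at a point \<open>k\<close> good for the new form and move in the direction of a
  point \<open>n\<close> good for the old ones. Along this line every form is a nonzero polynomial,
  by its constant term for the new form and by its leading coefficient for the others. So all but
  finitely many integers \<open>t\<close> work.\<close>

lemma quadratic_common_int_point: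
  assumes "finite \<D>" "\<And>D. D \<in> \<D> \<Longrightarrow> quadratic m r D" "\<And>D. D \<in> \<D> \<Longrightarrow> \<exists>z. D z \<noteq> 0"
  shows "\<exists>n :: var \<Rightarrow> int. \<forall>D\<in>\<D>. D (\<lambda>v. of_int (n v)) \<noteq> 0"
  using assms
proof (induction \<D>)
  case (insert D \<D>)
  have "\<exists>n :: var \<Rightarrow> int. \<forall>D\<in>\<D>. D (\<lambda>v. of_int (n v)) \<noteq> 0"
    by (rule insert.IH) (use insert.prems in auto)
  then obtain n :: "var \<Rightarrow> int" where n: "\<forall>D\<in>\<D>. D (\<lambda>v. of_int (n v)) \<noteq> 0" by blast
  obtain z0 where "D z0 \<noteq> 0" using insert.prems(2)[of D] by auto
  moreover have "quadratic m r D" using insert.prems(1) by simp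
  ultimately have "\<exists>n :: var \<Rightarrow> int. D (\<lambda>v. of_int (n v)) \<noteq> 0" using quadratic_int_point by blast
  then obtain k :: "var \<Rightarrow> int" where k: "D (\<lambda>v. of_int (k v)) \<noteq> 0" by auto
  define p where "p E = (SOME p. p \<noteq> 0 \<and> (\<forall>t. poly p t = E (\<lambda>v. of_int (k v) + t * of_int (n v))))" for E :: func
  have p: "p E \<noteq> 0 \<and> (\<forall>t. poly (p E) t = E (\<lambda>v. of_int (k v) + t * of_int (n v)))" if E: "E \<in> insert D \<D>" for E
  proof -
    obtain B where B: "\<And>z w t. E (\<lambda>v. z v + t * w v) = E z + t * B z w + t ^ 2 * E w"
      using insert.prems(1)[OF E] unfolding quadratic_def by blast
    let ?p = "[:E (\<lambda>v. of_int (k v)), B (\<lambda>v. of_int (k v)) (\<lambda>v. of_int (n v)), E (\<lambda>v. of_int (n v)):]"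
    have "?p \<noteq> 0" using E n k by auto
    moreover have "\<forall>t. poly ?p t = E (\<lambda>v. of_int (k v) + t * of_int (n v))"
      unfolding B by (simp add: power2_eq_square algebra_simps)
    ultimately have "?p \<noteq> 0 \<and> (\<forall>t. poly ?p t = E (\<lambda>v. of_int (k v) + t * of_int (n v)))" by (rule conjI)
    thus ?thesis unfolding p_def by (rule someI)
  qed
  have "finite (\<Union>E\<in>insert D \<D>. {t. poly (p E) t = 0})"
    using insert.hyps p by (intro finite_UN_I poly_roots_finite) auto
  moreover have "infinite (range (of_int :: int \<Rightarrow> complex))"
    using infinite_UNIV_int finite_imageD[of "of_int :: int \<Rightarrow> complex" UNIV] by (auto simp: inj_on_def)
  ultimately obtain t :: int where t: "of_int t \<notin> (\<Union>E\<in>insert D \<D>. {t. poly (p E) t = 0})"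
    by (meson finite_subset image_subsetI)
  have "E (\<lambda>v. of_int (k v + t * n v)) \<noteq> 0" if "E \<in> insert D \<D>" for E
  proof -
    have "poly (p E) (of_int t) \<noteq> 0" using t that by blast
    thus ?thesis using p[OF that] by simp
  qed
  thus ?case by (intro exI[of _ "\<lambda>v. k v + t * n v"]) blast
qed auto

text \<open>Growth under translations sees only the real part of an exponent. As types are real at
  integer points, distinct values of types there lead to distinct rates of growth.\<close>

lemma theta_mono_type_int_real:
  "Im (theta_mono_type e (\<lambda>v. of_int (n v))) = 0"
proof -
  have "lin l (\<lambda>v. of_int (n v)) = of_int (\<Sum>v\<in>Poly_Mapping.keys l. Poly_Mapping.lookup l v * n v)" for l
    by (simp add: lin_def)
  hence "theta_mono_type e (\<lambda>v. of_int (n v)) = of_real (\<Sum>l\<in>Poly_Mapping.keys e. of_int (Poly_Mapping.lookup e l) *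
      ((of_int (\<Sum>v\<in>Poly_Mapping.keys l. Poly_Mapping.lookup l v * n v))\<^sup>2 / 2))"
    by (simp add: theta_mono_type_def)
  thus ?thesis by (simp only: Im_complex_of_real)
qed

section \<open>Translations by the period lattice\<close>

text \<open>Even multiples of \<open>\<tau>\<close> are used so that the signs in the
  quasi-periodicity of theta disappear.\<close>

definition lattice_shift :: "(var \<Rightarrow> int) \<Rightarrow> nat \<Rightarrow> point \<Rightarrow> point" where
  "lattice_shift n k z = (\<lambda>v. z v + of_nat (2 * k) * z Tau * of_int (n v))"

lemma lin_lattice_shift:
  "lin l (lattice_shift n k z) = lin l z + of_int (int (2 * k) * (\<Sum>v\<in>Poly_Mapping.keys l. Poly_Mapping.lookup l v * n v)) * z Tau"
  unfolding lattice_shift_def lin_add_arg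
  by (simp add: lin_def sum_distrib_left sum_distrib_right mult_ac)

lemma theta_lattice_shift:
  assumes "Im (z Tau) > 0"
  shows "theta (z Tau) (lin l (lattice_shift n k z)) =
    exp (- (4 * of_real pi * \<i> * (of_nat k ^ 2 * z Tau * (lin l (\<lambda>v. of_int (n v)))\<^sup>2 + of_nat k * lin l (\<lambda>v. of_int (n v)) * lin l z))) * theta (z Tau) (lin l z)"
proof -
  define N where "N = (\<Sum>v\<in>Poly_Mapping.keys l. Poly_Mapping.lookup l v * n v)"
  have N: "lin l (\<lambda>v. of_int (n v)) = of_int N" by (simp add: lin_def N_def)
  have "(-1 :: complex) powi (int (2 * k) * N) = 1"
    by (simp add: power_int_mult)
  thus ?thesis
    unfolding lin_lattice_shift N_def[symmetric] theta_plus_int_tau[OF assms] N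
    by (simp add: power2_eq_square algebra_simps)
qed

text \<open>The exponents contributed by the single theta functions add up to the value of the type
  at \<open>n\<close> and to its polar form at \<open>n\<close> and \<open>z\<close>. Hence the
  factor depends on the type alone, not on the monomial.\<close>

lemma theta_mono_value_lattice_shift:
  assumes "Im (z Tau) > 0" "n Tau = 0"
  shows "theta_mono_value e (lattice_shift n k z) = theta_mono_value e z *
    exp (of_nat k ^ 2 * (- (8 * of_real pi * \<i> * z Tau * theta_mono_type e (\<lambda>v. of_int (n v)))) +
         of_nat k * (- (4 * of_real pi * \<i> * (theta_mono_type e (\<lambda>v. z v + of_int (n v)) - theta_mono_type e z - theta_mono_type e (\<lambda>v. of_int (n v))))))"
proof -
  let ?n = "\<lambda>v. of_int (n v) :: complex" and ?c = "\<lambda>l. of_int (Poly_Mapping.lookup e l) :: complex"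
  have T: "lattice_shift n k z Tau = z Tau" using assms by (simp add: lattice_shift_def)
  have B: "theta_mono_type e (\<lambda>v. z v + ?n v) - theta_mono_type e z - theta_mono_type e ?n =
      (\<Sum>l\<in>Poly_Mapping.keys e. ?c l * (lin l ?n * lin l z))"
    unfolding theta_mono_type_def lin_add_arg sum_subtractf[symmetric]
    by (intro sum.cong) (auto simp: power2_eq_square field_simps)
  have "theta_mono_value e (lattice_shift n k z) =
     (\<Prod>l\<in>Poly_Mapping.keys e. exp (?c l * (- (4 * of_real pi * \<i> * (of_nat k ^ 2 * z Tau * (lin l ?n)\<^sup>2 + of_nat k * lin l ?n * lin l z))))) * theta_mono_value e z"
    unfolding theta_mono_value_def T theta_lattice_shift[of z, OF assms(1)] power_int_mult_distrib exp_power_int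
    by (simp add: prod.distrib)
  also have "(\<Prod>l\<in>Poly_Mapping.keys e. exp (?c l * (- (4 * of_real pi * \<i> * (of_nat k ^ 2 * z Tau * (lin l ?n)\<^sup>2 + of_nat k * lin l ?n * lin l z))))) =
     exp (of_nat k ^ 2 * (- (8 * of_real pi * \<i> * z Tau * theta_mono_type e ?n)) + of_nat k * (- (4 * of_real pi * \<i> * (\<Sum>l\<in>Poly_Mapping.keys e. ?c l * (lin l ?n * lin l z)))))"
    unfolding exp_sum[symmetric, OF finite_keys] theta_mono_type_def
    by (rule arg_cong[of _ _ exp]) (simp add: sum_distrib_left sum_negf[symmetric] sum.distrib[symmetric] algebra_simps)
  finally show ?thesis unfolding B by (simp add: mult.commute)
qed

theorem types_independent:
  assumes S: "finite S" and type: "\<And>Q. Q \<in> S \<Longrightarrow> has_type_add m r (g Q) Q"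
    and sum0: "gen_eq dom_add (\<lambda>z. \<Sum>Q\<in>S. g Q z) (\<lambda>_. 0)" and Q: "Q \<in> S"
  shows "gen_eq dom_add (g Q) (\<lambda>_. 0)"
proof -
  define P where "P Q M c \<longleftrightarrow> finite M \<and> M \<subseteq> theta_monomials m r \<and>
     (\<forall>e\<in>M. theta_mono_type e = Q \<and> c e holomorphic_on {\<tau>. Im \<tau> > 0}) \<and>
     gen_eq dom_add (g Q) (\<lambda>z. \<Sum>e\<in>M. c e (z Tau) * theta_mono_value e z)" for Q M c
  have "\<forall>Q\<in>S. \<exists>M c. P Q M c"
    using type unfolding has_type_add_def P_def by blast
  then obtain M c where Pc: "\<And>Q. Q \<in> S \<Longrightarrow> P Q (M Q) (c Q)" by metis
  have M: "finite (M Q)" "M Q \<subseteq> theta_monomials m r"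
    "\<And>e. e \<in> M Q \<Longrightarrow> theta_mono_type e = Q"
    "\<And>e. e \<in> M Q \<Longrightarrow> c Q e holomorphic_on {\<tau>. Im \<tau> > 0}"
    "gen_eq dom_add (g Q) (\<lambda>z. \<Sum>e\<in>M Q. c Q e (z Tau) * theta_mono_value e z)"
    if "Q \<in> S" for Q using Pc[OF that] unfolding P_def by blast+
  define \<Phi> where "\<Phi> Q z = (\<Sum>e\<in>M Q. c Q e (z Tau) * theta_mono_value e z)" for Q z
  define L where "L = (\<Union>Q\<in>S. \<Union>e\<in>M Q. Poly_Mapping.keys e)"
  have finL: "finite L" unfolding L_def using S M(1) by auto
  have L: "l \<noteq> 0 \<and> Poly_Mapping.keys l \<subseteq> vars m r" if "l \<in> L" for l
    using that M(2) unfolding L_def theta_monomials_def by blast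
  \<comment> \<open>Unlike an unspecified dense open set, this one is stable under the lattice
    translations, because theta changes only by nonvanishing factors.\<close>
  define V where "V = {z \<in> dom_add. \<forall>l\<in>L. theta (z Tau) (lin l z) \<noteq> 0}"
  have "V = dom_add \<inter> (\<Inter>l\<in>L. dom_add \<inter> (\<lambda>z. theta (z Tau) (lin l z)) -` (- {0}))"
    by (auto simp: V_def)
  also have "open \<dots>"
    using finL by (intro open_Int open_INT ballI continuous_open_preimage open_dom_add continuous_intros)
      (auto simp: dom_add_def open_Compl)
  finally have "open V" .
  have VD: "V \<subseteq> dom_add" by (auto simp: V_def)
  have cont: "continuous_on V (\<Phi> Q)" if "Q \<in> S" for Q
    unfolding \<Phi>_def theta_mono_value_def
  proof (intro continuous_on_sum continuous_on_mult continuous_on_prod)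
    fix e assume e: "e \<in> M Q"
    have "continuous_on {\<tau>. Im \<tau> > 0} (c Q e)"
      using M(4)[OF that e] by (rule holomorphic_on_imp_continuous_on)
    hence "continuous_on V (c Q e \<circ> (\<lambda>z. z Tau))"
      by (intro continuous_on_compose continuous_intros) (auto simp: V_def dom_add_def elim!: continuous_on_subset)
    thus "continuous_on V (\<lambda>z. c Q e (z Tau))" by (simp add: o_def)
  next
    fix e l assume "e \<in> M Q" "l \<in> Poly_Mapping.keys e"
    hence "l \<in> L" using that by (auto simp: L_def)
    thus "continuous_on V (\<lambda>z. theta (z Tau) (lin l z) powi Poly_Mapping.lookup e l)"
      by (intro continuous_on_power_int continuous_intros) (auto simp: V_def dom_add_def)
  qed
  have "gen_eq dom_add (\<lambda>z. \<Sum>Q\<in>S. \<Phi> Q z) (\<lambda>z. \<Sum>Q\<in>S. g Q z)"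
    unfolding \<Phi>_def using S M(5) gen_eq_sym by (intro gen_eq_sum) auto
  from gen_eq_trans[OF this sum0] have "generic dom_add (\<lambda>z. (\<Sum>Q\<in>S. \<Phi> Q z) = 0)"
    unfolding gen_eq_generic .
  hence sumV: "(\<Sum>Q\<in>S. \<Phi> Q z) = 0" if "z \<in> V" for z
    using \<open>open V\<close> VD _ _ that by (rule generic_eq_continuous) (auto intro!: continuous_intros cont)
  \<comment> \<open>A type with an empty representation belongs to the zero function and may be any
    function at all, so it is set aside.\<close>
  define S' where "S' = {Q \<in> S. M Q \<noteq> {}}"
  have quad: "quadratic m r Q" if "Q \<in> S'" for Q
  proof -
    obtain e where "e \<in> M Q" using \<open>Q \<in> S'\<close> by (auto simp: S'_def)
    thus ?thesis using that M(2,3)[of Q] quadratic_theta_mono_type[of e m r] by (auto simp: S'_def)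
  qed
  define \<D> where "\<D> = (\<lambda>(P, Q) z. P z - Q z) ` {(P, Q) \<in> S' \<times> S'. P \<noteq> Q}"
  have "finite \<D>" unfolding \<D>_def
    by (rule finite_imageI, rule finite_subset[of _ "S' \<times> S'"]) (use S in \<open>auto simp: S'_def\<close>)
  moreover have "quadratic m r D" if "D \<in> \<D>" for D
    using that quad by (auto simp: \<D>_def intro!: quadratic_diff)
  moreover have "\<exists>z. D z \<noteq> 0" if "D \<in> \<D>" for D
    using that by (auto simp: \<D>_def fun_eq_iff)
  ultimately obtain n0 :: "var \<Rightarrow> int" where n0: "\<And>D. D \<in> \<D> \<Longrightarrow> D (\<lambda>v. of_int (n0 v)) \<noteq> 0"
    using quadratic_common_int_point[of \<D> m r] by blast
  \<comment> \<open>The translation must not move the modulus itself.\<close>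
  define n where "n = n0(Tau := 0)"
  have dist: "P (\<lambda>v. of_int (n v)) \<noteq> Q (\<lambda>v. of_int (n v))" if "P \<in> S'" "Q \<in> S'" "P \<noteq> Q" for P Q
  proof -
    have "R (\<lambda>v. of_int (n v)) = R (\<lambda>v. of_int (n0 v))" if "quadratic m r R" for R
    proof -
      have "\<forall>v\<in>vars m r. of_int (n v) = (of_int (n0 v) :: complex)" by (auto simp: n_def)
      moreover have "\<forall>z z'. (\<forall>v\<in>vars m r. z v = z' v) \<longrightarrow> R z = R z'"
        using that unfolding quadratic_def by (rule conjunct2)
      ultimately show ?thesis by simp
    qed
    note eq = this[OF quad[OF that(1)]] this[OF quad[OF that(2)]]
    have "(\<lambda>z. P z - Q z) \<in> \<D>" using that unfolding \<D>_def by force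
    from n0[OF this] show ?thesis unfolding eq by simp
  qed
  have zero: "\<Phi> Q z = 0" if z: "z \<in> V" and Q: "Q \<in> S'" for z Q
  proof -
    have \<tau>: "Im (z Tau) > 0" using z by (simp add: V_def dom_add_def)
    have n: "n Tau = 0" by (simp add: n_def)
    define a where "a Q = - (8 * of_real pi * \<i> * z Tau * Q (\<lambda>v. of_int (n v)))" for Q :: func
    define b where "b Q = - (4 * of_real pi * \<i> * (Q (\<lambda>v. z v + of_int (n v)) - Q z - Q (\<lambda>v. of_int (n v))))" for Q :: func
    have T: "lattice_shift n k z Tau = z Tau" for k by (simp add: lattice_shift_def n)
    have sh: "\<Phi> Q (lattice_shift n k z) = \<Phi> Q z * exp (of_nat k ^ 2 * a Q + of_nat k * b Q)" if "Q \<in> S'" for Q k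
      using that M(3)[of Q] unfolding \<Phi>_def T sum_distrib_right S'_def a_def b_def
      by (intro sum.cong) (auto simp: theta_mono_value_lattice_shift[of z n, OF \<tau> n])
    have "lattice_shift n k z \<in> V" for k
      using z \<tau> theta_lattice_shift[of z, OF \<tau>] by (auto simp: V_def dom_add_def T)
    from sumV[OF this] have s: "(\<Sum>Q\<in>S. \<Phi> Q (lattice_shift n k z)) = 0" for k .
    have "(\<Sum>Q\<in>S'. \<Phi> Q z * exp (of_nat k ^ 2 * a Q + of_nat k * b Q)) = 0" for k
    proof -
      have "(\<Sum>Q\<in>S'. \<Phi> Q z * exp (of_nat k ^ 2 * a Q + of_nat k * b Q)) = (\<Sum>Q\<in>S'. \<Phi> Q (lattice_shift n k z))"
        by (simp add: sh)
      also have "\<dots> = (\<Sum>Q\<in>S. \<Phi> Q (lattice_shift n k z))"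
        using S by (intro sum.mono_neutral_left) (auto simp: S'_def \<Phi>_def)
      finally show ?thesis using s by simp
    qed
    moreover have "inj_on (\<lambda>Q. Re (a Q)) S'"
    proof (rule inj_onI)
      fix P Q assume PQ: "P \<in> S'" "Q \<in> S'" "Re (a P) = Re (a Q)"
      have im: "Im (R (\<lambda>v. of_int (n v))) = 0" if "R \<in> S'" for R
      proof -
        obtain e where "e \<in> M R" using \<open>R \<in> S'\<close> by (auto simp: S'_def)
        hence "theta_mono_type e = R" using that M(3) by (auto simp: S'_def)
        thus ?thesis using theta_mono_type_int_real[of e n] by simp
      qed
      have re: "Re (a R) = 8 * pi * Im (z Tau) * Re (R (\<lambda>v. of_int (n v)))" if "R \<in> S'" for R
        using im[OF that] by (simp add: a_def)
      have "Re (P (\<lambda>v. of_int (n v))) = Re (Q (\<lambda>v. of_int (n v)))"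
        using PQ(3) \<tau> unfolding re[OF PQ(1)] re[OF PQ(2)] by simp
      hence "P (\<lambda>v. of_int (n v)) = Q (\<lambda>v. of_int (n v))"
        using im PQ by (simp add: complex_eq_iff)
      thus "P = Q" using dist PQ by blast
    qed
    ultimately show ?thesis
      using exp_quadratic_independent[of S' a "\<lambda>Q. \<Phi> Q z" b Q] S Q by (auto simp: S'_def)
  qed
  have "generic dom_add (\<lambda>z. \<forall>l\<in>L. theta (z Tau) (lin l z) \<noteq> 0)"
  proof (intro generic_ball_finite generic_theta_nonzero finL)
    fix l assume "l \<in> L"
    from L[OF this] show "l \<noteq> 0" "Tau \<notin> Poly_Mapping.keys l" using Tau_notin_vars(1)[of m r] by blast+
  qed auto
  moreover have "generic dom_add (\<lambda>z. g Q z = \<Phi> Q z)"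
    using M(5)[OF Q] unfolding gen_eq_generic \<Phi>_def .
  ultimately have "generic dom_add (\<lambda>z. g Q z = 0)"
  proof (rule generic_mono2)
    fix z assume "z \<in> dom_add" "\<forall>l\<in>L. theta (z Tau) (lin l z) \<noteq> 0" and g: "g Q z = \<Phi> Q z"
    hence "z \<in> V" by (simp add: V_def)
    thus "g Q z = 0" using g zero[of z Q] Q by (cases "M Q = {}") (auto simp: S'_def \<Phi>_def)
  qed
  thus ?thesis unfolding gen_eq_generic .
qed

corollary type_unique:
  assumes "has_type_add m r f P" "has_type_add m r f Q" "\<not> gen_eq dom_add f (\<lambda>_. 0)"
  shows "P = Q"
proof (rule ccontr)
  assume ne: "P \<noteq> Q"
  have "has_type_add m r (\<lambda>z. (-1) * f z) (\<lambda>z. 0 + Q z)"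
    using has_type_add_mult[OF has_type_add_const[of m r "-1"] assms(2)] by simp
  hence Q: "has_type_add m r (\<lambda>z. - f z) Q" by simp
  define g where "g R z = (if R = P then f z else - f z)" for R :: func and z
  have "gen_eq dom_add (g P) (\<lambda>_. 0)"
  proof (rule types_independent[of "{P, Q}" m r g])
    fix R assume "R \<in> {P, Q}" thus "has_type_add m r (g R) R"
      using ne Q assms(1) by (auto simp: g_def[abs_def])
  next
    show "gen_eq dom_add (\<lambda>z. \<Sum>Q\<in>{P, Q}. g Q z) (\<lambda>_. 0)"
      using ne by (simp add: g_def gen_eq_refl)
  qed auto
  thus False using assms(3) by (simp add: g_def[abs_def])
qed

text \<open>The type \<open>R\<close> of the sum is not known to be \<open>P\<close> or
  \<open>Q\<close>, so independence is applied to \<open>f\<close>, \<open>g\<close> and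
  \<open>- (f + g)\<close> together. If \<open>P \<noteq> Q\<close>, then \<open>R\<close> coincides
  with at most one of them, and the summand belonging to the other is forced to vanish.\<close>

lemma type_sum_unique:
  assumes f: "has_type_add m r f P" and g: "has_type_add m r g Q" and fg: "has_type_add m r (\<lambda>z. f z + g z) R"
    and nz: "\<not> gen_eq dom_add f (\<lambda>_. 0)" "\<not> gen_eq dom_add g (\<lambda>_. 0)"
  shows "P = Q"
proof (rule ccontr)
  assume ne: "P \<noteq> Q"
  have neg: "has_type_add m r (\<lambda>z. - h z) T" if "has_type_add m r h T" for h T
    using has_type_add_mult[OF has_type_add_const[of m r "-1"] that] by simp
  \<comment> \<open>Functions whose types happen to coincide are merged by addition.\<close>
  define k where "k T z = (if T = P then f z else 0) + ((if T = Q then g z else 0) + (if T = R then - (f z + g z) else 0))" for T :: func and z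
  have t: "has_type_add m r (k T) T" for T
    unfolding k_def[abs_def] using f g neg[OF fg]
    by (intro has_type_add_plus) (cases "T = P"; cases "T = Q"; cases "T = R"; simp add: has_type_add_0)+
  have s: "gen_eq dom_add (\<lambda>z. \<Sum>T\<in>{P, Q, R}. k T z) (\<lambda>_. 0)"
  proof -
    have "(\<Sum>T\<in>{P, Q, R}. k T z) = 0" for z
      unfolding k_def sum.distrib by (simp add: sum.delta')
    thus ?thesis by (simp add: gen_eq_refl)
  qed
  have "gen_eq dom_add (k P) (\<lambda>_. 0)" "gen_eq dom_add (k Q) (\<lambda>_. 0)"
    by (rule types_independent[of "{P, Q, R}" m r k]; use t s in auto)+
  moreover have "k P = f \<or> k Q = g" using ne by (cases "R = P") (auto simp: k_def[abs_def])
  ultimately show False using nz by auto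
qed

section \<open>The algebra generated by the functions \<open>\<delta>\<close>\<close>

lemma mon_value_expo:
  assumes "Tau \<notin> Poly_Mapping.keys l"
  shows "mon_value l (expo z) = exp (2 * of_real pi * \<i> * lin l z)"
proof -
  have "mon_value l (expo z) = (\<Prod>v\<in>Poly_Mapping.keys l. exp (of_int (Poly_Mapping.lookup l v) * (2 * of_real pi * \<i> * z v)))"
    unfolding mon_value_def
    by (intro prod.cong refl) (use assms in \<open>auto simp: expo_def exp_power_int\<close>)
  also have "\<dots> = exp (2 * of_real pi * \<i> * lin l z)"
    by (simp add: exp_sum[symmetric] lin_def sum_distrib_left mult_ac)
  finally show ?thesis .
qed

lemma deltaf_expo:
  assumes "Tau \<notin> Poly_Mapping.keys l1" "Tau \<notin> Poly_Mapping.keys l2"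
  shows "deltaf l1 l2 (expo z) = F (z Tau) (lin l1 z) (lin l2 z)"
  by (simp add: deltaf_def mon_value_expo assms delta_exp)

lemma mon_value_cong: "(\<And>v. v \<in> Poly_Mapping.keys l \<Longrightarrow> p v = q v) \<Longrightarrow> mon_value l p = mon_value l q"
  by (simp add: mon_value_def)

lemma depends_deltaf:
  assumes "Poly_Mapping.keys l1 \<subseteq> vars m r" "Poly_Mapping.keys l2 \<subseteq> vars m r"
  shows "depends m r (deltaf l1 l2)"
  unfolding depends_def
proof (intro allI impI)
  fix p q :: point assume eq: "\<forall>v\<in>insert Tau (vars m r). p v = q v"
  have "mon_value l1 p = mon_value l1 q" "mon_value l2 p = mon_value l2 q"
    by (rule mon_value_cong; use eq assms in blast)+
  thus "deltaf l1 l2 p = deltaf l1 l2 q" using eq by (simp add: deltaf_def)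
qed

section \<open>Meromorphy of the generators and of sums and products\<close>

lemma several_holomorphic_on_const: "several_holomorphic_on (\<lambda>_. c) W"
  by (simp add: several_holomorphic_on_def)

lemma several_holomorphic_on_add:
  "several_holomorphic_on f W \<Longrightarrow> several_holomorphic_on g W \<Longrightarrow> several_holomorphic_on (\<lambda>p. f p + g p) W"
  unfolding several_holomorphic_on_def
  by (auto intro!: continuous_intros derivative_intros)

lemma several_holomorphic_on_mult:
  "several_holomorphic_on f W \<Longrightarrow> several_holomorphic_on g W \<Longrightarrow> several_holomorphic_on (\<lambda>p. f p * g p) W"
  unfolding several_holomorphic_on_def
  by (auto intro!: continuous_intros field_differentiable_mult)

lemma several_holomorphic_on_subset:
  "several_holomorphic_on f W \<Longrightarrow> V \<subseteq> W \<Longrightarrow> several_holomorphic_on f V"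
  unfolding several_holomorphic_on_def by (meson continuous_on_subset subset_iff)

lemma holomorphic_upd: "(\<lambda>t. (q(v := t)) w) holomorphic_on S" for q :: point
  by (cases "w = v") (auto intro: holomorphic_intros)

lemma holomorphic_local_log:
  "(\<lambda>t. local_log m r z0 (q(v := t)) w) holomorphic_on {t. q(v := t) \<in> log_dom m r z0}"
proof (cases "w = Tau")
  case False
  show ?thesis
  proof (cases "w \<in> vars m r")
    case True
    have "(\<lambda>t. z0 w + Ln ((q(v := t)) w / expo z0 w) / (2 * of_real pi * \<i>)) holomorphic_on {t. q(v := t) \<in> log_dom m r z0}"
      by (intro holomorphic_intros holomorphic_upd)
         (use True False expo_nonzero[of w z0] in \<open>auto simp: log_dom_def complex_nonpos_Reals_iff simp del: fun_upd_apply\<close>)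
    thus ?thesis using True False by (simp add: local_log_def del: fun_upd_apply)
  qed (use False in \<open>simp add: local_log_def\<close>)
qed (simp add: local_log_def holomorphic_upd del: fun_upd_apply)

lemma open_upd_log_dom: "open {t. q(v := t) \<in> log_dom m r z0}"
proof -
  have "continuous_on UNIV (\<lambda>t. if i = v then t else q i)" for i
    by (cases "i = v") (auto intro: continuous_intros)
  hence "continuous_on UNIV (\<lambda>t. q(v := t))"
    unfolding fun_upd_def by (rule continuous_on_coordinatewise_then_product)
  hence "open ((\<lambda>t. q(v := t)) -` log_dom m r z0)"
    using open_log_dom open_vimage by blast
  thus ?thesis by (simp add: vimage_def)
qed

text \<open>Theta is not single-valued in multiplicative variables. Inserting a local branch of the
  logarithm turns numerator and denominator of \<open>\<delta>\<close> into local holomorphic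
  functions.\<close>

lemma several_holomorphic_theta:
  "several_holomorphic_on (\<lambda>q. theta (q Tau) (lin l (local_log m r z0 q))) (log_dom m r z0)"
  unfolding several_holomorphic_on_def
proof (intro conjI ballI allI)
  show "continuous_on (log_dom m r z0) (\<lambda>q. theta (q Tau) (lin l (local_log m r z0 q)))"
    by (intro continuous_intros continuous_on_local_log) (auto simp: log_dom_def)
  fix q v assume q: "q \<in> log_dom m r z0"
  let ?S = "{t. q(v := t) \<in> log_dom m r z0}"
  have "(\<lambda>t. theta ((q(v := t)) Tau) (lin l (local_log m r z0 (q(v := t))))) holomorphic_on ?S"
    unfolding lin_def
    by (intro holomorphic_theta holomorphic_upd holomorphic_intros holomorphic_local_log open_upd_log_dom)
       (auto simp: log_dom_def simp del: fun_upd_apply)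
  thus "(\<lambda>t. theta ((q(v := t)) Tau) (lin l (local_log m r z0 (q(v := t))))) field_differentiable at (q v)"
    using open_upd_log_dom q by (intro holomorphic_on_imp_differentiable_at[of _ ?S]) simp_all
qed

lemma several_holomorphic_deriv_theta:
  "several_holomorphic_on (\<lambda>q. deriv (theta (q Tau)) 0) (log_dom m r z0)"
  unfolding several_holomorphic_on_def
proof (intro conjI ballI allI)
  have "continuous_on (log_dom m r z0) ((\<lambda>\<tau>. deriv (theta \<tau>) 0) \<circ> (\<lambda>q. q Tau))"
    by (intro continuous_on_compose continuous_intros
          continuous_on_subset[OF holomorphic_on_imp_continuous_on[OF holomorphic_deriv_theta_0]])
       (auto simp: log_dom_def)
  thus "continuous_on (log_dom m r z0) (\<lambda>q. deriv (theta (q Tau)) 0)" by (simp add: o_def)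
  fix q v assume q: "q \<in> log_dom m r z0"
  have "(\<lambda>t. deriv (theta t) 0) field_differentiable at (q Tau)"
    using holomorphic_deriv_theta_0 q open_halfspace_Im_gt
    by (intro holomorphic_on_imp_differentiable_at) (auto simp: log_dom_def)
  thus "(\<lambda>t. deriv (theta ((q(v := t)) Tau)) 0) field_differentiable at (q v)"
    by (cases "v = Tau") auto
qed

lemma theta_Ln_exp: "theta \<tau> (Ln (exp (2 * of_real pi * \<i> * x)) / (2 * of_real pi * \<i>)) = 0 \<longleftrightarrow> theta \<tau> x = 0"
proof -
  have "exp (Ln (exp (2 * of_real pi * \<i> * x))) = exp (2 * of_real pi * \<i> * x)" by simp
  then obtain n :: int where "Ln (exp (2 * of_real pi * \<i> * x)) = 2 * of_real pi * \<i> * x + (of_int (2 * n) * pi) * \<i>"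
    unfolding exp_eq by blast
  hence "Ln (exp (2 * of_real pi * \<i> * x)) / (2 * of_real pi * \<i>) = x + of_int n"
    by (simp add: field_simps)
  thus ?thesis by (simp add: theta_plus_int)
qed

text \<open>Whether theta vanishes does not depend on the branch of the logarithm. So nonvanishing
  is a property of multiplicative points and can be transported from the additive side.\<close>

lemma theta_nonzero_dense:
  assumes l: "l \<noteq> 0" "Poly_Mapping.keys l \<subseteq> vars m r"
  shows "log_dom m r z0 \<subseteq> closure {q \<in> log_dom m r z0. theta (q Tau) (lin l (local_log m r z0 q)) \<noteq> 0}"
proof -
  have T: "Tau \<notin> Poly_Mapping.keys l" using l(2) Tau_notin_vars(1)[of m r] by blast
  define P where "P p \<longleftrightarrow> theta (p Tau) (Ln (mon_value l p) / (2 * of_real pi * \<i>)) \<noteq> 0" for p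
  have Pexpo: "P (expo z) \<longleftrightarrow> theta (z Tau) (lin l z) \<noteq> 0" for z
    unfolding P_def mon_value_expo[OF T] theta_Ln_exp by simp
  have dep: "P p = P q" if "\<forall>v\<in>insert Tau (vars m r). p v = q v" for p q
  proof -
    have "mon_value l p = mon_value l q" by (rule mon_value_cong) (use that l(2) in blast)
    thus ?thesis using that by (simp add: P_def)
  qed
  have "generic (dom_mult m r) P"
    using generic_theta_nonzero[OF l(1) T] generic_transport[OF dep] by (simp add: Pexpo)
  then obtain U where U: "open U" "dom_mult m r \<subseteq> closure U" "\<And>p. p \<in> U \<Longrightarrow> P p"
    unfolding generic_def by blast
  have "log_dom m r z0 \<inter> closure U \<subseteq> closure (log_dom m r z0 \<inter> U)"
    by (rule open_Int_closure_subset[OF open_log_dom])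
  moreover have "log_dom m r z0 \<inter> U \<subseteq> {q \<in> log_dom m r z0. theta (q Tau) (lin l (local_log m r z0 q)) \<noteq> 0}"
  proof safe
    fix q assume q: "q \<in> log_dom m r z0" "q \<in> U" "theta (q Tau) (lin l (local_log m r z0 q)) = 0"
    have "P (expo (local_log m r z0 q)) = P q"
      by (rule dep) (use expo_local_log[OF q(1)] in blast)
    thus False using q U(3)[OF q(2)] by (simp add: Pexpo local_log_def)
  qed
  ultimately show ?thesis using log_dom_subset[of m r z0] U(2) closure_mono by blast
qed

lemma mer_fun_depends: "f \<in> mer_fun m r \<Longrightarrow> depends m r f"
  by (simp add: mer_fun_def depends_def)

lemma closure_nonzero_mult:
  fixes h h' :: func
  assumes W: "open W" "continuous_on W h" "continuous_on W h'"
    and "W \<subseteq> closure {q \<in> W. h q \<noteq> 0}" "W \<subseteq> closure {q \<in> W. h' q \<noteq> 0}"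
  shows "W \<subseteq> closure {q \<in> W. h q * h' q \<noteq> 0}"
proof -
  have "open {q \<in> W. h q \<noteq> 0}"
    using continuous_open_preimage[OF W(2,1), of "- {0}"] by (simp add: vimage_def Int_def open_Compl)
  moreover have "open {q \<in> W. h' q \<noteq> 0}"
    using continuous_open_preimage[OF W(3,1), of "- {0}"] by (simp add: vimage_def Int_def open_Compl)
  ultimately have "W \<subseteq> closure ({q \<in> W. h q \<noteq> 0} \<inter> {q \<in> W. h' q \<noteq> 0})"
    using assms by (intro dense_open_Int) auto
  also have "{q \<in> W. h q \<noteq> 0} \<inter> {q \<in> W. h' q \<noteq> 0} = {q \<in> W. h q * h' q \<noteq> 0}" by auto
  finally show ?thesis .
qed

definition mer_at :: "nat \<Rightarrow> nat \<Rightarrow> func \<Rightarrow> point \<Rightarrow> bool" where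
  "mer_at m r f p \<longleftrightarrow> (\<exists>W g h. open W \<and> p \<in> W \<and> W \<subseteq> dom_mult m r \<and>
        several_holomorphic_on g W \<and> several_holomorphic_on h W \<and>
        W \<subseteq> closure {q \<in> W. h q \<noteq> 0} \<and>
        (\<forall>q\<in>W. h q \<noteq> 0 \<longrightarrow> f q = g q / h q))"

lemma mer_fun_iff: "f \<in> mer_fun m r \<longleftrightarrow> depends m r f \<and> (\<forall>p\<in>dom_mult m r. mer_at m r f p)"
  by (simp add: mer_fun_def depends_def mer_at_def)

text \<open>Provides a common neighbourhood on which both functions are fractions and the product of
  the denominators is still nonzero on a dense set, as sums and products require.\<close>

lemma mer_at_combine:
  assumes f: "mer_at m r f p" and f': "mer_at m r f' p"
  shows "\<exists>W g h g' h'. open W \<and> p \<in> W \<and> W \<subseteq> dom_mult m r \<and>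
        several_holomorphic_on g W \<and> several_holomorphic_on h W \<and>
        several_holomorphic_on g' W \<and> several_holomorphic_on h' W \<and>
        W \<subseteq> closure {q \<in> W. h q * h' q \<noteq> 0} \<and>
        (\<forall>q\<in>W. h q \<noteq> 0 \<longrightarrow> f q = g q / h q) \<and> (\<forall>q\<in>W. h' q \<noteq> 0 \<longrightarrow> f' q = g' q / h' q)"
proof -
  obtain V g h where V: "open V" "p \<in> V" "V \<subseteq> dom_mult m r"
        "several_holomorphic_on g V" "several_holomorphic_on h V"
        "V \<subseteq> closure {q \<in> V. h q \<noteq> 0}" "\<forall>q\<in>V. h q \<noteq> 0 \<longrightarrow> f q = g q / h q"
    using f unfolding mer_at_def by blast
  obtain V' g' h' where V': "open V'" "p \<in> V'" "V' \<subseteq> dom_mult m r"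
        "several_holomorphic_on g' V'" "several_holomorphic_on h' V'"
        "V' \<subseteq> closure {q \<in> V'. h' q \<noteq> 0}" "\<forall>q\<in>V'. h' q \<noteq> 0 \<longrightarrow> f' q = g' q / h' q"
    using f' unfolding mer_at_def by blast
  define W where "W = V \<inter> V'"
  have W: "open W" "W \<subseteq> V" "W \<subseteq> V'" using V V' by (auto simp: W_def)
  have cl: "W \<subseteq> closure {q \<in> W. k q \<noteq> 0}" if "W \<subseteq> U" "U \<subseteq> closure {q \<in> U. k q \<noteq> 0}" for U and k :: func
  proof -
    have "W \<inter> closure {q \<in> U. k q \<noteq> 0} \<subseteq> closure (W \<inter> {q \<in> U. k q \<noteq> 0})"
      by (rule open_Int_closure_subset[OF W(1)])
    moreover have "W \<inter> {q \<in> U. k q \<noteq> 0} \<subseteq> {q \<in> W. k q \<noteq> 0}" by blast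
    ultimately show ?thesis using that closure_mono by blast
  qed
  have sh: "several_holomorphic_on g W" "several_holomorphic_on h W" "several_holomorphic_on g' W" "several_holomorphic_on h' W"
    using V(4,5) V'(4,5) W several_holomorphic_on_subset by blast+
  have cont: "continuous_on W h" "continuous_on W h'" using sh by (simp_all add: several_holomorphic_on_def)
  note dense = closure_nonzero_mult[OF W(1) cont cl[OF W(2) V(6)] cl[OF W(3) V'(6)]]
  show ?thesis
  proof (intro exI conjI)
    show "p \<in> W" "W \<subseteq> dom_mult m r" using V V' by (auto simp: W_def)
    show "\<forall>q\<in>W. h q \<noteq> 0 \<longrightarrow> f q = g q / h q" "\<forall>q\<in>W. h' q \<noteq> 0 \<longrightarrow> f' q = g' q / h' q"
      using V(7) V'(7) by (simp_all add: W_def)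
  qed (fact W sh dense)+
qed

lemma depends_add: "depends m r f \<Longrightarrow> depends m r g \<Longrightarrow> depends m r (\<lambda>p. f p + g p)"
  and depends_mult: "depends m r f \<Longrightarrow> depends m r g \<Longrightarrow> depends m r (\<lambda>p. f p * g p)"
  unfolding depends_def by metis+

lemma mer_fun_add:
  assumes "f \<in> mer_fun m r" "f' \<in> mer_fun m r"
  shows "(\<lambda>p. f p + f' p) \<in> mer_fun m r"
  unfolding mer_fun_iff
proof (intro conjI ballI)
  fix p assume p: "p \<in> dom_mult m r"
  have at: "mer_at m r f p" "mer_at m r f' p" using assms p by (auto simp: mer_fun_iff)
  obtain W g h g' h' where W: "open W" "p \<in> W" "W \<subseteq> dom_mult m r"
        "several_holomorphic_on g W" "several_holomorphic_on h W"
        "several_holomorphic_on g' W" "several_holomorphic_on h' W"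
        "W \<subseteq> closure {q \<in> W. h q * h' q \<noteq> 0}"
        "\<forall>q\<in>W. h q \<noteq> 0 \<longrightarrow> f q = g q / h q" "\<forall>q\<in>W. h' q \<noteq> 0 \<longrightarrow> f' q = g' q / h' q"
    using mer_at_combine[OF at] by (elim exE conjE) (rule that)
  show "mer_at m r (\<lambda>p. f p + f' p) p" unfolding mer_at_def
  proof (intro exI conjI ballI impI)
    show "several_holomorphic_on (\<lambda>q. g q * h' q + g' q * h q) W" "several_holomorphic_on (\<lambda>q. h q * h' q) W"
      by (intro several_holomorphic_on_add several_holomorphic_on_mult W)+
    fix q assume "q \<in> W" "h q * h' q \<noteq> 0"
    thus "f q + f' q = (g q * h' q + g' q * h q) / (h q * h' q)"
      using W(9,10) by (simp add: add_frac_eq)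
  qed (fact W)+
qed (use assms in \<open>auto simp: mer_fun_iff intro: depends_add\<close>)

lemma mer_fun_mult:
  assumes "f \<in> mer_fun m r" "f' \<in> mer_fun m r"
  shows "(\<lambda>p. f p * f' p) \<in> mer_fun m r"
  unfolding mer_fun_iff
proof (intro conjI ballI)
  fix p assume p: "p \<in> dom_mult m r"
  have at: "mer_at m r f p" "mer_at m r f' p" using assms p by (auto simp: mer_fun_iff)
  obtain W g h g' h' where W: "open W" "p \<in> W" "W \<subseteq> dom_mult m r"
        "several_holomorphic_on g W" "several_holomorphic_on h W"
        "several_holomorphic_on g' W" "several_holomorphic_on h' W"
        "W \<subseteq> closure {q \<in> W. h q * h' q \<noteq> 0}"
        "\<forall>q\<in>W. h q \<noteq> 0 \<longrightarrow> f q = g q / h q" "\<forall>q\<in>W. h' q \<noteq> 0 \<longrightarrow> f' q = g' q / h' q"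
    using mer_at_combine[OF at] by (elim exE conjE) (rule that)
  show "mer_at m r (\<lambda>p. f p * f' p) p" unfolding mer_at_def
  proof (intro exI conjI ballI impI)
    show "several_holomorphic_on (\<lambda>q. g q * g' q) W" "several_holomorphic_on (\<lambda>q. h q * h' q) W"
      by (intro several_holomorphic_on_mult W)+
    fix q assume "q \<in> W" "h q * h' q \<noteq> 0"
    thus "f q * f' q = (g q * g' q) / (h q * h' q)"
      using W(9,10) by simp
  qed (fact W)+
qed (use assms in \<open>auto simp: mer_fun_iff intro: depends_mult\<close>)

lemma mer_fun_const: "(\<lambda>p. c) \<in> mer_fun m r"
  unfolding mer_fun_iff mer_at_def
proof (intro conjI ballI)
  fix p assume "p \<in> dom_mult m r"
  thus "\<exists>W g h. open W \<and> p \<in> W \<and> W \<subseteq> dom_mult m r \<and>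
        several_holomorphic_on g W \<and> several_holomorphic_on h W \<and>
        W \<subseteq> closure {q \<in> W. h q \<noteq> 0} \<and> (\<forall>q\<in>W. h q \<noteq> 0 \<longrightarrow> c = g q / h q)"
    using closure_subset[of "dom_mult m r"]
    by (intro exI[of _ "dom_mult m r"] exI[of _ "\<lambda>_. c"] exI[of _ "\<lambda>_. 1"])
       (auto intro: several_holomorphic_on_const)
qed (simp add: depends_def)

lemma deltaf_mer_fun:
  assumes "l1 \<noteq> 0" "Poly_Mapping.keys l1 \<subseteq> xvars m" "l2 \<noteq> 0" "Poly_Mapping.keys l2 \<subseteq> muvars r"
  shows "deltaf l1 l2 \<in> mer_fun m r"
  unfolding mer_fun_iff
proof (intro conjI ballI)
  have k: "Poly_Mapping.keys l1 \<subseteq> vars m r" "Poly_Mapping.keys l2 \<subseteq> vars m r"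
    using assms by (auto simp: vars_def)
  have T: "Tau \<notin> Poly_Mapping.keys l1" "Tau \<notin> Poly_Mapping.keys l2"
    using k Tau_notin_vars(1)[of m r] by blast+
  show dep: "depends m r (deltaf l1 l2)" by (rule depends_deltaf[OF k])
  fix p assume p: "p \<in> dom_mult m r"
  then obtain z0 where z0: "z0 \<in> dom_add" "\<And>v. v \<in> insert Tau (vars m r) \<Longrightarrow> expo z0 v = p v"
    by (rule exists_log) blast
  define W where "W = log_dom m r z0"
  define t where "t l q = theta (q Tau) (lin l (local_log m r z0 q))" for l q
  have sh: "several_holomorphic_on (t l) W" for l
    unfolding t_def[abs_def] W_def by (rule several_holomorphic_theta)
  have dense: "W \<subseteq> closure {q \<in> W. t l1 q * t l2 q \<noteq> 0}"
    using sh theta_nonzero_dense[OF assms(1) k(1)] theta_nonzero_dense[OF assms(3) k(2)]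
    by (intro closure_nonzero_mult) (auto simp: several_holomorphic_on_def W_def t_def open_log_dom)
  have val: "deltaf l1 l2 q = deriv (theta (q Tau)) 0 * t (l1 + l2) q / (t l1 q * t l2 q)" if "q \<in> W" for q
  proof -
    have "\<forall>v\<in>insert Tau (vars m r). q v = expo (local_log m r z0 q) v"
      using expo_local_log that unfolding W_def by auto
    hence "deltaf l1 l2 q = deltaf l1 l2 (expo (local_log m r z0 q))" using dep unfolding depends_def by blast
    also have "\<dots> = deriv (theta (q Tau)) 0 * t (l1 + l2) q / (t l1 q * t l2 q)"
      unfolding deltaf_expo[OF T] F_def t_def lin_plus by (simp add: local_log_def)
    finally show ?thesis .
  qed
  show "mer_at m r (deltaf l1 l2) p" unfolding mer_at_def
  proof (intro exI conjI)
    show "open W" "W \<subseteq> dom_mult m r" by (auto simp: W_def open_log_dom log_dom_subset)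
    show "p \<in> W" unfolding W_def using z0 by (intro in_log_dom) (auto simp: dom_add_def)
    show "several_holomorphic_on (\<lambda>q. deriv (theta (q Tau)) 0 * t (l1 + l2) q) W"
      "several_holomorphic_on (\<lambda>q. t l1 q * t l2 q) W"
      by (intro several_holomorphic_on_mult sh several_holomorphic_deriv_theta[of m r z0, folded W_def])+
  qed (use dense val in auto)
qed

lemma frakA_subset_mer_fun: "f \<in> frakA m r \<Longrightarrow> f \<in> mer_fun m r"
  by (induction rule: frakA.induct)
     (auto intro: deltaf_mer_fun mer_fun_const mer_fun_add mer_fun_mult)

lemma frakA_depends: "f \<in> frakA m r \<Longrightarrow> depends m r f"
  using frakA_subset_mer_fun mer_fun_depends by blast

theorem subalgebra_frakA: "subalgebra_of (frakA m r) (mer_fun m r)"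
  unfolding subalgebra_of_def using frakA_subset_mer_fun
  by (auto intro: frakA.intros)

lemma frakA_sum: "(\<And>i. i \<in> I \<Longrightarrow> f i \<in> frakA m r) \<Longrightarrow> (\<lambda>p. \<Sum>i\<in>I. f i p) \<in> frakA m r"
  by (induction I rule: infinite_finite_induct) (auto intro: frakA.const frakA.add)

lemma frakA_prod: "(\<And>i. i \<in> I \<Longrightarrow> f i \<in> frakA m r) \<Longrightarrow> (\<lambda>p. \<Prod>i\<in>I. f i p) \<in> frakA m r"
  by (induction I rule: infinite_finite_induct) (auto intro: frakA.const frakA.mult)

section \<open>The grading\<close>

lemma has_type_0: "has_type m r (\<lambda>_. 0) Q"
  unfolding has_type_iff_add by (rule has_type_add_0)

lemma has_type_const: "has_type m r (\<lambda>_. c) (\<lambda>_. 0)"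
  unfolding has_type_iff_add by (rule has_type_add_const)

lemma has_type_plus: "has_type m r f Q \<Longrightarrow> has_type m r g Q \<Longrightarrow> has_type m r (\<lambda>p. f p + g p) Q"
  unfolding has_type_iff_add by (rule has_type_add_plus)

lemma has_type_mult: "has_type m r f Q \<Longrightarrow> has_type m r g Q' \<Longrightarrow> has_type m r (\<lambda>p. f p * g p) (\<lambda>z. Q z + Q' z)"
  unfolding has_type_iff_add by (rule has_type_add_mult)

lemma has_type_sum: "(\<And>i. i \<in> I \<Longrightarrow> has_type m r (f i) Q) \<Longrightarrow> has_type m r (\<lambda>p. \<Sum>i\<in>I. f i p) Q"
  by (induction I rule: infinite_finite_induct) (auto intro: has_type_0 has_type_plus)

lemma has_type_prod:
  "(\<And>i. i \<in> I \<Longrightarrow> has_type m r (f i) (Q i)) \<Longrightarrow> has_type m r (\<lambda>p. \<Prod>i\<in>I. f i p) (\<lambda>z. \<Sum>i\<in>I. Q i z)"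
  by (induction I rule: infinite_finite_induct) (auto intro: has_type_const has_type_mult)

lemma has_type_deltaf:
  assumes "l1 \<noteq> 0" "Poly_Mapping.keys l1 \<subseteq> xvars m" "l2 \<noteq> 0" "Poly_Mapping.keys l2 \<subseteq> muvars r"
  shows "has_type m r (deltaf l1 l2) (\<lambda>z. lin l1 z * lin l2 z)"
proof -
  have "Tau \<notin> Poly_Mapping.keys l1" "Tau \<notin> Poly_Mapping.keys l2"
    using assms Tau_notin_vars(2)[of m] Tau_notin_vars(3)[of r] by blast+
  thus ?thesis using has_type_add_F[OF assms] unfolding has_type_iff_add by (simp add: deltaf_expo)
qed

section \<open>Characters and bilinear types\<close>

lemma lin_frag_cmul: "lin (frag_cmul k l) z = of_int k * lin l z"
  by (subst lin_superset[OF _ keys_cmul]) (auto simp: lin_def sum_distrib_left mult_ac)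

definition chars :: "nat \<Rightarrow> monomial set" where
  "chars r = {\<mu>. Poly_Mapping.keys \<mu> \<subseteq> muvars r}"

lemma chars_plus: "a \<in> chars r \<Longrightarrow> b \<in> chars r \<Longrightarrow> a + b \<in> chars r"
  using Poly_Mapping.keys_add[of a b] by (auto simp: chars_def)

lemma chars_minus: "a \<in> chars r \<Longrightarrow> b \<in> chars r \<Longrightarrow> a - b \<in> chars r"
  using Poly_Mapping.keys_diff[of a b] by (auto simp: chars_def)

lemma chars_frag_cmul: "a \<in> chars r \<Longrightarrow> frag_cmul k a \<in> chars r"
  using keys_cmul[of k a] unfolding chars_def by blast

lemma chars_0 [simp]: "0 \<in> chars r" by (simp add: chars_def)

lemma is_char_iff: "is_char r \<mu> \<longleftrightarrow> \<mu> \<in> chars r"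
  by (simp add: is_char_def chars_def)

lemma nontrivial_char_iff: "nontrivial_char r \<mu> \<longleftrightarrow> \<mu> \<in> chars r \<and> \<mu> \<noteq> 0"
  by (simp add: nontrivial_char_def is_char_iff)

text \<open>The type of a nonzero homogeneous element is bilinear: it pairs the variable \<open>x\<^sub>j\<close>, where
  \<open>x\<^sub>0 = u\<close>, with a character \<open>A\<^sub>j\<close> in \<open>h\<close> and the \<open>\<mu>\<^sub>i\<close>.\<close>

definition bil :: "nat \<Rightarrow> (nat \<Rightarrow> monomial) \<Rightarrow> func" where
  "bil m A = (\<lambda>z. \<Sum>j\<le>m. z (Xv j) * lin (A j) z)"

definition bils :: "nat \<Rightarrow> nat \<Rightarrow> func set" where
  "bils m r = {bil m A |A. \<forall>j. A j \<in> chars r}"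

lemma bil_plus: "bil m (\<lambda>j. A j + B j) = (\<lambda>z. bil m A z + bil m B z)"
  by (simp add: bil_def lin_plus ring_distribs sum.distrib)

lemma bils_plus: "P \<in> bils m r \<Longrightarrow> Q \<in> bils m r \<Longrightarrow> (\<lambda>z. P z + Q z) \<in> bils m r"
proof -
  assume "P \<in> bils m r" "Q \<in> bils m r"
  then obtain A B where AB: "P = bil m A" "Q = bil m B" "\<forall>j. A j \<in> chars r" "\<forall>j. B j \<in> chars r"
    unfolding bils_def by blast
  have "(\<lambda>z. P z + Q z) = bil m (\<lambda>j. A j + B j)" unfolding AB bil_plus ..
  moreover have "\<forall>j. A j + B j \<in> chars r" using AB chars_plus by blast
  ultimately show ?thesis unfolding bils_def by blast
qed

lemma bils_0: "(\<lambda>z. 0) \<in> bils m r"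
  unfolding bils_def by (auto simp: bil_def intro!: exI[of _ "\<lambda>_. 0"])

lemma lin_xvars:
  assumes "Poly_Mapping.keys l \<subseteq> xvars m"
  shows "lin l z = (\<Sum>j\<le>m. of_int (Poly_Mapping.lookup l (Xv j)) * z (Xv j))"
proof -
  have "lin l z = (\<Sum>v\<in>xvars m. of_int (Poly_Mapping.lookup l v) * z v)"
    by (rule lin_superset[OF _ assms]) simp
  also have "xvars m = Xv ` {..m}" by (auto simp: xvars_def)
  finally show ?thesis by (subst (asm) sum.reindex) (auto simp: inj_on_def)
qed

lemma mult_lin_bil:
  assumes "Poly_Mapping.keys l1 \<subseteq> xvars m"
  shows "(\<lambda>z. lin l1 z * lin l2 z) = bil m (\<lambda>j. frag_cmul (Poly_Mapping.lookup l1 (Xv j)) l2)"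
  unfolding bil_def lin_xvars[OF assms] lin_frag_cmul sum_distrib_right by (simp add: mult_ac)

lemma mult_lin_bils:
  assumes "Poly_Mapping.keys l1 \<subseteq> xvars m" "Poly_Mapping.keys l2 \<subseteq> muvars r"
  shows "(\<lambda>z. lin l1 z * lin l2 z) \<in> bils m r"
  unfolding mult_lin_bil[OF assms(1)] bils_def using assms(2) chars_frag_cmul[of l2 r]
  by (auto simp: chars_def intro!: exI[of _ "\<lambda>j. frag_cmul (Poly_Mapping.lookup l1 (Xv j)) l2"])

lemma integral_qform_bil:
  assumes "\<And>j. A j \<in> chars r"
  shows "integral_qform m r (bil m A)"
  unfolding integral_qform_def
proof (intro exI ext)
  fix z :: point
  let ?c = "\<lambda>v w. case v of Xv j \<Rightarrow> Poly_Mapping.lookup (A j) w | _ \<Rightarrow> 0"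
  have "(\<Sum>v\<in>vars m r. \<Sum>w\<in>vars m r. of_int (?c v w) * z v * z w) =
     (\<Sum>v\<in>xvars m. \<Sum>w\<in>vars m r. of_int (?c v w) * z v * z w)"
    by (intro sum.mono_neutral_right) (auto simp: vars_def muvars_def)
  also have "xvars m = Xv ` {..m}" by (auto simp: xvars_def)
  also have "(\<Sum>v\<in>Xv ` {..m}. \<Sum>w\<in>vars m r. of_int (?c v w) * z v * z w) =
     (\<Sum>j\<le>m. z (Xv j) * (\<Sum>w\<in>vars m r. of_int (Poly_Mapping.lookup (A j) w) * z w))"
    by (subst sum.reindex) (auto simp: inj_on_def sum_distrib_left mult_ac intro!: sum.cong)
  also have "\<dots> = bil m A z" unfolding bil_def
    using assms by (intro sum.cong refl arg_cong2[of _ _ _ _ "(*)"] lin_superset[symmetric]) (auto simp: chars_def vars_def)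
  finally show "bil m A z = (\<Sum>v\<in>vars m r. \<Sum>w\<in>vars m r. of_int (?c v w) * z v * z w)" by simp
qed

lemma integral_qform_plus:
  assumes "integral_qform m r P" "integral_qform m r Q"
  shows "integral_qform m r (\<lambda>z. P z + Q z)"
proof -
  obtain c d :: "var \<Rightarrow> var \<Rightarrow> int" where
    "P = (\<lambda>z. \<Sum>v\<in>vars m r. \<Sum>w\<in>vars m r. of_int (c v w) * z v * z w)"
    "Q = (\<lambda>z. \<Sum>v\<in>vars m r. \<Sum>w\<in>vars m r. of_int (d v w) * z v * z w)"
    using assms unfolding integral_qform_def by blast
  thus ?thesis unfolding integral_qform_def
    by (intro exI[of _ "\<lambda>v w. c v w + d v w"]) (simp add: sum.distrib ring_distribs)
qed

text \<open>The components are required to have bilinear types, which is more than the grading asks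
  for. This later forces the type of a nonzero pure element to be bilinear.\<close>

definition decomposable :: "nat \<Rightarrow> nat \<Rightarrow> func \<Rightarrow> bool" where
  "decomposable m r f \<longleftrightarrow> (\<exists>S g. finite S \<and> S \<subseteq> bils m r \<and> (\<forall>Q\<in>S. g Q \<in> type_piece m r Q) \<and>
     mer_eq m r f (\<lambda>p. \<Sum>Q\<in>S. g Q p))"

text \<open>Pieces that happen to have the same type are collected into one component.\<close>

lemma decomposableI:
  fixes I :: "'i set"
  assumes "finite I" "\<And>i. i \<in> I \<Longrightarrow> q i \<in> bils m r" "\<And>i. i \<in> I \<Longrightarrow> g i \<in> type_piece m r (q i)"
    "mer_eq m r f (\<lambda>p. \<Sum>i\<in>I. g i p)"
  shows "decomposable m r f"
proof -
  have "(\<Sum>i\<in>I. g i p) = (\<Sum>Q\<in>q ` I. \<Sum>i | i \<in> I \<and> q i = Q. g i p)" for p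
    by (rule sum.image_gen[OF assms(1)])
  with assms show ?thesis unfolding decomposable_def
    by (intro exI[of _ "q ` I"] exI[of _ "\<lambda>Q p. \<Sum>i | i \<in> I \<and> q i = Q. g i p"])
       (auto simp: type_piece_def intro!: frakA_sum has_type_sum, metis)
qed

lemma frakA_decomposable: "f \<in> frakA m r \<Longrightarrow> decomposable m r f"
proof (induction rule: frakA.induct)
  case (gen l1 l2)
  thus ?case
    by (intro decomposableI[of "{()}" "\<lambda>_. (\<lambda>z. lin l1 z * lin l2 z)" m r "\<lambda>_. deltaf l1 l2"])
       (auto simp: type_piece_def has_type_deltaf mult_lin_bils gen_eq_refl intro: frakA.gen)
next
  case (const c)
  show ?case
    by (intro decomposableI[of "{()}" "\<lambda>_ _. 0" m r "\<lambda>_ _. c"])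
       (auto simp: type_piece_def has_type_const bils_0 gen_eq_refl intro: frakA.const)
next
  case (add f f')
  obtain S g where S: "finite S" "S \<subseteq> bils m r" "\<forall>Q\<in>S. g Q \<in> type_piece m r Q" "mer_eq m r f (\<lambda>p. \<Sum>Q\<in>S. g Q p)"
    using add.IH(1) unfolding decomposable_def by blast
  obtain S' g' where S': "finite S'" "S' \<subseteq> bils m r" "\<forall>Q\<in>S'. g' Q \<in> type_piece m r Q" "mer_eq m r f' (\<lambda>p. \<Sum>Q\<in>S'. g' Q p)"
    using add.IH(2) unfolding decomposable_def by blast
  have "mer_eq m r (\<lambda>p. f p + f' p) (\<lambda>p. \<Sum>i\<in>S <+> S'. case_sum g g' i p)"
    using gen_eq_add[OF S(4) S'(4)] S(1) S'(1) by (simp add: sum.Plus)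
  thus ?case
    by (intro decomposableI[of "S <+> S'" "case_sum id id" m r "case_sum g g'"]) (use S S' in auto)
next
  case (mult f f')
  obtain S g where S: "finite S" "S \<subseteq> bils m r" "\<forall>Q\<in>S. g Q \<in> type_piece m r Q" "mer_eq m r f (\<lambda>p. \<Sum>Q\<in>S. g Q p)"
    using mult.IH(1) unfolding decomposable_def by blast
  obtain S' g' where S': "finite S'" "S' \<subseteq> bils m r" "\<forall>Q\<in>S'. g' Q \<in> type_piece m r Q" "mer_eq m r f' (\<lambda>p. \<Sum>Q\<in>S'. g' Q p)"
    using mult.IH(2) unfolding decomposable_def by blast
  have "mer_eq m r (\<lambda>p. f p * f' p) (\<lambda>p. \<Sum>(P, Q)\<in>S \<times> S'. g P p * g' Q p)"
    using gen_eq_mult[OF S(4) S'(4)] by (simp add: sum_product sum.cartesian_product)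
  hence "mer_eq m r (\<lambda>p. f p * f' p) (\<lambda>p. \<Sum>i\<in>S \<times> S'. (\<lambda>(P, Q) p. g P p * g' Q p) i p)"
    by (simp add: case_prod_beta)
  thus ?case
  proof (rule decomposableI[of "S \<times> S'" "\<lambda>(P, Q) z. P z + Q z" m r "\<lambda>(P, Q) p. g P p * g' Q p", rotated 3])
    fix i assume "i \<in> S \<times> S'"
    then obtain P Q where i: "i = (P, Q)" "P \<in> S" "Q \<in> S'" by blast
    show "(case i of (P, Q) \<Rightarrow> \<lambda>z. P z + Q z) \<in> bils m r"
      using i S(2) S'(2) by (auto intro!: bils_plus)
    show "(case i of (P, Q) \<Rightarrow> \<lambda>p. g P p * g' Q p) \<in> type_piece m r (case i of (P, Q) \<Rightarrow> \<lambda>z. P z + Q z)"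
      using i S(3) S'(3) by (auto simp: type_piece_def intro!: frakA.mult has_type_mult)
  qed (use S S' in auto)
next
  case (repr f g)
  have trans: "mer_eq m r g k" if "mer_eq m r f k" for k
    using gen_eq_trans[OF gen_eq_sym[OF repr.hyps(3)] that] .
  show ?case using repr.IH trans unfolding decomposable_def by blast
qed

lemma mer_eq_0_iff:
  assumes "depends m r f"
  shows "mer_eq m r f (\<lambda>p. 0) \<longleftrightarrow> gen_eq dom_add (\<lambda>z. f (expo z)) (\<lambda>z. 0)"
  using mer_eq_iff[OF assms, of "\<lambda>_. 0"] by (simp add: depends_def)

lemma frakA_types_independent:
  assumes "finite S" "\<And>Q. Q \<in> S \<Longrightarrow> g Q \<in> type_piece m r Q"
    "mer_eq m r (\<lambda>p. \<Sum>Q\<in>S. g Q p) (\<lambda>p. 0)" "Q \<in> S"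
  shows "mer_eq m r (g Q) (\<lambda>p. 0)"
proof -
  have A: "g Q \<in> frakA m r" "has_type m r (g Q) Q" if "Q \<in> S" for Q
    using assms(2)[OF that] by (auto simp: type_piece_def)
  have "(\<lambda>p. \<Sum>Q\<in>S. g Q p) \<in> frakA m r" by (intro frakA_sum A)
  hence "gen_eq dom_add (\<lambda>z. \<Sum>Q\<in>S. g Q (expo z)) (\<lambda>z. 0)"
    using assms(3) mer_eq_0_iff[OF frakA_depends] by blast
  hence "gen_eq dom_add (\<lambda>z. g Q (expo z)) (\<lambda>z. 0)"
    using types_independent[of S m r "\<lambda>Q z. g Q (expo z)" Q] assms(1,4) A(2)
    unfolding has_type_iff_add by blast
  thus ?thesis using mer_eq_0_iff[OF frakA_depends[OF A(1)[OF assms(4)]]] by blast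
qed

theorem graded_frakA:
  "graded_algebra (dom_mult m r) (frakA m r) {Q. integral_qform m r Q} (type_piece m r)"
proof -
  have 0: "integral_qform m r (\<lambda>z. 0)"
    unfolding integral_qform_def by (intro exI[of _ "\<lambda>_ _. 0"]) simp
  have bil_int: "Q \<in> bils m r \<Longrightarrow> integral_qform m r Q" for Q
    unfolding bils_def using integral_qform_bil by blast
  have scale: "(\<lambda>p. c * f p) \<in> type_piece m r Q" if "f \<in> type_piece m r Q" for c f Q
    using that frakA.mult[OF frakA.const, of f m r c] has_type_mult[OF has_type_const, of m r f Q c]
    by (simp add: type_piece_def)
  have decomp: "\<exists>S g. finite S \<and> S \<subseteq> {Q. integral_qform m r Q} \<and> (\<forall>Q\<in>S. g Q \<in> type_piece m r Q) \<and>
        mer_eq m r f (\<lambda>p. \<Sum>Q\<in>S. g Q p)" if "f \<in> frakA m r" for f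
    using frakA_decomposable[OF that] bil_int unfolding decomposable_def by blast
  show ?thesis
    unfolding graded_algebra_def
    using 0 scale decomp integral_qform_plus frakA_types_independent
    by (auto simp: type_piece_def intro: frakA.intros has_type_0 has_type_const has_type_plus has_type_mult)
qed

text \<open>If \<open>Q\<close> were not among the types of a decomposition of \<open>f\<close>,
  then \<open>- f\<close> could be added as a further component of type \<open>Q\<close>. The
  resulting sum vanishes, so independence would give \<open>f = 0\<close>.\<close>

lemma frakA_type_bil:
  assumes f: "f \<in> frakA m r" "has_type m r f Q" "\<not> mer_eq m r f (\<lambda>p. 0)"
  shows "Q \<in> bils m r"
proof -
  obtain S g where S: "finite S" "S \<subseteq> bils m r" "\<forall>Q\<in>S. g Q \<in> type_piece m r Q" "mer_eq m r f (\<lambda>p. \<Sum>Q\<in>S. g Q p)"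
    using frakA_decomposable[OF f(1)] unfolding decomposable_def by blast
  have "Q \<in> S"
  proof (rule ccontr)
    assume Q: "Q \<notin> S"
    define k where "k P = (if P = Q then (\<lambda>p. (-1) * f p) else g P)" for P
    have "mer_eq m r (\<lambda>p. \<Sum>P\<in>insert Q S. k P p) (\<lambda>p. 0)"
    proof -
      have "(\<Sum>P\<in>insert Q S. k P p) = - f p + (\<Sum>P\<in>S. g P p)" for p
      proof -
        have "(\<Sum>P\<in>S. k P p) = (\<Sum>P\<in>S. g P p)" using Q by (intro sum.cong) (auto simp: k_def)
        thus ?thesis using Q S(1) by (simp add: k_def)
      qed
      thus ?thesis using gen_eq_sym[OF S(4)] unfolding gen_eq_generic by simp
    qed
    moreover have "k P \<in> type_piece m r P" if "P \<in> insert Q S" for P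
      using that S(3) frakA.mult[OF frakA.const f(1), of "-1"] has_type_mult[OF has_type_const f(2), of "-1"]
      by (auto simp: k_def type_piece_def)
    ultimately have "mer_eq m r (k Q) (\<lambda>p. 0)"
      using frakA_types_independent[of "insert Q S" k m r Q] S(1) by blast
    hence "mer_eq m r f (\<lambda>p. 0)" unfolding gen_eq_generic k_def by simp
    thus False using f by blast
  qed
  thus ?thesis using S(2) by blast
qed

lemma pure_iff_homogeneous:
  assumes "f \<in> frakA m r"
  shows "(\<exists>Q. integral_qform m r Q \<and> f \<in> type_piece m r Q) \<longleftrightarrow> pure m r f"
proof
  assume "pure m r f"
  then obtain Q where Q: "has_type m r f Q" by (auto simp: pure_def)
  show "\<exists>Q. integral_qform m r Q \<and> f \<in> type_piece m r Q"
  proof (cases "mer_eq m r f (\<lambda>p. 0)")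
    \<comment> \<open>The zero function has every function as a type, integral or not; type 0 is
      chosen for it.\<close>
    case True
    hence "gen_eq dom_add (\<lambda>z. f (expo z)) (\<lambda>z. 0)" using mer_eq_0_iff frakA_depends assms by blast
    hence "has_type m r f (\<lambda>z. 0)" unfolding has_type_iff_add
      using has_type_add_cong has_type_add_0 by blast
    moreover have "integral_qform m r (\<lambda>z. 0)"
      unfolding integral_qform_def by (intro exI[of _ "\<lambda>_ _. 0"]) simp
    ultimately show ?thesis using assms by (auto simp: type_piece_def)
  next
    case False
    thus ?thesis using frakA_type_bil[OF assms Q] Q assms integral_qform_bil
      by (auto simp: bils_def type_piece_def)
  qed
qed (auto simp: type_piece_def pure_def)

section \<open>Actions of the symmetric groups\<close>

lemma ren_x_eq_iff: "inj v \<Longrightarrow> ren_x v a = ren_x v b \<longleftrightarrow> a = b"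
  by (cases a; cases b) (auto dest: injD)

lemma ren_mu_eq_iff: "inj v \<Longrightarrow> ren_mu v a = ren_mu v b \<longleftrightarrow> a = b"
  by (cases a; cases b) (auto dest: injD)

lemma ren_x_comp: "ren_x (v \<circ> w) = ren_x v \<circ> ren_x w"
proof
  fix a show "ren_x (v \<circ> w) a = (ren_x v \<circ> ren_x w) a" by (cases a) auto
qed

lemma ren_mu_comp: "ren_mu (v \<circ> w) = ren_mu v \<circ> ren_mu w"
proof
  fix a show "ren_mu (v \<circ> w) a = (ren_mu v \<circ> ren_mu w) a" by (cases a) auto
qed

lemma ren_x_id: "ren_x id = id" and ren_mu_id: "ren_mu id = id"
proof -
  show "ren_x id = id"
  proof
    fix a show "ren_x id a = id a" by (cases a) auto
  qed
  show "ren_mu id = id"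
  proof
    fix a show "ren_mu id a = id a" by (cases a) auto
  qed
qed

lemma ren_x_mu_comm: "ren_x v \<circ> ren_mu s = ren_mu s \<circ> ren_x v"
proof
  fix a show "(ren_x v \<circ> ren_mu s) a = (ren_mu s \<circ> ren_x v) a" by (cases a) auto
qed

lemma permutes_image_0:
  assumes "v permutes {1..m::nat}" shows "v ` {0..m} = {0..m}"
  using permutes_image[OF permutes_subset[OF assms, of "{0..m}"]] by auto

lemma renaming_ren_x:
  assumes v: "v permutes {1..m}"
  shows "renaming m r (ren_x v)"
  unfolding renaming_def
proof (intro conjI)
  show "bij (ren_x v)"
  proof (rule bijI)
    show "inj (ren_x v)" using ren_x_eq_iff permutes_inj[OF v] by (auto simp: inj_def)
    show "surj (ren_x v)"
    proof (rule surjI)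
      fix a show "ren_x v (ren_x (inv v) a) = a"
        by (cases a) (auto simp: permutes_inverses[OF v])
    qed
  qed
  have "ren_x v ` xvars m = Xv ` (v ` {0..m})" unfolding xvars_def image_image by simp
  thus "ren_x v ` xvars m = xvars m" unfolding permutes_image_0[OF v] xvars_def .
  show "ren_x v ` muvars r = muvars r" unfolding muvars_def image_image by simp
qed simp

lemma renaming_ren_mu:
  assumes v: "v permutes {1..r}"
  shows "renaming m r (ren_mu v)"
  unfolding renaming_def
proof (intro conjI)
  show "bij (ren_mu v)"
  proof (rule bijI)
    show "inj (ren_mu v)" using ren_mu_eq_iff permutes_inj[OF v] by (auto simp: inj_def)
    show "surj (ren_mu v)"
    proof (rule surjI)
      fix a show "ren_mu v (ren_mu (inv v) a) = a"
        by (cases a) (auto simp: permutes_inverses[OF v])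
    qed
  qed
  have "ren_mu v ` muvars r = Mv ` (v ` {0..r})" unfolding muvars_def image_image by simp
  thus "ren_mu v ` muvars r = muvars r" unfolding permutes_image_0[OF v] muvars_def .
  show "ren_mu v ` xvars m = xvars m" unfolding xvars_def image_image by simp
qed simp

lemma act_x_alt: "act_x v f = (\<lambda>p. f (p \<circ> ren_x v))"
  by (simp add: act_x_def o_def)

lemma act_mu_alt: "act_mu v f = (\<lambda>p. f (p \<circ> ren_mu v))"
  by (simp add: act_mu_def o_def)

lemma act_x_comp: "act_x (v \<circ> w) f = act_x v (act_x w f)"
  unfolding act_x_alt ren_x_comp by (simp add: o_assoc)

lemma act_mu_comp: "act_mu (v \<circ> w) f = act_mu v (act_mu w f)"
  unfolding act_mu_alt ren_mu_comp by (simp add: o_assoc)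

lemma act_x_id: "act_x id f = f"
  by (simp add: act_x_alt ren_x_id)

lemma deltaf_rename:
  assumes "bij \<rho>" "\<rho> Tau = Tau"
  shows "deltaf l1 l2 (p \<circ> \<rho>) = deltaf (rename \<rho> l1) (rename \<rho> l2) p"
  using assms by (simp add: deltaf_def mon_value_rename)

lemma depends_rename:
  assumes \<rho>: "renaming m r \<rho>" and "depends m r f"
  shows "depends m r (\<lambda>p. f (p \<circ> \<rho>))"
  unfolding depends_def
proof (intro allI impI)
  fix p q :: point assume "\<forall>v\<in>insert Tau (vars m r). p v = q v"
  hence "\<forall>v\<in>insert Tau (vars m r). (p \<circ> \<rho>) v = (q \<circ> \<rho>) v"
    using renaming_vars[OF \<rho>] \<rho> by (auto simp: renaming_def)
  thus "f (p \<circ> \<rho>) = f (q \<circ> \<rho>)" using assms(2) unfolding depends_def by blast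
qed

lemma several_holomorphic_rename:
  assumes "bij \<rho>" "several_holomorphic_on g W"
  shows "several_holomorphic_on (\<lambda>p. g (p \<circ> \<rho>)) {p. p \<circ> \<rho> \<in> W}"
  unfolding several_holomorphic_on_def
proof (intro conjI ballI allI)
  have "continuous_on {p. p \<circ> \<rho> \<in> W} (\<lambda>p :: point. p \<circ> \<rho>)"
    by (intro continuous_on_coordinatewise_then_product continuous_on_rename)
  moreover have "continuous_on W g" using assms(2) by (simp add: several_holomorphic_on_def)
  ultimately show "continuous_on {p. p \<circ> \<rho> \<in> W} (\<lambda>p. g (p \<circ> \<rho>))"
    using continuous_on_compose2[of W g] by blast
  fix q v assume q: "q \<in> {p. p \<circ> \<rho> \<in> W}"
  obtain u where u: "v = \<rho> u" using assms(1) by (metis bij_pointE)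
  have "(q(v := t)) \<circ> \<rho> = (q \<circ> \<rho>)(u := t)" for t
    using assms(1) u by (auto simp: fun_eq_iff bij_is_inj dest: injD[OF bij_is_inj])
  moreover have "(\<lambda>t. g ((q \<circ> \<rho>)(u := t))) field_differentiable at ((q \<circ> \<rho>) u)"
    using assms(2) q unfolding several_holomorphic_on_def by blast
  ultimately show "(\<lambda>t. g (q(v := t) \<circ> \<rho>)) field_differentiable at (q v)"
    using u by simp
qed

text \<open>The rule \<open>repr\<close> of \<open>frakA\<close> admits any meromorphic
  representative, so closure of the algebra under renaming needs this as well.\<close>

lemma mer_fun_rename:
  assumes \<rho>: "renaming m r \<rho>" and f: "f \<in> mer_fun m r"
  shows "(\<lambda>p. f (p \<circ> \<rho>)) \<in> mer_fun m r"
  unfolding mer_fun_iff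
proof (intro conjI ballI)
  show "depends m r (\<lambda>p. f (p \<circ> \<rho>))" using depends_rename[OF \<rho>] f by (simp add: mer_fun_iff)
  note bij = renaming_bij[OF \<rho>]
  fix p assume "p \<in> dom_mult m r"
  hence "p \<circ> \<rho> \<in> dom_mult m r" using dom_mult_rename[OF \<rho>] by blast
  hence "mer_at m r f (p \<circ> \<rho>)" using f by (simp add: mer_fun_iff)
  then obtain W g h where W: "open W" "p \<circ> \<rho> \<in> W" "W \<subseteq> dom_mult m r"
        "several_holomorphic_on g W" "several_holomorphic_on h W"
        "W \<subseteq> closure {q \<in> W. h q \<noteq> 0}" "\<forall>q\<in>W. h q \<noteq> 0 \<longrightarrow> f q = g q / h q"
    unfolding mer_at_def by blast
  let ?W = "{q. q \<circ> \<rho> \<in> W}"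
  show "mer_at m r (\<lambda>p. f (p \<circ> \<rho>)) p" unfolding mer_at_def
  proof (intro exI conjI ballI impI)
    have "open (UNIV \<inter> (\<lambda>p. p \<circ> \<rho>) -` W)"
      by (intro open_preimage_contains continuous_on_rename W) auto
    thus "open ?W" by (simp add: vimage_def)
    show "p \<in> ?W" using W by simp
    show "?W \<subseteq> dom_mult m r" using W(3) dom_mult_rename[OF \<rho>] by blast
    show "several_holomorphic_on (\<lambda>q. g (q \<circ> \<rho>)) ?W" "several_holomorphic_on (\<lambda>q. h (q \<circ> \<rho>)) ?W"
      by (intro several_holomorphic_rename bij W)+
    have "open {q \<in> W. h q \<noteq> 0}"
      using continuous_open_preimage[of W h "- {0}"] W by (simp add: several_holomorphic_on_def vimage_def Int_def open_Compl)
    hence "generic W (\<lambda>q. h q \<noteq> 0)" using W(6) unfolding generic_def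
      by (intro exI[of _ "{q \<in> W. h q \<noteq> 0}"]) auto
    hence "generic ?W (\<lambda>q. h (q \<circ> \<rho>) \<noteq> 0)"
      by (rule generic_rename[OF bij]) simp
    then obtain U where "U \<subseteq> ?W" "?W \<subseteq> closure U" "\<forall>q\<in>U. h (q \<circ> \<rho>) \<noteq> 0"
      unfolding generic_def by blast
    thus "?W \<subseteq> closure {q \<in> ?W. h (q \<circ> \<rho>) \<noteq> 0}"
      using closure_mono[of U "{q \<in> ?W. h (q \<circ> \<rho>) \<noteq> 0}"] by blast
    fix q assume "q \<in> ?W" "h (q \<circ> \<rho>) \<noteq> 0"
    thus "f (q \<circ> \<rho>) = g (q \<circ> \<rho>) / h (q \<circ> \<rho>)" using W(7) by simp
  qed
qed

lemma frakA_rename: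
  assumes \<rho>: "renaming m r \<rho>" and "f \<in> frakA m r"
  shows "(\<lambda>p. f (p \<circ> \<rho>)) \<in> frakA m r"
  using assms(2)
proof (induction rule: frakA.induct)
  case (gen l1 l2)
  note bij = renaming_bij[OF \<rho>]
  have T: "\<rho> Tau = Tau" using \<rho> by (simp add: renaming_def)
  have "\<rho> ` Poly_Mapping.keys l1 \<subseteq> xvars m" "\<rho> ` Poly_Mapping.keys l2 \<subseteq> muvars r"
  proof -
    have "\<rho> ` xvars m = xvars m" "\<rho> ` muvars r = muvars r" using \<rho> by (auto simp: renaming_def)
    thus "\<rho> ` Poly_Mapping.keys l1 \<subseteq> xvars m" "\<rho> ` Poly_Mapping.keys l2 \<subseteq> muvars r"
      using image_mono[OF gen(2), of \<rho>] image_mono[OF gen(4), of \<rho>] by metis+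
  qed
  moreover have "rename \<rho> l1 \<noteq> 0" "rename \<rho> l2 \<noteq> 0"
    using gen(1,3) rename_eq_0_iff[OF bij] by blast+
  ultimately show ?case unfolding deltaf_rename[OF bij T] keys_rename[OF bij, symmetric]
    by (intro frakA.gen)
next
  case (repr f g)
  show ?case
    by (rule frakA.repr[OF repr.IH mer_fun_rename[OF \<rho>] gen_eq_rename_mult[OF \<rho>]]) (use repr in auto)
qed (rule frakA.const, (rule frakA.add frakA.mult, assumption+)+)

lemma has_type_rename:
  assumes \<rho>: "renaming m r \<rho>" and "has_type m r f Q"
  shows "has_type m r (\<lambda>p. f (p \<circ> \<rho>)) (\<lambda>z. Q (z \<circ> \<rho>))"
  using has_type_add_rename[OF \<rho>, of "\<lambda>z. f (expo z)" Q] assms(2)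
  unfolding has_type_iff_add expo_rename[OF \<rho>] by simp

lemma gen_eq_rename_0:
  assumes \<rho>: "renaming m r \<rho>" and "mer_eq m r (\<lambda>p. f (p \<circ> \<rho>)) (\<lambda>p. 0)"
  shows "mer_eq m r f (\<lambda>p. 0)"
proof -
  have "(p \<circ> inv \<rho>) \<circ> \<rho> = p" for p :: point
    using renaming_bij[OF \<rho>] by (auto simp: fun_eq_iff bij_is_inj)
  thus ?thesis using gen_eq_rename_mult[OF renaming_inv[OF \<rho>] assms(2)] by simp
qed

section \<open>The operations\<close>

definition opA :: "nat \<Rightarrow> monomial \<Rightarrow> func \<Rightarrow> func" where
  "opA i \<mu> f = (\<lambda>z. F (z Tau) (z (Xv (Suc i)) - z (Xv i)) (lin \<mu> z) * f z +
     F (z Tau) (z (Xv i) - z (Xv (Suc i))) (z (Mv 0)) * f (z \<circ> ren_x (simple_refl i)))"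

lemma keys_xm_diff: "Poly_Mapping.keys (xm i - xm j) \<subseteq> {Xv i, Xv j}"
  using Poly_Mapping.keys_diff[of "xm i" "xm j"] by auto

lemma xm_diff_nonzero: "i \<noteq> j \<Longrightarrow> xm i - xm j \<noteq> 0"
proof
  assume ij: "i \<noteq> j" and "xm i - xm j = 0"
  hence "Poly_Mapping.lookup (xm i - xm j) (Xv i) = 0" by simp
  thus False using ij by (simp add: lookup_minus lookup_single)
qed

lemma xm_eq_iff [simp]: "xm i = xm j \<longleftrightarrow> i = j"
  using xm_diff_nonzero[of i j] by auto

lemma hm_chars [simp]: "hm \<in> chars r" and hm_nonzero: "hm \<noteq> 0"
  by (auto simp: chars_def muvars_def dest!: arg_cong[of _ _ "\<lambda>l. Poly_Mapping.lookup l (Mv 0)"])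

lemma chars_Tau: "\<mu> \<in> chars r \<Longrightarrow> Tau \<notin> Poly_Mapping.keys \<mu>"
  by (auto simp: chars_def muvars_def)

lemma xm_diff_xvars: "i \<le> m \<Longrightarrow> j \<le> m \<Longrightarrow> Poly_Mapping.keys (xm i - xm j) \<subseteq> xvars m"
  using keys_xm_diff[of i j] by (auto simp: xvars_def)

lemma opC_expo:
  assumes "\<mu> \<in> chars r"
  shows "opC i \<mu> f (expo z) = opA i \<mu> (\<lambda>z. f (expo z)) z"
proof -
  have T: "Tau \<notin> Poly_Mapping.keys (xm i - xm j)" for i j using keys_xm_diff[of i j] by auto
  have "expo z \<circ> ren_x (simple_refl i) = expo (z \<circ> ren_x (simple_refl i))"
  proof
    fix a show "(expo z \<circ> ren_x (simple_refl i)) a = expo (z \<circ> ren_x (simple_refl i)) a"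
      by (cases a) (auto simp: expo_def)
  qed
  thus ?thesis
    unfolding opC_def opA_def act_x_alt
    using T chars_Tau[OF assms] by (simp add: deltaf_expo lin_minus)
qed

lemma depends_opC:
  assumes "\<mu> \<in> chars r" "i \<in> {1..<m}" "depends m r f"
  shows "depends m r (opC i \<mu> f)"
proof -
  have "depends m r (deltaf (xm (Suc i) - xm i) \<mu>)" "depends m r (deltaf (xm i - xm (Suc i)) hm)"
    using assms xm_diff_xvars[of i m "Suc i"] xm_diff_xvars[of "Suc i" m i] hm_chars[of r]
    by (intro depends_deltaf; auto simp: vars_def chars_def)+
  moreover have "depends m r (act_x (simple_refl i) f)"
    unfolding act_x_alt using assms
    by (intro depends_rename renaming_ren_x permutes_swap_id) auto
  ultimately show ?thesis unfolding opC_def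
    using assms by (intro depends_add depends_mult)
qed

lemma simple_refl_renaming: "i \<in> {1..<m} \<Longrightarrow> renaming m r (ren_x (simple_refl i))"
  by (intro renaming_ren_x permutes_swap_id) auto

lemma opC_cong:
  assumes "i \<in> {1..<m}" "mer_eq m r f g"
  shows "mer_eq m r (opC i \<mu> f) (opC i \<mu> g)"
  unfolding opC_def act_x_alt
  by (intro gen_eq_add gen_eq_mult gen_eq_refl open_dom_mult assms gen_eq_rename_mult[OF simple_refl_renaming[OF assms(1)]])

lemma opC_frakA:
  assumes "i \<in> {1..<m}" "nontrivial_char r \<mu>" "f \<in> frakA m r"
  shows "opC i \<mu> f \<in> frakA m r"
proof -
  have "act_x (simple_refl i) f \<in> frakA m r"
    unfolding act_x_alt by (rule frakA_rename[OF simple_refl_renaming[OF assms(1)] assms(3)])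
  thus ?thesis unfolding opC_def
    using assms xm_diff_xvars[of i m "Suc i"] xm_diff_xvars[of "Suc i" m i] hm_chars[of r] hm_nonzero
    by (intro frakA.add frakA.mult frakA.gen) (auto simp: xm_diff_nonzero nontrivial_char_iff chars_def)
qed

lemma generic_thetas:
  assumes "finite L" "\<And>l. l \<in> L \<Longrightarrow> l \<noteq> 0" "\<And>l. l \<in> L \<Longrightarrow> Tau \<notin> Poly_Mapping.keys l"
  shows "generic dom_add (\<lambda>z. Im (z Tau) > 0 \<and> (\<forall>l\<in>L. theta (z Tau) (lin l z) \<noteq> 0))"
proof -
  have "generic dom_add (\<lambda>z. \<forall>l\<in>L. theta (z Tau) (lin l z) \<noteq> 0)"
    using assms by (intro generic_ball_finite generic_theta_nonzero) auto
  thus ?thesis by (rule generic_mono) (auto simp: dom_add_def)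
qed

lemma lin_ren_x:
  assumes "\<mu> \<in> chars r" shows "lin \<mu> (z \<circ> ren_x v) = lin \<mu> z"
  using assms by (intro lin_cong) (auto simp: chars_def muvars_def)

lemma Tau_xm_diff: "Tau \<notin> Poly_Mapping.keys (xm i - xm j)"
  using keys_xm_diff[of i j] by auto

lemma ren_x_simple_refl_twice: "z \<circ> ren_x (simple_refl i) \<circ> ren_x (simple_refl i) = z"
  unfolding comp_assoc ren_x_comp[symmetric] by (simp add: ren_x_id)

text \<open>Both sides are combinations of the six translates of \<open>f\<close> under permutations
  of three variables. For the permutations of length at least two the coefficients coincide term by
  term, for the two simple transpositions they agree by Fay's identity, and for the identity
  permutation by \<open>braid_identity\<close>.\<close>

theorem braid_relation:
  assumes i: "1 \<le> i" "i + 1 < m"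
    and \<mu>: "\<mu> \<in> chars r" "\<mu> \<noteq> 0" and \<nu>: "\<nu> \<in> chars r" "\<nu> \<noteq> 0" and \<mu>\<nu>: "\<mu> + \<nu> \<noteq> 0"
    and f: "depends m r f"
  shows "mer_eq m r (opC i \<mu> (opC (i + 1) (\<mu> + \<nu>) (opC i \<nu> f)))
                  (opC (i + 1) \<nu> (opC i (\<mu> + \<nu>) (opC (i + 1) \<mu> f)))"
proof (subst mer_eq_iff)
  let ?j = "Suc i" let ?k = "Suc (Suc i)"
  have ch: "\<mu> + \<nu> \<in> chars r" using \<mu> \<nu> chars_plus by blast
  show "depends m r (opC i \<mu> (opC (i + 1) (\<mu> + \<nu>) (opC i \<nu> f)))"
    "depends m r (opC (i + 1) \<nu> (opC i (\<mu> + \<nu>) (opC (i + 1) \<mu> f)))"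
    using i by (intro depends_opC \<mu> \<nu> ch f; simp)+
  define \<phi> where "\<phi> z = f (expo z)" for z
  define L where "L = {xm ?j - xm i, xm ?k - xm ?j, xm ?k - xm i, hm, \<mu>, \<nu>, \<mu> + \<nu>}"
  have "generic dom_add (\<lambda>z. Im (z Tau) > 0 \<and> (\<forall>l\<in>L. theta (z Tau) (lin l z) \<noteq> 0))"
    by (rule generic_thetas)
       (use \<mu> \<nu> \<mu>\<nu> ch hm_nonzero in \<open>auto simp: L_def xm_diff_nonzero Tau_xm_diff dest: chars_Tau\<close>)
  thus "gen_eq dom_add (\<lambda>z. opC i \<mu> (opC (i + 1) (\<mu> + \<nu>) (opC i \<nu> f)) (expo z))
     (\<lambda>z. opC (i + 1) \<nu> (opC i (\<mu> + \<nu>) (opC (i + 1) \<mu> f)) (expo z))"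
    unfolding gen_eq_generic
  proof (rule generic_mono)
    fix z :: point
    assume "Im (z Tau) > 0 \<and> (\<forall>l\<in>L. theta (z Tau) (lin l z) \<noteq> 0)"
    hence \<tau>: "Im (z Tau) > 0" and th: "\<And>l. l \<in> L \<Longrightarrow> theta (z Tau) (lin l z) \<noteq> 0" by auto
    define a b h M N where "a = z (Xv ?j) - z (Xv i)" and "b = z (Xv ?k) - z (Xv ?j)" and "h = z (Mv 0)"
      and "M = lin \<mu> z" and "N = lin \<nu> z"
    let ?F = "F (z Tau)" and ?r = "\<lambda>i. ren_x (simple_refl i)"
    have thn: "theta (z Tau) a \<noteq> 0" "theta (z Tau) b \<noteq> 0" "theta (z Tau) (a + b) \<noteq> 0" "theta (z Tau) h \<noteq> 0"
      "theta (z Tau) M \<noteq> 0" "theta (z Tau) N \<noteq> 0" "theta (z Tau) (M + N) \<noteq> 0"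
      using th[of "xm ?j - xm i"] th[of "xm ?k - xm ?j"] th[of "xm ?k - xm i"] th[of hm] th[of \<mu>] th[of \<nu>] th[of "\<mu> + \<nu>"]
      by (simp_all add: L_def lin_minus lin_plus a_def b_def h_def M_def N_def)
    define c where "c = a + b"
    have vals: "z (Xv ?j) - z (Xv i) = a" "z (Xv i) - z (Xv ?j) = - a" "z (Xv ?k) - z (Xv ?j) = b" "z (Xv ?j) - z (Xv ?k) = - b"
      "z (Xv ?k) - z (Xv i) = c" "z (Xv i) - z (Xv ?k) = - c"
      by (simp_all add: a_def b_def c_def)
    have ne: "simple_refl i ?k = ?k" "simple_refl ?j i = i" by (simp_all add: Transposition.transpose_def)
    have ii: "z \<circ> ?r i \<circ> ?r i = z" "z \<circ> ?r ?j \<circ> ?r ?j = z" by (rule ren_x_simple_refl_twice)+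
    have iji: "z \<circ> ?r i \<circ> ?r ?j \<circ> ?r i = z \<circ> ?r ?j \<circ> ?r i \<circ> ?r ?j"
      unfolding comp_assoc ren_x_comp[symmetric]
      by (intro arg_cong[of _ _ "\<lambda>v. z \<circ> ren_x v"]) (auto simp: fun_eq_iff Transposition.transpose_def)
    define \<phi>0 \<phi>1 \<phi>2 \<phi>12 \<phi>21 \<phi>3 where "\<phi>0 = \<phi> z" and "\<phi>1 = \<phi> (z \<circ> ?r i)" and "\<phi>2 = \<phi> (z \<circ> ?r ?j)"
      and "\<phi>12 = \<phi> (z \<circ> ?r i \<circ> ?r ?j)" and "\<phi>21 = \<phi> (z \<circ> ?r ?j \<circ> ?r i)" and "\<phi>3 = \<phi> (z \<circ> ?r i \<circ> ?r ?j \<circ> ?r i)"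
    have L: "opA i \<mu> (opA ?j (\<mu> + \<nu>) (opA i \<nu> \<phi>)) z =
        (?F a M * ?F b (M + N) * ?F a N + ?F (- a) h * ?F c (M + N) * ?F a h) * \<phi>0
      + (?F (- a) h * ?F c (M + N) * ?F (- a) N + ?F a M * ?F b (M + N) * ?F (- a) h) * \<phi>1
      + ?F a M * ?F (- b) h * ?F c N * \<phi>2
      + ?F (- a) h * ?F (- c) h * ?F b N * \<phi>12
      + ?F a M * ?F (- b) h * ?F (- c) h * \<phi>21
      + ?F (- a) h * ?F (- c) h * ?F (- b) h * \<phi>3"
      unfolding opA_def o_apply ren_x.simps transpose_apply_first transpose_apply_second ne ii
        lin_ren_x[OF \<mu>(1)] lin_ren_x[OF \<nu>(1)] lin_plus M_def[symmetric] N_def[symmetric] h_def[symmetric] vals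
        \<phi>0_def[symmetric] \<phi>1_def[symmetric] \<phi>2_def[symmetric] \<phi>12_def[symmetric] \<phi>21_def[symmetric] \<phi>3_def[symmetric]
      by (simp add: ring_distribs add_ac mult_ac)
    have R: "opA ?j \<nu> (opA i (\<mu> + \<nu>) (opA ?j \<mu> \<phi>)) z =
        (?F b N * ?F a (M + N) * ?F b M + ?F (- b) h * ?F c (M + N) * ?F b h) * \<phi>0
      + ?F b N * ?F (- a) h * ?F c M * \<phi>1
      + (?F (- b) h * ?F c (M + N) * ?F (- b) M + ?F b N * ?F a (M + N) * ?F (- b) h) * \<phi>2
      + ?F b N * ?F (- a) h * ?F (- c) h * \<phi>12
      + ?F (- b) h * ?F (- c) h * ?F a M * \<phi>21
      + ?F (- b) h * ?F (- c) h * ?F (- a) h * \<phi>3"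
      unfolding opA_def o_apply ren_x.simps transpose_apply_first transpose_apply_second ne ii iji[symmetric]
        lin_ren_x[OF \<mu>(1)] lin_ren_x[OF \<nu>(1)] lin_plus M_def[symmetric] N_def[symmetric] h_def[symmetric] vals
        \<phi>0_def[symmetric] \<phi>1_def[symmetric] \<phi>2_def[symmetric] \<phi>12_def[symmetric] \<phi>21_def[symmetric] \<phi>3_def[symmetric]
      by (simp add: ring_distribs add_ac mult_ac)
    have c0: "?F a M * ?F b (M + N) * ?F a N + ?F (- a) h * ?F c (M + N) * ?F a h =
        ?F b N * ?F a (M + N) * ?F b M + ?F (- b) h * ?F c (M + N) * ?F b h"
      using braid_identity[OF \<tau> thn(1,2,4,3,5,6,7)] unfolding c_def by (simp add: mult_ac)
    have c1: "?F (- a) h * ?F c (M + N) * ?F (- a) N + ?F a M * ?F b (M + N) * ?F (- a) h =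
        ?F b N * ?F (- a) h * ?F c M"
    proof -
      have "?F b N * ?F c M = ?F b (M + N) * ?F a M + ?F c (M + N) * ?F (- a) N"
        using fay_identity[OF \<tau>, of b c N M] thn unfolding c_def by (simp add: add.commute)
      hence "?F (- a) h * (?F b N * ?F c M) = ?F (- a) h * (?F b (M + N) * ?F a M + ?F c (M + N) * ?F (- a) N)"
        by (rule arg_cong)
      thus ?thesis by (simp add: ring_distribs mult_ac)
    qed
    have c2: "?F a M * ?F (- b) h * ?F c N =
       ?F (- b) h * ?F c (M + N) * ?F (- b) M + ?F b N * ?F a (M + N) * ?F (- b) h"
    proof -
      have "?F a M * ?F c N = ?F a (M + N) * ?F b N + ?F c (M + N) * ?F (- b) M"
        using fay_identity[OF \<tau>, of a c M N] thn unfolding c_def by simp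
      hence "?F (- b) h * (?F a M * ?F c N) = ?F (- b) h * (?F a (M + N) * ?F b N + ?F c (M + N) * ?F (- b) M)"
        by (rule arg_cong)
      thus ?thesis by (simp add: ring_distribs mult_ac)
    qed
    show "opC i \<mu> (opC (i + 1) (\<mu> + \<nu>) (opC i \<nu> f)) (expo z) = opC (i + 1) \<nu> (opC i (\<mu> + \<nu>) (opC (i + 1) \<mu> f)) (expo z)"
      unfolding opC_expo[OF \<mu>(1)] opC_expo[OF \<nu>(1)] opC_expo[OF ch] \<phi>_def[symmetric] Suc_eq_plus1[symmetric] L R c0 c1 c2
      by (simp add: mult_ac)
  qed
qed

text \<open>Transpositions that are far apart commute and fix each other's arguments, so the two
  sides agree at every additive point and no theta identity enters.\<close>

lemma opC_commute:
  assumes "i \<in> {1..<m}" "j \<in> {1..<m}" "Suc i < j" and \<mu>: "\<mu> \<in> chars r" and \<nu>: "\<nu> \<in> chars r" and f: "depends m r f"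
  shows "mer_eq m r (opC i \<mu> (opC j \<nu> f)) (opC j \<nu> (opC i \<mu> f))"
proof (subst mer_eq_iff)
  show "depends m r (opC i \<mu> (opC j \<nu> f))" "depends m r (opC j \<nu> (opC i \<mu> f))"
    using assms by (intro depends_opC; simp)+
  have "opC i \<mu> (opC j \<nu> f) (expo z) = opC j \<nu> (opC i \<mu> f) (expo z)" for z
  proof -
    let ?r = "\<lambda>i. ren_x (simple_refl i)"
    have ne: "simple_refl i j = j" "simple_refl i (Suc j) = Suc j" "simple_refl j i = i" "simple_refl j (Suc i) = Suc i"
      using assms by (simp_all add: Transposition.transpose_def)
    have ij: "z \<circ> ?r i \<circ> ?r j = z \<circ> ?r j \<circ> ?r i"
      unfolding comp_assoc ren_x_comp[symmetric] using assms
      by (intro arg_cong[of _ _ "\<lambda>v. z \<circ> ren_x v"]) (auto simp: fun_eq_iff Transposition.transpose_def)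
    show ?thesis
      unfolding opC_expo[OF \<mu>] opC_expo[OF \<nu>] opA_def o_apply ren_x.simps ne ij lin_ren_x[OF \<mu>] lin_ren_x[OF \<nu>]
      by (simp add: ring_distribs mult_ac)
  qed
  thus "gen_eq dom_add (\<lambda>z. opC i \<mu> (opC j \<nu> f) (expo z)) (\<lambda>z. opC j \<nu> (opC i \<mu> f) (expo z))"
    by (simp add: gen_eq_refl)
qed

text \<open>The operation with parameter \<open>- \<nu>\<close> cancels the transposed term and
  leaves a scalar multiple of \<open>f\<close>. The numerator of the scalar contains theta of
  \<open>\<nu> + h\<close> and of \<open>\<nu> - h\<close>, which are generically nonzero as
  \<open>\<nu>\<close> is neither \<open>- h\<close> nor \<open>h\<close>.\<close>

lemma opC_nonzero:
  assumes i: "i \<in> {1..<m}" and \<nu>: "\<nu> \<in> chars r" "\<nu> \<noteq> 0" "\<nu> \<noteq> hm" "\<nu> \<noteq> - hm"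
    and f: "depends m r f" "\<not> mer_eq m r f (\<lambda>p. 0)"
  shows "\<not> mer_eq m r (opC i \<nu> f) (\<lambda>p. 0)"
proof
  assume "mer_eq m r (opC i \<nu> f) (\<lambda>p. 0)"
  hence "mer_eq m r (opC i (- \<nu>) (opC i \<nu> f)) (opC i (- \<nu>) (\<lambda>p. 0))" by (rule opC_cong[OF i])
  hence "mer_eq m r (opC i (- \<nu>) (opC i \<nu> f)) (\<lambda>p. 0)" by (simp add: opC_def[of _ _ "\<lambda>p. 0"] act_x_alt)
  moreover have \<nu>': "- \<nu> \<in> chars r" using chars_minus[of 0 r \<nu>] \<nu> by simp
  ultimately have "generic dom_add (\<lambda>z. opC i (- \<nu>) (opC i \<nu> f) (expo z) = 0)"
    using mer_eq_0_iff[OF depends_opC[OF \<nu>' i depends_opC[OF \<nu>(1) i f(1)]]] by (simp add: gen_eq_generic)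
  moreover define L where "L = {xm (Suc i) - xm i, hm, \<nu>, \<nu> + hm, \<nu> - hm}"
  have "generic dom_add (\<lambda>z. Im (z Tau) > 0 \<and> (\<forall>l\<in>L. theta (z Tau) (lin l z) \<noteq> 0))"
  proof (rule generic_thetas)
    show "l \<noteq> 0" if "l \<in> L" for l
      using that \<nu> hm_nonzero by (auto simp: L_def xm_diff_nonzero eq_neg_iff_add_eq_0)
    show "Tau \<notin> Poly_Mapping.keys l" if "l \<in> L" for l
      using that chars_Tau[of _ r] chars_plus[OF \<nu>(1) hm_chars] chars_minus[OF \<nu>(1) hm_chars] \<nu>(1)
      by (auto simp: L_def Tau_xm_diff)
  qed (simp add: L_def)
  ultimately have "generic dom_add (\<lambda>z. f (expo z) = 0)"
  proof (rule generic_mono2)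
    fix z :: point
    assume 0: "opC i (- \<nu>) (opC i \<nu> f) (expo z) = 0"
      and "Im (z Tau) > 0 \<and> (\<forall>l\<in>L. theta (z Tau) (lin l z) \<noteq> 0)"
    hence \<tau>: "Im (z Tau) > 0" and th: "\<And>l. l \<in> L \<Longrightarrow> theta (z Tau) (lin l z) \<noteq> 0" by auto
    define a h N where "a = z (Xv (Suc i)) - z (Xv i)" and "h = z (Mv 0)" and "N = lin \<nu> z"
    have thn: "theta (z Tau) a \<noteq> 0" "theta (z Tau) h \<noteq> 0" "theta (z Tau) N \<noteq> 0" "theta (z Tau) (N + h) \<noteq> 0" "theta (z Tau) (N - h) \<noteq> 0"
      using th[of "xm (Suc i) - xm i"] th[of hm] th[of \<nu>] th[of "\<nu> + hm"] th[of "\<nu> - hm"]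
      by (simp_all add: L_def lin_minus lin_plus a_def h_def N_def)
    let ?F = "F (z Tau)" and ?r = "ren_x (simple_refl i)"
    have vals: "z (Xv (Suc i)) - z (Xv i) = a" "z (Xv i) - z (Xv (Suc i)) = - a" by (simp_all add: a_def)
    define \<phi> where "\<phi> z = f (expo z)" for z
    have "opA i (- \<nu>) (opA i \<nu> \<phi>) z = (?F a (- N) * ?F a N + ?F (- a) h * ?F a h) * \<phi> z +
        (?F a (- N) * ?F (- a) h + ?F (- a) h * ?F (- a) N) * \<phi> (z \<circ> ?r)"
      unfolding opA_def o_apply ren_x.simps transpose_apply_first transpose_apply_second ren_x_simple_refl_twice
        lin_ren_x[OF \<nu>(1)] lin_uminus N_def[symmetric] h_def[symmetric] vals
      by (simp add: ring_distribs mult_ac)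
    \<comment> \<open>Since \<open>F\<close> changes sign when both arguments do, the two
      coefficients of the transposed term cancel.\<close>
    moreover have "?F a (- N) = - ?F (- a) N" using F_uminus[of "z Tau" "-a" N] by simp
    ultimately have "opA i (- \<nu>) (opA i \<nu> \<phi>) z = (?F (- a) h * ?F a h - ?F (- a) N * ?F a N) * \<phi> z"
      by (simp add: algebra_simps)
    also have "\<dots> = (deriv (theta (z Tau)) 0)\<^sup>2 * theta (z Tau) (N + h) * theta (z Tau) (N - h) / ((theta (z Tau) h)\<^sup>2 * (theta (z Tau) N)\<^sup>2) * \<phi> z"
      using F_mult_uminus_diff'[OF \<tau> thn(1,3,2)] by simp
    finally have "opA i (- \<nu>) (opA i \<nu> \<phi>) z = \<dots>" .
    moreover have "opA i (- \<nu>) (opA i \<nu> \<phi>) z = 0"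
      using 0 unfolding opC_expo[OF \<nu>'] opC_expo[OF \<nu>(1)] \<phi>_def[symmetric] .
    ultimately show "f (expo z) = 0" using thn deriv_theta_0_nonzero[OF \<tau>] by (simp add: \<phi>_def)
  qed
  thus False using f mer_eq_0_iff[OF f(1)] by (simp add: gen_eq_generic)
qed

section \<open>Purity of the operations\<close>

lemma bil_rename:
  assumes "i \<in> {1..<m}" "\<And>j. A j \<in> chars r"
  shows "bil m A (z \<circ> ren_x (simple_refl i)) = bil m (A \<circ> simple_refl i) z"
proof -
  have "bil m A (z \<circ> ren_x (simple_refl i)) = (\<Sum>j\<le>m. z (Xv (simple_refl i j)) * lin (A j) z)"
    unfolding bil_def lin_ren_x[OF assms(2)] by simp
  also have "\<dots> = (\<Sum>j\<le>m. z (Xv j) * lin (A (simple_refl i j)) z)"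
    using assms(1)
    by (intro sum.reindex_bij_witness[of _ "simple_refl i" "simple_refl i"]) (auto simp: Transposition.transpose_def)
  finally show ?thesis by (simp add: bil_def)
qed

lemma bil_split:
  assumes "i \<in> {1..<m}"
  shows "bil m A z = z (Xv i) * lin (A i) z + z (Xv (Suc i)) * lin (A (Suc i)) z
    + (\<Sum>j\<in>{..m} - {i, Suc i}. z (Xv j) * lin (A j) z)"
proof -
  have "{..m} = insert i (insert (Suc i) ({..m} - {i, Suc i}))" using assms by auto
  hence "bil m A z = (\<Sum>j\<in>insert i (insert (Suc i) ({..m} - {i, Suc i})). z (Xv j) * lin (A j) z)"
    unfolding bil_def by simp
  also have "\<dots> = z (Xv i) * lin (A i) z + z (Xv (Suc i)) * lin (A (Suc i)) z
    + (\<Sum>j\<in>{..m} - {i, Suc i}. z (Xv j) * lin (A j) z)"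
    by (subst sum.insert; simp)+
  finally show ?thesis .
qed

text \<open>The types of the two summands differ by the product of the linear form of
  \<open>x\<close> at \<open>Suc i\<close> minus \<open>x\<close> at \<open>i\<close> with
  \<open>\<mu> - (A i - A (Suc i) - h)\<close>, so they agree exactly if the second factor is
  zero.\<close>

lemma balanced_bil:
  assumes i: "i \<in> {1..<m}" and A: "\<And>j. A j \<in> chars r" and \<mu>: "\<mu> \<in> chars r"
  shows "balanced i \<mu> (bil m A) \<longleftrightarrow> \<mu> = A i - A (Suc i) - hm"
proof -
  have diff: "lin (xm (Suc i) - xm i) z * lin \<mu> z + bil m A z - (lin (xm i - xm (Suc i)) z * lin hm z + act_x (simple_refl i) (bil m A) z)
     = (z (Xv (Suc i)) - z (Xv i)) * (lin \<mu> z - lin (A i - A (Suc i) - hm) z)" for z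
  proof -
    have "(\<Sum>j\<in>{..m} - {i, Suc i}. z (Xv j) * lin (A (simple_refl i j)) z) = (\<Sum>j\<in>{..m} - {i, Suc i}. z (Xv j) * lin (A j) z)"
      by (intro sum.cong) (auto simp: Transposition.transpose_def)
    thus ?thesis unfolding act_x_alt bil_rename[OF i A] unfolding bil_split[OF i]
      by (simp add: lin_minus lin_plus algebra_simps)
  qed
  have "balanced i \<mu> (bil m A) \<longleftrightarrow> (\<forall>z. (z (Xv (Suc i)) - z (Xv i)) * (lin \<mu> z - lin (A i - A (Suc i) - hm) z) = 0)"
    unfolding balanced_def fun_eq_iff diff[symmetric] by simp
  also have "\<dots> \<longleftrightarrow> \<mu> = A i - A (Suc i) - hm"
  proof
    assume 0: "\<forall>z. (z (Xv (Suc i)) - z (Xv i)) * (lin \<mu> z - lin (A i - A (Suc i) - hm) z) = 0"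
    have ch: "A i - A (Suc i) - hm \<in> chars r" by (intro chars_minus A hm_chars)
    show "\<mu> = A i - A (Suc i) - hm"
    proof (rule lin_eq_imp_eq)
      fix z :: point
      \<comment> \<open>Setting these two coordinates makes the first factor equal to 1 without
        affecting any character.\<close>
      define y where "y = z(Xv i := 0, Xv (Suc i) := 1)"
      have "lin l y = lin l z" if "l \<in> chars r" for l
        using that by (intro lin_cong) (auto simp: chars_def muvars_def y_def)
      moreover have "lin \<mu> y - lin (A i - A (Suc i) - hm) y = 0"
        using 0[rule_format, of y] by (simp add: y_def)
      ultimately show "lin \<mu> z = lin (A i - A (Suc i) - hm) z" using \<mu> ch by simp
    qed
  qed simp
  finally show ?thesis .
qed

lemma F_generic_nonzero:
  assumes "l1 \<noteq> 0" "Poly_Mapping.keys l1 \<subseteq> xvars m" "l2 \<noteq> 0" "l2 \<in> chars r"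
  shows "generic dom_add (\<lambda>z. deltaf l1 l2 (expo z) \<noteq> 0)"
proof -
  have T: "Tau \<notin> Poly_Mapping.keys l1" "Tau \<notin> Poly_Mapping.keys l2"
    using assms(2) Tau_notin_vars(2)[of m] chars_Tau[OF assms(4)] by blast+
  have "l1 + l2 \<noteq> 0"
  proof
    assume 0: "l1 + l2 = 0"
    obtain v where v: "v \<in> Poly_Mapping.keys l1" using assms(1) by fastforce
    hence "v \<notin> Poly_Mapping.keys l2" using assms by (auto simp: xvars_def muvars_def chars_def)
    hence "Poly_Mapping.lookup (l1 + l2) v \<noteq> 0" using v by (simp add: lookup_add in_keys_iff)
    thus False using 0 by simp
  qed
  moreover have "Tau \<notin> Poly_Mapping.keys (l1 + l2)" using T Poly_Mapping.keys_add[of l1 l2] by blast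
  ultimately have "generic dom_add (\<lambda>z. Im (z Tau) > 0 \<and> (\<forall>l\<in>{l1, l2, l1 + l2}. theta (z Tau) (lin l z) \<noteq> 0))"
    by (intro generic_thetas) (use assms T in auto)
  thus ?thesis
    by (rule generic_mono) (auto simp: deltaf_expo[OF T] F_def lin_plus deriv_theta_0_nonzero)
qed

lemma deltaf_mult_nonzero:
  assumes "l1 \<noteq> 0" "Poly_Mapping.keys l1 \<subseteq> xvars m" "l2 \<noteq> 0" "l2 \<in> chars r" "depends m r f" "\<not> mer_eq m r f (\<lambda>p. 0)"
  shows "\<not> gen_eq dom_add (\<lambda>z. deltaf l1 l2 (expo z) * f (expo z)) (\<lambda>z. 0)"
proof
  assume "gen_eq dom_add (\<lambda>z. deltaf l1 l2 (expo z) * f (expo z)) (\<lambda>z. 0)"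
  hence "generic dom_add (\<lambda>z. f (expo z) = 0)"
    unfolding gen_eq_generic using F_generic_nonzero[OF assms(1-4)]
    by (rule generic_mono2) simp
  thus False using assms(5,6) mer_eq_0_iff[OF assms(5)] by (simp add: gen_eq_generic)
qed

lemma summand_types:
  assumes i: "i \<in> {1..<m}" and \<nu>: "nontrivial_char r \<nu>" and f: "has_type m r f Q"
  shows "has_type m r (\<lambda>p. deltaf (xm (Suc i) - xm i) \<nu> p * f p) (\<lambda>z. lin (xm (Suc i) - xm i) z * lin \<nu> z + Q z)"
    "has_type m r (\<lambda>p. deltaf (xm i - xm (Suc i)) hm p * act_x (simple_refl i) f p)
       (\<lambda>z. lin (xm i - xm (Suc i)) z * lin hm z + act_x (simple_refl i) Q z)"
proof -
  have "has_type m r (deltaf (xm (Suc i) - xm i) \<nu>) (\<lambda>z. lin (xm (Suc i) - xm i) z * lin \<nu> z)"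
    using i \<nu> xm_diff_xvars[of "Suc i" m i] by (intro has_type_deltaf) (auto simp: xm_diff_nonzero nontrivial_char_iff chars_def)
  thus "has_type m r (\<lambda>p. deltaf (xm (Suc i) - xm i) \<nu> p * f p) (\<lambda>z. lin (xm (Suc i) - xm i) z * lin \<nu> z + Q z)"
    using f by (rule has_type_mult)
  have "has_type m r (deltaf (xm i - xm (Suc i)) hm) (\<lambda>z. lin (xm i - xm (Suc i)) z * lin hm z)"
    using i xm_diff_xvars[of i m "Suc i"] hm_nonzero hm_chars[of r] by (intro has_type_deltaf) (auto simp: xm_diff_nonzero chars_def)
  moreover have "has_type m r (act_x (simple_refl i) f) (act_x (simple_refl i) Q)"
    unfolding act_x_alt by (rule has_type_rename[OF simple_refl_renaming[OF i] f])
  ultimately show "has_type m r (\<lambda>p. deltaf (xm i - xm (Suc i)) hm p * act_x (simple_refl i) f p)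
       (\<lambda>z. lin (xm i - xm (Suc i)) z * lin hm z + act_x (simple_refl i) Q z)"
    by (rule has_type_mult)
qed

text \<open>Both summands of the operation are nonzero, so purity of the sum forces their types to
  coincide by \<open>type_sum_unique\<close>; conversely, functions of equal type add up to one of
  that type.\<close>

lemma pure_opC_iff:
  assumes f: "f \<in> frakA m r" "\<not> mer_eq m r f (\<lambda>p. 0)" "has_type m r f Q" and i: "i \<in> {1..<m}" and \<nu>: "nontrivial_char r \<nu>"
  shows "pure m r (opC i \<nu> f) \<longleftrightarrow> balanced i \<nu> Q"
proof
  note t = summand_types[OF i \<nu> f(3)]
  {
    assume "balanced i \<nu> Q"
    hence "has_type m r (opC i \<nu> f) (\<lambda>z. lin (xm (Suc i) - xm i) z * lin \<nu> z + Q z)"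
      unfolding opC_def balanced_def using t by (intro has_type_plus) simp_all
    thus "pure m r (opC i \<nu> f)" by (auto simp: pure_def)
  next
    assume "pure m r (opC i \<nu> f)"
    then obtain R where R: "has_type m r (opC i \<nu> f) R" by (auto simp: pure_def)
    note dep = frakA_depends[OF f(1)]
    have g: "depends m r (act_x (simple_refl i) f)" "\<not> mer_eq m r (act_x (simple_refl i) f) (\<lambda>p. 0)"
      unfolding act_x_alt using simple_refl_renaming[OF i] depends_rename dep gen_eq_rename_0 f(2) by blast+
    have nz: "\<not> gen_eq dom_add (\<lambda>z. deltaf (xm (Suc i) - xm i) \<nu> (expo z) * f (expo z)) (\<lambda>z. 0)"
      using i \<nu> f(2) dep xm_diff_xvars[of "Suc i" m i]
      by (intro deltaf_mult_nonzero) (auto simp: xm_diff_nonzero nontrivial_char_iff)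
    have nz': "\<not> gen_eq dom_add (\<lambda>z. deltaf (xm i - xm (Suc i)) hm (expo z) * act_x (simple_refl i) f (expo z)) (\<lambda>z. 0)"
      using i g xm_diff_xvars[of i m "Suc i"] hm_nonzero
      by (intro deltaf_mult_nonzero) (auto simp: xm_diff_nonzero)
    show "balanced i \<nu> Q" unfolding balanced_def
      using t R nz nz' unfolding has_type_iff_add opC_def by (rule type_sum_unique)
  }
qed

lemma frakA_pure_bil:
  assumes "f \<in> frakA m r" "pure m r f" "\<not> mer_eq m r f (\<lambda>p. 0)"
  obtains A where "\<And>j. A j \<in> chars r" "has_type m r f (bil m A)"
proof -
  obtain Q where Q: "has_type m r f Q" using assms(2) by (auto simp: pure_def)
  thus ?thesis using frakA_type_bil[OF assms(1) Q assms(3)] that unfolding bils_def by blast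
qed

lemma frakA_type_unique:
  assumes "f \<in> frakA m r" "\<not> mer_eq m r f (\<lambda>p. 0)" "has_type m r f P" "has_type m r f Q"
  shows "P = Q"
  using assms mer_eq_0_iff[OF frakA_depends[OF assms(1)]] type_unique unfolding has_type_iff_add by blast

text \<open>The parameter is \<open>A i - A (Suc i) - h\<close> if \<open>f\<close> has type
  \<open>bil m A\<close>. It may be trivial, and then no nontrivial parameter gives a pure function;
  the balance of types still identifies it.\<close>

theorem unique_purifying_parameter:
  assumes f: "f \<in> frakA m r" "pure m r f" "\<not> mer_eq m r f (\<lambda>p. 0)" and i: "i \<in> {1..<m}"
  shows "\<exists>!\<mu>. is_char r \<mu> \<and> (\<forall>Q. has_type m r f Q \<longrightarrow> balanced i \<mu> Q) \<and>
             (\<forall>\<nu>. nontrivial_char r \<nu> \<longrightarrow> (pure m r (opC i \<nu> f) \<longleftrightarrow> \<nu> = \<mu>))"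
proof -
  obtain A where A: "\<And>j. A j \<in> chars r" "has_type m r f (bil m A)" by (rule frakA_pure_bil[OF f]) blast
  let ?\<mu> = "A i - A (Suc i) - hm"
  have ch: "?\<mu> \<in> chars r" by (intro chars_minus A hm_chars)
  have bal: "balanced i \<nu> (bil m A) \<longleftrightarrow> \<nu> = ?\<mu>" if "\<nu> \<in> chars r" for \<nu>
    by (rule balanced_bil[OF i A(1) that])
  show ?thesis
  proof (rule ex1I[of _ ?\<mu>])
    show "is_char r ?\<mu> \<and> (\<forall>Q. has_type m r f Q \<longrightarrow> balanced i ?\<mu> Q) \<and>
             (\<forall>\<nu>. nontrivial_char r \<nu> \<longrightarrow> (pure m r (opC i \<nu> f) \<longleftrightarrow> \<nu> = ?\<mu>))"
    proof (intro conjI allI impI)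
      fix Q assume "has_type m r f Q"
      hence "Q = bil m A" using frakA_type_unique[OF f(1,3)] A(2) by blast
      thus "balanced i ?\<mu> Q" using bal[OF ch] by simp
    next
      fix \<nu> assume "nontrivial_char r \<nu>"
      thus "pure m r (opC i \<nu> f) \<longleftrightarrow> \<nu> = ?\<mu>"
        using pure_opC_iff[OF f(1,3) A(2) i] bal[of \<nu>] by (simp add: nontrivial_char_iff)
    qed (simp add: is_char_iff ch)
  next
    fix \<mu> assume "is_char r \<mu> \<and> (\<forall>Q. has_type m r f Q \<longrightarrow> balanced i \<mu> Q) \<and>
             (\<forall>\<nu>. nontrivial_char r \<nu> \<longrightarrow> (pure m r (opC i \<nu> f) \<longleftrightarrow> \<nu> = \<mu>))"
    thus "\<mu> = ?\<mu>" using bal[of \<mu>] A(2) by (simp add: is_char_iff)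
  qed
qed

text \<open>The characters at \<open>i\<close> and \<open>Suc i\<close> are exchanged, one gaining
  and the other losing an \<open>h\<close>. Adding \<open>j * h\<close> to the character at each
  \<open>j\<close> turns this into a plain exchange, which is the reason for
  \<open>shifted\<close>.\<close>

lemma has_type_opC_bil:
  assumes f: "f \<in> frakA m r" "has_type m r f (bil m A)" and A: "\<And>j. A j \<in> chars r" and i: "i \<in> {1..<m}"
    and \<nu>: "\<nu> = A i - A (Suc i) - hm" "\<nu> \<noteq> 0"
  shows "has_type m r (opC i \<nu> f) (bil m (A(i := A (Suc i) + hm, Suc i := A i - hm)))"
proof -
  have ch: "\<nu> \<in> chars r" unfolding \<nu>(1) by (intro chars_minus A hm_chars)
  have nt: "nontrivial_char r \<nu>" using ch \<nu> by (simp add: nontrivial_char_iff)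
  have "balanced i \<nu> (bil m A)" using balanced_bil[OF i A ch] \<nu>(1) by simp
  hence "has_type m r (opC i \<nu> f) (\<lambda>z. lin (xm (Suc i) - xm i) z * lin \<nu> z + bil m A z)"
    unfolding opC_def balanced_def using summand_types[OF i nt f(2)] by (intro has_type_plus) simp_all
  also have "(\<lambda>z. lin (xm (Suc i) - xm i) z * lin \<nu> z + bil m A z) = bil m (A(i := A (Suc i) + hm, Suc i := A i - hm))"
  proof
    fix z
    have "(\<Sum>j\<in>{..m} - {i, Suc i}. z (Xv j) * lin ((A(i := A (Suc i) + hm, Suc i := A i - hm)) j) z) =
       (\<Sum>j\<in>{..m} - {i, Suc i}. z (Xv j) * lin (A j) z)"
      by (intro sum.cong) auto
    thus "lin (xm (Suc i) - xm i) z * lin \<nu> z + bil m A z = bil m (A(i := A (Suc i) + hm, Suc i := A i - hm)) z"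
      unfolding bil_split[OF i] \<nu>(1) by (simp add: lin_minus lin_plus algebra_simps)
  qed
  finally show ?thesis .
qed

section \<open>Reduced words in the symmetric group\<close>

lemma word_perm_Nil [simp]: "word_perm [] = id"
  by (simp add: word_perm_def)

lemma word_perm_Cons [simp]: "word_perm (i # ws) = simple_refl i \<circ> word_perm ws"
  by (simp add: word_perm_def)

lemma word_perm_append: "word_perm (us @ vs) = word_perm us \<circ> word_perm vs"
  by (induction us) (simp_all add: o_assoc)

lemma simple_refl_permutes: "i \<in> {1..<m} \<Longrightarrow> simple_refl i permutes {1..m}"
  by (intro permutes_swap_id) auto

lemma simple_refl_invol [simp]: "simple_refl i \<circ> (simple_refl i \<circ> w) = w" "w \<circ> simple_refl i \<circ> simple_refl i = w"
  by (simp_all add: fun_eq_iff)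

lemma word_perm_permutes: "set ws \<subseteq> {1..<m} \<Longrightarrow> word_perm ws permutes {1..m}"
proof (induction ws)
  case (Cons i ws)
  hence "word_perm ws permutes {1..m}" "simple_refl i permutes {1..m}"
    using simple_refl_permutes[of i m] by auto
  thus ?case unfolding word_perm_Cons by (rule permutes_compose)
qed (simp add: permutes_id)

section \<open>Length as the number of inversions\<close>

definition invs :: "nat \<Rightarrow> (nat \<Rightarrow> nat) \<Rightarrow> (nat \<times> nat) set" where
  "invs m w = {(a, b). a \<in> {1..m} \<and> b \<in> {1..m} \<and> a < b \<and> w b < w a}"

definition ninv :: "nat \<Rightarrow> (nat \<Rightarrow> nat) \<Rightarrow> nat" where
  "ninv m w = card (invs m w)"

lemma finite_invs [simp]: "finite (invs m w)"
  by (rule finite_subset[of _ "{1..m} \<times> {1..m}"]) (auto simp: invs_def)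

lemma ninv_id: "ninv m id = 0"
proof -
  have "invs m id = {}" by (auto simp: invs_def)
  thus ?thesis unfolding ninv_def by (simp only: card.empty)
qed

lemma simple_refl_less_iff:
  assumes "(a, b) \<noteq> (k, Suc k)" "(b, a) \<noteq> (k, Suc k)"
  shows "simple_refl k a < simple_refl k b \<longleftrightarrow> a < b"
  using assms by (auto simp: Transposition.transpose_def)

text \<open>Exchanging the positions \<open>k\<close> and \<open>Suc k\<close> carries old
  inversions to inversions and creates only the pair \<open>(k, Suc k)\<close>.\<close>

lemma ninv_right_up:
  assumes k: "k \<in> {1..<m}" and less: "w k < w (Suc k)"
  shows "ninv m (w \<circ> simple_refl k) = ninv m w + 1"
proof -
  let ?s = "simple_refl k"
  define \<phi> where "\<phi> = map_prod ?s ?s"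
  have \<phi>\<phi>: "\<phi> (\<phi> x) = x" for x by (cases x) (simp add: \<phi>_def)
  have s: "?s a \<in> {1..m} \<longleftrightarrow> a \<in> {1..m}" for a
    using permutes_in_image[OF simple_refl_permutes[OF k]] .
  have fwd: "\<phi> x \<in> invs m (w \<circ> ?s) - {(k, Suc k)}" if x: "x \<in> invs m w" for x
  proof -
    obtain a b where ab: "x = (a, b)" "a \<in> {1..m}" "b \<in> {1..m}" "a < b" "w b < w a"
      using x by (auto simp: invs_def)
    have "(a, b) \<noteq> (k, Suc k)" using ab less by auto
    moreover have "(b, a) \<noteq> (k, Suc k)" using ab by auto
    ultimately have "?s a < ?s b" using simple_refl_less_iff[of a b k] ab(4) by simp
    moreover have "(?s a, ?s b) \<noteq> (k, Suc k)"
    proof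
      assume "(?s a, ?s b) = (k, Suc k)"
      hence "?s (?s a) = ?s k" "?s (?s b) = ?s (Suc k)" by simp_all
      thus False using ab(4) by simp
    qed
    moreover have "?s a \<in> {1..m}" "?s b \<in> {1..m}" using s ab by blast+
    ultimately show ?thesis using ab(5) unfolding ab(1) invs_def \<phi>_def by simp
  qed
  have bwd: "\<phi> x \<in> invs m w" if x: "x \<in> invs m (w \<circ> ?s) - {(k, Suc k)}" for x
  proof -
    obtain a b where ab: "x = (a, b)" "a \<in> {1..m}" "b \<in> {1..m}" "a < b" "w (?s b) < w (?s a)" "(a, b) \<noteq> (k, Suc k)"
      using x by (auto simp: invs_def)
    have "(b, a) \<noteq> (k, Suc k)" using ab by auto
    hence "?s a < ?s b" using simple_refl_less_iff[of a b k] ab(4,6) by simp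
    moreover have "?s a \<in> {1..m}" "?s b \<in> {1..m}" using s ab by blast+
    ultimately show ?thesis using ab(5) unfolding ab(1) invs_def \<phi>_def by simp
  qed
  have "bij_betw \<phi> (invs m w) (invs m (w \<circ> ?s) - {(k, Suc k)})"
  proof (rule bij_betw_byWitness[of _ \<phi>])
    show "\<phi> ` invs m w \<subseteq> invs m (w \<circ> ?s) - {(k, Suc k)}"
      by (rule image_subsetI) (rule fwd)
    show "\<phi> ` (invs m (w \<circ> ?s) - {(k, Suc k)}) \<subseteq> invs m w"
      by (rule image_subsetI) (rule bwd)
  qed (simp_all add: \<phi>\<phi>)
  hence "card (invs m w) = card (invs m (w \<circ> ?s) - {(k, Suc k)})" by (rule bij_betw_same_card)
  moreover have "(k, Suc k) \<in> invs m (w \<circ> ?s)" using k less by (auto simp: invs_def)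
  ultimately show ?thesis unfolding ninv_def using card_Suc_Diff1[of "invs m (w \<circ> ?s)" "(k, Suc k)"] by simp
qed

lemma ninv_right_down:
  assumes k: "k \<in> {1..<m}" and less: "w (Suc k) < w k"
  shows "ninv m (w \<circ> simple_refl k) + 1 = ninv m w"
  using ninv_right_up[OF k, of "w \<circ> simple_refl k"] less by simp

lemma ninv_inv:
  assumes w: "w permutes {1..m}"
  shows "ninv m (inv w) = ninv m w"
proof -
  have "bij_betw (\<lambda>(a, b). (w b, w a)) (invs m w) (invs m (inv w))"
    by (rule bij_betw_byWitness[of _ "\<lambda>(a, b). (inv w b, inv w a)"])
       (use permutes_in_image[OF w] permutes_in_image[OF permutes_inv[OF w]] permutes_inverses[OF w] in \<open>auto simp: invs_def\<close>)
  thus ?thesis unfolding ninv_def using bij_betw_same_card by metis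
qed

lemma inv_simple_refl_comp:
  assumes "w permutes {1..m}"
  shows "inv (simple_refl i \<circ> w) = inv w \<circ> simple_refl i"
  using o_inv_distrib[of "simple_refl i" w] permutes_bij[OF assms] by simp

lemma ninv_left_up:
  assumes w: "w permutes {1..m}" and i: "i \<in> {1..<m}" and less: "inv w i < inv w (Suc i)"
  shows "ninv m (simple_refl i \<circ> w) = ninv m w + 1"
proof -
  have "simple_refl i \<circ> w permutes {1..m}"
    using permutes_compose[OF w simple_refl_permutes[OF i]] .
  hence "ninv m (simple_refl i \<circ> w) = ninv m (inv w \<circ> simple_refl i)"
    using ninv_inv inv_simple_refl_comp[OF w] by metis
  thus ?thesis using ninv_right_up[OF i less] ninv_inv[OF w] by simp
qed

lemma ninv_left_down:
  assumes w: "w permutes {1..m}" and i: "i \<in> {1..<m}" and less: "inv w (Suc i) < inv w i"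
  shows "ninv m (simple_refl i \<circ> w) + 1 = ninv m w"
proof -
  have p: "simple_refl i \<circ> w permutes {1..m}"
    using permutes_compose[OF w simple_refl_permutes[OF i]] .
  have "inv (simple_refl i \<circ> w) i < inv (simple_refl i \<circ> w) (Suc i)"
    unfolding inv_simple_refl_comp[OF w] using less by simp
  from ninv_left_up[OF p i this] show ?thesis by simp
qed

lemma left_descent_cases:
  assumes w: "w permutes {1..m}"
  shows "inv w i < inv w (Suc i) \<or> inv w (Suc i) < inv w i"
  using permutes_inj[OF permutes_inv[OF w]] by (metis injD linorder_neqE_nat n_not_Suc_n)

text \<open>Lower bounds for the values propagate upwards from 1, upper bounds downwards from
  \<open>m\<close>.\<close>

lemma permutes_increasing_id:
  assumes w: "w permutes {1..m}" and inc: "\<And>k. k \<in> {1..<m} \<Longrightarrow> w k < w (Suc k)"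
  shows "w = id"
proof -
  have ge: "k \<le> w k" if "k \<in> {1..m}" for k
    using that
  proof (induction k)
    case (Suc k)
    show ?case
    proof (cases "k = 0")
      case True thus ?thesis using permutes_in_image[OF w, of 1] Suc.prems by auto
    next
      case False
      hence "k \<le> w k" "w k < w (Suc k)" using Suc inc[of k] by auto
      thus ?thesis by simp
    qed
  qed simp
  have le: "w (m - j) \<le> m - j" if "j < m" for j
    using that
  proof (induction j)
    case 0
    thus ?case using permutes_in_image[OF w, of m] by auto
  next
    case (Suc j)
    hence "w (m - j) \<le> m - j" "w (m - Suc j) < w (Suc (m - Suc j))" using inc[of "m - Suc j"] by auto
    moreover have "Suc (m - Suc j) = m - j" using Suc.prems by simp
    ultimately show ?case by simp
  qed
  show "w = id"
  proof
    fix k show "w k = id k"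
    proof (cases "k \<in> {1..m}")
      case True
      thus ?thesis using ge[of k] le[of "m - k"] by auto
    qed (use permutes_not_in[OF w] in auto)
  qed
qed

text \<open>Bubble sort: a permutation that is not increasing has a descent, and undoing it on the
  right removes exactly one inversion.\<close>

lemma exists_word:
  assumes "w permutes {1..m}"
  shows "\<exists>ws. set ws \<subseteq> {1..<m} \<and> word_perm ws = w \<and> length ws = ninv m w"
  using assms
proof (induction "ninv m w" arbitrary: w rule: less_induct)
  case less
  show ?case
  proof (cases "\<forall>k\<in>{1..<m}. w k < w (Suc k)")
    case True
    hence "w = id" using permutes_increasing_id[OF less.prems] by blast
    hence "set [] \<subseteq> {1..<m} \<and> word_perm [] = w \<and> length ([] :: nat list) = ninv m w"
      using ninv_id[of m] by simp
    thus ?thesis by blast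
  next
    case False
    then obtain k where k: "k \<in> {1..<m}" "\<not> w k < w (Suc k)" by blast
    moreover have "w k \<noteq> w (Suc k)" using permutes_inj[OF less.prems] by (metis injD n_not_Suc_n)
    ultimately have "w (Suc k) < w k" by simp
    from ninv_right_down[OF k(1) this] have n: "ninv m (w \<circ> simple_refl k) + 1 = ninv m w" .
    moreover have "w \<circ> simple_refl k permutes {1..m}"
      using permutes_compose[OF simple_refl_permutes[OF k(1)] less.prems] .
    ultimately obtain ws where ws: "set ws \<subseteq> {1..<m}" "word_perm ws = w \<circ> simple_refl k" "length ws = ninv m (w \<circ> simple_refl k)"
      using less.hyps[of "w \<circ> simple_refl k"] by auto
    thus ?thesis using k n by (intro exI[of _ "ws @ [k]"]) (auto simp: word_perm_append)
  qed
qed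

lemma ninv_word_le:
  assumes "set ws \<subseteq> {1..<m}"
  shows "ninv m (word_perm ws) \<le> length ws"
  using assms
proof (induction ws)
  case Nil
  show ?case unfolding word_perm_Nil ninv_id by simp
next
  case (Cons i ws)
  hence w: "word_perm ws permutes {1..m}" and i: "i \<in> {1..<m}" using word_perm_permutes by auto
  have "ninv m (simple_refl i \<circ> word_perm ws) \<le> ninv m (word_perm ws) + 1"
    using left_descent_cases[OF w, of i] ninv_left_up[OF w i] ninv_left_down[OF w i] by linarith
  moreover have "ninv m (word_perm ws) \<le> length ws" using Cons by simp
  ultimately show ?case unfolding word_perm_Cons length_Cons by linarith
qed

lemma perm_length_eq_ninv:
  assumes "w permutes {1..m}"
  shows "perm_length m w = ninv m w"
  unfolding perm_length_def
proof (rule Least_equality)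
  fix n assume "\<exists>ws. set ws \<subseteq> {1..<m} \<and> word_perm ws = w \<and> length ws = n"
  then obtain ws where ws: "set ws \<subseteq> {1..<m}" "word_perm ws = w" "length ws = n" by blast
  show "ninv m w \<le> n" using ninv_word_le[OF ws(1)] unfolding ws(2,3) .
qed (rule exists_word[OF assms])

lemma reduced_word_iff:
  assumes "w permutes {1..m}"
  shows "reduced_word m w ws \<longleftrightarrow> set ws \<subseteq> {1..<m} \<and> word_perm ws = w \<and> length ws = ninv m w"
  by (simp add: reduced_word_def perm_length_eq_ninv[OF assms])

lemma exists_reduced_word: "w permutes {1..m} \<Longrightarrow> \<exists>ws. reduced_word m w ws"
  using exists_word reduced_word_iff by blast

lemma reduced_word_permutes: "reduced_word m w ws \<Longrightarrow> w permutes {1..m}"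
  unfolding reduced_word_def using word_perm_permutes by blast

lemma reduced_word_ConsD:
  assumes "reduced_word m w (i # ws)"
  shows "i \<in> {1..<m}" "reduced_word m (simple_refl i \<circ> w) ws" "inv w (Suc i) < inv w i"
proof -
  note w = reduced_word_permutes[OF assms]
  have r: "set (i # ws) \<subseteq> {1..<m}" "word_perm (i # ws) = w" "length (i # ws) = ninv m w"
    using assms unfolding reduced_word_iff[OF w] by auto
  show i: "i \<in> {1..<m}" using r by simp
  have p: "simple_refl i \<circ> w permutes {1..m}" using permutes_compose[OF w simple_refl_permutes[OF i]] .
  have wp: "word_perm ws = simple_refl i \<circ> w" using r(2) by auto
  have le: "ninv m (simple_refl i \<circ> w) \<le> length ws" using ninv_word_le[of ws m] r(1) wp by simp
  thus d: "inv w (Suc i) < inv w i"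
    using left_descent_cases[OF w, of i] ninv_left_up[OF w i] r(3) by auto
  show "reduced_word m (simple_refl i \<circ> w) ws"
    unfolding reduced_word_iff[OF p] using r wp ninv_left_down[OF w i d] by auto
qed

lemma reduced_word_ConsI:
  assumes w: "w permutes {1..m}" and i: "i \<in> {1..<m}" and d: "inv w (Suc i) < inv w i"
    and red: "reduced_word m (simple_refl i \<circ> w) ws"
  shows "reduced_word m w (i # ws)"
proof -
  have p: "simple_refl i \<circ> w permutes {1..m}" using permutes_compose[OF w simple_refl_permutes[OF i]] .
  show ?thesis using red ninv_left_down[OF w i d] i
    unfolding reduced_word_iff[OF p] reduced_word_iff[OF w] by auto
qed

text \<open>Matsumoto's theorem.\<close>

theorem reduced_words_braid:
  fixes E :: "nat list \<Rightarrow> nat list \<Rightarrow> bool"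
  assumes refl: "\<And>us. E us us" and sym: "\<And>us vs. E us vs \<Longrightarrow> E vs us"
    and trans: "\<And>us vs ws. E us vs \<Longrightarrow> E vs ws \<Longrightarrow> E us ws"
    and cong: "\<And>i us vs. i \<in> {1..<m} \<Longrightarrow> set us \<subseteq> {1..<m} \<Longrightarrow> set vs \<subseteq> {1..<m} \<Longrightarrow> E us vs \<Longrightarrow> E (i # us) (i # vs)"
    and comm: "\<And>i j us. i \<in> {1..<m} \<Longrightarrow> j \<in> {1..<m} \<Longrightarrow> Suc i < j \<Longrightarrow> set us \<subseteq> {1..<m} \<Longrightarrow> E (i # j # us) (j # i # us)"
    and braid: "\<And>i us. i \<in> {1..<m} \<Longrightarrow> Suc i \<in> {1..<m} \<Longrightarrow> set us \<subseteq> {1..<m} \<Longrightarrow>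
        E (i # Suc i # i # us) (Suc i # i # Suc i # us)"
    and red: "reduced_word m w ws" "reduced_word m w ws'"
  shows "E ws ws'"
  using red
proof (induction "length ws" arbitrary: w ws ws')
  case 0
  have "length ws = perm_length m w" "length ws' = perm_length m w"
    using 0 unfolding reduced_word_def by blast+
  thus ?case using 0 refl by simp
next
  case (Suc n)
  note w = reduced_word_permutes[OF Suc.prems(1)]
  have "length ws = perm_length m w" "length ws' = perm_length m w"
    using Suc.prems unfolding reduced_word_def by blast+
  hence len: "length ws' = Suc n" using Suc.hyps(2) by simp
  have sub: "set us \<subseteq> {1..<m}" if "reduced_word m v us" for v us using that by (simp add: reduced_word_def)
  \<comment> \<open>Both first letters are left descents of \<open>w\<close>, so \<open>w\<close> is
    the longest element of the subgroup they generate times some \<open>x\<close>, with lengths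
    adding up. By induction each tail may be replaced by a reduced word ending in one for
    \<open>x\<close>, and the two words so obtained differ by a single commutation or braid
    move.\<close>
  have less: "E (i # us) (j # vs)"
    if us: "reduced_word m w (i # us)" "length us = n" and vs: "reduced_word m w (j # vs)" "length vs = n" and ij: "i < j" for i j us vs
  proof -
    note u = reduced_word_ConsD[OF us(1)] and v = reduced_word_ConsD[OF vs(1)]
    have pw: "simple_refl k \<circ> x permutes {1..m}" if "x permutes {1..m}" "k \<in> {1..<m}" for k x
      using permutes_compose[OF that(1) simple_refl_permutes[OF that(2)]] .
    note pu = pw[OF w u(1)] and pv = pw[OF w v(1)]
    have tail: "E (i # us) (i # xs)" if "reduced_word m (simple_refl i \<circ> w) xs" for xs
      using cong[OF u(1) sub[OF u(2)] sub[OF that]] Suc.hyps(1)[of us "simple_refl i \<circ> w" xs] us(2) u(2) that by simp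
    have tail': "E (j # vs) (j # xs)" if "reduced_word m (simple_refl j \<circ> w) xs" for xs
      using cong[OF v(1) sub[OF v(2)] sub[OF that]] Suc.hyps(1)[of vs "simple_refl j \<circ> w" xs] vs(2) v(2) that by simp
    show ?thesis
    proof (cases "j = Suc i")
      case False
      define x where "x = simple_refl j \<circ> (simple_refl i \<circ> w)"
      have x': "x = simple_refl i \<circ> (simple_refl j \<circ> w)"
        unfolding x_def using False ij by (auto simp: fun_eq_iff Transposition.transpose_def)
      obtain xs where xs: "reduced_word m x xs" using exists_reduced_word pw[OF pu v(1)] unfolding x_def by blast
      have "reduced_word m (simple_refl i \<circ> w) (j # xs)"
        using xs v(3) False ij
        by (intro reduced_word_ConsI pu v(1)) (auto simp: x_def inv_simple_refl_comp[OF w])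
      moreover have "reduced_word m (simple_refl j \<circ> w) (i # xs)"
        using xs u(3) False ij
        by (intro reduced_word_ConsI pv u(1)) (auto simp: x' inv_simple_refl_comp[OF w])
      moreover have "E (i # j # xs) (j # i # xs)" using comm[OF u(1) v(1) _ sub[OF xs]] False ij by simp
      ultimately show ?thesis using tail tail' trans sym by blast
    next
      case True
      note j = True
      have ui: "inv w (Suc i) < inv w i" "inv w (Suc (Suc i)) < inv w (Suc i)" using u(3) v(3) j by auto
      define x where "x = simple_refl i \<circ> (simple_refl j \<circ> (simple_refl i \<circ> w))"
      have x': "x = simple_refl j \<circ> (simple_refl i \<circ> (simple_refl j \<circ> w))"
        unfolding x_def using j by (auto simp: fun_eq_iff Transposition.transpose_def)
      note pu2 = pw[OF pu v(1)] and pv2 = pw[OF pv u(1)]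
      obtain xs where xs: "reduced_word m x xs" using exists_reduced_word pw[OF pu2 u(1)] unfolding x_def by blast
      have "reduced_word m (simple_refl j \<circ> (simple_refl i \<circ> w)) (i # xs)"
        using xs ui j
        by (intro reduced_word_ConsI pu2 u(1)) (auto simp: x_def inv_simple_refl_comp[OF w] inv_simple_refl_comp[OF pu] Transposition.transpose_def)
      hence "reduced_word m (simple_refl i \<circ> w) (j # i # xs)"
        by (rule reduced_word_ConsI[OF pu v(1), rotated])
           (use ui j in \<open>auto simp: inv_simple_refl_comp[OF w] Transposition.transpose_def\<close>)
      moreover have "reduced_word m (simple_refl i \<circ> (simple_refl j \<circ> w)) (j # xs)"
        using xs ui j
        by (intro reduced_word_ConsI pv2 v(1)) (auto simp: x' inv_simple_refl_comp[OF w] inv_simple_refl_comp[OF pv[unfolded j]] Transposition.transpose_def)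
      hence "reduced_word m (simple_refl j \<circ> w) (i # j # xs)"
        by (rule reduced_word_ConsI[OF pv u(1), rotated])
           (use ui j in \<open>auto simp: inv_simple_refl_comp[OF w] Transposition.transpose_def\<close>)
      moreover have "E (i # j # i # xs) (j # i # j # xs)"
        using braid[OF u(1) _ sub[OF xs]] v(1) j by simp
      ultimately show ?thesis using tail tail' trans sym by blast
    qed
  qed
  obtain i us where ws: "ws = i # us" "length us = n" using Suc.hyps(2) by (cases ws) auto
  obtain j vs where ws': "ws' = j # vs" "length vs = n" using len by (cases ws') auto
  consider "i < j" | "j < i" | "i = j" by linarith
  thus ?case
  proof cases
    case 3
    note u = reduced_word_ConsD[OF Suc.prems(1)[unfolded ws]] and v = reduced_word_ConsD[OF Suc.prems(2)[unfolded ws']]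
    have "E us vs" using Suc.hyps(1)[of us _ vs] u(2) v(2) ws(2) 3 by auto
    thus ?thesis using cong[OF u(1) sub[OF u(2)] sub[OF v(2)]] ws ws' 3 by simp
  qed (use less sym Suc.prems ws ws' in blast)+
qed

section \<open>The class of the minimal pattern\<close>

lemma lookup_um_xm:
  assumes "1 \<le> i" "1 \<le> j"
  shows "Poly_Mapping.lookup (um + xm i - xm j) (Xv 0) = 1"
  using assms by (simp add: lookup_add lookup_minus lookup_single)

lemma um_xm_nonzero: "1 \<le> i \<Longrightarrow> 1 \<le> j \<Longrightarrow> um + xm i - xm j \<noteq> 0"
  using lookup_um_xm by fastforce

lemma um_xm_neq: "1 \<le> i \<Longrightarrow> 1 \<le> j \<Longrightarrow> um + xm i \<noteq> xm j"
  using um_xm_nonzero[of i j] by auto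

lemma keys_um_xm: "Poly_Mapping.keys (um + xm i - xm j) \<subseteq> {Xv 0, Xv i, Xv j}"
  using Poly_Mapping.keys_diff[of "um + xm i" "xm j"] Poly_Mapping.keys_add[of um "xm i"] by auto

lemma um_xm_xvars: "i \<le> m \<Longrightarrow> j \<le> m \<Longrightarrow> Poly_Mapping.keys (um + xm i - xm j) \<subseteq> xvars m"
  using keys_um_xm[of i j] by (auto simp: xvars_def)

lemma Tau_um_xm: "Tau \<notin> Poly_Mapping.keys (um + xm i - xm j)"
  using keys_um_xm[of i j] by auto

lemma mum_chars: "i \<le> r \<Longrightarrow> mum i \<in> chars r"
  by (auto simp: chars_def muvars_def)

lemma mum_nonzero: "mum i \<noteq> 0"
  by (auto dest!: arg_cong[of _ _ "\<lambda>l. Poly_Mapping.lookup l (Mv i)"])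

lemma ell_min_frakA:
  assumes "m \<ge> 2 * r"
  shows "ell_min m r \<in> frakA m r"
  unfolding ell_min_def
proof (intro frakA_prod frakA.mult frakA.gen)
  fix i assume i: "i \<in> {1..r}"
  show "um + xm i - xm (m - r + i) \<noteq> 0" using i by (intro um_xm_nonzero) auto
  show "Poly_Mapping.keys (um + xm i - xm (m - r + i)) \<subseteq> xvars m" using i assms by (intro um_xm_xvars) auto
  show "mum i \<noteq> 0" "Poly_Mapping.keys (mum i) \<subseteq> muvars r" "hm \<noteq> 0" "Poly_Mapping.keys hm \<subseteq> muvars r"
    using i mum_chars[of i r] hm_chars[of r] mum_nonzero hm_nonzero by (auto simp: chars_def)
  fix j assume j: "j \<in> {m - r + i + 1..m}"
  show "um + xm i - xm j \<noteq> 0" using i j by (intro um_xm_nonzero) auto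
  show "Poly_Mapping.keys (um + xm i - xm j) \<subseteq> xvars m" using i j assms by (intro um_xm_xvars) auto
qed

lemma gen_eq_dom_add_nonzero:
  assumes "generic dom_add (\<lambda>z. f (expo z) \<noteq> 0)"
  shows "\<not> gen_eq dom_add (\<lambda>z. f (expo z)) (\<lambda>z. 0)"
proof
  assume "gen_eq dom_add (\<lambda>z. f (expo z)) (\<lambda>z. 0)"
  hence "generic dom_add (\<lambda>z. f (expo z) = 0)" by (simp add: gen_eq_generic)
  hence "generic dom_add (\<lambda>z. False)" using assms by (rule generic_mono2) simp
  hence "dom_add = {}" unfolding generic_def by fastforce
  moreover have "(\<lambda>_. \<i>) \<in> dom_add" by (simp add: dom_add_def)
  ultimately show False by blast
qed

lemma ell_min_nonzero:
  assumes "m \<ge> 2 * r"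
  shows "\<not> mer_eq m r (ell_min m r) (\<lambda>p. 0)"
proof -
  have g: "generic dom_add (\<lambda>z. deltaf (um + xm i - xm j) \<mu> (expo z) \<noteq> 0)"
    if "i \<in> {1..m}" "j \<in> {1..m}" "\<mu> \<in> chars r" "\<mu> \<noteq> 0" for i j \<mu>
    using that um_xm_xvars[of i m j] um_xm_nonzero[of i j] by (intro F_generic_nonzero) auto
  have "generic dom_add (\<lambda>z. \<forall>i\<in>{1..r}. deltaf (um + xm i - xm (m - r + i)) (mum i) (expo z) \<noteq> 0 \<and>
      (\<forall>j\<in>{m - r + i + 1..m}. deltaf (um + xm i - xm j) hm (expo z) \<noteq> 0))"
    using assms by (intro generic_ball_finite generic_conj g) (auto simp: mum_chars mum_nonzero hm_nonzero)
  hence "generic dom_add (\<lambda>z. ell_min m r (expo z) \<noteq> 0)"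
    by (rule generic_mono) (auto simp: ell_min_def)
  thus ?thesis
    using gen_eq_dom_add_nonzero mer_eq_0_iff[OF frakA_depends[OF ell_min_frakA[OF assms]]] by blast
qed

text \<open>The type of the class of a pattern \<open>wP\<^sup>m\<^sup>i\<^sup>n\<close> is \<open>\<Sum>\<^sub>j x\<^sub>j A\<^sub>j\<close> with \<open>A\<^sub>j = B (w\<inverse> j) - j h\<close>: after
  this shift the operations simply permute the characters \<open>B j\<close>.  The value at \<open>0\<close> is the
  coefficient of \<open>u\<close>.\<close>

definition min_chars :: "nat \<Rightarrow> nat \<Rightarrow> nat \<Rightarrow> monomial" where
  "min_chars m r j = (if j = 0 then (\<Sum>i\<in>{1..r}. mum i + frag_cmul (int (r - i)) hm)
     else if j \<le> r then mum j + frag_cmul (int r) hm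
     else if m - r < j \<and> j \<le> m then frag_cmul (int (m - r + 1)) hm - mum (j - (m - r))
     else frag_cmul (int j) hm)"

definition shifted :: "(nat \<Rightarrow> monomial) \<Rightarrow> nat \<Rightarrow> monomial" where
  "shifted B j = B j - frag_cmul (int j) hm"

lemma chars_sum: "(\<And>i. i \<in> I \<Longrightarrow> f i \<in> chars r) \<Longrightarrow> (\<Sum>i\<in>I. f i) \<in> chars r"
  by (induction I rule: infinite_finite_induct) (auto intro: chars_plus)

lemma min_chars_chars: "min_chars m r j \<in> chars r"
  unfolding min_chars_def by (auto intro!: chars_sum chars_plus chars_minus chars_frag_cmul mum_chars)

lemma shifted_chars: "(\<And>j. B j \<in> chars r) \<Longrightarrow> shifted B j \<in> chars r"
  unfolding shifted_def by (intro chars_minus chars_frag_cmul) auto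

lemma sum_atMost_split3:
  fixes f :: "nat \<Rightarrow> complex"
  assumes "m \<ge> 2 * r" "\<And>j. r < j \<Longrightarrow> j \<le> m - r \<Longrightarrow> f j = 0"
  shows "(\<Sum>j\<le>m. f j) = f 0 + (\<Sum>i\<in>{1..r}. f i) + (\<Sum>i\<in>{1..r}. f (m - r + i))"
proof -
  have "{..m} = {0} \<union> {1..r} \<union> {r<..m - r} \<union> (\<lambda>i. m - r + i) ` {1..r}"
  proof (intro equalityI subsetI)
    fix j assume "j \<in> {..m}"
    hence "j = 0 \<or> j \<in> {1..r} \<or> j \<in> {r<..m - r} \<or> j = m - r + (j - (m - r)) \<and> j - (m - r) \<in> {1..r}" using assms(1) by auto
    thus "j \<in> {0} \<union> {1..r} \<union> {r<..m - r} \<union> (\<lambda>i. m - r + i) ` {1..r}" by blast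
  qed (use assms(1) in auto)
  hence "(\<Sum>j\<le>m. f j) = sum f ({0} \<union> {1..r} \<union> {r<..m - r} \<union> (\<lambda>i. m - r + i) ` {1..r})" by simp
  also have "\<dots> = f 0 + sum f {1..r} + sum f {r<..m - r} + sum f ((\<lambda>i. m - r + i) ` {1..r})"
  proof -
    have d: "({0} \<union> {1..r} \<union> {r<..m - r}) \<inter> (\<lambda>i. m - r + i) ` {1..r} = {}"
      "({0} \<union> {1..r}) \<inter> {r<..m - r} = {}" "{0} \<inter> {1..r} = {}" using assms(1) by auto
    have "sum f ({0} \<union> {1..r} \<union> {r<..m - r} \<union> (\<lambda>i. m - r + i) ` {1..r}) =
        sum f ({0} \<union> {1..r} \<union> {r<..m - r}) + sum f ((\<lambda>i. m - r + i) ` {1..r})"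
      by (rule sum.union_disjoint[OF _ _ d(1)]) auto
    moreover have "sum f ({0} \<union> {1..r} \<union> {r<..m - r}) = sum f ({0} \<union> {1..r}) + sum f {r<..m - r}"
      by (rule sum.union_disjoint[OF _ _ d(2)]) auto
    moreover have "sum f ({0} \<union> {1..r}) = sum f {0} + sum f {1..r}"
      by (rule sum.union_disjoint[OF _ _ d(3)]) auto
    moreover have "sum f {0} = f 0" by simp
    ultimately show ?thesis by metis
  qed
  also have "sum f {r<..m - r} = 0" using assms(2) by (intro sum.neutral) auto
  also have "sum f ((\<lambda>i. m - r + i) ` {1..r}) = (\<Sum>i\<in>{1..r}. f (m - r + i))"
    by (subst sum.reindex) (auto simp: inj_on_def)
  finally show ?thesis by simp
qed

text \<open>The target \<open>i\<close> meets \<open>mum i\<close> once and \<open>h\<close> in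
  \<open>r - i\<close> factors. The source of the arrow \<open>i\<close> meets \<open>mum i\<close>
  once and \<open>h\<close> in \<open>i - 1\<close> factors, all with negative sign. Adding
  \<open>j * h\<close> at the vertex \<open>j\<close> makes the multiples of \<open>h\<close> equal
  to \<open>r\<close> at all targets and to \<open>m - r + 1\<close> at all sources, which explains
  the constants of \<open>min_chars\<close>; a vertex off the arrows carries just the shift.\<close>

lemma ell_min_type:
  assumes m: "m \<ge> 2 * r"
  shows "has_type m r (ell_min m r) (bil m (shifted (min_chars m r)))"
proof -
  let ?Q = "\<lambda>z. \<Sum>i\<in>{1..r}. lin (um + xm i - xm (m - r + i)) z * lin (mum i) z +
     (\<Sum>j\<in>{m - r + i + 1..m}. lin (um + xm i - xm j) z * lin hm z)"
  have "has_type m r (ell_min m r) ?Q"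
    unfolding ell_min_def
  proof (intro has_type_prod has_type_mult has_type_deltaf)
    fix i assume i: "i \<in> {1..r}"
    show "um + xm i - xm (m - r + i) \<noteq> 0" using i by (intro um_xm_nonzero) auto
    show "Poly_Mapping.keys (um + xm i - xm (m - r + i)) \<subseteq> xvars m" using i m by (intro um_xm_xvars) auto
    show "mum i \<noteq> 0" "Poly_Mapping.keys (mum i) \<subseteq> muvars r" "hm \<noteq> 0" "Poly_Mapping.keys hm \<subseteq> muvars r"
      using i mum_chars[of i r] hm_chars[of r] mum_nonzero hm_nonzero by (auto simp: chars_def)
    fix j assume j: "j \<in> {m - r + i + 1..m}"
    show "um + xm i - xm j \<noteq> 0" using i j by (intro um_xm_nonzero) auto
    show "Poly_Mapping.keys (um + xm i - xm j) \<subseteq> xvars m" using i j m by (intro um_xm_xvars) auto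
  qed
  also have "?Q = bil m (shifted (min_chars m r))"
  proof
    fix z :: point
    define u h x \<mu> where "u = z (Xv 0)" and "h = z (Mv 0)" and "x j = z (Xv j)" and "\<mu> j = z (Mv j)" for j
    have tail: "(\<Sum>j\<in>{m - r + i + 1..m}. (u + x i - x j) * h) =
        of_nat (r - i) * (u + x i) * h - (\<Sum>k\<in>{1..r}. if i < k then x (m - r + k) * h else 0)" if "i \<in> {1..r}" for i
    proof -
      have img: "{m - r + i + 1..m} = (\<lambda>k. m - r + k) ` {i<..r}"
      proof (intro equalityI subsetI)
        fix j assume "j \<in> {m - r + i + 1..m}"
        hence "j = m - r + (j - (m - r))" "j - (m - r) \<in> {i<..r}" using m by auto
        thus "j \<in> (\<lambda>k. m - r + k) ` {i<..r}" by blast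
      qed (use m that in auto)
      have "(\<Sum>j\<in>{m - r + i + 1..m}. (u + x i - x j) * h) = (\<Sum>k\<in>{i<..r}. (u + x i) * h - x (m - r + k) * h)"
        unfolding img by (subst sum.reindex) (auto simp: inj_on_def algebra_simps)
      also have "\<dots> = of_nat (r - i) * (u + x i) * h - (\<Sum>k\<in>{i<..r}. x (m - r + k) * h)"
        by (simp add: sum_subtractf)
      also have "(\<Sum>k\<in>{i<..r}. x (m - r + k) * h) = (\<Sum>k\<in>{1..r}. if i < k then x (m - r + k) * h else 0)"
        using that by (intro sum.mono_neutral_cong_left) auto
      finally show ?thesis .
    qed
    have swap: "(\<Sum>i\<in>{1..r}. \<Sum>k\<in>{1..r}. if i < k then x (m - r + k) * h else 0) = (\<Sum>k\<in>{1..r}. of_nat (k - 1) * x (m - r + k) * h)"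
    proof (subst sum.swap, intro sum.cong refl)
      fix k assume k: "k \<in> {1..r}"
      have "(\<Sum>i\<in>{1..r}. if i < k then x (m - r + k) * h else 0) = (\<Sum>i\<in>{1..<k}. x (m - r + k) * h)"
        using k by (intro sum.mono_neutral_cong_right) auto
      thus "(\<Sum>i\<in>{1..r}. if i < k then x (m - r + k) * h else 0) = of_nat (k - 1) * x (m - r + k) * h" by simp
    qed
    have Q: "?Q z = (\<Sum>i\<in>{1..r}. (u + x i - x (m - r + i)) * \<mu> i + of_nat (r - i) * (u + x i) * h) -
        (\<Sum>k\<in>{1..r}. of_nat (k - 1) * x (m - r + k) * h)"
    proof -
      have "?Q z = (\<Sum>i\<in>{1..r}. (u + x i - x (m - r + i)) * \<mu> i + (\<Sum>j\<in>{m - r + i + 1..m}. (u + x i - x j) * h))"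
        by (simp add: lin_minus lin_plus u_def x_def h_def \<mu>_def)
      also have "\<dots> = (\<Sum>i\<in>{1..r}. ((u + x i - x (m - r + i)) * \<mu> i + of_nat (r - i) * (u + x i) * h) - (\<Sum>k\<in>{1..r}. if i < k then x (m - r + k) * h else 0))"
        by (intro sum.cong refl) (simp only: tail add_diff_eq)
      also have "\<dots> = (\<Sum>i\<in>{1..r}. (u + x i - x (m - r + i)) * \<mu> i + of_nat (r - i) * (u + x i) * h) - (\<Sum>k\<in>{1..r}. of_nat (k - 1) * x (m - r + k) * h)"
        unfolding sum_subtractf swap ..
      finally show ?thesis .
    qed
    have v0: "lin (shifted (min_chars m r) 0) z = (\<Sum>i\<in>{1..r}. \<mu> i + of_nat (r - i) * h)"
      by (simp add: shifted_def min_chars_def lin_minus lin_sum lin_plus lin_frag_cmul h_def \<mu>_def)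
    have v1: "lin (shifted (min_chars m r) i) z = \<mu> i + of_nat (r - i) * h" if "i \<in> {1..r}" for i
      using that by (simp add: shifted_def min_chars_def lin_minus lin_plus lin_frag_cmul h_def \<mu>_def of_nat_diff algebra_simps)
    have v2: "lin (shifted (min_chars m r) (m - r + i)) z = - \<mu> i - of_nat (i - 1) * h" if "i \<in> {1..r}" for i
    proof -
      have "\<not> m - r + i \<le> r" "m - r < m - r + i" "m - r + i \<le> m" "m - r + i \<noteq> 0" using that m by auto
      hence "min_chars m r (m - r + i) = frag_cmul (int (m - r + 1)) hm - mum i"
        by (simp only: min_chars_def if_False if_True simp_thms diff_add_inverse)
      hence "lin (shifted (min_chars m r) (m - r + i)) z = of_nat (m - r + 1) * h - \<mu> i - of_nat (m - r + i) * h"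
        by (simp only: shifted_def lin_minus lin_frag_cmul lin_single h_def \<mu>_def of_int_of_nat_eq of_int_1 mult_1)
      also have "\<dots> = - \<mu> i - of_nat (i - 1) * h"
        using that unfolding of_nat_add by (simp add: of_nat_diff algebra_simps)
      finally show ?thesis .
    qed
    have v3: "lin (shifted (min_chars m r) j) z = 0" if "r < j" "j \<le> m - r" for j
      using that by (simp add: shifted_def min_chars_def lin_minus)
    have "bil m (shifted (min_chars m r)) z = u * (\<Sum>i\<in>{1..r}. \<mu> i + of_nat (r - i) * h) +
       (\<Sum>i\<in>{1..r}. x i * (\<mu> i + of_nat (r - i) * h)) + (\<Sum>i\<in>{1..r}. x (m - r + i) * (- \<mu> i - of_nat (i - 1) * h))"
      unfolding bil_def using v0 v1 v2 v3
      by (subst sum_atMost_split3[OF m]) (simp_all add: u_def x_def)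
    also have "\<dots> = ?Q z" unfolding Q sum_distrib_left sum.distrib[symmetric] sum_subtractf[symmetric]
      by (intro sum.cong refl) (simp add: algebra_simps)
    finally show "?Q z = bil m (shifted (min_chars m r)) z" by simp
  qed
  finally show ?thesis .
qed

definition middle :: "nat \<Rightarrow> nat \<Rightarrow> nat \<Rightarrow> bool" where
  "middle m r j \<longleftrightarrow> r < j \<and> j \<le> m - r"

lemma lookup_min_chars:
  assumes m: "m \<ge> 2 * r" and "j \<in> {1..m}" "k \<in> {1..r}"
  shows "Poly_Mapping.lookup (min_chars m r j) (Mv k) = (if j = k then 1 else if j = m - r + k then -1 else 0)"
  using assms by (auto simp: min_chars_def lookup_add lookup_minus lookup_single)

text \<open>The coefficient of some \<open>mum k\<close> tells \<open>a\<close> from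
  \<open>b\<close>, unless both lie off the arrows, where no \<open>mum k\<close> occurs.\<close>

lemma min_chars_diff_lookup:
  assumes m: "m \<ge> 2 * r" and ab: "a \<in> {1..m}" "b \<in> {1..m}" "a \<noteq> b" "\<not> (middle m r a \<and> middle m r b)"
  shows "\<exists>k\<in>{1..r}. Poly_Mapping.lookup (min_chars m r a - min_chars m r b) (Mv k) \<noteq> 0"
proof -
  have *: "\<exists>k\<in>{1..r}. Poly_Mapping.lookup (min_chars m r a - min_chars m r b) (Mv k) \<noteq> 0"
    if "a \<in> {1..m}" "b \<in> {1..m}" "a \<noteq> b" "\<not> middle m r a" for a b
  proof (cases "a \<le> r")
    case True
    thus ?thesis using that m
      by (intro bexI[of _ a]) (auto simp: lookup_minus lookup_min_chars)
  next
    case False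
    define k where "k = a - (m - r)"
    have "a = m - r + k" "k \<in> {1..r}" using False that m by (auto simp: k_def middle_def)
    thus ?thesis using that False m
      by (intro bexI[of _ k]) (auto simp: lookup_minus lookup_min_chars)
  qed
  show ?thesis
  proof (cases "middle m r a")
    case True
    hence "\<exists>k\<in>{1..r}. Poly_Mapping.lookup (min_chars m r b - min_chars m r a) (Mv k) \<noteq> 0"
      using *[of b a] ab by blast
    then obtain k where "k \<in> {1..r}" "Poly_Mapping.lookup (min_chars m r b - min_chars m r a) (Mv k) \<noteq> 0" by blast
    thus ?thesis by (intro bexI[of _ k]) (auto simp: lookup_minus)
  qed (use * ab in blast)
qed

text \<open>Off the arrows the characters are distinct multiples of \<open>h\<close>; elsewhere some
  \<open>mum k\<close> separates them.\<close>

lemma min_chars_diff_nonzero: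
  assumes m: "m \<ge> 2 * r" and ab: "a \<in> {1..m}" "b \<in> {1..m}" "a \<noteq> b"
  shows "min_chars m r a - min_chars m r b \<noteq> 0"
proof (cases "middle m r a \<and> middle m r b")
  case True
  hence "Poly_Mapping.lookup (min_chars m r a - min_chars m r b) (Mv 0) = int a - int b"
    by (simp add: min_chars_def middle_def lookup_minus lookup_single)
  thus ?thesis using ab(3) by auto
next
  case False
  thus ?thesis using min_chars_diff_lookup[OF assms] by auto
qed

lemma min_chars_diff_hm:
  assumes m: "m \<ge> 2 * r" and ab: "a \<in> {1..m}" "b \<in> {1..m}" "a \<noteq> b" "\<not> (middle m r a \<and> middle m r b)"
  shows "min_chars m r a - min_chars m r b \<noteq> hm" "min_chars m r a - min_chars m r b \<noteq> - hm"
  using min_chars_diff_lookup[OF assms] by (auto simp: lookup_single)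

section \<open>The flip relation\<close>

lemma prod_simple_refl:
  fixes g :: "nat \<Rightarrow> complex"
  assumes "a \<le> q \<and> Suc q \<le> b \<or> Suc q < a"
  shows "(\<Prod>j\<in>{a..b}. g (simple_refl q j)) = (\<Prod>j\<in>{a..b}. g j)"
  using assms
  by (intro prod.reindex_bij_witness[of _ "simple_refl q" "simple_refl q"]) (auto simp: Transposition.transpose_def)

text \<open>The class splits as \<open>E0 * (R1 * R2)\<close>. Here \<open>E0\<close> collects the
  three factors in the rows \<open>k\<close>, \<open>Suc k\<close> and the columns \<open>q\<close>,
  \<open>Suc q\<close>, and the rest is invariant under all three transpositions involved. So the
  relation reduces to \<open>flip_identity\<close>.\<close>

theorem flip_relation:
  assumes m: "m \<ge> 2 * r" and k: "1 \<le> k" "k < r"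
  shows "mer_eq m r (act_mu (simple_refl k) (opC k (mum k - mum (k + 1)) (ell_min m r)))
                  (opC (m - r + k) (mum (k + 1) - mum k) (ell_min m r))"
proof (subst mer_eq_iff)
  define q where "q = m - r + k"
  let ?k = "Suc k" and ?q = "Suc q"
  have q: "?k < q" "?q \<le> m" using m k by (auto simp: q_def)
  have ch: "mum k - mum ?k \<in> chars r" "mum ?k - mum k \<in> chars r" using k by (auto intro!: chars_minus mum_chars)
  have sk: "simple_refl k permutes {1..r}" using k by (intro permutes_swap_id) auto
  have dE: "depends m r (ell_min m r)" using frakA_depends[OF ell_min_frakA[OF m]] .
  show "depends m r (act_mu (simple_refl k) (opC k (mum k - mum (k + 1)) (ell_min m r)))"
    unfolding act_mu_alt using k q ch dE by (intro depends_rename renaming_ren_mu sk depends_opC) auto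
  show "depends m r (opC (m - r + k) (mum (k + 1) - mum k) (ell_min m r))"
    unfolding q_def[symmetric] using k q ch dE by (intro depends_opC) auto
  define E where "E z = ell_min m r (expo z)" for z
  define T where "T i j z = z (Xv 0) + z (Xv i) - z (Xv j)" for i j and z :: point
  have Eexp: "E z = (\<Prod>i\<in>{1..r}. F (z Tau) (T i (m - r + i) z) (z (Mv i)) * (\<Prod>j\<in>{m - r + i + 1..m}. F (z Tau) (T i j z) (z (Mv 0))))" for z
    unfolding E_def ell_min_def T_def by (simp add: deltaf_expo Tau_um_xm lin_minus lin_plus)
  define G where "G i z = F (z Tau) (T i (m - r + i) z) (z (Mv i)) * (\<Prod>j\<in>{m - r + i + 1..m}. F (z Tau) (T i j z) (z (Mv 0)))" for i z
  define E0 where "E0 z = F (z Tau) (T k q z) (z (Mv k)) * F (z Tau) (T k ?q z) (z (Mv 0)) * F (z Tau) (T ?k ?q z) (z (Mv ?k))" for z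
  define R1 where "R1 z = (\<Prod>j\<in>{q + 2..m}. F (z Tau) (T k j z) (z (Mv 0))) * (\<Prod>j\<in>{q + 2..m}. F (z Tau) (T ?k j z) (z (Mv 0)))" for z
  define R2 where "R2 z = (\<Prod>i\<in>{1..r} - {k, ?k}. G i z)" for z
  have split: "E z = E0 z * (R1 z * R2 z)" for z
  proof -
    have "{1..r} = insert k (insert ?k ({1..r} - {k, ?k}))" using k by auto
    hence "E z = (\<Prod>i\<in>insert k (insert ?k ({1..r} - {k, ?k})). G i z)" unfolding Eexp G_def by simp
    also have "\<dots> = G k z * G ?k z * R2 z" unfolding R2_def by (subst prod.insert; simp)+
    also have "G k z = F (z Tau) (T k q z) (z (Mv k)) * (F (z Tau) (T k ?q z) (z (Mv 0)) * (\<Prod>j\<in>{q + 2..m}. F (z Tau) (T k j z) (z (Mv 0))))"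
    proof -
      have "{q + 1..m} = insert ?q {q + 2..m}" using q by auto
      thus ?thesis unfolding G_def q_def[symmetric] by simp
    qed
    also have "G ?k z = F (z Tau) (T ?k ?q z) (z (Mv ?k)) * (\<Prod>j\<in>{q + 2..m}. F (z Tau) (T ?k j z) (z (Mv 0)))"
      unfolding G_def q_def by simp
    finally show ?thesis unfolding E0_def R1_def by (simp add: mult_ac)
  qed
  let ?rx = "\<lambda>i z. z \<circ> ren_x (simple_refl i)" and ?rm = "\<lambda>z. z \<circ> ren_mu (simple_refl k)"
  have R_mu: "R1 (?rm z) * R2 (?rm z) = R1 z * R2 z" for z
  proof -
    have "R1 (?rm z) = R1 z" using k by (simp add: R1_def T_def Transposition.transpose_def)
    moreover have "R2 (?rm z) = R2 z" unfolding R2_def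
      using k by (intro prod.cong) (auto simp: G_def T_def Transposition.transpose_def)
    ultimately show ?thesis by simp
  qed
  have R_k: "R1 (?rx k z) * R2 (?rx k z) = R1 z * R2 z" for z
  proof -
    have T: "T i j (?rx k z) = T (simple_refl k i) j z" if "j > ?k" for i j
      using that k by (auto simp: T_def Transposition.transpose_def)
    have "R1 (?rx k z) = (\<Prod>j\<in>{q + 2..m}. F (z Tau) (T ?k j z) (z (Mv 0))) * (\<Prod>j\<in>{q + 2..m}. F (z Tau) (T k j z) (z (Mv 0)))"
      unfolding R1_def using q by (intro arg_cong2[of _ _ _ _ "(*)"] prod.cong refl) (auto simp: T)
    hence "R1 (?rx k z) = R1 z" by (simp add: R1_def mult.commute)
    moreover have "R2 (?rx k z) = R2 z" unfolding R2_def
    proof (intro prod.cong refl)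
      fix i assume i: "i \<in> {1..r} - {k, ?k}"
      hence s: "simple_refl k i = i" by (auto simp: Transposition.transpose_def)
      have gt: "j > ?k" if "j \<ge> m - r + i" for j using that i m k by auto
      have "T i j (?rx k z) = T i j z" if "j \<ge> m - r + i" for j using T[OF gt[OF that]] s by simp
      thus "G i (?rx k z) = G i z" unfolding G_def by simp
    qed
    ultimately show ?thesis by simp
  qed
  have R_q: "R1 (?rx q z) * R2 (?rx q z) = R1 z * R2 z" for z
  proof -
    have T: "T i j (?rx q z) = T i (simple_refl q j) z" if "i < q" for i j
      using that q by (auto simp: T_def Transposition.transpose_def)
    have "R1 (?rx q z) = R1 z" unfolding R1_def
      using q by (intro arg_cong2[of _ _ _ _ "(*)"] prod.cong refl) (auto simp: T Transposition.transpose_def)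
    moreover have "R2 (?rx q z) = R2 z" unfolding R2_def
    proof (intro prod.cong refl)
      fix i assume i: "i \<in> {1..r} - {k, ?k}"
      have iq: "i < q" using i m k by (auto simp: q_def)
      have "simple_refl q (m - r + i) = m - r + i" using i by (auto simp: Transposition.transpose_def q_def)
      \<comment> \<open>The columns in which the row \<open>i\<close> has parameter \<open>h\<close>
        include both \<open>q\<close> and \<open>Suc q\<close> if \<open>i < k\<close>, and neither
        if \<open>i > Suc k\<close>; in both cases they are permuted among themselves.\<close>
      moreover have "m - r + i + 1 \<le> q \<and> Suc q \<le> m \<or> Suc q < m - r + i + 1"
      proof (cases "i < k")
        case True
        hence "m - r + i + 1 \<le> q" unfolding q_def by linarith
        thus ?thesis using q by blast
      next
        case False
        hence "i > Suc k" using i by auto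
        thus ?thesis by (simp add: q_def)
      qed
      hence "(\<Prod>j\<in>{m - r + i + 1..m}. F (z Tau) (T i (simple_refl q j) z) (z (Mv 0))) = (\<Prod>j\<in>{m - r + i + 1..m}. F (z Tau) (T i j z) (z (Mv 0)))"
        by (rule prod_simple_refl[of _ q m "\<lambda>j. F (z Tau) (T i j z) (z (Mv 0))"])
      ultimately show "G i (?rx q z) = G i z" unfolding G_def T[OF iq] by simp
    qed
    ultimately show ?thesis by simp
  qed
  define L where "L = {um + xm k - xm ?q, um + xm ?k - xm ?q, um + xm k - xm q, um + xm ?k - xm q, xm ?q - xm q, xm ?k - xm k, hm, mum k, mum ?k, mum ?k - mum k}"
  have "mum ?k - mum k \<noteq> 0"
  proof
    assume "mum ?k - mum k = 0"
    hence "Poly_Mapping.lookup (mum ?k - mum k) (Mv k) = 0" by simp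
    thus False by (simp add: lookup_minus lookup_single)
  qed
  hence "generic dom_add (\<lambda>z. Im (z Tau) > 0 \<and> (\<forall>l\<in>L. theta (z Tau) (lin l z) \<noteq> 0))"
    using k q
    by (intro generic_thetas)
       (auto simp: L_def Tau_um_xm Tau_xm_diff xm_diff_nonzero mum_nonzero hm_nonzero um_xm_neq chars_Tau[OF ch(2)])
  thus "gen_eq dom_add (\<lambda>z. act_mu (simple_refl k) (opC k (mum k - mum (k + 1)) (ell_min m r)) (expo z))
       (\<lambda>z. opC (m - r + k) (mum (k + 1) - mum k) (ell_min m r) (expo z))"
    unfolding gen_eq_generic
  proof (rule generic_mono)
    fix z :: point
    assume "Im (z Tau) > 0 \<and> (\<forall>l\<in>L. theta (z Tau) (lin l z) \<noteq> 0)"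
    hence \<tau>: "Im (z Tau) > 0" and th: "\<And>l. l \<in> L \<Longrightarrow> theta (z Tau) (lin l z) \<noteq> 0" by auto
    let ?F = "F (z Tau)"
    define a b c h M N where "a = T k ?q z" and "b = T ?k ?q z" and "c = z (Xv ?q) - z (Xv q)"
      and "h = z (Mv 0)" and "M = z (Mv k)" and "N = z (Mv ?k)"
    have Tz: "T k q z = a + c" "T ?k q z = b + c" "T k ?q z = a" "T ?k ?q z = b"
      by (simp_all add: T_def a_def b_def c_def)
    have thn: "theta (z Tau) a \<noteq> 0" "theta (z Tau) b \<noteq> 0" "theta (z Tau) c \<noteq> 0" "theta (z Tau) h \<noteq> 0" "theta (z Tau) M \<noteq> 0"
       "theta (z Tau) N \<noteq> 0" "theta (z Tau) (N - M) \<noteq> 0" "theta (z Tau) (b - a) \<noteq> 0" "theta (z Tau) (a + c) \<noteq> 0" "theta (z Tau) (b + c) \<noteq> 0"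
      using th[of "um + xm k - xm ?q"] th[of "um + xm ?k - xm ?q"] th[of "xm ?q - xm q"] th[of hm] th[of "mum k"] th[of "mum ?k"]
        th[of "mum ?k - mum k"] th[of "xm ?k - xm k"] th[of "um + xm k - xm q"] th[of "um + xm ?k - xm q"]
      unfolding Tz(1,2)[symmetric]
      by (simp_all add: L_def lin_minus lin_plus T_def a_def b_def c_def h_def M_def N_def)
    have kk: "simple_refl k 0 = 0" "simple_refl k q = q" "simple_refl k ?q = ?q" "simple_refl q 0 = 0" "simple_refl q k = k" "simple_refl q ?k = ?k"
      using k q by (auto simp: Transposition.transpose_def)
    have Tr: "T i j (?rm w) = T i j w" "T i j (?rx k w) = T (simple_refl k i) (simple_refl k j) w"
      "T i j (?rx q w) = T (simple_refl q i) (simple_refl q j) w" for i j w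
      by (simp_all add: T_def kk)
    have E_mu: "E0 (?rm z) = ?F (a + c) N * ?F a h * ?F b M"
      unfolding E0_def Tr Tz by (simp add: kk h_def M_def N_def)
    have E_muk: "E0 (?rx k (?rm z)) = ?F (b + c) N * ?F b h * ?F a M"
      unfolding E0_def Tr kk transpose_apply_first transpose_apply_second Tz by (simp add: kk h_def M_def N_def)
    have E_1: "E0 z = ?F (a + c) M * ?F a h * ?F b N"
      unfolding E0_def Tz by (simp add: h_def M_def N_def)
    have E_q: "E0 (?rx q z) = ?F a M * ?F (a + c) h * ?F (b + c) N"
      unfolding E0_def Tr kk transpose_apply_first transpose_apply_second Tz by (simp add: h_def M_def N_def)
    have "act_mu (simple_refl k) (opC k (mum k - mum ?k) (ell_min m r)) (expo z) = opA k (mum k - mum ?k) E (?rm z)"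
      unfolding act_mu_alt expo_rename[OF renaming_ren_mu[OF sk, of m]] opC_expo[OF ch(1)] E_def[symmetric] ..
    also have "\<dots> = (?F (b - a) (N - M) * (?F (a + c) N * ?F a h * ?F b M) + ?F (a - b) h * (?F (b + c) N * ?F b h * ?F a M)) * (R1 z * R2 z)"
      unfolding opA_def split R_mu R_k E_mu E_muk
      by (simp add: kk lin_minus T_def a_def b_def h_def M_def N_def ring_distribs mult_ac)
    also have "\<dots> = (?F c (N - M) * (?F (a + c) M * ?F a h * ?F b N) + ?F (- c) h * (?F a M * ?F (a + c) h * ?F (b + c) N)) * (R1 z * R2 z)"
      using flip_identity[OF \<tau> thn] by (simp add: mult_ac)
    also have "\<dots> = opA q (mum ?k - mum k) E z"
      unfolding opA_def split R_q E_1 E_q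
      by (simp add: kk lin_minus T_def c_def h_def M_def N_def ring_distribs mult_ac)
    also have "\<dots> = opC q (mum ?k - mum k) (ell_min m r) (expo z)"
      unfolding opC_expo[OF ch(2)] E_def[symmetric] ..
    finally show "act_mu (simple_refl k) (opC k (mum k - mum (k + 1)) (ell_min m r)) (expo z) =
       opC (m - r + k) (mum (k + 1) - mum k) (ell_min m r) (expo z)" by (simp add: q_def)
  qed
qed

section \<open>Push-forwards\<close>

lemma subword_perm_0 [simp]: "subword_perm ws \<epsilon> 0 = id"
  by (simp add: subword_perm_def)

lemma subword_perm_Cons:
  "subword_perm (i # ws) (b # \<epsilon>) (Suc k) = (if b then simple_refl i else id) \<circ> subword_perm ws \<epsilon> k"
  by (simp add: subword_perm_def)

lemma push_forward_Nil: "push_forward m r [] [] = ell_min m r"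
  by (simp add: push_forward_def act_x_id)

lemma act_x_deltaf_simple_refl:
  "act_x (simple_refl i) (deltaf (xm (Suc i) - xm i) hm) = deltaf (xm i - xm (Suc i)) hm"
proof -
  have "ren_x (simple_refl i) \<circ> ren_x (simple_refl i) = id"
    unfolding ren_x_comp[symmetric] by (simp add: ren_x_id)
  hence bij: "bij (ren_x (simple_refl i))" by (intro o_bij)
  have T: "ren_x (simple_refl i) Tau = Tau" by simp
  show ?thesis
    unfolding act_x_alt deltaf_rename[OF bij T] by (simp add: rename_minus[OF bij] rename_single[OF bij])
qed

lemma bool_lists_Suc: "{\<epsilon> :: bool list. length \<epsilon> = Suc n} = (\<lambda>(b, \<epsilon>). b # \<epsilon>) ` (UNIV \<times> {\<epsilon>. length \<epsilon> = n})"
  by (auto simp: length_Suc_conv image_iff)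

text \<open>The fixed points are split by their first bit. If it is 1, all the permutations
  \<open>v_k\<close> begin with the transposition of \<open>i\<close>, so the whole contribution of
  the tail is transposed and the first factor becomes the second coefficient of the
  operation.\<close>

lemma push_forward_Cons:
  "push_forward m r (i # ws) (\<nu> # \<nu>s) = opC i \<nu> (push_forward m r ws \<nu>s)"
proof
  fix p :: point
  define t where "t us \<nu>s \<epsilon> p = (\<Prod>k<length us. act_x (subword_perm us \<epsilon> (Suc k))
        (deltaf (xm (Suc (us ! k)) - xm (us ! k)) (if \<epsilon> ! k then hm else \<nu>s ! k)) p)
     * act_x (subword_perm us \<epsilon> (length us)) (ell_min m r) p" for us \<nu>s \<epsilon> p
  have pf: "push_forward m r us \<nu>s p = (\<Sum>\<epsilon> | length \<epsilon> = length us. t us \<nu>s \<epsilon> p)" for us \<nu>s p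
    by (simp add: push_forward_def t_def)
  have F: "t (i # ws) (\<nu> # \<nu>s) (False # \<epsilon>) p = deltaf (xm (Suc i) - xm i) \<nu> p * t ws \<nu>s \<epsilon> p" for \<epsilon>
    unfolding t_def length_Cons prod.lessThan_Suc_shift
    by (simp add: subword_perm_Cons act_x_id mult.assoc cong: if_cong)
  have Tr: "t (i # ws) (\<nu> # \<nu>s) (True # \<epsilon>) p = deltaf (xm i - xm (Suc i)) hm p * t ws \<nu>s \<epsilon> (p \<circ> ren_x (simple_refl i))" for \<epsilon>
    unfolding t_def length_Cons prod.lessThan_Suc_shift
    by (simp add: subword_perm_Cons act_x_comp act_x_deltaf_simple_refl mult.assoc cong: if_cong)
       (simp add: act_x_alt)
  have "push_forward m r (i # ws) (\<nu> # \<nu>s) p =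
     (\<Sum>(b, \<epsilon>)\<in>UNIV \<times> {\<epsilon>. length \<epsilon> = length ws}. t (i # ws) (\<nu> # \<nu>s) (b # \<epsilon>) p)"
    unfolding pf length_Cons bool_lists_Suc
    by (subst sum.reindex) (auto simp: inj_on_def case_prod_beta)
  also have "\<dots> = (\<Sum>b\<in>UNIV. \<Sum>\<epsilon> | length \<epsilon> = length ws. t (i # ws) (\<nu> # \<nu>s) (b # \<epsilon>) p)"
    by (rule sum.cartesian_product[symmetric])
  also have "\<dots> = opC i \<nu> (push_forward m r ws \<nu>s) p"
    unfolding opC_def act_x_alt pf by (simp add: UNIV_bool F Tr sum_distrib_left add.commute)
  finally show "push_forward m r (i # ws) (\<nu> # \<nu>s) p = opC i \<nu> (push_forward m r ws \<nu>s) p" .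
qed

lemma purifying_Nil: "purifying m r [] \<nu>s \<longleftrightarrow> \<nu>s = []"
  by (auto simp: purifying_def)

lemma purifying_Cons:
  "purifying m r (i # ws) (\<nu> # \<nu>s) \<longleftrightarrow>
     nontrivial_char r \<nu> \<and> pure m r (opC i \<nu> (push_forward m r ws \<nu>s)) \<and> purifying m r ws \<nu>s"
proof -
  have "(\<forall>k<length (i # ws). P k) \<longleftrightarrow> P 0 \<and> (\<forall>k<length ws. P (Suc k))" for P
    by (auto simp: less_Suc_eq_0_disj)
  thus ?thesis unfolding purifying_def by (auto simp: push_forward_Cons)
qed

text \<open>The parameter of a letter is the difference of the two characters it exchanges. The head
  of the word acts last, so it finds the characters already permuted by the tail.\<close>

fun params :: "(nat \<Rightarrow> monomial) \<Rightarrow> nat list \<Rightarrow> monomial list" where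
  "params B [] = []"
| "params B (i # ws) = (B (inv (word_perm ws) i) - B (inv (word_perm ws) (Suc i))) # params B ws"

text \<open>With explicit parameters the class makes sense for every word, reduced or not, so that
  words can be manipulated before purity is considered.\<close>

definition word_class :: "nat \<Rightarrow> nat \<Rightarrow> nat list \<Rightarrow> func" where
  "word_class m r ws = push_forward m r ws (params (min_chars m r) ws)"

definition word_char :: "nat \<Rightarrow> nat \<Rightarrow> nat list \<Rightarrow> nat \<Rightarrow> monomial" where
  "word_char m r ws j = min_chars m r (inv (word_perm ws) j)"

lemma word_class_Nil: "word_class m r [] = ell_min m r"
  by (simp add: word_class_def push_forward_Nil)

lemma word_class_Cons:
  "word_class m r (i # ws) = opC i (word_char m r ws i - word_char m r ws (Suc i)) (word_class m r ws)"
  by (simp add: word_class_def word_char_def push_forward_Cons)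

lemma word_char_Nil: "word_char m r [] j = min_chars m r j"
  by (simp only: word_char_def word_perm_Nil inv_id id_apply)

lemma inv_word_perm_Cons:
  assumes "set ws \<subseteq> {1..<m}"
  shows "inv (word_perm (i # ws)) = inv (word_perm ws) \<circ> simple_refl i"
  unfolding word_perm_Cons by (rule inv_simple_refl_comp[OF word_perm_permutes[OF assms]])

lemma word_char_Cons:
  assumes "set ws \<subseteq> {1..<m}"
  shows "word_char m r (i # ws) j = word_char m r ws (simple_refl i j)"
  unfolding word_char_def inv_word_perm_Cons[OF assms] by simp

lemma word_char_chars: "word_char m r ws j \<in> chars r"
  by (simp add: word_char_def min_chars_chars)

lemma word_char_diff_chars: "word_char m r ws i - word_char m r ws j \<in> chars r"
  by (intro chars_minus word_char_chars)

lemma inv_word_perm_in: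
  assumes "set ws \<subseteq> {1..<m}" "j \<in> {1..m}"
  shows "inv (word_perm ws) j \<in> {1..m}"
  using permutes_in_image[OF permutes_inv[OF word_perm_permutes[OF assms(1)]]] assms(2) by blast

lemma inv_word_perm_neq:
  assumes "set ws \<subseteq> {1..<m}" "i \<noteq> j"
  shows "inv (word_perm ws) i \<noteq> inv (word_perm ws) j"
  using permutes_inj[OF permutes_inv[OF word_perm_permutes[OF assms(1)]]] assms(2) by (auto dest: injD)

lemma word_char_diff_nonzero:
  assumes "m \<ge> 2 * r" "set ws \<subseteq> {1..<m}" "i \<in> {1..m}" "j \<in> {1..m}" "i \<noteq> j"
  shows "word_char m r ws i - word_char m r ws j \<noteq> 0"
  unfolding word_char_def
  by (intro min_chars_diff_nonzero inv_word_perm_in inv_word_perm_neq) (use assms in auto)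

lemma depends_word_class:
  assumes "m \<ge> 2 * r" "set ws \<subseteq> {1..<m}"
  shows "depends m r (word_class m r ws)"
  using assms(2)
proof (induction ws)
  case Nil
  show ?case unfolding word_class_Nil by (rule frakA_depends[OF ell_min_frakA[OF assms(1)]])
next
  case (Cons i ws)
  thus ?case unfolding word_class_Cons by (intro depends_opC word_char_diff_chars) auto
qed

text \<open>A good word never exchanges two vertices off the arrows; hence no parameter along it is \<open>h\<close> or
  its inverse, which are the parameters for which an operation can annihilate a class.\<close>

fun good_word :: "nat \<Rightarrow> nat \<Rightarrow> nat list \<Rightarrow> bool" where
  "good_word m r [] \<longleftrightarrow> True"
| "good_word m r (i # ws) \<longleftrightarrow> i \<in> {1..<m} \<and>
     \<not> (middle m r (inv (word_perm ws) i) \<and> middle m r (inv (word_perm ws) (Suc i))) \<and> good_word m r ws"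

lemma good_word_set: "good_word m r ws \<Longrightarrow> set ws \<subseteq> {1..<m}"
  by (induction ws) auto

text \<open>Nonvanishing is inherited through \<open>opC_nonzero\<close>, as goodness of the word
  excludes the parameters \<open>h\<close> and \<open>- h\<close>. For the type, the shift by
  multiples of \<open>h\<close> turns the change made by the operation into an exchange of two
  characters.\<close>

lemma word_class_props:
  assumes m: "m \<ge> 2 * r" and "good_word m r ws"
  shows "word_class m r ws \<in> frakA m r" "\<not> mer_eq m r (word_class m r ws) (\<lambda>p. 0)"
    "has_type m r (word_class m r ws) (bil m (shifted (word_char m r ws)))"
proof -
  have "word_class m r ws \<in> frakA m r \<and> \<not> mer_eq m r (word_class m r ws) (\<lambda>p. 0) \<and>
    has_type m r (word_class m r ws) (bil m (shifted (word_char m r ws)))"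
    using assms(2)
  proof (induction ws)
    case Nil
    have "word_char m r [] = min_chars m r" by (rule ext) (rule word_char_Nil)
    thus ?case
      unfolding word_class_Nil using ell_min_frakA[OF m] ell_min_nonzero[OF m] ell_min_type[OF m] by simp_all
  next
    case (Cons i ws)
    have i: "i \<in> {1..<m}" and gw: "good_word m r ws" using Cons.prems by auto
    note set_ws = good_word_set[OF gw]
    have IH: "word_class m r ws \<in> frakA m r" "\<not> mer_eq m r (word_class m r ws) (\<lambda>p. 0)"
      "has_type m r (word_class m r ws) (bil m (shifted (word_char m r ws)))" using Cons.IH[OF gw] by auto
    let ?\<nu> = "word_char m r ws i - word_char m r ws (Suc i)" and ?v = "inv (word_perm ws)"
    have in_m: "?v i \<in> {1..m}" "?v (Suc i) \<in> {1..m}" using inv_word_perm_in[OF set_ws] i by auto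
    have ne: "?v i \<noteq> ?v (Suc i)" by (rule inv_word_perm_neq[OF set_ws]) simp
    have nz: "?\<nu> \<noteq> 0" unfolding word_char_def by (rule min_chars_diff_nonzero[OF m in_m ne])
    have nh: "?\<nu> \<noteq> hm" "?\<nu> \<noteq> - hm"
      unfolding word_char_def using Cons.prems by (intro min_chars_diff_hm[OF m in_m ne]; simp)+
    have nt: "nontrivial_char r ?\<nu>" using nz word_char_diff_chars by (simp add: nontrivial_char_iff)
    have A: "word_class m r (i # ws) \<in> frakA m r"
      unfolding word_class_Cons by (rule opC_frakA[OF i nt IH(1)])
    have N: "\<not> mer_eq m r (word_class m r (i # ws)) (\<lambda>p. 0)"
      unfolding word_class_Cons
      by (rule opC_nonzero[OF i word_char_diff_chars nz nh frakA_depends[OF IH(1)] IH(2)])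
    have sh: "\<And>j. shifted (word_char m r ws) j \<in> chars r" by (intro shifted_chars word_char_chars)
    have h1: "frag_cmul (int (Suc i)) hm = frag_cmul (int i) hm + hm"
      by (simp add: frag_cmul_distrib)
    have \<nu>: "?\<nu> = shifted (word_char m r ws) i - shifted (word_char m r ws) (Suc i) - hm"
      unfolding shifted_def h1 by simp
    have "shifted (word_char m r (i # ws)) = (shifted (word_char m r ws))
        (i := shifted (word_char m r ws) (Suc i) + hm, Suc i := shifted (word_char m r ws) i - hm)"
      unfolding shifted_def[abs_def] word_char_Cons[OF set_ws]
      by (auto simp: fun_eq_iff Transposition.transpose_def h1 simp del: of_nat_Suc)
    hence "has_type m r (word_class m r (i # ws)) (bil m (shifted (word_char m r (i # ws))))"
      unfolding word_class_Cons using has_type_opC_bil[OF IH(1) IH(3) sh i \<nu> nz] by simp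
    with A N show ?case by blast
  qed
  thus "word_class m r ws \<in> frakA m r" "\<not> mer_eq m r (word_class m r ws) (\<lambda>p. 0)"
    "has_type m r (word_class m r ws) (bil m (shifted (word_char m r ws)))" by auto
qed

text \<open>Each class along the word is nonzero of known type, so purity leaves exactly one
  parameter for every letter. The tail has to be settled first, since the head acts last.\<close>

lemma purifying_iff:
  assumes m: "m \<ge> 2 * r" and "good_word m r ws"
  shows "purifying m r ws \<nu>s \<longleftrightarrow> \<nu>s = params (min_chars m r) ws"
  using assms(2)
proof (induction ws arbitrary: \<nu>s)
  case Nil
  show ?case by (simp add: purifying_Nil)
next
  case (Cons i ws)
  have i: "i \<in> {1..<m}" and gw: "good_word m r ws" using Cons.prems by auto
  note props = word_class_props[OF m gw]
  have sh: "\<And>j. shifted (word_char m r ws) j \<in> chars r" by (intro shifted_chars word_char_chars)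
  let ?\<mu> = "word_char m r ws i - word_char m r ws (Suc i)"
  have \<mu>: "?\<mu> = shifted (word_char m r ws) i - shifted (word_char m r ws) (Suc i) - hm"
    unfolding shifted_def by (simp add: frag_cmul_distrib)
  have nt: "nontrivial_char r ?\<mu>"
    using word_char_diff_nonzero[OF m good_word_set[OF gw], of i "Suc i"] i word_char_diff_chars
    by (simp add: nontrivial_char_iff)
  have pure_iff: "pure m r (opC i \<nu> (word_class m r ws)) \<longleftrightarrow> \<nu> = ?\<mu>" if "nontrivial_char r \<nu>" for \<nu>
    using pure_opC_iff[OF props(1,2,3) i that] balanced_bil[OF i sh, of \<nu>] that \<mu> by (simp add: nontrivial_char_iff)
  show ?case
  proof (cases \<nu>s)
    case Nil
    thus ?thesis by (simp add: purifying_def)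
  next
    case (Cons \<nu> \<nu>s')
    have "purifying m r (i # ws) \<nu>s \<longleftrightarrow> nontrivial_char r \<nu> \<and> \<nu>s' = params (min_chars m r) ws \<and> pure m r (opC i \<nu> (word_class m r ws))"
      unfolding Cons purifying_Cons Cons.IH[OF gw] word_class_def by auto
    also have "\<dots> \<longleftrightarrow> \<nu> = ?\<mu> \<and> \<nu>s' = params (min_chars m r) ws"
      using pure_iff nt by auto
    finally show ?thesis unfolding Cons by (simp add: word_char_def)
  qed
qed

lemma word_class_cong:
  assumes m: "m \<ge> 2 * r" and red: "reduced_word m w ws" "reduced_word m w ws'"
  shows "mer_eq m r (word_class m r ws) (word_class m r ws')"
proof -
  \<comment> \<open>The permutations are recorded as well, because the parameter of a letter put in
    front depends on the permutation of the word behind it.\<close>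
  define E where "E us vs \<longleftrightarrow> word_perm us = word_perm vs \<and> mer_eq m r (word_class m r us) (word_class m r vs)" for us vs
  have "E ws ws'"
  proof (rule reduced_words_braid[OF _ _ _ _ _ _ red])
    show "E us us" for us by (simp add: E_def gen_eq_refl)
    show "E us vs \<Longrightarrow> E vs us" for us vs unfolding E_def using gen_eq_sym by auto
    show "E us vs \<Longrightarrow> E vs ws \<Longrightarrow> E us ws" for us vs ws unfolding E_def using gen_eq_trans by auto
  next
    fix i us vs assume i: "i \<in> {1..<m}" and E: "E us vs"
    have "word_perm us = word_perm vs" using E unfolding E_def by (rule conjunct1)
    hence "word_char m r us = word_char m r vs" unfolding word_char_def[abs_def] by (simp only:)
    thus "E (i # us) (i # vs)"
      unfolding E_def word_class_Cons using E opC_cong[OF i] by (simp add: E_def)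
  next
    fix i j us assume i: "i \<in> {1..<m}" and j: "j \<in> {1..<m}" and ij: "Suc i < j" and us: "set us \<subseteq> {1..<m}"
    have "word_perm (i # j # us) = word_perm (j # i # us)"
      using ij by (auto simp: fun_eq_iff Transposition.transpose_def)
    moreover have "mer_eq m r (word_class m r (i # j # us)) (word_class m r (j # i # us))"
    proof -
      have s: "simple_refl j i = i" "simple_refl j (Suc i) = Suc i" "simple_refl i j = j" "simple_refl i (Suc j) = Suc j"
        using ij by (auto simp: Transposition.transpose_def)
      show ?thesis unfolding word_class_Cons word_char_Cons[OF us] s
        by (intro opC_commute i j ij word_char_diff_chars depends_word_class m us)
    qed
    ultimately show "E (i # j # us) (j # i # us)" by (simp add: E_def)
  next
    fix i us assume i: "i \<in> {1..<m}" "Suc i \<in> {1..<m}" and us: "set us \<subseteq> {1..<m}"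
    have "word_perm (i # Suc i # i # us) = word_perm (Suc i # i # Suc i # us)"
      by (auto simp: fun_eq_iff Transposition.transpose_def)
    moreover have "mer_eq m r (word_class m r (i # Suc i # i # us)) (word_class m r (Suc i # i # Suc i # us))"
    proof -
      let ?B = "word_char m r us"
      \<comment> \<open>The characters exchanged along the two words give the parameters
        \<open>\<mu>\<close>, \<open>\<mu> + \<nu>\<close>, \<open>\<nu>\<close> in opposite orders,
        which is the exact shape of the braid relation.\<close>
      define \<mu> \<nu> where "\<mu> = ?B (Suc i) - ?B (Suc (Suc i))" and "\<nu> = ?B i - ?B (Suc i)"
      have \<mu>\<nu>: "?B i - ?B (Suc (Suc i)) = \<mu> + \<nu>" by (simp add: \<mu>_def \<nu>_def)
      have nz: "\<mu> \<noteq> 0" "\<nu> \<noteq> 0" "\<mu> + \<nu> \<noteq> 0"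
        unfolding \<mu>\<nu>[symmetric] unfolding \<mu>_def \<nu>_def using i
        by (intro word_char_diff_nonzero[OF m us]; simp)+
      have set2: "set (i # us) \<subseteq> {1..<m}" "set (Suc i # us) \<subseteq> {1..<m}"
        "set (Suc i # i # us) \<subseteq> {1..<m}" "set (i # Suc i # us) \<subseteq> {1..<m}" using i us by auto
      have s: "simple_refl i (Suc (Suc i)) = Suc (Suc i)" "simple_refl (Suc i) i = i"
        by (auto simp: Transposition.transpose_def)
      have 1: "word_class m r (i # Suc i # i # us) = opC i \<mu> (opC (i + 1) (\<mu> + \<nu>) (opC i \<nu> (word_class m r us)))"
        unfolding word_class_Cons word_char_Cons[OF set2(1)] word_char_Cons[OF us] s
          transpose_apply_first transpose_apply_second Suc_eq_plus1[symmetric] \<mu>_def[symmetric] \<nu>_def[symmetric] \<mu>\<nu> ..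
      have 2: "word_class m r (Suc i # i # Suc i # us) = opC (i + 1) \<nu> (opC i (\<mu> + \<nu>) (opC (i + 1) \<mu> (word_class m r us)))"
        unfolding word_class_Cons word_char_Cons[OF set2(2)] word_char_Cons[OF us] s
          transpose_apply_first transpose_apply_second Suc_eq_plus1[symmetric] \<mu>_def[symmetric] \<nu>_def[symmetric] \<mu>\<nu> ..
      show ?thesis unfolding 1 2 using i
        by (intro braid_relation[OF _ _ _ nz(1) _ nz(2,3) depends_word_class[OF m us]])
           (auto simp: \<mu>_def \<nu>_def word_char_diff_chars)
    qed
    ultimately show "E (i # Suc i # i # us) (Suc i # i # Suc i # us)" by (simp add: E_def)
  qed
  thus ?thesis by (simp add: E_def)
qed

section \<open>Flips\<close>

lemma bij_simple_refl: "bij (simple_refl q)"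
  by (rule o_bij[of "simple_refl q"]) (auto simp: fun_eq_iff)

text \<open>The two symmetric groups act on different variables and \<open>h\<close> is not
  relabelled, so only the parameter changes.\<close>

lemma act_mu_opC:
  assumes \<sigma>: "\<sigma> permutes {1..r}"
  shows "act_mu \<sigma> (opC i \<nu> f) = opC i (rename (ren_mu \<sigma>) \<nu>) (act_mu \<sigma> f)"
proof
  fix p :: point
  have bij: "bij (ren_mu \<sigma>)" using renaming_bij[OF renaming_ren_mu[OF \<sigma>, of 0]] .
  have T: "ren_mu \<sigma> Tau = Tau" by simp
  have "\<sigma> 0 = 0" using permutes_not_in[OF \<sigma>, of 0] by simp
  note \<sigma>0 = this
  hence h: "rename (ren_mu \<sigma>) hm = hm" by (simp add: rename_single[OF bij])
  have comm: "p \<circ> ren_mu \<sigma> \<circ> ren_x (simple_refl i) = p \<circ> ren_x (simple_refl i) \<circ> ren_mu \<sigma>"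
    unfolding comp_assoc ren_x_mu_comm ..
  show "act_mu \<sigma> (opC i \<nu> f) p = opC i (rename (ren_mu \<sigma>) \<nu>) (act_mu \<sigma> f) p"
    unfolding act_mu_alt opC_def act_x_alt deltaf_rename[OF bij T] comm
    by (simp add: rename_minus[OF bij] rename_single[OF bij] \<sigma>0)
qed

lemma act_mu_cong:
  assumes "\<sigma> permutes {1..r}" "mer_eq m r f g"
  shows "mer_eq m r (act_mu \<sigma> f) (act_mu \<sigma> g)"
  unfolding act_mu_alt by (rule gen_eq_rename_mult[OF renaming_ren_mu[OF assms(1)] assms(2)])

lemma rename_frag_cmul: "bij \<rho> \<Longrightarrow> rename \<rho> (frag_cmul k l) = frag_cmul k (rename \<rho> l)"
proof (rule poly_mapping_eqI)
  fix v assume bij: "bij \<rho>"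
  obtain w where "v = \<rho> w" using bij by (metis bij_pointE)
  thus "Poly_Mapping.lookup (rename \<rho> (frag_cmul k l)) v = Poly_Mapping.lookup (frag_cmul k (rename \<rho> l)) v"
    by (simp add: lookup_rename[OF bij])
qed

lemma min_chars_target: "j \<in> {1..r} \<Longrightarrow> min_chars m r j = mum j + frag_cmul (int r) hm"
  by (simp add: min_chars_def)

lemma min_chars_source:
  assumes "m \<ge> 2 * r" "i \<in> {1..r}"
  shows "min_chars m r (m - r + i) = frag_cmul (int (m - r + 1)) hm - mum i"
proof -
  have "\<not> m - r + i \<le> r" "m - r < m - r + i" "m - r + i \<le> m" "m - r + i \<noteq> 0" using assms by auto
  thus ?thesis by (simp only: min_chars_def if_False if_True simp_thms diff_add_inverse)
qed

text \<open>Exchanging two targets and relabelling their arrows amounts to exchanging the two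
  sources, because the multiple of \<open>h\<close> in \<open>min_chars\<close> is the same for all
  targets and the same for all sources.\<close>

lemma min_chars_flip:
  assumes m: "m \<ge> 2 * r" and k: "k \<in> {1..<r}" and j: "j \<in> {1..m}"
  shows "rename (ren_mu (simple_refl k)) (min_chars m r (simple_refl k j)) = min_chars m r (simple_refl (m - r + k) j)"
proof -
  have sk: "simple_refl k permutes {1..r}" by (rule simple_refl_permutes[OF k])
  note bij = renaming_bij[OF renaming_ren_mu[OF sk, of m]]
  have h: "rename (ren_mu (simple_refl k)) hm = hm" using k by (simp add: rename_single[OF bij] Transposition.transpose_def)
  have k0: "simple_refl k 0 = 0" using k by (simp add: Transposition.transpose_def)
  note simps = rename_plus[OF bij] rename_minus[OF bij] rename_frag_cmul[OF bij] rename_single[OF bij] h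
  consider "j \<in> {1..r}" | "r < j" "j \<le> m - r" | "j \<in> {m - r<..m}" using j by force
  thus ?thesis
  proof cases
    case 1
    hence "simple_refl k j \<in> {1..r}" using permutes_in_image[OF sk] by blast
    moreover have "simple_refl (m - r + k) j = j" using 1 m k by (auto simp: Transposition.transpose_def)
    ultimately show ?thesis using 1 k0 by (simp add: min_chars_target simps)
  next
    case 2
    hence "simple_refl k j = j" "simple_refl (m - r + k) j = j" using m k by (auto simp: Transposition.transpose_def)
    thus ?thesis using 2 k0 by (simp add: min_chars_def simps)
  next
    case 3
    define l where "l = j - (m - r)"
    have l: "j = m - r + l" "l \<in> {1..r}" using 3 m by (auto simp: l_def)
    have "simple_refl k l \<in> {1..r}" using permutes_in_image[OF sk] l(2) by blast
    moreover have "simple_refl k j = j" using l m k by (auto simp: Transposition.transpose_def)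
    moreover have "simple_refl (m - r + k) j = m - r + simple_refl k l" unfolding l(1) by (auto simp: Transposition.transpose_def)
    ultimately show ?thesis using k0 min_chars_source[OF m l(2)] unfolding l(1)
      by (simp add: min_chars_source[OF m] simps)
  qed
qed

text \<open>For the empty prefix this is the flip relation. Each further letter is compatible with
  relabelling, since \<open>min_chars_flip\<close> identifies the parameters on both sides.\<close>

lemma word_class_flip:
  assumes m: "m \<ge> 2 * r" and k: "k \<in> {1..<r}" and us: "set us \<subseteq> {1..<m}"
  shows "mer_eq m r (word_class m r (us @ [m - r + k])) (act_mu (simple_refl k) (word_class m r (us @ [k])))"
  using us
proof (induction us)
  case Nil
  have "word_class m r [k] = opC k (mum k - mum (k + 1)) (ell_min m r)"
    unfolding word_class_Cons word_class_Nil word_char_Nil using k by (simp add: min_chars_target)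
  moreover have "word_class m r [m - r + k] = opC (m - r + k) (mum (k + 1) - mum k) (ell_min m r)"
    unfolding word_class_Cons word_class_Nil word_char_Nil
    using k min_chars_source[OF m, of k] min_chars_source[OF m, of "Suc k"] by simp
  ultimately show ?case using gen_eq_sym[OF flip_relation[OF m, of k]] k by simp
next
  case (Cons i us)
  have i: "i \<in> {1..<m}" and us: "set us \<subseteq> {1..<m}" using Cons.prems by auto
  have sk: "simple_refl k permutes {1..r}" by (rule simple_refl_permutes[OF k])
  note bij = renaming_bij[OF renaming_ren_mu[OF sk, of m]]
  have inv_snoc: "inv (word_perm (us @ [q])) j = simple_refl q (inv (word_perm us) j)" for q j
  proof -
    have "inv (word_perm us \<circ> simple_refl q) = inv (simple_refl q) \<circ> inv (word_perm us)"
      by (rule o_inv_distrib[OF permutes_bij[OF word_perm_permutes[OF us]] bij_simple_refl])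
    thus ?thesis by (simp add: word_perm_append)
  qed
  have ch: "word_char m r (us @ [m - r + k]) j = rename (ren_mu (simple_refl k)) (word_char m r (us @ [k]) j)" if "j \<in> {1..m}" for j
    unfolding word_char_def inv_snoc
    using min_chars_flip[OF m k inv_word_perm_in[OF us that]] by simp
  have "mer_eq m r (word_class m r (us @ [m - r + k])) (act_mu (simple_refl k) (word_class m r (us @ [k])))"
    by (rule Cons.IH[OF us])
  hence "mer_eq m r (word_class m r (i # us @ [m - r + k]))
     (opC i (word_char m r (us @ [m - r + k]) i - word_char m r (us @ [m - r + k]) (Suc i)) (act_mu (simple_refl k) (word_class m r (us @ [k]))))"
    unfolding word_class_Cons by (rule opC_cong[OF i])
  also have "word_char m r (us @ [m - r + k]) i - word_char m r (us @ [m - r + k]) (Suc i) =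
      rename (ren_mu (simple_refl k)) (word_char m r (us @ [k]) i - word_char m r (us @ [k]) (Suc i))"
    using ch[of i] ch[of "Suc i"] i by (simp add: rename_minus[OF bij])
  finally show ?case unfolding append_Cons word_class_Cons[of m r i "us @ [k]"] act_mu_opC[OF sk] .
qed

section \<open>Presentations of link patterns\<close>

lemma presents_iff:
  "presents m r P \<sigma> w \<longleftrightarrow> \<sigma> permutes {1..r} \<and> w permutes {1..m} \<and>
     (\<forall>k\<in>{1..r}. P k = (w (m - r + inv \<sigma> k), w (inv \<sigma> k)))"
  by (simp add: presents_def pattern_eq_def relabel_pattern_def move_pattern_def min_pattern_def)

section \<open>Existence of presentations and properties of minimal ones\<close>

lemma permutes_extend:
  fixes f :: "'a \<Rightarrow> 'a"
  assumes "finite A" "T \<subseteq> A" "inj_on f T" "f ` T \<subseteq> A"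
  shows "\<exists>w. w permutes A \<and> (\<forall>x\<in>T. w x = f x)"
proof -
  have "card (A - T) = card (A - f ` T)"
    using assms by (simp add: card_Diff_subset finite_subset card_image)
  hence "\<exists>g. bij_betw g (A - T) (A - f ` T)"
    using assms(1) by (intro finite_same_card_bij) simp_all
  then obtain g where g: "bij_betw g (A - T) (A - f ` T)" by blast
  define w where "w x = (if x \<in> T then f x else if x \<in> A then g x else x)" for x
  have "bij_betw w T (f ` T)"
    using assms(3) by (subst bij_betw_cong[of _ _ f]) (auto simp: w_def bij_betw_def)
  moreover have "bij_betw w (A - T) (A - f ` T)"
    using g by (subst bij_betw_cong[of _ _ g]) (auto simp: w_def)
  ultimately have "bij_betw w (T \<union> (A - T)) (f ` T \<union> (A - f ` T))"
    by (rule bij_betw_combine) auto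
  moreover have "T \<union> (A - T) = A" "f ` T \<union> (A - f ` T) = A" using assms by auto
  ultimately have "bij_betw w A A" by simp
  hence "w permutes A" by (rule bij_imp_permutes) (use assms(2) in \<open>auto simp: w_def\<close>)
  thus ?thesis by (auto simp: w_def)
qed

lemma exists_presents:
  assumes m: "m \<ge> 2 * r" and P: "link_pattern m r P"
  shows "\<exists>w. presents m r P id w"
proof -
  \<comment> \<open>The prescribed values of the permutation, targets at the first \<open>r\<close>
    places and sources at the last \<open>r\<close>; these places are disjoint as
    \<open>m \<ge> 2 * r\<close>.\<close>
  define f where "f j = (if j \<le> r then snd (P j) else fst (P (j - (m - r))))" for j
  let ?T = "{1..r} \<union> (\<lambda>k. m - r + k) ` {1..r}"
  have inj: "inj_on (fst \<circ> P) {1..r}" "inj_on (snd \<circ> P) {1..r}" and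
    disj: "(fst \<circ> P) ` {1..r} \<inter> (snd \<circ> P) ` {1..r} = {}"
    using P by (auto simp: link_pattern_def)
  have f: "f k = snd (P k)" "f (m - r + k) = fst (P k)" if "k \<in> {1..r}" for k
    using that m by (auto simp: f_def)
  have "inj_on f ?T"
  proof (subst inj_on_Un, intro conjI)
    show "inj_on f {1..r}"
    proof (rule inj_onI)
      fix a b assume "a \<in> {1..r}" "b \<in> {1..r}" "f a = f b"
      thus "a = b" using inj_onD[OF inj(2), of a b] f(1)[of a] f(1)[of b] by simp
    qed
    show "inj_on f ((\<lambda>k. m - r + k) ` {1..r})"
    proof (rule inj_onI)
      fix x y assume "x \<in> (\<lambda>k. m - r + k) ` {1..r}" "y \<in> (\<lambda>k. m - r + k) ` {1..r}" "f x = f y"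
      then obtain a b where "x = m - r + a" "y = m - r + b" "a \<in> {1..r}" "b \<in> {1..r}" "f (m - r + a) = f (m - r + b)" by blast
      thus "x = y" using inj_onD[OF inj(1), of a b] f(2)[of a] f(2)[of b] by simp
    qed
    have "f a \<noteq> f (m - r + b)" if "a \<in> {1..r}" "b \<in> {1..r}" for a b
    proof
      assume "f a = f (m - r + b)"
      hence "(snd \<circ> P) a = (fst \<circ> P) b" using f(1)[OF that(1)] f(2)[OF that(2)] by simp
      thus False using disj that by (metis IntI empty_iff imageI)
    qed
    thus "f ` ({1..r} - (\<lambda>k. m - r + k) ` {1..r}) \<inter> f ` ((\<lambda>k. m - r + k) ` {1..r} - {1..r}) = {}"
      by blast
  qed
  moreover have "f ` ?T \<subseteq> {1..m}"
  proof -
    have "f k \<in> {1..m}" "f (m - r + k) \<in> {1..m}" if "k \<in> {1..r}" for k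
      using P f[OF that] that by (simp_all add: link_pattern_def)
    thus ?thesis by blast
  qed
  moreover have "?T \<subseteq> {1..m}" using m by auto
  ultimately obtain w where w: "w permutes {1..m}" "\<forall>x\<in>?T. w x = f x"
    using permutes_extend[of "{1..m}" ?T f] by blast
  have "P k = (w (m - r + k), w k)" if "k \<in> {1..r}" for k
    using w(2) f[OF that] that by (simp add: prod_eq_iff)
  thus ?thesis using w(1) by (intro exI[of _ w]) (auto simp: presents_iff permutes_id inv_id)
qed

lemma exists_choice:
  assumes "m \<ge> 2 * r" "link_pattern m r P"
  shows "\<exists>\<sigma> w ws. ell_choice m r P \<sigma> w ws"
proof -
  have "\<exists>n \<sigma> w. presents m r P \<sigma> w \<and> perm_length m w = n" using exists_presents[OF assms] by blast
  hence "\<exists>\<sigma> w. presents m r P \<sigma> w \<and> perm_length m w = min_length m r P"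
    unfolding min_length_def by (rule LeastI_ex)
  then obtain \<sigma> w where w: "presents m r P \<sigma> w" "perm_length m w = min_length m r P" by blast
  hence "w permutes {1..m}" by (simp add: presents_def)
  then obtain ws where "reduced_word m w ws" using exists_reduced_word by blast
  thus ?thesis using w unfolding ell_choice_def by blast
qed

lemma min_length_le: "presents m r P \<sigma> w \<Longrightarrow> min_length m r P \<le> perm_length m w"
  unfolding min_length_def by (rule Least_le) blast

lemma perm_length_word_le:
  "set ws \<subseteq> {1..<m} \<Longrightarrow> perm_length m (word_perm ws) \<le> length ws"
  using perm_length_eq_ninv[OF word_perm_permutes] ninv_word_le by metis

lemma ell_choice_length:
  assumes "ell_choice m r P \<sigma> w ws" "presents m r P \<sigma>' w'" "set ws' \<subseteq> {1..<m}" "word_perm ws' = w'"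
  shows "length ws \<le> length ws'"
  using assms min_length_le[OF assms(2)] perm_length_word_le[OF assms(3)]
  by (auto simp: ell_choice_def reduced_word_def)

lemma good_wordI:
  assumes "set ws \<subseteq> {1..<m}"
    "\<And>us i vs. ws = us @ i # vs \<Longrightarrow> \<not> (middle m r (inv (word_perm vs) i) \<and> middle m r (inv (word_perm vs) (Suc i)))"
  shows "good_word m r ws"
  using assms
proof (induction ws)
  case (Cons i ws)
  have "\<not> (middle m r (inv (word_perm ws) i) \<and> middle m r (inv (word_perm ws) (Suc i)))"
    using Cons.prems(2)[of "[]" i ws] by simp
  moreover have "good_word m r ws"
    by (rule Cons.IH) (use Cons.prems(1) Cons.prems(2)[of "i # us" for us] in auto)
  ultimately show ?case using Cons.prems(1) by simp
qed simp

text \<open>A letter exchanging two vertices off the arrows could be left out: the resulting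
  permutation has the same values at all sources and targets of the minimal pattern, so it would
  present \<open>P\<close> by a shorter word.\<close>

lemma ell_choice_good:
  assumes m: "m \<ge> 2 * r" and choice: "ell_choice m r P \<sigma> w ws"
  shows "good_word m r ws"
proof (rule good_wordI)
  have pr: "presents m r P \<sigma> w" and ws: "set ws \<subseteq> {1..<m}" "word_perm ws = w"
    using choice by (auto simp: ell_choice_def reduced_word_def)
  show "set ws \<subseteq> {1..<m}" by (rule ws)
  fix us i vs assume split: "ws = us @ i # vs"
  show "\<not> (middle m r (inv (word_perm vs) i) \<and> middle m r (inv (word_perm vs) (Suc i)))"
  proof
    assume mid: "middle m r (inv (word_perm vs) i) \<and> middle m r (inv (word_perm vs) (Suc i))"
    have sub: "set (us @ vs) \<subseteq> {1..<m}" "set vs \<subseteq> {1..<m}" using ws(1) split by auto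
    have vsp: "word_perm vs permutes {1..m}" by (rule word_perm_permutes[OF sub(2)])
    have same: "word_perm (us @ vs) t = w t" if "\<not> middle m r t" for t
    proof -
      have "word_perm vs t \<noteq> i" "word_perm vs t \<noteq> Suc i"
        using mid that permutes_inverses(2)[OF vsp, of t] by metis+
      hence "simple_refl i (word_perm vs t) = word_perm vs t" by simp
      thus ?thesis unfolding ws(2)[symmetric] split word_perm_append word_perm_Cons by simp
    qed
    have \<sigma>: "\<sigma> permutes {1..r}" using pr by (simp add: presents_def)
    have "\<not> middle m r (m - r + inv \<sigma> k)" "\<not> middle m r (inv \<sigma> k)" if "k \<in> {1..r}" for k
    proof -
      have "inv \<sigma> k \<in> {1..r}" by (subst permutes_in_image[OF permutes_inv[OF \<sigma>]]) (rule that)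
      thus "\<not> middle m r (m - r + inv \<sigma> k)" "\<not> middle m r (inv \<sigma> k)" by (auto simp: middle_def)
    qed
    hence "presents m r P \<sigma> (word_perm (us @ vs))"
      using pr word_perm_permutes[OF sub(1)] by (simp add: presents_iff same)
    from ell_choice_length[OF choice this sub(1) refl] show False using split by simp
  qed
qed

lemma ell_choice_class:
  assumes "m \<ge> 2 * r" "ell_choice m r P \<sigma> w ws" "purifying m r ws \<nu>"
  shows "push_forward m r ws \<nu> = word_class m r ws"
  using purifying_iff[OF assms(1) ell_choice_good[OF assms(1,2)]] assms(3) by (simp add: word_class_def)

lemma permutes_neq: "w permutes A \<Longrightarrow> i \<noteq> j \<Longrightarrow> w i \<noteq> w j"
  using permutes_inj by (metis injD)

text \<open>Relabelling two arrows is compensated by exchanging both their targets and their sources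
  in the minimal pattern.\<close>

lemma presents_flip:
  assumes m: "m \<ge> 2 * r" and k: "k \<in> {1..<r}" and pr: "presents m r P \<sigma> w"
  shows "presents m r P (\<sigma> \<circ> simple_refl k) (w \<circ> simple_refl k \<circ> simple_refl (m - r + k))"
proof -
  let ?q = "m - r + k"
  have \<sigma>: "\<sigma> permutes {1..r}" and w: "w permutes {1..m}" using pr by (auto simp: presents_def)
  have sk: "simple_refl k permutes {1..r}" by (rule simple_refl_permutes[OF k])
  have inv\<sigma>: "inv (\<sigma> \<circ> simple_refl k) = simple_refl k \<circ> inv \<sigma>"
    using o_inv_distrib[OF permutes_bij[OF \<sigma>] bij_simple_refl, of k] by simp
  show ?thesis unfolding presents_iff
  proof (intro conjI ballI)
    show "\<sigma> \<circ> simple_refl k permutes {1..r}" by (rule permutes_compose[OF sk \<sigma>])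
    show "w \<circ> simple_refl k \<circ> simple_refl ?q permutes {1..m}"
      using k m by (intro permutes_compose[OF simple_refl_permutes permutes_compose[OF simple_refl_permutes w]]) auto
    fix a assume a: "a \<in> {1..r}"
    define j where "j = inv \<sigma> a"
    have j: "j \<in> {1..r}" using a permutes_in_image[OF permutes_inv[OF \<sigma>]] by (simp add: j_def)
    have sj: "simple_refl k j \<in> {1..r}" using permutes_in_image[OF sk] j by blast
    have "simple_refl ?q (m - r + simple_refl k j) = m - r + j"
      by (auto simp: Transposition.transpose_def)
    moreover have "simple_refl k (m - r + j) = m - r + j"
      using j k m by (auto simp: Transposition.transpose_def)
    moreover have "simple_refl ?q (simple_refl k j) = simple_refl k j"
    proof (rule transpose_apply_other)
      have "simple_refl k j \<le> r" using sj by (simp only: atLeastAtMost_iff)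
      moreover have "r < ?q" using k m by auto
      ultimately show "simple_refl k j \<noteq> ?q" "simple_refl k j \<noteq> Suc ?q" by linarith+
    qed
    ultimately show "P a = ((w \<circ> simple_refl k \<circ> simple_refl ?q) (m - r + inv (\<sigma> \<circ> simple_refl k) a), (w \<circ> simple_refl k \<circ> simple_refl ?q) (inv (\<sigma> \<circ> simple_refl k) a))"
      using pr a unfolding presents_iff inv\<sigma> by (simp add: j_def)
  qed
qed

text \<open>A flip exchanges the labels of two arrows.  If it does not change the length, then exactly
  one of the pairs of sources and targets of the two arrows is inverted, and the two
  presentations are related by the flip relation.\<close>

lemma ell_choice_flip:
  assumes m: "m \<ge> 2 * r" and choice: "ell_choice m r P \<sigma> w ws" and k: "k \<in> {1..<r}" and desc: "w (Suc k) < w k"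
  shows "\<exists>us. ell_choice m r P (\<sigma> \<circ> simple_refl k) (w \<circ> simple_refl k \<circ> simple_refl (m - r + k)) us \<and>
     mer_eq m r (act_mu (\<sigma> \<circ> simple_refl k) (word_class m r us)) (act_mu \<sigma> (word_class m r ws))"
proof -
  let ?q = "m - r + k"
  have pr: "presents m r P \<sigma> w" and len: "perm_length m w = min_length m r P" and red: "reduced_word m w ws"
    using choice by (auto simp: ell_choice_def)
  have \<sigma>: "\<sigma> permutes {1..r}" and w: "w permutes {1..m}" using pr by (auto simp: presents_def)
  have km: "k \<in> {1..<m}" and qm: "?q \<in> {1..<m}" using k m by auto
  define v where "v = w \<circ> simple_refl k"
  have v: "v permutes {1..m}" unfolding v_def by (rule permutes_compose[OF simple_refl_permutes[OF km] w])
  have vq: "v \<circ> simple_refl ?q permutes {1..m}" by (rule permutes_compose[OF simple_refl_permutes[OF qm] v])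
  have nv: "ninv m v + 1 = ninv m w" unfolding v_def by (rule ninv_right_down[OF km desc])
  note pr' = presents_flip[OF m k pr, folded v_def]
  have ml: "ninv m w \<le> ninv m (v \<circ> simple_refl ?q)"
    using min_length_le[OF pr'] len perm_length_eq_ninv[OF w] perm_length_eq_ninv[OF vq] by simp
  have "v ?q \<noteq> v (Suc ?q)" by (rule permutes_neq[OF v]) simp
  \<comment> \<open>A second descent would make the new permutation shorter than \<open>w\<close>,
    against minimality.\<close>
  moreover have "\<not> v (Suc ?q) < v ?q" using ninv_right_down[OF qm, of v] nv ml by auto
  ultimately have "v ?q < v (Suc ?q)" by simp
  from ninv_right_up[OF qm this] have nvq: "ninv m (v \<circ> simple_refl ?q) = ninv m w" using nv by simp
  obtain us where us: "reduced_word m v us" using exists_reduced_word[OF v] by blast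
  hence us': "set us \<subseteq> {1..<m}" "word_perm us = v" "length us = ninv m v"
    using reduced_word_iff[OF v] by auto
  \<comment> \<open>Both presentations now have reduced words with the common prefix
    \<open>us\<close>, the form in which \<open>word_class_flip\<close> compares them.\<close>
  have "word_perm (us @ [k]) = w" by (simp add: word_perm_append us'(2) v_def)
  hence red1: "reduced_word m w (us @ [k])"
    unfolding reduced_word_iff[OF w] using us' km nv by simp
  have red2: "reduced_word m (v \<circ> simple_refl ?q) (us @ [?q])"
    unfolding reduced_word_iff[OF vq] using us' qm nv nvq by (simp add: word_perm_append)
  have sk: "simple_refl k permutes {1..r}" by (rule simple_refl_permutes[OF k])
  have "mer_eq m r (act_mu (\<sigma> \<circ> simple_refl k) (word_class m r (us @ [?q])))
      (act_mu (\<sigma> \<circ> simple_refl k) (act_mu (simple_refl k) (word_class m r (us @ [k]))))"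
    by (intro act_mu_cong permutes_compose[OF sk \<sigma>] word_class_flip[OF m k us'(1)])
  also have "act_mu (\<sigma> \<circ> simple_refl k) (act_mu (simple_refl k) (word_class m r (us @ [k]))) = act_mu \<sigma> (word_class m r (us @ [k]))"
    unfolding act_mu_comp[symmetric] comp_assoc by simp
  finally have "mer_eq m r (act_mu (\<sigma> \<circ> simple_refl k) (word_class m r (us @ [?q]))) (act_mu \<sigma> (word_class m r ws))"
    using gen_eq_trans act_mu_cong[OF \<sigma> word_class_cong[OF m red1 red]] by blast
  moreover have "ell_choice m r P (\<sigma> \<circ> simple_refl k) (v \<circ> simple_refl ?q) (us @ [?q])"
    unfolding ell_choice_def using pr' red2 len perm_length_eq_ninv[OF w] perm_length_eq_ninv[OF vq] nvq by simp
  ultimately show ?thesis unfolding v_def by blast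
qed

lemma invs_cong: "(\<And>j. j \<in> {1..m} \<Longrightarrow> v j = w j) \<Longrightarrow> invs m v = invs m w"
  unfolding invs_def by (intro Collect_cong) (auto simp del: atLeastAtMost_iff)

section \<open>Sorted presentations and their uniqueness\<close>

text \<open>Bubble sort by flips, measured by the inversions among the first \<open>r\<close>
  places; the accompanying exchange of two sources happens outside these places.\<close>

lemma ell_choice_sorted:
  assumes m: "m \<ge> 2 * r" and "ell_choice m r P \<sigma> w ws"
  shows "\<exists>\<sigma>' w' ws'. ell_choice m r P \<sigma>' w' ws' \<and> (\<forall>k\<in>{1..<r}. w' k < w' (Suc k)) \<and>
     mer_eq m r (act_mu \<sigma> (word_class m r ws)) (act_mu \<sigma>' (word_class m r ws'))"
  using assms(2)
proof (induction "ninv r w" arbitrary: \<sigma> w ws rule: less_induct)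
  case less
  show ?case
  proof (cases "\<forall>k\<in>{1..<r}. w k < w (Suc k)")
    case True
    thus ?thesis using less.prems gen_eq_refl[OF open_dom_mult] by blast
  next
    case False
    then obtain k where k: "k \<in> {1..<r}" "\<not> w k < w (Suc k)" by blast
    have w: "w permutes {1..m}" using less.prems by (simp add: ell_choice_def presents_def)
    have "w k \<noteq> w (Suc k)" by (rule permutes_neq[OF w]) simp
    hence desc: "w (Suc k) < w k" using k(2) by simp
    let ?w = "w \<circ> simple_refl k \<circ> simple_refl (m - r + k)"
    obtain us where us: "ell_choice m r P (\<sigma> \<circ> simple_refl k) ?w us"
      "mer_eq m r (act_mu (\<sigma> \<circ> simple_refl k) (word_class m r us)) (act_mu \<sigma> (word_class m r ws))"
      using ell_choice_flip[OF m less.prems k(1) desc] by blast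
    have "?w j = (w \<circ> simple_refl k) j" if "j \<in> {1..r}" for j
    proof -
      have "j \<noteq> m - r + k" "j \<noteq> Suc (m - r + k)" using that k m by auto
      thus ?thesis by simp
    qed
    hence "invs r ?w = invs r (w \<circ> simple_refl k)" by (rule invs_cong)
    hence "ninv r ?w + 1 = ninv r w" unfolding ninv_def using ninv_right_down[OF k(1) desc] by (simp only: ninv_def)
    hence "ninv r ?w < ninv r w" by linarith
    from less.hyps[OF this us(1)] obtain \<sigma>' w' ws' where
      "ell_choice m r P \<sigma>' w' ws'" "\<forall>k\<in>{1..<r}. w' k < w' (Suc k)"
      "mer_eq m r (act_mu (\<sigma> \<circ> simple_refl k) (word_class m r us)) (act_mu \<sigma>' (word_class m r ws'))" by (elim exE conjE)
    thus ?thesis using gen_eq_trans[OF gen_eq_sym[OF us(2)]] by blast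
  qed
qed

text \<open>The pattern does not depend on the values of \<open>w\<close> off the arrows, so a
  descent there could be removed, giving a shorter presentation.\<close>

lemma ell_choice_middle_increasing:
  assumes m: "m \<ge> 2 * r" and choice: "ell_choice m r P \<sigma> w ws" and j: "r < j" "Suc j \<le> m - r"
  shows "w j < w (Suc j)"
proof (rule ccontr)
  have pr: "presents m r P \<sigma> w" and len: "perm_length m w = min_length m r P"
    using choice by (auto simp: ell_choice_def)
  have \<sigma>: "\<sigma> permutes {1..r}" and w: "w permutes {1..m}" using pr by (auto simp: presents_def)
  have jm: "j \<in> {1..<m}" using j by auto
  assume "\<not> w j < w (Suc j)"
  moreover have "w j \<noteq> w (Suc j)" by (rule permutes_neq[OF w]) simp
  ultimately have "ninv m (w \<circ> simple_refl j) + 1 = ninv m w" by (intro ninv_right_down[OF jm]) auto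
  moreover have wj: "w \<circ> simple_refl j permutes {1..m}" by (rule permutes_compose[OF simple_refl_permutes[OF jm] w])
  moreover have "presents m r P \<sigma> (w \<circ> simple_refl j)"
    unfolding presents_iff
  proof (intro conjI ballI \<sigma> wj)
    fix k assume k: "k \<in> {1..r}"
    hence "inv \<sigma> k \<in> {1..r}" using permutes_in_image[OF permutes_inv[OF \<sigma>]] by blast
    hence "simple_refl j (m - r + inv \<sigma> k) = m - r + inv \<sigma> k" "simple_refl j (inv \<sigma> k) = inv \<sigma> k"
      using j by (auto simp: Transposition.transpose_def)
    thus "P k = ((w \<circ> simple_refl j) (m - r + inv \<sigma> k), (w \<circ> simple_refl j) (inv \<sigma> k))"
      using pr k by (simp add: presents_iff)
  qed
  ultimately show False
    using min_length_le[of m r P \<sigma> "w \<circ> simple_refl j"] len perm_length_eq_ninv[OF w] perm_length_eq_ninv[OF wj] by simp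
qed

lemma increasing_lift:
  fixes w :: "nat \<Rightarrow> nat"
  assumes "\<And>k. a \<le> k \<Longrightarrow> k < b \<Longrightarrow> w k < w (Suc k)" "a \<le> i" "i < j" "j \<le> b"
  shows "w i < w j"
  using assms(3,4)
proof (induction j)
  case (Suc j)
  have "w j < w (Suc j)" using Suc.prems assms(2) by (intro assms(1)) auto
  thus ?case using Suc by (cases "i = j") auto
qed simp

lemma increasing_reflect:
  fixes w :: "nat \<Rightarrow> nat"
  assumes "\<And>k. a \<le> k \<Longrightarrow> k < b \<Longrightarrow> w k < w (Suc k)" "a \<le> i" "i \<le> b" "a \<le> j" "j \<le> b" "w i < w j"
  shows "i < j"
proof (rule ccontr)
  assume "\<not> i < j"
  hence "i = j \<or> j < i" by auto
  thus False using increasing_lift[of a b w j i] assms by auto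
qed

text \<open>Increasing values at the targets leave no freedom in the labels, so both permutations
  agree at targets and sources. The remaining values form the same set for both, and by minimality
  both are increasing there.\<close>

lemma sorted_choice_unique:
  assumes m: "m \<ge> 2 * r"
    and c1: "ell_choice m r P \<sigma> w ws" and s1: "\<forall>k\<in>{1..<r}. w k < w (Suc k)"
    and c2: "ell_choice m r P \<sigma>' w' ws'" and s2: "\<forall>k\<in>{1..<r}. w' k < w' (Suc k)"
  shows "\<sigma>' = \<sigma> \<and> w' = w"
proof -
  have pr: "presents m r P \<sigma> w" and pr': "presents m r P \<sigma>' w'"
    using c1 c2 by (auto simp: ell_choice_def)
  have \<sigma>: "\<sigma> permutes {1..r}" "\<sigma>' permutes {1..r}" and w: "w permutes {1..m}" "w' permutes {1..m}"
    using pr pr' by (auto simp: presents_def)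
  define \<rho> where "\<rho> = inv \<sigma> \<circ> \<sigma>'"
  have \<rho>: "\<rho> permutes {1..r}" unfolding \<rho>_def by (rule permutes_compose[OF \<sigma>(2) permutes_inv[OF \<sigma>(1)]])
  have eq: "w' j = w (\<rho> j)" "w' (m - r + j) = w (m - r + \<rho> j)" if "j \<in> {1..r}" for j
  proof -
    have "\<sigma>' j \<in> {1..r}" using that permutes_in_image[OF \<sigma>(2)] by blast
    thus "w' j = w (\<rho> j)" "w' (m - r + j) = w (m - r + \<rho> j)"
      using pr pr' permutes_inverses(2)[OF \<sigma>(2)] by (auto simp: presents_iff \<rho>_def)
  qed
  have "\<rho> = id"
  proof (rule permutes_increasing_id[OF \<rho>])
    fix k assume k: "k \<in> {1..<r}"
    have in_r: "\<rho> k \<in> {1..r}" "\<rho> (Suc k) \<in> {1..r}" using k permutes_in_image[OF \<rho>] by auto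
    have "w' k < w' (Suc k)" by (rule bspec[OF s2 k])
    hence "w (\<rho> k) < w (\<rho> (Suc k))" using k eq(1)[of k] eq(1)[of "Suc k"] by simp
    thus "\<rho> k < \<rho> (Suc k)"
      by (rule increasing_reflect[of 1 r w, rotated -1]) (use s1 in_r in auto)
  qed
  hence \<rho>id: "\<rho> j = j" for j by simp
  have "\<sigma>' = \<sigma> \<circ> \<rho>" unfolding \<rho>_def o_assoc permutes_inv_o(1)[OF \<sigma>(1)] by simp
  hence \<sigma>eq: "\<sigma>' = \<sigma>" using \<open>\<rho> = id\<close> by simp
  \<comment> \<open>\<open>g\<close> fixes the first and the last \<open>r\<close> places and
    preserves the block between them; it remains to see that it is increasing.\<close>
  define g where "g = inv w \<circ> w'"
  have g: "g permutes {1..m}" unfolding g_def by (rule permutes_compose[OF w(2) permutes_inv[OF w(1)]])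
  have wg: "w (g j) = w' j" for j unfolding g_def using permutes_inverses(1)[OF w(1)] by simp
  have g_eqI: "g j = j" if "w' j = w j" for j unfolding g_def using that permutes_inverses(2)[OF w(1)] by simp
  have gT: "g j = j" if "j \<in> {1..r}" for j using eq(1)[OF that] \<rho>id by (intro g_eqI) simp
  have gS: "g j = j" if "j \<in> {m - r<..m}" for j
  proof -
    have "j = m - r + (j - (m - r))" "j - (m - r) \<in> {1..r}" using that m by auto
    thus ?thesis using eq(2)[of "j - (m - r)"] \<rho>id by (intro g_eqI) simp
  qed
  have gM: "g j \<in> {r<..m - r}" if "j \<in> {r<..m - r}" for j
  proof -
    have gj: "g j \<in> {1..m}" using that m permutes_in_image[OF g, of j] by auto
    have "g j \<notin> {1..r} \<and> g j \<notin> {m - r<..m}"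
    proof (intro conjI notI)
      assume "g j \<in> {1..r}"
      hence "g (g j) = g j" by (rule gT)
      hence "g j = j" by (rule injD[OF permutes_inj[OF g]])
      thus False using that \<open>g j \<in> {1..r}\<close> by auto
    next
      assume "g j \<in> {m - r<..m}"
      hence "g (g j) = g j" by (rule gS)
      hence "g j = j" by (rule injD[OF permutes_inj[OF g]])
      thus False using that \<open>g j \<in> {m - r<..m}\<close> by auto
    qed
    thus ?thesis using gj by auto
  qed
  have "g = id"
  proof (rule permutes_increasing_id[OF g])
    fix k assume k: "k \<in> {1..<m}"
    \<comment> \<open>Two neighbours lie in one of the three blocks, or in consecutive blocks, or on
      both sides of an empty middle block. Only the case inside the middle block uses
      minimality.\<close>
    consider "Suc k \<le> r" | "k \<le> r" "r < Suc k" "Suc k \<le> m - r" | "k \<le> r" "m - r < Suc k"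
      | "r < k" "Suc k \<le> m - r" | "r < k" "k \<le> m - r" "m - r < Suc k" | "m - r < k" by linarith
    thus "g k < g (Suc k)"
    proof cases
      case 4
      have "w (g k) < w (g (Suc k))" unfolding wg by (rule ell_choice_middle_increasing[OF m c2 4])
      moreover have "g k \<in> {r<..m - r}" "g (Suc k) \<in> {r<..m - r}" using gM 4 by auto
      ultimately show ?thesis
        by (intro increasing_reflect[of "Suc r" "m - r" w "g k" "g (Suc k)"])
          (auto intro: ell_choice_middle_increasing[OF m c1])
    qed (use k gT[of k] gT[of "Suc k"] gS[of k] gS[of "Suc k"] gM[of k] gM[of "Suc k"] m in auto)
  qed
  hence "w' j = w j" for j using wg[of j] by simp
  thus ?thesis using \<sigma>eq by auto
qed

theorem ell_choice_unique_class:
  assumes m: "m \<ge> 2 * r" and "ell_choice m r P \<sigma> w ws" "ell_choice m r P \<sigma>' w' ws'"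
  shows "mer_eq m r (act_mu \<sigma> (word_class m r ws)) (act_mu \<sigma>' (word_class m r ws'))"
proof -
  obtain \<sigma>1 w1 ws1 where 1: "ell_choice m r P \<sigma>1 w1 ws1" "\<forall>k\<in>{1..<r}. w1 k < w1 (Suc k)"
     "mer_eq m r (act_mu \<sigma> (word_class m r ws)) (act_mu \<sigma>1 (word_class m r ws1))"
    using ell_choice_sorted[OF m assms(2)] by blast
  obtain \<sigma>2 w2 ws2 where 2: "ell_choice m r P \<sigma>2 w2 ws2" "\<forall>k\<in>{1..<r}. w2 k < w2 (Suc k)"
     "mer_eq m r (act_mu \<sigma>' (word_class m r ws')) (act_mu \<sigma>2 (word_class m r ws2))"
    using ell_choice_sorted[OF m assms(3)] by blast
  have eq: "\<sigma>2 = \<sigma>1" "w2 = w1" using sorted_choice_unique[OF m 1(1,2) 2(1,2)] by auto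
  have "\<sigma>1 permutes {1..r}" "reduced_word m w1 ws1" "reduced_word m w1 ws2"
    using 1(1) 2(1) unfolding eq by (auto simp: ell_choice_def presents_def)
  hence "mer_eq m r (act_mu \<sigma>1 (word_class m r ws1)) (act_mu \<sigma>1 (word_class m r ws2))"
    by (intro act_mu_cong word_class_cong[OF m])
  thus ?thesis using 1(3) 2(3) gen_eq_trans gen_eq_sym unfolding eq by meson
qed

section \<open>Elliptic classes of arbitrary link patterns\<close>

lemma is_ell_iff:
  assumes m: "m \<ge> 2 * r"
  shows "is_ell m r P E \<longleftrightarrow> (\<exists>\<sigma> w ws. ell_choice m r P \<sigma> w ws \<and> E = act_mu \<sigma> (word_class m r ws))"
proof -
  have "purifying m r ws (params (min_chars m r) ws)" if "ell_choice m r P \<sigma> w ws" for \<sigma> w ws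
    using purifying_iff[OF m ell_choice_good[OF m that]] by simp
  thus ?thesis unfolding is_ell_def using ell_choice_class[OF m] by metis
qed

theorem well_defined:
  assumes m: "m \<ge> 2 * r" and P: "link_pattern m r P"
  shows "ell_well_defined m r P"
  unfolding ell_well_defined_def
proof (intro conjI allI impI)
  show "\<exists>\<sigma> w ws. ell_choice m r P \<sigma> w ws" by (rule exists_choice[OF assms])
  show "\<exists>!\<nu>. purifying m r ws \<nu>" if "ell_choice m r P \<sigma> w ws" for \<sigma> w ws
    using purifying_iff[OF m ell_choice_good[OF m that]] by simp
  fix E E' assume "is_ell m r P E \<and> is_ell m r P E'"
  then obtain \<sigma> w ws \<sigma>' w' ws' where "ell_choice m r P \<sigma> w ws" "ell_choice m r P \<sigma>' w' ws'"
    and eqs: "E = act_mu \<sigma> (word_class m r ws)" "E' = act_mu \<sigma>' (word_class m r ws')"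
    unfolding is_ell_iff[OF m] by blast
  thus "mer_eq m r E E'" unfolding eqs by (intro ell_choice_unique_class[OF m])
qed

text \<open>The hypothesis on lengths makes \<open>i # ws\<close> a reduced word of a minimal
  presentation of the moved pattern, with the same \<open>\<sigma>\<close>. Its class is one
  operation applied to \<open>E\<close>, it is pure, and by uniqueness of the purifying parameter no
  other parameter qualifies.\<close>

theorem operation_on_classes:
  assumes m: "m \<ge> 2 * r" and i: "i \<in> {1..<m}"
    and len: "min_length m r (move_pattern (simple_refl i) P) = min_length m r P + 1"
    and E: "is_ell m r P E" and E': "is_ell m r (move_pattern (simple_refl i) P) E'"
  shows "(\<exists>!\<nu>. nontrivial_char r \<nu> \<and> pure m r (opC i \<nu> E)) \<and>
       (\<forall>\<nu>. nontrivial_char r \<nu> \<and> pure m r (opC i \<nu> E) \<longrightarrow> mer_eq m r (opC i \<nu> E) E')"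
proof -
  obtain \<sigma> w ws where choice: "ell_choice m r P \<sigma> w ws" and E_eq: "E = act_mu \<sigma> (word_class m r ws)"
    using E unfolding is_ell_iff[OF m] by blast
  have pr: "presents m r P \<sigma> w" and ws: "set ws \<subseteq> {1..<m}" "word_perm ws = w" "length ws = min_length m r P"
    using choice by (auto simp: ell_choice_def reduced_word_def)
  have \<sigma>: "\<sigma> permutes {1..r}" and w: "w permutes {1..m}" using pr by (auto simp: presents_def)
  have p: "simple_refl i \<circ> w permutes {1..m}" by (rule permutes_compose[OF w simple_refl_permutes[OF i]])
  have pr': "presents m r (move_pattern (simple_refl i) P) \<sigma> (simple_refl i \<circ> w)"
    using pr p by (simp add: presents_iff move_pattern_def)
  have set': "set (i # ws) \<subseteq> {1..<m}" and wp: "word_perm (i # ws) = simple_refl i \<circ> w" using i ws by auto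
  have "perm_length m (simple_refl i \<circ> w) \<le> length (i # ws)"
    using perm_length_word_le[OF set'] unfolding wp .
  moreover have "length (i # ws) = min_length m r (move_pattern (simple_refl i) P)" using len ws(3) by simp
  ultimately have "perm_length m (simple_refl i \<circ> w) = min_length m r (move_pattern (simple_refl i) P)"
    "length (i # ws) = perm_length m (simple_refl i \<circ> w)"
    using min_length_le[OF pr'] by simp_all
  hence choice': "ell_choice m r (move_pattern (simple_refl i) P) \<sigma> (simple_refl i \<circ> w) (i # ws)"
    unfolding ell_choice_def reduced_word_def using pr' set' wp by blast
  note good = ell_choice_good[OF m choice] and good' = ell_choice_good[OF m choice']
  note props = word_class_props[OF m good] and props' = word_class_props[OF m good']
  note ren = renaming_ren_mu[OF \<sigma>, of m] and bij = renaming_bij[OF renaming_ren_mu[OF \<sigma>, of m]]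
  define \<nu>0 where "\<nu>0 = word_char m r ws i - word_char m r ws (Suc i)"
  \<comment> \<open>Relabelling by \<open>\<sigma>\<close> turns the parameter of the new letter
    into the one that purifies the relabelled class.\<close>
  define \<nu>1 where "\<nu>1 = rename (ren_mu \<sigma>) \<nu>0"
  have \<nu>0: "\<nu>0 \<in> chars r" "\<nu>0 \<noteq> 0"
    unfolding \<nu>0_def using word_char_diff_nonzero[OF m ws(1), of i "Suc i"] i
    by (auto simp: word_char_diff_chars)
  have \<nu>1: "nontrivial_char r \<nu>1"
  proof -
    have "ren_mu \<sigma> ` Poly_Mapping.keys \<nu>0 \<subseteq> ren_mu \<sigma> ` muvars r"
      using \<nu>0(1) by (intro image_mono) (simp add: chars_def)
    thus ?thesis using ren \<nu>0(2)
      by (simp add: nontrivial_char_iff chars_def \<nu>1_def keys_rename[OF bij] rename_eq_0_iff[OF bij] renaming_def)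
  qed
  have step: "act_mu \<sigma> (word_class m r (i # ws)) = opC i \<nu>1 E"
    unfolding word_class_Cons \<nu>0_def[symmetric] act_mu_opC[OF \<sigma>] \<nu>1_def E_eq ..
  have EA: "E \<in> frakA m r" unfolding E_eq act_mu_alt by (rule frakA_rename[OF ren props(1)])
  have Enz: "\<not> mer_eq m r E (\<lambda>p. 0)"
    unfolding E_eq act_mu_alt using gen_eq_rename_0[OF ren] props(2) by blast
  have Ep: "pure m r E" unfolding E_eq act_mu_alt pure_def using has_type_rename[OF ren props(3)] by blast
  have E''p: "pure m r (opC i \<nu>1 E)"
    unfolding step[symmetric] act_mu_alt pure_def using has_type_rename[OF ren props'(3)] by blast
  obtain \<mu> where \<mu>: "\<And>\<nu>. nontrivial_char r \<nu> \<Longrightarrow> pure m r (opC i \<nu> E) \<longleftrightarrow> \<nu> = \<mu>"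
    using unique_purifying_parameter[OF EA Ep Enz i] by blast
  have "\<mu> = \<nu>1" using \<mu>[OF \<nu>1] E''p by simp
  obtain \<sigma>' w' ws' where "ell_choice m r (move_pattern (simple_refl i) P) \<sigma>' w' ws'"
    and E'_eq: "E' = act_mu \<sigma>' (word_class m r ws')"
    using E' unfolding is_ell_iff[OF m] by blast
  hence "mer_eq m r (opC i \<nu>1 E) E'"
    unfolding E'_eq step[symmetric] by (intro ell_choice_unique_class[OF m choice'])
  thus ?thesis using \<mu> \<nu>1 unfolding \<open>\<mu> = \<nu>1\<close> by blast
qed

theorem theorem1p1:
  fixes m r :: nat
  assumes "m \<ge> 2 * r"
  shows
    \<comment> \<open>(1)\<close>
    "subalgebra_of (frakA m r) (mer_fun m r) \<and>
    \<comment> \<open>(2)\<close>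
    graded_algebra (dom_mult m r) (frakA m r) {Q. integral_qform m r Q} (type_piece m r) \<and>
    (\<forall>l1 l2. l1 \<noteq> 0 \<and> Poly_Mapping.keys l1 \<subseteq> xvars m \<and> l2 \<noteq> 0 \<and> Poly_Mapping.keys l2 \<subseteq> muvars r \<longrightarrow>
       deltaf l1 l2 \<in> type_piece m r (\<lambda>z. lin l1 z * lin l2 z)) \<and>
    (\<forall>f\<in>frakA m r. (\<exists>Q. integral_qform m r Q \<and> f \<in> type_piece m r Q) \<longleftrightarrow> pure m r f) \<and>
    \<comment> \<open>(3)\<close>
    (\<forall>i \<mu> \<nu> f. 1 \<le> i \<and> i + 1 < m \<and>
       nontrivial_char r \<mu> \<and> nontrivial_char r \<nu> \<and> nontrivial_char r (\<mu> + \<nu>) \<and>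
       f \<in> mer_fun m r \<longrightarrow>
       mer_eq m r (opC i \<mu> (opC (i + 1) (\<mu> + \<nu>) (opC i \<nu> f)))
                  (opC (i + 1) \<nu> (opC i (\<mu> + \<nu>) (opC (i + 1) \<mu> f)))) \<and>
    (\<forall>k. 1 \<le> k \<and> k < r \<longrightarrow>
       mer_eq m r (act_mu (simple_refl k) (opC k (mum k - mum (k + 1)) (ell_min m r)))
                  (opC (m - r + k) (mum (k + 1) - mum k) (ell_min m r))) \<and>
    \<comment> \<open>(4)\<close>
    (\<forall>f\<in>frakA m r. \<forall>i\<in>{1..<m}. pure m r f \<and> \<not> mer_eq m r f (\<lambda>p. 0) \<longrightarrow>
       (\<exists>!\<mu>. is_char r \<mu> \<and> (\<forall>Q. has_type m r f Q \<longrightarrow> balanced i \<mu> Q) \<and>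
             (\<forall>\<nu>. nontrivial_char r \<nu> \<longrightarrow> (pure m r (opC i \<nu> f) \<longleftrightarrow> \<nu> = \<mu>)))) \<and>
    \<comment> \<open>(5)\<close>
    (\<forall>P. link_pattern m r P \<and> upper_triangular r P \<longrightarrow> ell_well_defined m r P) \<and>
    (\<forall>P i E E'. link_pattern m r P \<and> upper_triangular r P \<and> i \<in> {1..<m} \<and>
       upper_triangular r (move_pattern (simple_refl i) P) \<and>
       min_length m r (move_pattern (simple_refl i) P) = min_length m r P + 1 \<and>
       is_ell m r P E \<and> is_ell m r (move_pattern (simple_refl i) P) E' \<longrightarrow>
       (\<exists>!\<nu>. nontrivial_char r \<nu> \<and> pure m r (opC i \<nu> E)) \<and>
       (\<forall>\<nu>. nontrivial_char r \<nu> \<and> pure m r (opC i \<nu> E) \<longrightarrow> mer_eq m r (opC i \<nu> E) E')) \<and>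
    \<comment> \<open>(6)\<close>
    (\<forall>P. link_pattern m r P \<longrightarrow> ell_well_defined m r P) \<and>
    (\<forall>P i E E'. link_pattern m r P \<and> i \<in> {1..<m} \<and>
       min_length m r (move_pattern (simple_refl i) P) = min_length m r P + 1 \<and>
       is_ell m r P E \<and> is_ell m r (move_pattern (simple_refl i) P) E' \<longrightarrow>
       (\<exists>!\<nu>. nontrivial_char r \<nu> \<and> pure m r (opC i \<nu> E)) \<and>
       (\<forall>\<nu>. nontrivial_char r \<nu> \<and> pure m r (opC i \<nu> E) \<longrightarrow> mer_eq m r (opC i \<nu> E) E'))"
proof -
  have deltaf_piece: "deltaf l1 l2 \<in> type_piece m r (\<lambda>z. lin l1 z * lin l2 z)"
    if "l1 \<noteq> 0 \<and> Poly_Mapping.keys l1 \<subseteq> xvars m \<and> l2 \<noteq> 0 \<and> Poly_Mapping.keys l2 \<subseteq> muvars r" for l1 l2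
    using frakA.gen[of l1 m l2 r] has_type_deltaf[of l1 m l2 r] that by (simp add: type_piece_def)
  have braid: "mer_eq m r (opC i \<mu> (opC (i + 1) (\<mu> + \<nu>) (opC i \<nu> f)))
                  (opC (i + 1) \<nu> (opC i (\<mu> + \<nu>) (opC (i + 1) \<mu> f)))"
    if "1 \<le> i \<and> i + 1 < m \<and> nontrivial_char r \<mu> \<and> nontrivial_char r \<nu> \<and> nontrivial_char r (\<mu> + \<nu>) \<and>
       f \<in> mer_fun m r" for i \<mu> \<nu> f
    using that unfolding nontrivial_char_iff by (elim conjE) (rule braid_relation, auto dest: mer_fun_depends)
  show ?thesis
    by (intro conjI allI ballI impI subalgebra_frakA graded_frakA deltaf_piece pure_iff_homogeneous
          braid flip_relation[OF assms] unique_purifying_parameter well_defined[OF assms];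
        (elim conjE)?;
        (assumption | rule operation_on_classes[OF assms, THEN conjunct1]
          operation_on_classes[OF assms, THEN conjunct2, rule_format])?; (intro conjI)?; assumption)
qed

end
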